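(* Let $\Lambda = kQ/I$ be an admissible quotient of the path algebra $kQ$ over a field $k$. Suppose that there are arrows $a_i\colon v_{e_i}\to v_{f_i}$ in $Q$ for $i=1,2,\dots,t$ which do not occur in a set of minimal generators of $I$ in $kQ$ and $\mathrm{Hom}_\Lambda(e_i\Lambda, f_j\Lambda)=0$ for all $i$ and $j$ in $\{1,2,\dots,t\}$. Let $\bar{a}_i = a_i + I$ in $\Lambda$. Let $\Gamma = \Lambda/\Lambda\{\bar{a}_i\}_{i=1}^t\Lambda$. (i) Injectives generate for $\Lambda$ if and only if injectives generate for $\Gamma$. (ii) Projectives cogenerate for $\Lambda$ if and only if projectives cogenerate for $\Gamma$.
   Context: All rings are unital and modules are right modules. $Q$ is a finite quiver and $I$ an admissible ideal of the path algebra $kQ$. For a vertex denoted $v_e$, $e$ denotes the corresponding primitive idempotent (trivial path) of $kQ$ and its image in $\Lambda$; paths are multiplied so that an arrow $a\colon v_e\to v_f$ satisfies $a = eaf$. $\Lambda\{\bar{a}_i\}_{i=1}^t\Lambda$ denotes the two-sided ideal of $\Lambda$ generated by $\bar a_1,\dots,\bar a_t$. For a ring $A$, $\mathcal{D}(A)$ is the unbounded derived category of cochain complexes of $A$-modules. A localising (respectively colocalising) subcategory of $\mathcal{D}(A)$ is a triangulated subcategory closed under set indexed coproducts (respectively products). Injectives generate for $A$ if the smallest localising subcategory of $\mathcal{D}(A)$ containing all injective $A$-modules is $\mathcal{D}(A)$. Projectives cogenerate for $A$ if the smallest colocalising subcategory of $\mathcal{D}(A)$ containing all projective $A$-modules is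 $\mathcal{D}(A)$. *)

theory Defs
  imports
    "HOL-Algebra.Module"
    "HOL-Algebra.QuotRing"
    "HOL-Algebra.Ideal_Product"
    "HOL-Library.Poly_Mapping"
    "HOL-Library.Equipollence"
    "Graph_Theory.Arc_Walk"
begin

section \<open>Path algebras and admissible quotients\<close>

text \<open>
  A finite quiver is a finite directed multigraph (\<open>fin_digraph\<close>). A path is a triple (source,
  list of arrows, target); trivial paths have the empty list. Paths are composed from left to
  right, so an arrow \<open>a : v_e \<rightarrow> v_f\<close> satisfies \<open>a = e a f\<close>. The ground field is an arbitrary type
  \<open>'k\<close> of class \<open>field\<close>, and elements of the path algebra are finitely supported functions on paths.
\<close>

type_synonym ('v, 'e) qpath = "'v \<times> 'e list \<times> 'v"

definition paths :: "('v, 'e) pre_digraph \<Rightarrow> ('v, 'e) qpath set" where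
  "paths Q = {(u, p, v). pre_digraph.awalk Q u p v}"

definition path_mult ::
  "(('v, 'e) qpath \<Rightarrow>\<^sub>0 'k::field) \<Rightarrow> (('v, 'e) qpath \<Rightarrow>\<^sub>0 'k) \<Rightarrow> (('v, 'e) qpath \<Rightarrow>\<^sub>0 'k)" where
  "path_mult x y = (\<Sum>(u, p, v)\<in>Poly_Mapping.keys x. \<Sum>(u', q, w)\<in>Poly_Mapping.keys y.
     if v = u' then Poly_Mapping.single (u, p @ q, w)
       (Poly_Mapping.lookup x (u, p, v) * Poly_Mapping.lookup y (u', q, w)) else 0)"

definition trivial_path :: "'v \<Rightarrow> ('v, 'e) qpath \<Rightarrow>\<^sub>0 'k::field" where
  "trivial_path v = Poly_Mapping.single (v, [], v) 1"

definition arrow_path :: "('v, 'e) pre_digraph \<Rightarrow> 'e \<Rightarrow> ('v, 'e) qpath \<Rightarrow>\<^sub>0 'k::field" where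
  "arrow_path Q a = Poly_Mapping.single (tail Q a, [a], head Q a) 1"

definition path_algebra :: "('v, 'e) pre_digraph \<Rightarrow> (('v, 'e) qpath \<Rightarrow>\<^sub>0 'k::field) ring" where
  "path_algebra Q = \<lparr>carrier = {x. Poly_Mapping.keys x \<subseteq> paths Q}, mult = path_mult,
     one = (\<Sum>v\<in>verts Q. trivial_path v), zero = 0, add = (+)\<rparr>"

definition arrow_ideal :: "('v, 'e) pre_digraph \<Rightarrow> (('v, 'e) qpath \<Rightarrow>\<^sub>0 'k::field) set" where
  "arrow_ideal Q = genideal (path_algebra Q) (arrow_path Q ` arcs Q)"

primrec ideal_power :: "('r, 'm) ring_scheme \<Rightarrow> 'r set \<Rightarrow> nat \<Rightarrow> 'r set" where
  "ideal_power R J 0 = carrier R"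
| "ideal_power R J (Suc n) = ideal_prod R (ideal_power R J n) J"

definition admissible_ideal ::
  "('v, 'e) pre_digraph \<Rightarrow> (('v, 'e) qpath \<Rightarrow>\<^sub>0 'k::field) set \<Rightarrow> bool" where
  "admissible_ideal Q I \<longleftrightarrow> ideal I (path_algebra Q) \<and>
     (\<exists>m\<ge>2. ideal_power (path_algebra Q) (arrow_ideal Q) m \<subseteq> I) \<and>
     I \<subseteq> ideal_power (path_algebra Q) (arrow_ideal Q) 2"

definition bound_quiver_algebra ::
  "('v, 'e) pre_digraph \<Rightarrow> (('v, 'e) qpath \<Rightarrow>\<^sub>0 'k::field) set \<Rightarrow> (('v, 'e) qpath \<Rightarrow>\<^sub>0 'k) set ring" where
  "bound_quiver_algebra Q I = path_algebra Q Quot I"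

definition residue ::
  "('v, 'e) pre_digraph \<Rightarrow> (('v, 'e) qpath \<Rightarrow>\<^sub>0 'k::field) set \<Rightarrow> (('v, 'e) qpath \<Rightarrow>\<^sub>0 'k)
     \<Rightarrow> (('v, 'e) qpath \<Rightarrow>\<^sub>0 'k) set" where
  "residue Q I x = I +>\<^bsub>path_algebra Q\<^esub> x"

definition minimal_generators :: "('r, 'm) ring_scheme \<Rightarrow> 'r set \<Rightarrow> 'r set \<Rightarrow> bool" where
  "minimal_generators R I G \<longleftrightarrow>
     G \<subseteq> carrier R \<and> genideal R G = I \<and> (\<forall>H. H \<subset> G \<longrightarrow> genideal R H \<noteq> I)"

definition arrow_occurs :: "'e \<Rightarrow> (('v, 'e) qpath \<Rightarrow>\<^sub>0 'k::field) \<Rightarrow> bool" where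
  "arrow_occurs a x \<longleftrightarrow> (\<exists>(u, p, v)\<in>Poly_Mapping.keys x. a \<in> set p)"


section \<open>Right modules\<close>

text \<open>
  Right modules reuse the record type of \<open>HOL-Algebra.Module\<close>, so \<open>r \<odot>\<^bsub>M\<^esub> x\<close> stands for the right
  action \<open>x r\<close>; the fields \<open>mult\<close> and \<open>one\<close> of a module are irrelevant. The library locale
  \<open>module\<close> is not used because it is restricted to commutative rings.
\<close>

definition right_module :: "('r, 'c) ring_scheme \<Rightarrow> ('r, 'm) module \<Rightarrow> bool" where
  "right_module R M \<longleftrightarrow> ring R \<and> abelian_group M \<and>
     (\<forall>r\<in>carrier R. \<forall>x\<in>carrier M. r \<odot>\<^bsub>M\<^esub> x \<in> carrier M) \<and>
     (\<forall>r\<in>carrier R. \<forall>x\<in>carrier M. \<forall>y\<in>carrier M. r \<odot>\<^bsub>M\<^esub> (x \<oplus>\<^bsub>M\<^esub> y) = r \<odot>\<^bsub>M\<^esub> x \<oplus>\<^bsub>M\<^esub> r \<odot>\<^bsub>M\<^esub> y) \<and>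
     (\<forall>r\<in>carrier R. \<forall>s\<in>carrier R. \<forall>x\<in>carrier M. (r \<oplus>\<^bsub>R\<^esub> s) \<odot>\<^bsub>M\<^esub> x = r \<odot>\<^bsub>M\<^esub> x \<oplus>\<^bsub>M\<^esub> s \<odot>\<^bsub>M\<^esub> x) \<and>
     (\<forall>r\<in>carrier R. \<forall>s\<in>carrier R. \<forall>x\<in>carrier M. (r \<otimes>\<^bsub>R\<^esub> s) \<odot>\<^bsub>M\<^esub> x = s \<odot>\<^bsub>M\<^esub> (r \<odot>\<^bsub>M\<^esub> x)) \<and>
     (\<forall>x\<in>carrier M. \<one>\<^bsub>R\<^esub> \<odot>\<^bsub>M\<^esub> x = x)"

definition rmod_hom ::
  "('r, 'c) ring_scheme \<Rightarrow> ('r, 'm) module \<Rightarrow> ('r, 'n) module \<Rightarrow> ('m \<Rightarrow> 'n) set" where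
  "rmod_hom R M N = {h. h \<in> carrier M \<rightarrow> carrier N \<and>
     (\<forall>x\<in>carrier M. \<forall>y\<in>carrier M. h (x \<oplus>\<^bsub>M\<^esub> y) = h x \<oplus>\<^bsub>N\<^esub> h y) \<and>
     (\<forall>r\<in>carrier R. \<forall>x\<in>carrier M. h (r \<odot>\<^bsub>M\<^esub> x) = r \<odot>\<^bsub>N\<^esub> h x)}"

text \<open>\<open>Hom\<^sub>R(M, N) = 0\<close>; homomorphisms are only considered on the carrier.\<close>

definition hom_zero :: "('r, 'c) ring_scheme \<Rightarrow> ('r, 'm) module \<Rightarrow> ('r, 'n) module \<Rightarrow> bool" where
  "hom_zero R M N \<longleftrightarrow> (\<forall>h\<in>rmod_hom R M N. \<forall>x\<in>carrier M. h x = \<zero>\<^bsub>N\<^esub>)"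

text \<open>The right ideal \<open>e R\<close> as a right module.\<close>

definition principal_rmod :: "('r, 'c) ring_scheme \<Rightarrow> 'r \<Rightarrow> ('r, 'r) module" where
  "principal_rmod R e = \<lparr>carrier = (\<lambda>r. e \<otimes>\<^bsub>R\<^esub> r) ` carrier R, mult = mult R, one = one R,
     zero = zero R, add = add R, smult = (\<lambda>r x. x \<otimes>\<^bsub>R\<^esub> r)\<rparr>"


section \<open>Size bounds\<close>

text \<open>
  HOL cannot quantify over all types inside a formula, so \<open>\<D>(R)\<close> and ``set indexed'' are relative
  to a universe, given by the family \<open>Car\<close> of sets admitted as carriers of modules and the family
  \<open>Idx\<close> of sets admitted as index sets of products and coproducts. For a Grothendieck universe,
  both consist of the small sets. As HOL does not prove the existence of a type containing an
  uncountable universe, only the closure properties needed to form products and coproducts are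
  required. These can be met for every ring and with an arbitrarily large index type, see
  \<open>size_universe_UNIV\<close>. The last condition makes \<open>R\<close> itself small.
\<close>

definition size_universe :: "'i set set \<Rightarrow> 'u set set \<Rightarrow> ('r, 'c) ring_scheme \<Rightarrow> bool" where
  "size_universe Idx Car R \<longleftrightarrow>
     (\<exists>J\<in>Idx. infinite J) \<and>
     (\<forall>J\<in>Idx. \<forall>J'. J' \<lesssim> J \<longrightarrow> J' \<in> Idx) \<and>
     (\<forall>S\<in>Car. \<forall>S'. S' \<lesssim> S \<longrightarrow> S' \<in> Car) \<and>
     (\<forall>J\<in>Idx. \<forall>S. (\<forall>j\<in>J. S j \<in> Car) \<longrightarrow> (\<exists>T\<in>Car. T \<approx> PiE J S)) \<and>
     (\<exists>T\<in>Car. carrier R \<lesssim> T)"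

lemma size_universe_UNIV:
  fixes R :: "('r, 'c) ring_scheme"
  assumes "infinite (UNIV :: 'i set)"
  shows "size_universe (UNIV :: 'i set set) (UNIV :: ('i list \<times> 'r) set set set) R"
proof -
  have "\<exists>T :: ('i list \<times> 'r) set set. T \<approx> PiE J S" for J :: "'i set" and S :: "'i \<Rightarrow> ('i list \<times> 'r) set set"
  proof -
    define c where "c f = {(j # l, r) | j l r. j \<in> J \<and> (l, r) \<in> f j}" for f :: "'i \<Rightarrow> ('i list \<times> 'r) set"
    have c: "(j # l, r) \<in> c f \<longleftrightarrow> j \<in> J \<and> (l, r) \<in> f j" for f j l r
      by (auto simp: c_def)
    have "inj_on c (PiE J S)"
    proof (rule inj_onI)
      fix f g assume fg: "f \<in> PiE J S" "g \<in> PiE J S" "c f = c g"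
      have "f j = g j" if "j \<in> J" for j
        using c[of j _ _ f] c[of j _ _ g] fg(3) that by auto
      then show "f = g"
        using PiE_ext[OF fg(1,2)] by blast
    qed
    then have "c ` PiE J S \<approx> PiE J S"
      by (simp add: inj_on_image_eqpoll_self)
    then show ?thesis ..
  qed
  moreover have "carrier R \<lesssim> (UNIV :: ('i list \<times> 'r) set set)"
    unfolding lepoll_def by (rule exI[of _ "\<lambda>r. {([], r)}"]) (auto simp: inj_on_def)
  ultimately show ?thesis
    using assms unfolding size_universe_def by blast
qed

definition modules :: "'u set set \<Rightarrow> ('r, 'c) ring_scheme \<Rightarrow> ('r, 'u) module set" where
  "modules Car R = {M. right_module R M \<and> carrier M \<in> Car}"

definition injective_modules :: "'u set set \<Rightarrow> ('r, 'c) ring_scheme \<Rightarrow> ('r, 'u) module set" where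
  "injective_modules Car R = {E \<in> modules Car R.
     \<forall>M\<in>modules Car R. \<forall>N\<in>modules Car R. \<forall>g\<in>rmod_hom R M N. \<forall>h\<in>rmod_hom R M E.
       inj_on g (carrier M) \<longrightarrow> (\<exists>k\<in>rmod_hom R N E. \<forall>x\<in>carrier M. k (g x) = h x)}"

definition projective_modules :: "'u set set \<Rightarrow> ('r, 'c) ring_scheme \<Rightarrow> ('r, 'u) module set" where
  "projective_modules Car R = {P \<in> modules Car R.
     \<forall>M\<in>modules Car R. \<forall>N\<in>modules Car R. \<forall>g\<in>rmod_hom R M N. \<forall>h\<in>rmod_hom R P N.
       g ` carrier M = carrier N \<longrightarrow> (\<exists>k\<in>rmod_hom R P M. \<forall>x\<in>carrier P. g (k x) = h x)}"


section \<open>Cochain complexes\<close>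

record ('r, 'm) cochain =
  obj :: "int \<Rightarrow> ('r, 'm) module"
  dif :: "int \<Rightarrow> 'm \<Rightarrow> 'm"

type_synonym ('m, 'n) cmap = "int \<Rightarrow> 'm \<Rightarrow> 'n"

definition is_complex :: "('r, 'c) ring_scheme \<Rightarrow> ('r, 'm) cochain \<Rightarrow> bool" where
  "is_complex R X \<longleftrightarrow> (\<forall>n. right_module R (obj X n) \<and>
     dif X n \<in> rmod_hom R (obj X n) (obj X (n + 1)) \<and>
     (\<forall>x\<in>carrier (obj X n). dif X (n + 1) (dif X n x) = \<zero>\<^bsub>obj X (n + 2)\<^esub>))"

definition complexes :: "'u set set \<Rightarrow> ('r, 'c) ring_scheme \<Rightarrow> ('r, 'u) cochain set" where
  "complexes Car R = {X. is_complex R X \<and> (\<forall>n. carrier (obj X n) \<in> Car)}"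

definition chain_map ::
  "('r, 'c) ring_scheme \<Rightarrow> ('r, 'm) cochain \<Rightarrow> ('r, 'n) cochain \<Rightarrow> ('m, 'n) cmap \<Rightarrow> bool" where
  "chain_map R X Y f \<longleftrightarrow> (\<forall>n. f n \<in> rmod_hom R (obj X n) (obj Y n) \<and>
     (\<forall>x\<in>carrier (obj X n). f (n + 1) (dif X n x) = dif Y n (f n x)))"

definition cmap_comp :: "('n, 'p) cmap \<Rightarrow> ('m, 'n) cmap \<Rightarrow> ('m, 'p) cmap" (infixl "\<circ>\<^sub>c" 55) where
  "g \<circ>\<^sub>c f = (\<lambda>n. g n \<circ> f n)"

definition cmap_id :: "('m, 'm) cmap" where
  "cmap_id = (\<lambda>n x. x)"

definition homotopic ::
  "('r, 'c) ring_scheme \<Rightarrow> ('r, 'm) cochain \<Rightarrow> ('r, 'n) cochain \<Rightarrow> ('m, 'n) cmap \<Rightarrow> ('m, 'n) cmap \<Rightarrow> bool"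
where
  "homotopic R X Y f g \<longleftrightarrow> (\<exists>s. \<forall>n. s n \<in> rmod_hom R (obj X n) (obj Y (n - 1)) \<and>
     (\<forall>x\<in>carrier (obj X n).
        f n x = g n x \<oplus>\<^bsub>obj Y n\<^esub> (dif Y (n - 1) (s n x) \<oplus>\<^bsub>obj Y n\<^esub> s (n + 1) (dif X n x))))"

definition cocycles :: "('r, 'm) cochain \<Rightarrow> int \<Rightarrow> 'm set" where
  "cocycles X n = {x \<in> carrier (obj X n). dif X n x = \<zero>\<^bsub>obj X (n + 1)\<^esub>}"

definition coboundaries :: "('r, 'm) cochain \<Rightarrow> int \<Rightarrow> 'm set" where
  "coboundaries X n = dif X (n - 1) ` carrier (obj X (n - 1))"

definition cohomology :: "('r, 'm) cochain \<Rightarrow> int \<Rightarrow> 'm set set" where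
  "cohomology X n = (\<lambda>x. coboundaries X n +>\<^bsub>obj X n\<^esub> x) ` cocycles X n"

definition cohomology_map :: "('r, 'n) cochain \<Rightarrow> ('m, 'n) cmap \<Rightarrow> int \<Rightarrow> 'm set \<Rightarrow> 'n set" where
  "cohomology_map Y f n c = (\<Union>x\<in>c. coboundaries Y n +>\<^bsub>obj Y n\<^esub> f n x)"

definition quasi_iso ::
  "('r, 'c) ring_scheme \<Rightarrow> ('r, 'm) cochain \<Rightarrow> ('r, 'n) cochain \<Rightarrow> ('m, 'n) cmap \<Rightarrow> bool" where
  "quasi_iso R X Y f \<longleftrightarrow> chain_map R X Y f \<and>
     (\<forall>n. bij_betw (cohomology_map Y f n) (cohomology X n) (cohomology Y n))"

definition stalk :: "('r, 'm) module \<Rightarrow> ('r, 'm) cochain" where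
  "stalk M = \<lparr>obj = (\<lambda>n. if n = 0 then M else M\<lparr>carrier := {\<zero>\<^bsub>M\<^esub>}\<rparr>), dif = (\<lambda>n x. \<zero>\<^bsub>M\<^esub>)\<rparr>"

definition shift :: "int \<Rightarrow> ('r, 'm) cochain \<Rightarrow> ('r, 'm) cochain" where
  "shift k X = \<lparr>obj = (\<lambda>n. obj X (n + k)),
     dif = (\<lambda>n x. if even k then dif X (n + k) x else \<ominus>\<^bsub>obj X (n + k + 1)\<^esub> dif X (n + k) x)\<rparr>"

definition shift_cmap :: "int \<Rightarrow> ('m, 'n) cmap \<Rightarrow> ('m, 'n) cmap" where
  "shift_cmap k f = (\<lambda>n. f (n + k))"

definition module_sum :: "('r, 'm) module \<Rightarrow> ('r, 'n) module \<Rightarrow> ('r, 'm \<times> 'n) module" where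
  "module_sum M N = \<lparr>carrier = carrier M \<times> carrier N, mult = undefined, one = undefined,
     zero = (\<zero>\<^bsub>M\<^esub>, \<zero>\<^bsub>N\<^esub>), add = (\<lambda>(x, y) (x', y'). (x \<oplus>\<^bsub>M\<^esub> x', y \<oplus>\<^bsub>N\<^esub> y')),
     smult = (\<lambda>r (x, y). (r \<odot>\<^bsub>M\<^esub> x, r \<odot>\<^bsub>N\<^esub> y))\<rparr>"

definition cone ::
  "('r, 'm) cochain \<Rightarrow> ('r, 'n) cochain \<Rightarrow> ('m, 'n) cmap \<Rightarrow> ('r, 'm \<times> 'n) cochain" where
  "cone X Y f = \<lparr>obj = (\<lambda>n. module_sum (obj X (n + 1)) (obj Y n)),
     dif = (\<lambda>n (x, y). (\<ominus>\<^bsub>obj X (n + 2)\<^esub> dif X (n + 1) x, f (n + 1) x \<oplus>\<^bsub>obj Y (n + 1)\<^esub> dif Y n y))\<rparr>"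

text \<open>
  \<open>X \<rightarrow> Y \<rightarrow> Z \<rightarrow> X[1]\<close> is a standard triangle. Since \<open>cone X Y f\<close> lives on pairs and not on \<open>'u\<close>, the
  complex \<open>Z\<close> is an isomorphic copy of the cone, along \<open>\<theta>\<close>.
\<close>

definition standard_triangle ::
  "('r, 'c) ring_scheme \<Rightarrow> ('r, 'u) cochain \<Rightarrow> ('r, 'u) cochain \<Rightarrow> ('r, 'u) cochain
     \<Rightarrow> ('u, 'u) cmap \<Rightarrow> ('u, 'u) cmap \<Rightarrow> ('u, 'u) cmap \<Rightarrow> bool" where
  "standard_triangle R X Y Z f g h \<longleftrightarrow> chain_map R X Y f \<and> chain_map R Y Z g \<and>
     (\<exists>\<theta>. chain_map R Z (cone X Y f) \<theta> \<and>
        (\<forall>n. bij_betw (\<theta> n) (carrier (obj Z n)) (carrier (obj (cone X Y f) n))) \<and>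
        (\<forall>n. \<forall>y\<in>carrier (obj Y n). \<theta> n (g n y) = (\<zero>\<^bsub>obj X (n + 1)\<^esub>, y)) \<and>
        (\<forall>n. \<forall>z\<in>carrier (obj Z n). h n z = fst (\<theta> n z)))"


section \<open>The derived category\<close>

text \<open>
  Morphisms \<open>X \<rightarrow> Y\<close> in \<open>\<D>(R)\<close> are equivalence classes of roofs \<open>X \<leftarrow> Z \<rightarrow> Y\<close>, the left leg being a
  quasi-isomorphism, in the localisation of the homotopy category at the quasi-isomorphisms.
\<close>

type_synonym ('r, 'u) roof = "('r, 'u) cochain \<times> ('u, 'u) cmap \<times> ('u, 'u) cmap"

definition roofs ::
  "'u set set \<Rightarrow> ('r, 'c) ring_scheme \<Rightarrow> ('r, 'u) cochain \<Rightarrow> ('r, 'u) cochain \<Rightarrow> ('r, 'u) roof set" where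
  "roofs Car R X Y = {(Z, s, f). Z \<in> complexes Car R \<and> quasi_iso R Z X s \<and> chain_map R Z Y f}"

definition roof_equiv ::
  "'u set set \<Rightarrow> ('r, 'c) ring_scheme \<Rightarrow> ('r, 'u) cochain \<Rightarrow> ('r, 'u) cochain \<Rightarrow> ('r, 'u) roof rel" where
  "roof_equiv Car R X Y = {((Z, s, f), (Z', s', f')).
     (Z, s, f) \<in> roofs Car R X Y \<and> (Z', s', f') \<in> roofs Car R X Y \<and>
     (\<exists>W\<in>complexes Car R. \<exists>p q. chain_map R W Z p \<and> chain_map R W Z' q \<and>
        quasi_iso R W X (s \<circ>\<^sub>c p) \<and>
        homotopic R W X (s \<circ>\<^sub>c p) (s' \<circ>\<^sub>c q) \<and> homotopic R W Y (f \<circ>\<^sub>c p) (f' \<circ>\<^sub>c q))}"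

definition D_hom ::
  "'u set set \<Rightarrow> ('r, 'c) ring_scheme \<Rightarrow> ('r, 'u) cochain \<Rightarrow> ('r, 'u) cochain \<Rightarrow> ('r, 'u) roof set set" where
  "D_hom Car R X Y = roofs Car R X Y // roof_equiv Car R X Y"

definition D_map ::
  "'u set set \<Rightarrow> ('r, 'c) ring_scheme \<Rightarrow> ('r, 'u) cochain \<Rightarrow> ('r, 'u) cochain \<Rightarrow> ('u, 'u) cmap
     \<Rightarrow> ('r, 'u) roof set" where
  "D_map Car R X Y f = roof_equiv Car R X Y `` {(X, cmap_id, f)}"

definition D_id :: "'u set set \<Rightarrow> ('r, 'c) ring_scheme \<Rightarrow> ('r, 'u) cochain \<Rightarrow> ('r, 'u) roof set" where
  "D_id Car R X = D_map Car R X X cmap_id"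

text \<open>
  The composite of \<open>\<phi> : X \<rightarrow> Y\<close> followed by \<open>\<psi> : Y \<rightarrow> V\<close>: complete \<open>Z \<rightarrow> Y \<leftarrow> Z'\<close> to a square, commuting
  up to homotopy, by a complex \<open>W\<close> with \<open>W \<rightarrow> Z\<close> a quasi-isomorphism.
\<close>

definition D_comp ::
  "'u set set \<Rightarrow> ('r, 'c) ring_scheme \<Rightarrow> ('r, 'u) cochain \<Rightarrow> ('r, 'u) cochain \<Rightarrow> ('r, 'u) cochain
     \<Rightarrow> ('r, 'u) roof set \<Rightarrow> ('r, 'u) roof set \<Rightarrow> ('r, 'u) roof set" where
  "D_comp Car R X Y V \<psi> \<phi> = roof_equiv Car R X V ``
     {(W, s \<circ>\<^sub>c p, g \<circ>\<^sub>c q) | W p q Z s f Z' t g.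
        (Z, s, f) \<in> \<phi> \<and> (Z', t, g) \<in> \<psi> \<and> W \<in> complexes Car R \<and>
        quasi_iso R W Z p \<and> chain_map R W Z' q \<and> homotopic R W Y (f \<circ>\<^sub>c p) (t \<circ>\<^sub>c q)}"

definition D_shift ::
  "'u set set \<Rightarrow> ('r, 'c) ring_scheme \<Rightarrow> int \<Rightarrow> ('r, 'u) cochain \<Rightarrow> ('r, 'u) cochain
     \<Rightarrow> ('r, 'u) roof set \<Rightarrow> ('r, 'u) roof set" where
  "D_shift Car R k X Y \<phi> = roof_equiv Car R (shift k X) (shift k Y) ``
     ((\<lambda>(Z, s, f). (shift k Z, shift_cmap k s, shift_cmap k f)) ` \<phi>)"

definition D_isos ::
  "'u set set \<Rightarrow> ('r, 'c) ring_scheme \<Rightarrow> ('r, 'u) cochain \<Rightarrow> ('r, 'u) cochain \<Rightarrow> ('r, 'u) roof set set" where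
  "D_isos Car R X Y = {\<phi> \<in> D_hom Car R X Y. \<exists>\<psi>\<in>D_hom Car R Y X.
     D_comp Car R X Y X \<psi> \<phi> = D_id Car R X \<and> D_comp Car R Y X Y \<phi> \<psi> = D_id Car R Y}"

definition distinguished_triangle ::
  "'u set set \<Rightarrow> ('r, 'c) ring_scheme \<Rightarrow> ('r, 'u) cochain \<Rightarrow> ('r, 'u) cochain \<Rightarrow> ('r, 'u) cochain
     \<Rightarrow> ('r, 'u) roof set \<Rightarrow> ('r, 'u) roof set \<Rightarrow> ('r, 'u) roof set \<Rightarrow> bool" where
  "distinguished_triangle Car R X Y Z u v w \<longleftrightarrow>
     u \<in> D_hom Car R X Y \<and> v \<in> D_hom Car R Y Z \<and> w \<in> D_hom Car R Z (shift 1 X) \<and>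
     (\<exists>X'\<in>complexes Car R. \<exists>Y'\<in>complexes Car R. \<exists>Z'\<in>complexes Car R. \<exists>f g h.
        standard_triangle R X' Y' Z' f g h \<and>
        (\<exists>\<alpha>\<in>D_isos Car R X X'. \<exists>\<beta>\<in>D_isos Car R Y Y'. \<exists>\<gamma>\<in>D_isos Car R Z Z'.
           D_comp Car R X Y Y' \<beta> u = D_comp Car R X X' Y' (D_map Car R X' Y' f) \<alpha> \<and>
           D_comp Car R Y Z Z' \<gamma> v = D_comp Car R Y Y' Z' (D_map Car R Y' Z' g) \<beta> \<and>
           D_comp Car R Z (shift 1 X) (shift 1 X') (D_shift Car R 1 X X' \<alpha>) w =
             D_comp Car R Z Z' (shift 1 X') (D_map Car R Z' (shift 1 X') h) \<gamma>))"

definition D_coproduct ::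
  "'u set set \<Rightarrow> ('r, 'c) ring_scheme \<Rightarrow> 'i set \<Rightarrow> ('i \<Rightarrow> ('r, 'u) cochain) \<Rightarrow> ('r, 'u) cochain
     \<Rightarrow> ('i \<Rightarrow> ('r, 'u) roof set) \<Rightarrow> bool" where
  "D_coproduct Car R J X C \<iota> \<longleftrightarrow> C \<in> complexes Car R \<and> (\<forall>j\<in>J. \<iota> j \<in> D_hom Car R (X j) C) \<and>
     (\<forall>Y\<in>complexes Car R. \<forall>\<phi>. (\<forall>j\<in>J. \<phi> j \<in> D_hom Car R (X j) Y) \<longrightarrow>
        (\<exists>!\<psi>. \<psi> \<in> D_hom Car R C Y \<and> (\<forall>j\<in>J. D_comp Car R (X j) C Y \<psi> (\<iota> j) = \<phi> j)))"

definition D_product ::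
  "'u set set \<Rightarrow> ('r, 'c) ring_scheme \<Rightarrow> 'i set \<Rightarrow> ('i \<Rightarrow> ('r, 'u) cochain) \<Rightarrow> ('r, 'u) cochain
     \<Rightarrow> ('i \<Rightarrow> ('r, 'u) roof set) \<Rightarrow> bool" where
  "D_product Car R J X P \<pi> \<longleftrightarrow> P \<in> complexes Car R \<and> (\<forall>j\<in>J. \<pi> j \<in> D_hom Car R P (X j)) \<and>
     (\<forall>Y\<in>complexes Car R. \<forall>\<phi>. (\<forall>j\<in>J. \<phi> j \<in> D_hom Car R Y (X j)) \<longrightarrow>
        (\<exists>!\<psi>. \<psi> \<in> D_hom Car R Y P \<and> (\<forall>j\<in>J. D_comp Car R Y P (X j) (\<pi> j) \<psi> = \<phi> j)))"


section \<open>Localising and colocalising subcategories, generation\<close>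

text \<open>
  Subcategories are full and closed under isomorphism, hence given by their classes of objects.
\<close>

definition triangulated_subcategory ::
  "'u set set \<Rightarrow> ('r, 'c) ring_scheme \<Rightarrow> ('r, 'u) cochain set \<Rightarrow> bool" where
  "triangulated_subcategory Car R \<S> \<longleftrightarrow> \<S> \<subseteq> complexes Car R \<and> \<S> \<noteq> {} \<and>
     (\<forall>X\<in>\<S>. \<forall>Y\<in>complexes Car R. D_isos Car R X Y \<noteq> {} \<longrightarrow> Y \<in> \<S>) \<and>
     (\<forall>X\<in>\<S>. \<forall>k. shift k X \<in> \<S>) \<and>
     (\<forall>X\<in>complexes Car R. \<forall>Y\<in>complexes Car R. \<forall>Z\<in>complexes Car R. \<forall>u v w.
        distinguished_triangle Car R X Y Z u v w \<longrightarrow>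
          (X \<in> \<S> \<and> Y \<in> \<S> \<longrightarrow> Z \<in> \<S>) \<and> (X \<in> \<S> \<and> Z \<in> \<S> \<longrightarrow> Y \<in> \<S>) \<and> (Y \<in> \<S> \<and> Z \<in> \<S> \<longrightarrow> X \<in> \<S>))"

definition localising ::
  "'i set set \<Rightarrow> 'u set set \<Rightarrow> ('r, 'c) ring_scheme \<Rightarrow> ('r, 'u) cochain set \<Rightarrow> bool" where
  "localising Idx Car R \<S> \<longleftrightarrow> triangulated_subcategory Car R \<S> \<and>
     (\<forall>J\<in>Idx. \<forall>X C \<iota>. (\<forall>j\<in>J. X j \<in> \<S>) \<and> D_coproduct Car R J X C \<iota> \<longrightarrow> C \<in> \<S>)"

definition colocalising ::
  "'i set set \<Rightarrow> 'u set set \<Rightarrow> ('r, 'c) ring_scheme \<Rightarrow> ('r, 'u) cochain set \<Rightarrow> bool" where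
  "colocalising Idx Car R \<S> \<longleftrightarrow> triangulated_subcategory Car R \<S> \<and>
     (\<forall>J\<in>Idx. \<forall>X P \<pi>. (\<forall>j\<in>J. X j \<in> \<S>) \<and> D_product Car R J X P \<pi> \<longrightarrow> P \<in> \<S>)"

definition injectives_generate :: "'i set set \<Rightarrow> 'u set set \<Rightarrow> ('r, 'c) ring_scheme \<Rightarrow> bool" where
  "injectives_generate Idx Car R \<longleftrightarrow>
     \<Inter>{\<S>. localising Idx Car R \<S> \<and> stalk ` injective_modules Car R \<subseteq> \<S>} = complexes Car R"

definition projectives_cogenerate :: "'i set set \<Rightarrow> 'u set set \<Rightarrow> ('r, 'c) ring_scheme \<Rightarrow> bool" where
  "projectives_cogenerate Idx Car R \<longleftrightarrow>
     \<Inter>{\<S>. colocalising Idx Car R \<S> \<and> stalk ` projective_modules Car R \<subseteq> \<S>} = complexes Car R"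

end

theory Submission
  imports Defs
begin

text \<open>
  Let \<open>P\<close> be the ideal of \<open>\<Lambda>\<close> generated by the removed arrows \<open>e\<^sub>i \<rightarrow> f\<^sub>i\<close>. As these do not occur in
  the generators of \<open>I\<close>, forgetting the paths through them makes \<open>\<Gamma> = \<Lambda> / P\<close> a subring of \<open>\<Lambda>\<close> as
  well, and a \<open>\<Lambda>\<close>-module is a \<open>\<Gamma>\<close>-module \<open>V\<close> with arbitrary linear maps \<open>V e\<^sub>i \<rightarrow> V f\<^sub>i\<close>. The
  condition on homomorphisms means \<open>f\<^sub>j \<Lambda> e\<^sub>i = 0\<close>, so that \<open>P\<close> squares to zero.

  Restriction to \<open>\<Gamma>\<close> preserves injectives: given a monomorphism of \<open>\<Gamma>\<close>-modules \<open>E \<rightarrow> V\<close>, the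
  action of the arrows on \<open>E\<close> extends along a linear retraction to \<open>V\<close>, and over \<open>\<Lambda>\<close> the map splits. An
  injective \<open>\<Gamma>\<close>-module, seen as a \<open>\<Lambda>\<close>-module, embeds into a coinduced injective one, and choosing
  actions of the arrows in the same way shows that the cokernel is injective. Both arguments dualise.

  Preimages of (co)localising subcategories under restriction of scalars are (co)localising. Every
  \<open>\<Gamma>\<close>-complex is restricted from \<open>\<Lambda>\<close>, and since \<open>P\<close> squares to zero, every \<open>\<Lambda>\<close>-complex is an extension
  of two \<open>\<Gamma>\<close>-complexes, which gives both implications. All of this takes place on the level of
  complexes: a calculus of fractions shows that a subcategory is (co)localising as soon as
  it is closed under quasi-isomorphisms, shifts, cones and the explicit (co)products of complexes.
\<close>

notation cmap_comp (infixl "**" 55)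

abbreviation (input) bracket_add ("(_ \<oplus>[_]/ _)" [65, 0, 66] 65) where "x \<oplus>[M] y \<equiv> add M x y"
abbreviation (input) bracket_minus ("(_ \<ominus>[_]/ _)" [65, 0, 66] 65) where "x \<ominus>[M] y \<equiv> a_minus M x y"
abbreviation (input) bracket_neg ("(\<ominus>[_] _)" [0, 81] 80) where "\<ominus>[M] x \<equiv> a_inv M x"
abbreviation (input) bracket_mult ("(_ \<otimes>[_]/ _)" [70, 0, 71] 70) where "x \<otimes>[M] y \<equiv> mult M x y"
abbreviation (input) bracket_smult ("(_ \<odot>[_]/ _)" [70, 0, 71] 70) where "r \<odot>[M] x \<equiv> smult M r x"
abbreviation (input) bracket_zero ("\<zero>[_]") where "\<zero>[M] \<equiv> zero M"
abbreviation (input) bracket_one ("\<one>[_]") where "\<one>[M] \<equiv> one M"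

abbreviation (input) el :: "('r, 'm) cochain => int => 'm set" where
  "el X n \<equiv> carrier (obj X n)"

section \<open>Right modules and their homomorphisms\<close>

locale rmod = abelian_group M + R: ring R
  for R :: "('r, 'c) ring_scheme" and M :: "('r, 'm) module" (structure) +
  assumes smult_closed [simp, intro]: "r \<in> carrier R ==> x \<in> carrier M ==> r \<odot> x \<in> carrier M"
    and smult_add: "r \<in> carrier R ==> x \<in> carrier M ==> y \<in> carrier M ==>
      r \<odot> (x \<oplus> y) = r \<odot> x \<oplus> r \<odot> y"
    and add_smult: "r \<in> carrier R ==> s \<in> carrier R ==> x \<in> carrier M ==>
      (r \<oplus>[R] s) \<odot> x = r \<odot> x \<oplus> s \<odot> x"
    and mult_smult: "r \<in> carrier R ==> s \<in> carrier R ==> x \<in> carrier M ==>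
      (r \<otimes>[R] s) \<odot> x = s \<odot> (r \<odot> x)"
    and one_smult [simp]: "x \<in> carrier M ==> \<one>[R] \<odot> x = x"

lemma right_module_iff: "right_module R M \<longleftrightarrow> rmod R M"
proof
  assume "right_module R M"
  then show "rmod R M"
    unfolding right_module_def by (intro rmod.intro rmod_axioms.intro) simp_all
next
  assume "rmod R M"
  then interpret rmod R M .
  show "right_module R M"
    unfolding right_module_def
    using abelian_group_axioms R.ring_axioms
    by (simp add: smult_add add_smult mult_smult)
qed

context abelian_group
begin

lemmas group_normalise [algebra abelian_group "zero G" "add G" "a_inv G" "a_minus G"] =
  a_closed zero_closed a_inv_closed minus_closed a_assoc l_zero r_zero l_neg r_neg minus_add
  minus_minus a_comm r_neg1 r_neg2 a_lcomm minus_eq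

lemma minus_eq_zeroD: "x \<ominus> y = \<zero> ==> x \<in> carrier G ==> y \<in> carrier G ==> x = y"
  using minus_equality[of x "\<ominus> y"] by (simp add: minus_eq)

lemma minus_self [simp]: "x \<in> carrier G ==> x \<ominus> x = \<zero>"
  by (simp add: minus_eq r_neg)

end

lemma additive_subgroupI':
  assumes "abelian_group G" "H \<subseteq> carrier G" "\<zero>[G] \<in> H"
    "\<And>x y. x \<in> H ==> y \<in> H ==> x \<oplus>[G] y \<in> H" "\<And>x. x \<in> H ==> \<ominus>[G] x \<in> H"
  shows "additive_subgroup H G"
proof -
  interpret abelian_group G by fact
  show ?thesis
    using assms(2-5) by (intro additive_subgroup.intro subgroup.intro) (auto simp: a_inv_def)
qed

context rmod
begin

lemma smult_zero [simp]: "r \<in> carrier R ==> r \<odot> \<zero> = \<zero>"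
  using smult_add[of r \<zero> \<zero>] by simp

lemma zero_smult [simp]: "x \<in> carrier M ==> \<zero>[R] \<odot> x = \<zero>"
  using add_smult[of "\<zero>[R]" "\<zero>[R]" x] by simp

lemma smult_neg: "r \<in> carrier R ==> x \<in> carrier M ==> r \<odot> (\<ominus> x) = \<ominus> (r \<odot> x)"
  using smult_add[of r "\<ominus> x" x] by (intro minus_equality[symmetric]) (simp_all add: l_neg)

lemma smult_minus:
  "r \<in> carrier R ==> x \<in> carrier M ==> y \<in> carrier M ==> r \<odot> (x \<ominus> y) = r \<odot> x \<ominus> r \<odot> y"
  by (simp add: minus_eq smult_add smult_neg)

end

lemma rmod_homI:
  assumes "\<And>x. x \<in> carrier M ==> h x \<in> carrier N"
    "\<And>x y. x \<in> carrier M ==> y \<in> carrier M ==> h (x \<oplus>[M] y) = h x \<oplus>[N] h y"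
    "\<And>r x. r \<in> carrier R ==> x \<in> carrier M ==> h (r \<odot>[M] x) = r \<odot>[N] h x"
  shows "h \<in> rmod_hom R M N"
  using assms unfolding rmod_hom_def by auto

locale rmor = M: rmod R M + N: rmod R N
  for R :: "('r, 'c) ring_scheme" and M :: "('r, 'm) module" and N :: "('r, 'n) module" +
  fixes h
  assumes hom: "h \<in> rmod_hom R M N"
begin

lemma closed [simp, intro]: "x \<in> carrier M ==> h x \<in> carrier N"
  using hom unfolding rmod_hom_def by auto

lemma add [simp]: "x \<in> carrier M ==> y \<in> carrier M ==> h (x \<oplus>[M] y) = h x \<oplus>[N] h y"
  using hom unfolding rmod_hom_def by auto

lemma smult [simp]: "r \<in> carrier R ==> x \<in> carrier M ==> h (r \<odot>[M] x) = r \<odot>[N] h x"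
  using hom unfolding rmod_hom_def by auto

lemma zero [simp]: "h \<zero>[M] = \<zero>[N]"
  using add[of "\<zero>[M]" "\<zero>[M]"] by (simp del: add)

lemma neg [simp]: "x \<in> carrier M ==> h (\<ominus>[M] x) = \<ominus>[N] h x"
  using add[of "\<ominus>[M] x" x] by (intro N.minus_equality[symmetric]) (simp_all add: M.l_neg del: add)

lemma minus [simp]:
  "x \<in> carrier M ==> y \<in> carrier M ==> h (x \<ominus>[M] y) = h x \<ominus>[N] h y"
  by (simp add: M.minus_eq N.minus_eq)

end

lemma rmod_hom_comp:
  "h \<in> rmod_hom R M N ==> k \<in> rmod_hom R N P ==> (\<lambda>x. k (h x)) \<in> rmod_hom R M P"
  unfolding rmod_hom_def by (auto simp: Pi_iff)

lemma rmod_hom_comp': "h \<in> rmod_hom R M N ==> k \<in> rmod_hom R N P ==> k \<circ> h \<in> rmod_hom R M P"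
  unfolding comp_def by (rule rmod_hom_comp)

lemma rmod_hom_id: "(\<lambda>x. x) \<in> rmod_hom R M M"
  unfolding rmod_hom_def by auto

lemma rmod_hom_zero: "rmod R N ==> (\<lambda>x. \<zero>[N]) \<in> rmod_hom R M N"
proof -
  assume "rmod R N"
  then interpret rmod R N .
  show ?thesis by (rule rmod_homI) auto
qed

lemma rmod_hom_add:
  assumes "rmod R M" "rmod R N" "h \<in> rmod_hom R M N" "k \<in> rmod_hom R M N"
  shows "(\<lambda>x. h x \<oplus>[N] k x) \<in> rmod_hom R M N"
proof -
  interpret h: rmor R M N h using assms by (simp add: rmor_def rmor_axioms_def)
  interpret k: rmor R M N k using assms by (simp add: rmor_def rmor_axioms_def)
  show ?thesis by (rule rmod_homI) (simp_all add: h.N.a_ac h.N.smult_add)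
qed

lemma rmod_hom_neg:
  assumes "rmod R M" "rmod R N" "h \<in> rmod_hom R M N"
  shows "(\<lambda>x. \<ominus>[N] h x) \<in> rmod_hom R M N"
proof -
  interpret h: rmor R M N h using assms by (simp add: rmor_def rmor_axioms_def)
  show ?thesis by (rule rmod_homI) (simp_all add: h.N.minus_add h.N.smult_neg h.N.a_comm)
qed


section \<open>Complexes, homotopies and quasi-isomorphisms\<close>

locale cplx =
  fixes R :: "('r, 'c) ring_scheme" and X :: "('r, 'm) cochain"
  assumes cplx: "is_complex R X"

sublocale cplx \<subseteq> rmod R "obj X n" for n
  using cplx unfolding is_complex_def right_module_iff by blast

context cplx
begin

lemma dif_hom: "m = n + 1 ==> dif X n \<in> rmod_hom R (obj X n) (obj X m)"
  using cplx unfolding is_complex_def by auto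

lemma dif_rmor: "rmor R (obj X n) (obj X (n + 1)) (dif X n)"
  by (intro rmor.intro rmor_axioms.intro dif_hom rmod_axioms) simp

lemma dif_closed [simp]: "x \<in> el X n ==> m = n + 1 ==> dif X n x \<in> el X m"
  using rmor.closed[OF dif_rmor] by simp

lemmas dif_add [simp] = rmor.add[OF dif_rmor]
lemmas dif_smult [simp] = rmor.smult[OF dif_rmor]
lemmas dif_zero [simp] = rmor.zero[OF dif_rmor]
lemmas dif_neg [simp] = rmor.neg[OF dif_rmor]
lemmas dif_minus [simp] = rmor.minus[OF dif_rmor]

lemma dif_dif [simp]:
  "x \<in> el X n ==> m = n + 1 ==> dif X m (dif X n x) = \<zero>[obj X (m + 1)]"
  using cplx unfolding is_complex_def by (metis add.assoc one_add_one)

lemma cocyclesD: "x \<in> cocycles X n ==> x \<in> el X n"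
  "x \<in> cocycles X n ==> dif X n x = \<zero>[obj X (n + 1)]"
  unfolding cocycles_def by auto

lemma coboundariesI: "y \<in> el X m ==> n = m + 1 ==> dif X m y \<in> coboundaries X n"
  unfolding coboundaries_def by auto

lemma coboundariesE:
  assumes "x \<in> coboundaries X n"
  obtains y where "y \<in> el X (n - 1)" "x = dif X (n - 1) y"
  using assms unfolding coboundaries_def by auto

lemma coboundaries_closed: "x \<in> coboundaries X n ==> x \<in> el X n"
  unfolding coboundaries_def by auto

lemma coboundaries_add:
  assumes "x \<in> coboundaries X n" "y \<in> coboundaries X n"
  shows "x \<oplus>[obj X n] y \<in> coboundaries X n"
proof -
  obtain x' y' where "x' \<in> el X (n - 1)" "x = dif X (n - 1) x'"
    "y' \<in> el X (n - 1)" "y = dif X (n - 1) y'"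
    using assms by (auto elim!: coboundariesE)
  then show ?thesis
    using coboundariesI[of "x' \<oplus>[obj X (n - 1)] y'" "n - 1" n] by simp
qed

lemma coboundaries_neg:
  assumes "x \<in> coboundaries X n"
  shows "\<ominus>[obj X n] x \<in> coboundaries X n"
proof -
  obtain x' where "x' \<in> el X (n - 1)" "x = dif X (n - 1) x'"
    using assms by (auto elim!: coboundariesE)
  then show ?thesis
    using coboundariesI[of "\<ominus>[obj X (n - 1)] x'" "n - 1" n] by simp
qed

lemma coboundaries_subgroup: "additive_subgroup (coboundaries X n) (obj X n)"
proof (rule additive_subgroupI')
  show "\<zero>[obj X n] \<in> coboundaries X n"
    using coboundariesI[of "\<zero>[obj X (n - 1)]" "n - 1" n] by simp
qed (use abelian_group_axioms coboundaries_closed coboundaries_add coboundaries_neg in auto)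

end

locale cmor = X: cplx R X + Y: cplx R Y
  for R :: "('r, 'c) ring_scheme" and X :: "('r, 'm) cochain" and Y :: "('r, 'n) cochain" +
  fixes f
  assumes chain: "chain_map R X Y f"
begin

lemma hom: "f n \<in> rmod_hom R (obj X n) (obj Y n)"
  using chain unfolding chain_map_def by auto

lemma rmor: "rmor R (obj X n) (obj Y n) (f n)"
  by (intro rmor.intro rmor_axioms.intro hom X.rmod_axioms Y.rmod_axioms)

lemmas closed [simp, intro] = rmor.closed[OF rmor]
lemmas add [simp] = rmor.add[OF rmor]
lemmas smult [simp] = rmor.smult[OF rmor]
lemmas zero [simp] = rmor.zero[OF rmor]
lemmas neg [simp] = rmor.neg[OF rmor]
lemmas minus [simp] = rmor.minus[OF rmor]

lemma comm [simp]: "x \<in> el X n ==> m = n + 1 ==> f m (dif X n x) = dif Y n (f n x)"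
  using chain unfolding chain_map_def by auto

lemma cocycles: "x \<in> cocycles X n ==> f n x \<in> cocycles Y n"
  unfolding cocycles_def using comm[of x n "n + 1"] by auto

lemma coboundaries: "x \<in> coboundaries X n ==> f n x \<in> coboundaries Y n"
  unfolding coboundaries_def by auto

end

definition hinj :: "('r, 'm) cochain => ('r, 'n) cochain => ('m, 'n) cmap => bool" where
  "hinj X Y f \<longleftrightarrow> (\<forall>n. \<forall>x\<in>cocycles X n. f n x \<in> coboundaries Y n \<longrightarrow> x \<in> coboundaries X n)"

definition hsurj :: "('r, 'm) cochain => ('r, 'n) cochain => ('m, 'n) cmap => bool" where
  "hsurj X Y f \<longleftrightarrow> (\<forall>n. \<forall>y\<in>cocycles Y n. \<exists>x\<in>cocycles X n. \<exists>b\<in>coboundaries Y n.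
     y = f n x \<oplus>[obj Y n] b)"

lemma hinjD: "hinj X Y f ==> x \<in> cocycles X n ==> f n x \<in> coboundaries Y n ==> x \<in> coboundaries X n"
  unfolding hinj_def by blast

lemma hsurjE:
  assumes "hsurj X Y f" "y \<in> cocycles Y n"
  obtains x b where "x \<in> cocycles X n" "b \<in> coboundaries Y n" "y = f n x \<oplus>[obj Y n] b"
  using assms unfolding hsurj_def by blast

lemma image_eq_iff_of_subset:
  "g ` S \<subseteq> h ` T ==> g ` S = h ` T \<longleftrightarrow> (\<forall>y\<in>T. \<exists>x\<in>S. g x = h y)"
  by (auto simp: set_eq_subset subset_iff image_iff) (metis+)?

context cplx
begin

lemma coset_eq_iff:
  assumes "x \<in> el X n" "y \<in> el X n"
  shows "coboundaries X n +>\<^bsub>obj X n\<^esub> x = coboundaries X n +>\<^bsub>obj X n\<^esub> y \<longleftrightarrow>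
    (\<exists>b\<in>coboundaries X n. y = x \<oplus>[obj X n] b)"
proof -
  interpret S: abelian_subgroup "coboundaries X n" "obj X n"
    by (rule abelian_subgroupI3[OF coboundaries_subgroup abelian_group_axioms])
  have "y \<in> coboundaries X n +>\<^bsub>obj X n\<^esub> x \<longleftrightarrow> (\<exists>b\<in>coboundaries X n. y = x \<oplus>[obj X n] b)"
    using assms coboundaries_closed by (auto simp: a_r_coset_def' a_comm)
  then show ?thesis
    using a_repr_independence[OF _ assms(1) additive_subgroup.a_subgroup[OF coboundaries_subgroup], of y] S.a_rcos_self[OF assms(2)]
    by metis
qed

lemma coset_zero_add:
  assumes "x \<in> el X n" "b \<in> coboundaries X n"
  shows "coboundaries X n +>\<^bsub>obj X n\<^esub> (x \<oplus>[obj X n] b) = coboundaries X n +>\<^bsub>obj X n\<^esub> x"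
  using coset_eq_iff[of x n "x \<oplus>[obj X n] b"] assms coboundaries_closed by auto

lemma coset_members:
  "x \<in> el X n ==>
    coboundaries X n +>\<^bsub>obj X n\<^esub> x = {x \<oplus>[obj X n] b | b. b \<in> coboundaries X n}"
  using coboundaries_closed a_comm by (auto simp: a_r_coset_def') metis

lemma zero_coboundary: "\<zero>[obj X n] \<in> coboundaries X n"
  using coboundaries_subgroup additive_subgroup.zero_closed by blast

lemma cocycles_minus:
  "x \<in> cocycles X n ==> y \<in> cocycles X n ==> x \<ominus>[obj X n] y \<in> cocycles X n"
  unfolding cocycles_def by auto

end

context cmor
begin

lemma cohomology_map_coset:
  assumes "x \<in> cocycles X n"
  shows "cohomology_map Y f n (coboundaries X n +>\<^bsub>obj X n\<^esub> x) =
    coboundaries Y n +>\<^bsub>obj Y n\<^esub> f n x"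
proof -
  have "coboundaries Y n +>\<^bsub>obj Y n\<^esub> f n (x \<oplus>[obj X n] b) = coboundaries Y n +>\<^bsub>obj Y n\<^esub> f n x"
    if "b \<in> coboundaries X n" for b
    using that assms Y.coset_zero_add[OF _ coboundaries[OF that]] X.cocyclesD(1) X.coboundaries_closed
    by simp
  then show ?thesis
    using X.zero_coboundary
    unfolding cohomology_map_def X.coset_members[OF X.cocyclesD(1)[OF assms]] by blast
qed

lemma quasi_iso_iff: "quasi_iso R X Y f \<longleftrightarrow> hinj X Y f \<and> hsurj X Y f"
proof -
  have inj: "inj_on (cohomology_map Y f n) (cohomology X n) \<longleftrightarrow>
      (\<forall>x\<in>cocycles X n. f n x \<in> coboundaries Y n \<longrightarrow> x \<in> coboundaries X n)" for n
  proof
    assume inj: "inj_on (cohomology_map Y f n) (cohomology X n)"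
    show "\<forall>x\<in>cocycles X n. f n x \<in> coboundaries Y n \<longrightarrow> x \<in> coboundaries X n"
    proof (intro ballI impI)
      fix x assume x: "x \<in> cocycles X n" "f n x \<in> coboundaries Y n"
      let ?z = "\<zero>[obj X n]"
      have z: "?z \<in> cocycles X n"
        by (simp add: cocycles_def)
      have "coboundaries Y n +>\<^bsub>obj Y n\<^esub> \<zero>[obj Y n] = coboundaries Y n +>\<^bsub>obj Y n\<^esub> f n x"
        using x X.cocyclesD(1)[OF x(1)] by (subst Y.coset_eq_iff) (auto intro!: bexI[of _ "f n x"])
      then have "cohomology_map Y f n (coboundaries X n +>\<^bsub>obj X n\<^esub> ?z) =
          cohomology_map Y f n (coboundaries X n +>\<^bsub>obj X n\<^esub> x)"
        by (simp add: cohomology_map_coset z x)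
      then have "coboundaries X n +>\<^bsub>obj X n\<^esub> ?z = coboundaries X n +>\<^bsub>obj X n\<^esub> x"
        using inj z x unfolding cohomology_def inj_on_def by blast
      then show "x \<in> coboundaries X n"
        using X.coset_eq_iff[of ?z n x] X.cocyclesD(1)[OF x(1)] X.coboundaries_closed by auto
    qed
  next
    assume h: "\<forall>x\<in>cocycles X n. f n x \<in> coboundaries Y n \<longrightarrow> x \<in> coboundaries X n"
    have "coboundaries X n +>\<^bsub>obj X n\<^esub> x = coboundaries X n +>\<^bsub>obj X n\<^esub> y"
      if xy: "x \<in> cocycles X n" "y \<in> cocycles X n"
        and eq: "coboundaries Y n +>\<^bsub>obj Y n\<^esub> f n x = coboundaries Y n +>\<^bsub>obj Y n\<^esub> f n y" for x y
    proof -
      obtain b where b: "b \<in> coboundaries Y n" "f n y = f n x \<oplus>[obj Y n] b"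
        using eq xy X.cocyclesD Y.coset_eq_iff[of "f n x" n "f n y"] by auto
      have c: "x \<in> el X n" "y \<in> el X n" "b \<in> el Y n"
        "f n x \<in> el Y n"
        using xy b X.cocyclesD Y.coboundaries_closed by auto
      have "f n y \<ominus>[obj Y n] f n x = b"
        using c(3,4) unfolding b(2) by algebra
      then have "f n (y \<ominus>[obj X n] x) = b"
        using c(1,2) by simp
      then have "y \<ominus>[obj X n] x \<in> coboundaries X n"
        using h xy b X.cocycles_minus by auto
      moreover have "y = x \<oplus>[obj X n] (y \<ominus>[obj X n] x)"
        using c by algebra
      ultimately show ?thesis
        using X.coset_eq_iff[OF c(1,2)] by blast
    qed
    note eq = this
    show "inj_on (cohomology_map Y f n) (cohomology X n)"
    proof (rule inj_onI)
      fix c d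
      assume c: "c \<in> cohomology X n" and d: "d \<in> cohomology X n"
        and cd: "cohomology_map Y f n c = cohomology_map Y f n d"
      obtain x where x: "x \<in> cocycles X n" "c = coboundaries X n +>\<^bsub>obj X n\<^esub> x"
        using c unfolding cohomology_def by (rule imageE)
      obtain y where y: "y \<in> cocycles X n" "d = coboundaries X n +>\<^bsub>obj X n\<^esub> y"
        using d unfolding cohomology_def by (rule imageE)
      show "c = d"
        unfolding x(2) y(2)
        by (rule eq[OF x(1) y(1)])
          (use cd cohomology_map_coset[OF x(1)] cohomology_map_coset[OF y(1)] x(2) y(2) in simp)
    qed
  qed
  have surj: "cohomology_map Y f n ` cohomology X n = cohomology Y n \<longleftrightarrow>
      (\<forall>y\<in>cocycles Y n. \<exists>x\<in>cocycles X n. \<exists>b\<in>coboundaries Y n. y = f n x \<oplus>[obj Y n] b)" for n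
  proof -
    let ?c = "\<lambda>y. coboundaries Y n +>\<^bsub>obj Y n\<^esub> y"
    have 1: "cohomology_map Y f n ` cohomology X n = (\<lambda>x. ?c (f n x)) ` cocycles X n"
      unfolding cohomology_def image_image
      by (rule image_cong[OF refl]) (rule cohomology_map_coset)
    have 2: "(\<lambda>x. ?c (f n x)) ` cocycles X n \<subseteq> ?c ` cocycles Y n"
      using cocycles by blast
    have 3: "?c (f n x) = ?c y \<longleftrightarrow> (\<exists>b\<in>coboundaries Y n. y = f n x \<oplus>[obj Y n] b)"
      if "x \<in> cocycles X n" "y \<in> cocycles Y n" for x y
      using that X.cocyclesD(1) Y.cocyclesD(1) by (intro Y.coset_eq_iff) blast+
    have "cohomology_map Y f n ` cohomology X n = cohomology Y n \<longleftrightarrow>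
        (\<forall>y\<in>cocycles Y n. \<exists>x\<in>cocycles X n. ?c (f n x) = ?c y)"
      unfolding 1 unfolding cohomology_def
      by (rule image_eq_iff_of_subset[OF 2])
    then show ?thesis
      using 3 by simp
  qed
  show ?thesis
    unfolding quasi_iso_def bij_betw_def hinj_def hsurj_def inj surj using chain by blast
qed

end

definition cmap_add :: "('r, 'n) cochain => ('m, 'n) cmap => ('m, 'n) cmap => ('m, 'n) cmap" where
  "cmap_add Y f g = (\<lambda>n x. f n x \<oplus>[obj Y n] g n x)"

lemma chain_mapI:
  assumes "\<And>n. f n \<in> rmod_hom R (obj X n) (obj Y n)"
    "\<And>n x. x \<in> el X n ==> f (n + 1) (dif X n x) = dif Y n (f n x)"
  shows "chain_map R X Y f"
  using assms unfolding chain_map_def by blast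

lemma cmorI: "is_complex R X ==> is_complex R Y ==> chain_map R X Y f ==> cmor R X Y f"
  unfolding cmor_def cmor_axioms_def cplx_def by blast

lemma chain_map_id: "is_complex R X ==> chain_map R X X cmap_id"
  unfolding cmap_id_def by (intro chain_mapI rmod_hom_id) simp

lemma chain_map_comp:
  assumes "chain_map R X Y f" "chain_map R Y Z g"
  shows "chain_map R X Z (g ** f)"
proof (rule chain_mapI)
  show "(g ** f) n \<in> rmod_hom R (obj X n) (obj Z n)" for n
    using assms unfolding chain_map_def cmap_comp_def by (auto intro: rmod_hom_comp')
  show "(g ** f) (n + 1) (dif X n x) = dif Z n ((g ** f) n x)" if "x \<in> el X n" for n x
    using assms that unfolding chain_map_def cmap_comp_def rmod_hom_def by (auto simp: Pi_iff)
qed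

lemma cmap_comp_assoc: "h ** (g ** f) = h ** g ** f"
  unfolding cmap_comp_def by (simp add: comp_assoc)

lemma cmap_id_comp [simp]: "cmap_id ** f = f" "f ** cmap_id = f"
  unfolding cmap_comp_def cmap_id_def by (auto simp: fun_eq_iff)

lemma homotopicI:
  assumes "\<And>n. s n \<in> rmod_hom R (obj X n) (obj Y (n - 1))"
    "\<And>n x. x \<in> el X n ==>
      f n x = g n x \<oplus>[obj Y n] (dif Y (n - 1) (s n x) \<oplus>[obj Y n] s (n + 1) (dif X n x))"
  shows "homotopic R X Y f g"
  using assms unfolding homotopic_def by blast

locale htpy = X: cplx R X + Y: cplx R Y
  for R :: "('r, 'c) ring_scheme" and X :: "('r, 'm) cochain" and Y :: "('r, 'n) cochain" +
  fixes s
  assumes s_hom: "s n \<in> rmod_hom R (obj X n) (obj Y (n - 1))"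
begin

lemma s_rmor: "m = n - 1 ==> rmor R (obj X n) (obj Y m) (s n)"
  by (intro rmor.intro rmor_axioms.intro) (auto intro: s_hom X.rmod_axioms Y.rmod_axioms)

lemma s_closed [simp]: "x \<in> el X n ==> m = n - 1 ==> s n x \<in> el Y m"
  using rmor.closed[OF s_rmor[of m n]] by simp

lemmas s_add [simp] = rmor.add[OF s_rmor[OF refl]]
lemmas s_zero [simp] = rmor.zero[OF s_rmor[OF refl]]
lemmas s_neg [simp] = rmor.neg[OF s_rmor[OF refl]]
lemmas s_smult [simp] = rmor.smult[OF s_rmor[OF refl]]
lemmas s_minus [simp] = rmor.minus[OF s_rmor[OF refl]]

end

lemma homotopicE:
  assumes "homotopic R X Y f g" "is_complex R X" "is_complex R Y"
  obtains s where "htpy R X Y s" "\<And>n x. x \<in> el X n ==>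
      f n x = g n x \<oplus>[obj Y n] (dif Y (n - 1) (s n x) \<oplus>[obj Y n] s (n + 1) (dif X n x))"
  using assms unfolding homotopic_def htpy_def htpy_axioms_def cplx_def by blast

lemma homotopic_eqI:
  assumes "is_complex R X" "chain_map R X Y g" "is_complex R Y"
    "\<And>n x. x \<in> el X n ==> f n x = g n x"
  shows "homotopic R X Y f g"
proof -
  interpret g: cmor R X Y g using assms by (simp add: cmorI)
  show ?thesis
  proof (rule homotopicI)
    show "(\<lambda>n x. \<zero>[obj Y (n - 1)]) n \<in> rmod_hom R (obj X n) (obj Y (n - 1))" for n
      by (rule rmod_hom_zero) (rule g.Y.rmod_axioms)
    show "f n x = g n x \<oplus>[obj Y n] (dif Y (n - 1) \<zero>[obj Y (n - 1)] \<oplus>[obj Y n] \<zero>[obj Y (n + 1 - 1)])"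
      if "x \<in> el X n" for n x
      using that assms(4) g.Y.dif_zero[of "n - 1"] by simp
  qed
qed

lemma homotopic_refl: "is_complex R X ==> is_complex R Y ==> chain_map R X Y f ==> homotopic R X Y f f"
  by (rule homotopic_eqI) auto

lemma homotopic_sym:
  assumes "homotopic R X Y f g" "is_complex R X" "is_complex R Y" "chain_map R X Y g"
  shows "homotopic R X Y g f"
proof -
  interpret g: cmor R X Y g using assms by (simp add: cmorI)
  from homotopicE[OF assms(1-3)] obtain s where s: "htpy R X Y s" and
    eq: "\<And>n x. x \<in> el X n ==>
      f n x = g n x \<oplus>[obj Y n] (dif Y (n - 1) (s n x) \<oplus>[obj Y n] s (n + 1) (dif X n x))" by blast
  interpret htpy R X Y s by fact
  show ?thesis
  proof (rule homotopicI)
    show "(\<lambda>n x. \<ominus>[obj Y (n - 1)] s n x) n \<in> rmod_hom R (obj X n) (obj Y (n - 1))" for n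
      by (rule rmod_hom_neg) (auto intro: g.X.rmod_axioms g.Y.rmod_axioms s_hom)
    fix n x assume x: "x \<in> el X n"
    have c: "g n x \<in> el Y n" "dif Y (n - 1) (s n x) \<in> el Y n"
      "s (n + 1) (dif X n x) \<in> el Y n"
      using x by auto
    have "g n x = g n x \<oplus>[obj Y n] (dif Y (n - 1) (s n x) \<oplus>[obj Y n] s (n + 1) (dif X n x)) \<oplus>[obj Y n]
      (\<ominus>[obj Y n] dif Y (n - 1) (s n x) \<oplus>[obj Y n] \<ominus>[obj Y n] s (n + 1) (dif X n x))"
      using c by algebra
    then show "g n x = f n x \<oplus>[obj Y n] (dif Y (n - 1) (\<ominus>[obj Y (n - 1)] s n x) \<oplus>[obj Y n]
        \<ominus>[obj Y (n + 1 - 1)] s (n + 1) (dif X n x))"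
      using x g.Y.dif_neg[of "s n x" "n - 1"] by (simp add: eq)
  qed
qed

lemma homotopic_trans:
  assumes "homotopic R X Y f g" "homotopic R X Y g h" "is_complex R X" "is_complex R Y"
    "chain_map R X Y h"
  shows "homotopic R X Y f h"
proof -
  interpret h: cmor R X Y h using assms by (simp add: cmorI)
  from homotopicE[OF assms(1,3,4)] obtain s where s: "htpy R X Y s" and
    eq: "\<And>n x. x \<in> el X n ==>
      f n x = g n x \<oplus>[obj Y n] (dif Y (n - 1) (s n x) \<oplus>[obj Y n] s (n + 1) (dif X n x))" by blast
  from homotopicE[OF assms(2-4)] obtain t where t: "htpy R X Y t" and
    eq': "\<And>n x. x \<in> el X n ==>
      g n x = h n x \<oplus>[obj Y n] (dif Y (n - 1) (t n x) \<oplus>[obj Y n] t (n + 1) (dif X n x))" by blast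
  interpret s: htpy R X Y s by fact
  interpret t: htpy R X Y t by fact
  show ?thesis
  proof (rule homotopicI)
    show "(\<lambda>n x. s n x \<oplus>[obj Y (n - 1)] t n x) n \<in> rmod_hom R (obj X n) (obj Y (n - 1))" for n
      by (rule rmod_hom_add) (auto intro: h.X.rmod_axioms h.Y.rmod_axioms s.s_hom t.s_hom)
    fix n x assume x: "x \<in> el X n"
    have c: "h n x \<in> el Y n" "dif Y (n - 1) (s n x) \<in> el Y n"
      "s (n + 1) (dif X n x) \<in> el Y n" "dif Y (n - 1) (t n x) \<in> el Y n"
      "t (n + 1) (dif X n x) \<in> el Y n"
      using x by auto
    have "h n x \<oplus>[obj Y n] (dif Y (n - 1) (t n x) \<oplus>[obj Y n] t (n + 1) (dif X n x)) \<oplus>[obj Y n]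
      (dif Y (n - 1) (s n x) \<oplus>[obj Y n] s (n + 1) (dif X n x)) =
      h n x \<oplus>[obj Y n] ((dif Y (n - 1) (s n x) \<oplus>[obj Y n] dif Y (n - 1) (t n x)) \<oplus>[obj Y n]
      (s (n + 1) (dif X n x) \<oplus>[obj Y n] t (n + 1) (dif X n x)))"
      using c by algebra
    then show "f n x = h n x \<oplus>[obj Y n] (dif Y (n - 1) (s n x \<oplus>[obj Y (n - 1)] t n x) \<oplus>[obj Y n]
        (s (n + 1) (dif X n x) \<oplus>[obj Y (n + 1 - 1)] t (n + 1) (dif X n x)))"
      using x h.Y.dif_add[of "s n x" "n - 1" "t n x"] by (simp add: eq eq')
  qed
qed

lemma homotopic_comp_left:
  assumes "homotopic R X Y f g" "is_complex R X" "is_complex R Y" "is_complex R Z"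
    "chain_map R X Y g" "chain_map R Y Z h"
  shows "homotopic R X Z (h ** f) (h ** g)"
proof -
  interpret g: cmor R X Y g using assms by (simp add: cmorI)
  interpret h: cmor R Y Z h using assms by (simp add: cmorI)
  from homotopicE[OF assms(1-3)] obtain s where s: "htpy R X Y s" and
    eq: "\<And>n x. x \<in> el X n ==>
      f n x = g n x \<oplus>[obj Y n] (dif Y (n - 1) (s n x) \<oplus>[obj Y n] s (n + 1) (dif X n x))" by blast
  interpret htpy R X Y s by fact
  show ?thesis
  proof (rule homotopicI)
    show "(\<lambda>n x. h (n - 1) (s n x)) n \<in> rmod_hom R (obj X n) (obj Z (n - 1))" for n
      by (rule rmod_hom_comp[OF s_hom h.hom])
    show "(h ** f) n x = (h ** g) n x \<oplus>[obj Z n] (dif Z (n - 1) (h (n - 1) (s n x)) \<oplus>[obj Z n]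
        h (n + 1 - 1) (s (n + 1) (dif X n x)))" if x: "x \<in> el X n" for n x
      using x h.comm[of "s n x" "n - 1" n] by (simp add: eq cmap_comp_def del: h.comm)
  qed
qed

lemma homotopic_comp_right:
  assumes "homotopic R Y Z f g" "is_complex R X" "is_complex R Y" "is_complex R Z"
    "chain_map R X Y h"
  shows "homotopic R X Z (f ** h) (g ** h)"
proof -
  interpret h: cmor R X Y h using assms by (simp add: cmorI)
  from homotopicE[OF assms(1,3,4)] obtain s where s: "htpy R Y Z s" and
    eq: "\<And>n x. x \<in> el Y n ==>
      f n x = g n x \<oplus>[obj Z n] (dif Z (n - 1) (s n x) \<oplus>[obj Z n] s (n + 1) (dif Y n x))" by blast
  interpret htpy R Y Z s by fact
  show ?thesis
  proof (rule homotopicI)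
    show "(\<lambda>n x. s n (h n x)) n \<in> rmod_hom R (obj X n) (obj Z (n - 1))" for n
      by (rule rmod_hom_comp[OF h.hom s_hom])
    show "(f ** h) n x = (g ** h) n x \<oplus>[obj Z n] (dif Z (n - 1) (s n (h n x)) \<oplus>[obj Z n]
        s (n + 1) (h (n + 1) (dif X n x)))" if x: "x \<in> el X n" for n x
      using x by (simp add: eq cmap_comp_def)
  qed
qed

context
  fixes R :: "('r, 'c) ring_scheme" and X :: "('r, 'm) cochain" and Y :: "('r, 'n) cochain"
    and Z :: "('r, 'p) cochain" and f g
  assumes cx: "is_complex R X" "is_complex R Y" "is_complex R Z"
    and f: "chain_map R X Y f" and g: "chain_map R Y Z g"
begin

interpretation f: cmor R X Y f using cx f by (simp add: cmorI)
interpretation g: cmor R Y Z g using cx g by (simp add: cmorI)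

lemma hinj_comp: "hinj X Y f ==> hinj Y Z g ==> hinj X Z (g ** f)"
  unfolding hinj_def cmap_comp_def using f.cocycles by simp

lemma hsurj_comp:
  assumes "hsurj X Y f" "hsurj Y Z g"
  shows "hsurj X Z (g ** f)"
  unfolding hsurj_def
proof (intro allI ballI)
  fix n z assume "z \<in> cocycles Z n"
  then obtain y b where y: "y \<in> cocycles Y n" "b \<in> coboundaries Z n" "z = g n y \<oplus>[obj Z n] b"
    by (rule hsurjE[OF assms(2)])
  obtain x b' where x: "x \<in> cocycles X n" "b' \<in> coboundaries Y n" "y = f n x \<oplus>[obj Y n] b'"
    by (rule hsurjE[OF assms(1) y(1)])
  have c: "f n x \<in> el Y n" "b' \<in> el Y n" "b \<in> el Z n"
    using x y f.X.cocyclesD f.Y.coboundaries_closed g.Y.coboundaries_closed by auto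
  have "z = (g ** f) n x \<oplus>[obj Z n] (g n b' \<oplus>[obj Z n] b)"
    using c unfolding cmap_comp_def y(3) x(3) by (simp add: g.Y.a_assoc)
  then show "\<exists>x\<in>cocycles X n. \<exists>b\<in>coboundaries Z n. z = (g ** f) n x \<oplus>[obj Z n] b"
    using x y g.coboundaries g.Y.coboundaries_add by blast
qed

lemma hinj_comp_first: "hinj X Z (g ** f) ==> hinj X Y f"
  unfolding hinj_def cmap_comp_def using g.coboundaries by simp

lemma hsurj_comp_second:
  assumes "hsurj X Z (g ** f)"
  shows "hsurj Y Z g"
  using assms f.cocycles unfolding hsurj_def cmap_comp_def comp_def by metis

lemma hinj_comp_second:
  assumes "hinj X Z (g ** f)" "hsurj X Y f"
  shows "hinj Y Z g"
  unfolding hinj_def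
proof (intro allI ballI impI)
  fix n y assume y: "y \<in> cocycles Y n" "g n y \<in> coboundaries Z n"
  obtain x b where x: "x \<in> cocycles X n" "b \<in> coboundaries Y n" "y = f n x \<oplus>[obj Y n] b"
    by (rule hsurjE[OF assms(2) y(1)])
  have c: "f n x \<in> el Y n" "b \<in> el Y n" "g n (f n x) \<in> el Z n"
    "g n b \<in> el Z n"
    using x y f.X.cocyclesD f.Y.coboundaries_closed by auto
  have "g n y = g n (f n x) \<oplus>[obj Z n] g n b"
    using c x(3) by simp
  then have "g n (f n x) = g n y \<oplus>[obj Z n] \<ominus>[obj Z n] g n b"
    using c(3,4) by (simp add: g.Y.a_assoc g.Y.r_neg)
  then have "(g ** f) n x \<in> coboundaries Z n"
    using y(2) g.coboundaries[OF x(2)] g.Y.coboundaries_add g.Y.coboundaries_neg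
    unfolding cmap_comp_def by simp
  then have "f n x \<in> coboundaries Y n"
    using hinjD[OF assms(1) x(1)] f.coboundaries by blast
  then show "y \<in> coboundaries Y n"
    using x f.Y.coboundaries_add by blast
qed

lemma hsurj_comp_first:
  assumes "hsurj X Z (g ** f)" "hinj Y Z g"
  shows "hsurj X Y f"
  unfolding hsurj_def
proof (intro allI ballI)
  fix n y assume y: "y \<in> cocycles Y n"
  obtain x b where x: "x \<in> cocycles X n" "b \<in> coboundaries Z n" "g n y = (g ** f) n x \<oplus>[obj Z n] b"
    by (rule hsurjE[OF assms(1) g.cocycles[OF y]])
  have c: "f n x \<in> el Y n" "b \<in> el Z n" "g n (f n x) \<in> el Z n"
    "y \<in> el Y n"
    using x y f.X.cocyclesD f.Y.cocyclesD g.Y.coboundaries_closed by auto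
  have "g n y \<ominus>[obj Z n] g n (f n x) = b"
    using c(2,3) unfolding x(3) cmap_comp_def comp_def by algebra
  then have "g n (y \<ominus>[obj Y n] f n x) = b"
    using c by simp
  then have "y \<ominus>[obj Y n] f n x \<in> coboundaries Y n"
    using hinjD[OF assms(2) f.Y.cocycles_minus[OF y f.cocycles[OF x(1)]]] x(2) by simp
  moreover have "y = f n x \<oplus>[obj Y n] (y \<ominus>[obj Y n] f n x)"
    using c(1,4) by algebra
  ultimately show "\<exists>x\<in>cocycles X n. \<exists>b\<in>coboundaries Y n. y = f n x \<oplus>[obj Y n] b"
    using x(1) by blast
qed

end

lemma homotopic_cocycle:
  assumes "homotopic R X Y f g" "is_complex R X" "is_complex R Y" "chain_map R X Y g"
    "x \<in> cocycles X n"
  obtains b where "b \<in> coboundaries Y n" "f n x = g n x \<oplus>[obj Y n] b"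
proof -
  interpret g: cmor R X Y g using assms by (simp add: cmorI)
  from homotopicE[OF assms(1-3)] obtain s where s: "htpy R X Y s" and
    eq: "\<And>n x. x \<in> el X n ==>
      f n x = g n x \<oplus>[obj Y n] (dif Y (n - 1) (s n x) \<oplus>[obj Y n] s (n + 1) (dif X n x))" by blast
  interpret htpy R X Y s by fact
  have x: "x \<in> el X n" "dif X n x = \<zero>[obj X (n + 1)]"
    using g.X.cocyclesD assms(5) by auto
  show thesis
  proof (rule that)
    show "dif Y (n - 1) (s n x) \<in> coboundaries Y n"
      using x by (intro g.Y.coboundariesI) auto
    show "f n x = g n x \<oplus>[obj Y n] dif Y (n - 1) (s n x)"
      using x s_zero[of "n + 1"] by (simp add: eq)
  qed
qed

lemma hinj_homotopic:
  assumes "homotopic R X Y f g" "is_complex R X" "is_complex R Y" "chain_map R X Y g" "hinj X Y f"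
  shows "hinj X Y g"
  unfolding hinj_def
proof (intro allI ballI impI)
  interpret g: cmor R X Y g using assms by (simp add: cmorI)
  fix n x assume x: "x \<in> cocycles X n" "g n x \<in> coboundaries Y n"
  obtain b where "b \<in> coboundaries Y n" "f n x = g n x \<oplus>[obj Y n] b"
    by (rule homotopic_cocycle[OF assms(1-4) x(1)])
  then show "x \<in> coboundaries X n"
    using hinjD[OF assms(5) x(1)] x(2) g.Y.coboundaries_add by simp
qed

lemma hsurj_homotopic:
  assumes "homotopic R X Y f g" "is_complex R X" "is_complex R Y" "chain_map R X Y g" "hsurj X Y f"
  shows "hsurj X Y g"
  unfolding hsurj_def
proof (intro allI ballI)
  interpret g: cmor R X Y g using assms by (simp add: cmorI)
  fix n y assume "y \<in> cocycles Y n"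
  then obtain x b where x: "x \<in> cocycles X n" "b \<in> coboundaries Y n" "y = f n x \<oplus>[obj Y n] b"
    by (rule hsurjE[OF assms(5)])
  obtain b' where b': "b' \<in> coboundaries Y n" "f n x = g n x \<oplus>[obj Y n] b'"
    by (rule homotopic_cocycle[OF assms(1-4) x(1)])
  have "y = g n x \<oplus>[obj Y n] (b' \<oplus>[obj Y n] b)"
    using x b' g.X.cocyclesD(1)[OF x(1)] g.Y.coboundaries_closed by (simp add: g.Y.a_assoc)
  then show "\<exists>x\<in>cocycles X n. \<exists>b\<in>coboundaries Y n. y = g n x \<oplus>[obj Y n] b"
    using x(1,2) b' g.Y.coboundaries_add by blast
qed

lemma quasi_isoD:
  assumes "quasi_iso R X Y f" "is_complex R X" "is_complex R Y"
  shows "chain_map R X Y f" "hinj X Y f" "hsurj X Y f"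
proof -
  show c: "chain_map R X Y f"
    using assms(1) unfolding quasi_iso_def by blast
  show "hinj X Y f" "hsurj X Y f"
    using cmor.quasi_iso_iff[OF cmorI[OF assms(2,3) c]] assms(1) by auto
qed

lemma quasi_isoI:
  assumes "is_complex R X" "is_complex R Y" "chain_map R X Y f" "hinj X Y f" "hsurj X Y f"
  shows "quasi_iso R X Y f"
  using cmor.quasi_iso_iff[OF cmorI[OF assms(1-3)]] assms(4,5) by blast

section \<open>Calculus of fractions in the derived category\<close>

lemma roofs_iff: "(Z, s, f) \<in> roofs Car R X Y \<longleftrightarrow>
    Z \<in> complexes Car R \<and> quasi_iso R Z X s \<and> chain_map R Z Y f"
  unfolding roofs_def by auto

locale cochain_calculus =
  fixes Car :: "'u set set" and R :: "('r, 'c) ring_scheme"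
begin

definition hom :: "('r, 'u) cochain => ('r, 'u) cochain => ('u, 'u) cmap => bool" where
  "hom X Y f \<longleftrightarrow> X \<in> complexes Car R \<and> Y \<in> complexes Car R \<and> chain_map R X Y f"

definition we :: "('r, 'u) cochain => ('r, 'u) cochain => ('u, 'u) cmap => bool" where
  "we X Y f \<longleftrightarrow> X \<in> complexes Car R \<and> Y \<in> complexes Car R \<and> quasi_iso R X Y f"

definition ho :: "('r, 'u) cochain => ('r, 'u) cochain => ('u, 'u) cmap => ('u, 'u) cmap => bool" where
  "ho X Y f g \<longleftrightarrow> hom X Y f \<and> hom X Y g \<and> homotopic R X Y f g"

lemma complexesD: "X \<in> complexes Car R ==> is_complex R X"
  unfolding complexes_def by auto

lemma hom_ob: "hom X Y f ==> X \<in> complexes Car R" "hom X Y f ==> Y \<in> complexes Car R"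
  unfolding hom_def by auto

lemma hom_id: "X \<in> complexes Car R ==> hom X X cmap_id"
  unfolding hom_def using chain_map_id complexesD by blast

lemma hom_comp: "hom Y Z g ==> hom X Y f ==> hom X Z (g ** f)"
  unfolding hom_def using chain_map_comp by blast

lemma ho_hom: "ho X Y f g ==> hom X Y f" "ho X Y f g ==> hom X Y g"
  unfolding ho_def by auto

lemma ho_refl: "hom X Y f ==> ho X Y f f"
  unfolding ho_def hom_def using homotopic_refl complexesD by blast

lemma ho_sym: "ho X Y f g ==> ho X Y g f"
  unfolding ho_def hom_def using homotopic_sym complexesD by blast

lemma ho_trans [trans]: "ho X Y f g ==> ho X Y g h ==> ho X Y f h"
  unfolding ho_def hom_def using homotopic_trans complexesD by blast

lemma ho_left: "ho X Y f g ==> hom Y Z h ==> ho X Z (h ** f) (h ** g)"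
  unfolding ho_def hom_def using homotopic_comp_left complexesD chain_map_comp by metis

lemma ho_right: "ho Y Z f g ==> hom X Y h ==> ho X Z (f ** h) (g ** h)"
  unfolding ho_def hom_def using homotopic_comp_right complexesD chain_map_comp by metis

lemma we_hom: "we X Y f ==> hom X Y f"
  unfolding we_def hom_def quasi_iso_def by auto

lemma we_iff: "we X Y f \<longleftrightarrow> hom X Y f \<and> hinj X Y f \<and> hsurj X Y f"
  unfolding we_def hom_def using quasi_isoD quasi_isoI complexesD by metis

lemma we_id: "X \<in> complexes Car R ==> we X X cmap_id"
proof -
  assume X: "X \<in> complexes Car R"
  then interpret cplx R X
    by (simp add: cplx_def complexesD)
  have "hsurj X X cmap_id"
    unfolding hsurj_def cmap_id_def
  proof (intro allI ballI)
    fix n x assume x: "x \<in> cocycles X n"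
    then show "\<exists>y\<in>cocycles X n. \<exists>b\<in>coboundaries X n. x = y \<oplus>[obj X n] b"
      using zero_coboundary cocyclesD(1)[OF x] by (intro bexI[of _ x] bexI[of _ "\<zero>[obj X n]"]) auto
  qed
  then show ?thesis
    unfolding we_iff by (simp add: hom_id[OF X] hinj_def) (simp add: cmap_id_def)
qed

lemma we_comp: "we Y Z g ==> we X Y f ==> we X Z (g ** f)"
  unfolding we_iff unfolding hom_def
  using hinj_comp hsurj_comp chain_map_comp complexesD by metis

lemma we_cancel_left: "we X Z (g ** f) ==> we Y Z g ==> hom X Y f ==> we X Y f"
  unfolding we_iff unfolding hom_def
  using hinj_comp_first hsurj_comp_first complexesD by metis

lemma we_cancel_right: "we X Z (g ** f) ==> we X Y f ==> hom Y Z g ==> we Y Z g"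
  unfolding we_iff unfolding hom_def
  using hinj_comp_second hsurj_comp_second complexesD by metis

lemma we_ho: "ho X Y f g ==> we X Y f ==> we X Y g"
  unfolding we_iff unfolding hom_def ho_def
  using hinj_homotopic hsurj_homotopic complexesD by metis

end

locale homotopy_pullbacks = cochain_calculus Car R
  for Car :: "'u set set" and R :: "('r, 'c) ring_scheme" +
  assumes pullback: "hom Z Y f ==> we Z' Y t ==> \<exists>W p q. we W Z p \<and> hom W Z' q \<and>
      ho W Y (f ** p) (t ** q) \<and>
      (\<forall>X u v. hom X Z u \<and> hom X Z' v \<and> ho X Y (f ** u) (t ** v) \<longrightarrow>
         (\<exists>e. hom X W e \<and> ho X Z (p ** e) u \<and> ho X Z' (q ** e) v))"
begin

lemma square:
  assumes "hom Z Y f" "we Z' Y t"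
  obtains W p q where "we W Z p" "hom W Z' q" "ho W Y (f ** p) (t ** q)"
  using pullback[OF assms] by blast

lemma square_we:
  assumes "we Z Y f" "we Z' Y t"
  obtains W p q where "we W Z p" "we W Z' q" "ho W Y (f ** p) (t ** q)"
proof -
  obtain W p q where W: "we W Z p" "hom W Z' q" "ho W Y (f ** p) (t ** q)"
    by (rule square[OF we_hom[OF assms(1)] assms(2)])
  have "we W Y (t ** q)"
    by (rule we_ho[OF W(3) we_comp[OF assms(1) W(1)]])
  then have "we W Z' q"
    by (rule we_cancel_left) (use assms W in auto)
  then show thesis
    using that W by blast
qed

text \<open>The homotopy pullback of \<open>t\<close> with itself is a path object, along whose diagonal the pair
  \<open>(f, g)\<close> is pulled back.\<close>

lemma cancel_left:
  assumes fg: "ho X V (t ** f) (t ** g)" and t: "we Y V t" and f: "hom X Y f" and g: "hom X Y g"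
  obtains W w where "we W X w" "ho W Y (f ** w) (g ** w)"
proof -
  obtain E p q where E: "we E Y p" "hom E Y q"
    and univ: "\<And>X u v. hom X Y u ==> hom X Y v ==> ho X V (t ** u) (t ** v) ==>
         \<exists>e. hom X E e \<and> ho X Y (p ** e) u \<and> ho X Y (q ** e) v"
    using pullback[OF we_hom[OF t] t] by blast
  have Y: "Y \<in> complexes Car R"
    using f hom_ob by blast
  obtain d where d: "hom Y E d" "ho Y Y (p ** d) cmap_id" "ho Y Y (q ** d) cmap_id"
    using univ[OF hom_id[OF Y] hom_id[OF Y]] ho_refl[OF we_hom[OF t]] by auto
  have "we Y Y (p ** d)"
    using we_ho[OF ho_sym[OF d(2)] we_id[OF Y]] .
  then have "we Y E d"
    using we_cancel_left E(1) d(1) by blast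
  obtain e where e: "hom X E e" "ho X Y (p ** e) f" "ho X Y (q ** e) g"
    using univ[OF f g fg] by blast
  obtain W w v where W: "we W X w" "hom W Y v" "ho W E (e ** w) (d ** v)"
    by (rule square[OF e(1) \<open>we Y E d\<close>])
  note w = we_hom[OF W(1)]
  have *: "ho W Y (h ** w) v"
    if "hom E Y r" "ho X Y (r ** e) h" "ho Y Y (r ** d) cmap_id" for r h
  proof -
    have "ho W Y (h ** w) (r ** e ** w)"
      by (rule ho_sym[OF ho_right[OF that(2) w]])
    also have "ho W Y (r ** e ** w) (r ** d ** v)"
      using ho_left[OF W(3) that(1)] by (simp add: cmap_comp_assoc)
    also have "ho W Y (r ** d ** v) v"
      using ho_right[OF that(3) W(2)] by simp
    finally show ?thesis .
  qed
  have "ho W Y (f ** w) (g ** w)"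
    using *[OF we_hom[OF E(1)] e(2) d(2)] *[OF E(2) e(3) d(3)] ho_trans ho_sym by blast
  then show thesis
    using that W(1) by blast
qed

abbreviation req where
  "req X Y r r' \<equiv> (r, r') \<in> roof_equiv Car R X Y"

abbreviation cls where
  "cls X Y r \<equiv> roof_equiv Car R X Y `` {r}"

lemma roof_iff:
  assumes "X \<in> complexes Car R" "Y \<in> complexes Car R"
  shows "(Z, s, f) \<in> roofs Car R X Y \<longleftrightarrow> we Z X s \<and> hom Z Y f"
  using assms unfolding roofs_iff we_def hom_def by auto

lemma req_iff:
  assumes "X \<in> complexes Car R" "Y \<in> complexes Car R"
  shows "req X Y (Z, s, f) (Z', s', f') \<longleftrightarrow> we Z X s \<and> hom Z Y f \<and> we Z' X s' \<and> hom Z' Y f' \<and>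
    (\<exists>W p q. we W Z p \<and> we W Z' q \<and> ho W X (s ** p) (s' ** q) \<and> ho W Y (f ** p) (f' ** q))"
    (is "?L \<longleftrightarrow> ?R")
proof
  assume L: ?L
  then have r: "we Z X s" "hom Z Y f" "we Z' X s'" "hom Z' Y f'"
    using roof_iff[OF assms] unfolding roof_equiv_def by auto
  obtain W p q where W: "W \<in> complexes Car R" "chain_map R W Z p" "chain_map R W Z' q"
    "quasi_iso R W X (s ** p)" "homotopic R W X (s ** p) (s' ** q)"
    "homotopic R W Y (f ** p) (f' ** q)"
    using L unfolding roof_equiv_def by auto
  have h: "hom W Z p" "hom W Z' q" "we W X (s ** p)"
    using W assms hom_ob[OF r(2)] hom_ob[OF r(4)] unfolding hom_def we_def by auto
  have ho: "ho W X (s ** p) (s' ** q)" "ho W Y (f ** p) (f' ** q)"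
    using W(5,6) h r we_hom hom_comp unfolding ho_def by blast+
  have "we W Z p" "we W Z' q"
    using we_cancel_left h r we_ho[OF ho(1)] by blast+
  then show ?R
    using r ho by blast
next
  assume ?R
  then obtain W p q where r: "we Z X s" "hom Z Y f" "we Z' X s'" "hom Z' Y f'"
    and W: "we W Z p" "we W Z' q" "ho W X (s ** p) (s' ** q)" "ho W Y (f ** p) (f' ** q)"
    by blast
  have "W \<in> complexes Car R" "chain_map R W Z p" "chain_map R W Z' q"
    "quasi_iso R W X (s ** p)" "homotopic R W X (s ** p) (s' ** q)"
    "homotopic R W Y (f ** p) (f' ** q)"
    using W we_hom[OF W(1)] we_hom[OF W(2)] we_comp[OF r(1) W(1)]
    unfolding ho_def hom_def we_def by auto
  then show ?L
    using r roof_iff[OF assms] unfolding roof_equiv_def by blast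
qed

lemma reqI:
  assumes "we Z X s" "hom Z Y f" "we Z' X s'" "hom Z' Y f'" "we W Z p" "hom W Z' q"
    "ho W X (s ** p) (s' ** q)" "ho W Y (f ** p) (f' ** q)"
  shows "req X Y (Z, s, f) (Z', s', f')"
proof -
  have "we W Z' q"
    using we_cancel_left we_ho[OF assms(7) we_comp[OF assms(1,5)]] assms(3,6) by blast
  then show ?thesis
    using assms req_iff hom_ob[OF we_hom[OF assms(1)]] hom_ob[OF assms(2)] by blast
qed

lemma req_ho:
  assumes "we Z X s" "ho Z X s s'" "ho Z Y f f'"
  shows "req X Y (Z, s, f) (Z, s', f')"
proof -
  have "Z \<in> complexes Car R"
    using assms hom_ob ho_hom by blast
  then show ?thesis
    using reqI[of Z X s Y f Z s' f' Z cmap_id cmap_id] assms we_id hom_id we_ho[OF assms(2)] ho_hom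
    by auto
qed

lemma req_refl: "we Z X s ==> hom Z Y f ==> req X Y (Z, s, f) (Z, s, f)"
  using req_ho ho_refl we_hom by blast

lemma req_sym: "req X Y r r' ==> X \<in> complexes Car R ==> Y \<in> complexes Car R ==> req X Y r' r"
  by (cases r, cases r') (simp add: req_iff, blast intro: ho_sym)

lemma req_trans:
  assumes "req X Y r1 r2" "req X Y r2 r3" "X \<in> complexes Car R" "Y \<in> complexes Car R"
  shows "req X Y r1 r3"
proof -
  obtain Z1 s1 f1 Z2 s2 f2 Z3 s3 f3 where r: "r1 = (Z1, s1, f1)" "r2 = (Z2, s2, f2)" "r3 = (Z3, s3, f3)"
    by (metis prod_cases3)
  obtain W p q where W: "we W Z1 p" "we W Z2 q" "ho W X (s1 ** p) (s2 ** q)"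
      "ho W Y (f1 ** p) (f2 ** q)"
    and r12: "we Z1 X s1" "hom Z1 Y f1" "we Z2 X s2" "hom Z2 Y f2"
    using assms(1) unfolding r req_iff[OF assms(3,4)] by blast
  obtain W' p' q' where W': "we W' Z2 p'" "we W' Z3 q'" "ho W' X (s2 ** p') (s3 ** q')"
      "ho W' Y (f2 ** p') (f3 ** q')"
    and r3: "we Z3 X s3" "hom Z3 Y f3"
    using assms(2) unfolding r req_iff[OF assms(3,4)] by blast
  obtain V v v' where V: "we V W v" "we V W' v'" "ho V Z2 (q ** v) (p' ** v')"
    by (rule square_we[OF W(2) W'(1)])
  have *: "ho V T (h1 ** (p ** v)) (h3 ** (q' ** v'))"
    if "ho W T (h1 ** p) (h2 ** q)" "ho W' T (h2 ** p') (h3 ** q')" "hom Z2 T h2" for T h1 h2 h3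
  proof -
    have "ho V T (h1 ** p ** v) (h2 ** q ** v)"
      by (rule ho_right[OF that(1) we_hom[OF V(1)]])
    also have "ho V T (h2 ** q ** v) (h2 ** p' ** v')"
      using ho_left[OF V(3) that(3)] by (simp add: cmap_comp_assoc)
    also have "ho V T (h2 ** p' ** v') (h3 ** q' ** v')"
      by (rule ho_right[OF that(2) we_hom[OF V(2)]])
    finally show ?thesis
      by (simp add: cmap_comp_assoc)
  qed
  show ?thesis
    unfolding r
    by (rule reqI[OF r12(1,2) r3 we_comp[OF W(1) V(1)] we_hom[OF we_comp[OF W'(2) V(2)]]
          *[OF W(3) W'(3) we_hom[OF r12(3)]] *[OF W(4) W'(4) r12(4)]])
qed

lemma equiv_req:
  assumes "X \<in> complexes Car R" "Y \<in> complexes Car R"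
  shows "equiv (roofs Car R X Y) (roof_equiv Car R X Y)"
proof (intro equivI refl_onI symI transI)
  show "roof_equiv Car R X Y \<subseteq> roofs Car R X Y \<times> roofs Car R X Y"
    unfolding roof_equiv_def by auto
  show "req X Y r r" if "r \<in> roofs Car R X Y" for r
    using that roof_iff[OF assms] req_refl by (cases r) auto
qed (use req_sym req_trans assms in blast)+

lemma cls_eq_iff:
  assumes "we Z X s" "hom Z Y f" "we Z' X s'" "hom Z' Y f'"
  shows "cls X Y (Z, s, f) = cls X Y (Z', s', f') \<longleftrightarrow> req X Y (Z, s, f) (Z', s', f')"
proof -
  have ob: "X \<in> complexes Car R" "Y \<in> complexes Car R"
    using assms hom_ob we_hom by blast+
  show ?thesis
    using eq_equiv_class_iff[OF equiv_req[OF ob]] roof_iff[OF ob] assms by blast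
qed

lemma cls_eqI: "req X Y r r' ==> X \<in> complexes Car R ==> Y \<in> complexes Car R ==> cls X Y r = cls X Y r'"
  using equiv_class_eq[OF equiv_req] by blast

lemma cls_mem: "we Z X s ==> hom Z Y f ==> cls X Y (Z, s, f) \<in> D_hom Car R X Y"
  unfolding D_hom_def using roof_iff hom_ob we_hom by (metis quotientI)

lemma D_homE:
  assumes "\<phi> \<in> D_hom Car R X Y" "X \<in> complexes Car R" "Y \<in> complexes Car R"
  obtains Z s f where "we Z X s" "hom Z Y f" "\<phi> = cls X Y (Z, s, f)"
  using assms roof_iff unfolding D_hom_def quotient_def by auto

lemma D_comp_cls:
  assumes r: "we Z X s" "hom Z Y f" and r': "we Z' Y t" "hom Z' V g"
    and W: "we W Z p" "hom W Z' q" "ho W Y (f ** p) (t ** q)"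
  shows "D_comp Car R X Y V (cls Y V (Z', t, g)) (cls X Y (Z, s, f)) = cls X V (W, s ** p, g ** q)"
proof -
  have ob: "X \<in> complexes Car R" "Y \<in> complexes Car R" "V \<in> complexes Car R"
    using r r' hom_ob we_hom by blast+
  let ?\<phi> = "cls X Y (Z, s, f)" and ?\<psi> = "cls Y V (Z', t, g)"
  let ?S = "{(W, s ** p, g ** q) | W p q Z s f Z' t g.
        (Z, s, f) \<in> ?\<phi> \<and> (Z', t, g) \<in> ?\<psi> \<and> W \<in> complexes Car R \<and>
        quasi_iso R W Z p \<and> chain_map R W Z' q \<and> homotopic R W Y (f ** p) (t ** q)}"
  have key: "req X V (W, s ** p, g ** q) (W2, s2 ** p2, g2 ** q2)"
    if eq: "req X Y (Z, s, f) (Z2, s2, f2)" and eq': "req Y V (Z', t, g) (Z2', t2, g2)"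
      and W2: "we W2 Z2 p2" "hom W2 Z2' q2" "ho W2 Y (f2 ** p2) (t2 ** q2)"
    for Z2 s2 f2 Z2' t2 g2 W2 p2 q2
  proof -
    obtain A a1 a2 where A: "we A Z a1" "we A Z2 a2" "ho A X (s ** a1) (s2 ** a2)"
        "ho A Y (f ** a1) (f2 ** a2)" and r2: "we Z2 X s2" "hom Z2 Y f2"
      using eq unfolding req_iff[OF ob(1,2)] by blast
    obtain B b1 b2 where B: "we B Z' b1" "we B Z2' b2" "ho B Y (t ** b1) (t2 ** b2)"
        "ho B V (g ** b1) (g2 ** b2)" and r2': "we Z2' Y t2" "hom Z2' V g2"
      using eq' unfolding req_iff[OF ob(2,3)] by blast
    obtain U u u' where U: "we U W u" "we U A u'" "ho U Z (p ** u) (a1 ** u')"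
      by (rule square_we[OF W(1) A(1)])
    obtain T w w' where T: "we T U w" "we T W2 w'" "ho T Z2 (a2 ** u' ** w) (p2 ** w')"
      by (rule square_we[OF we_comp[OF A(2) U(2)] W2(1)])
    define v1 where "v1 = u ** w"
    have v1: "we T W v1"
      unfolding v1_def by (rule we_comp[OF U(1) T(1)])
    have px: "ho T Q (h ** p ** v1) (h2 ** p2 ** w')"
      if "ho A Q (h ** a1) (h2 ** a2)" "hom Z Q h" "hom Z2 Q h2" for Q h h2
    proof -
      have "ho T Q (h ** p ** v1) (h ** a1 ** u' ** w)"
        using ho_right[OF ho_left[OF U(3) that(2)] we_hom[OF T(1)]]
        unfolding v1_def by (simp add: cmap_comp_assoc)
      also have "ho T Q (h ** a1 ** u' ** w) (h2 ** a2 ** u' ** w)"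
        using ho_right[OF that(1) we_hom[OF we_comp[OF U(2) T(1)]]] by (simp add: cmap_comp_assoc)
      also have "ho T Q (h2 ** a2 ** u' ** w) (h2 ** p2 ** w')"
        using ho_left[OF T(3) that(3)] by (simp add: cmap_comp_assoc)
      finally show ?thesis .
    qed
    have sp: "ho T X (s ** p ** v1) (s2 ** p2 ** w')"
      by (rule px[OF A(3) we_hom[OF r(1)] we_hom[OF r2(1)]])
    have fp: "ho T Y (f ** p ** v1) (f2 ** p2 ** w')"
      by (rule px[OF A(4) r(2) r2(2)])
    have q1v: "hom T Z' (q ** v1)"
      by (rule hom_comp[OF W(2) we_hom[OF v1]])
    obtain T' x y where T': "we T' T x" "hom T' B y" "ho T' Z' (q ** v1 ** x) (b1 ** y)"
      by (rule square[OF q1v B(1)])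
    note x = we_hom[OF T'(1)]
    have "ho T' Y (t2 ** (b2 ** y)) (t ** b1 ** y)"
      using ho_sym[OF ho_right[OF B(3) T'(2)]] by (simp add: cmap_comp_assoc)
    also have "ho T' Y (t ** b1 ** y) (t ** q ** v1 ** x)"
      using ho_sym[OF ho_left[OF T'(3) we_hom[OF r'(1)]]] by (simp add: cmap_comp_assoc)
    also have "ho T' Y (t ** q ** v1 ** x) (f ** p ** v1 ** x)"
      using ho_sym[OF ho_right[OF W(3) hom_comp[OF we_hom[OF v1] x]]] by (simp add: cmap_comp_assoc)
    also have "ho T' Y (f ** p ** v1 ** x) (f2 ** p2 ** w' ** x)"
      by (rule ho_right[OF fp x])
    also have "ho T' Y (f2 ** p2 ** w' ** x) (t2 ** (q2 ** w' ** x))"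
      using ho_right[OF W2(3) hom_comp[OF we_hom[OF T(2)] x]] by (simp add: cmap_comp_assoc)
    finally have "ho T' Y (t2 ** (b2 ** y)) (t2 ** (q2 ** w' ** x))" .
    then obtain S z where S: "we S T' z" "ho S Z2' (b2 ** y ** z) (q2 ** w' ** x ** z)"
      by (rule cancel_left[OF _ r2'(1)])
        (use hom_comp[OF we_hom[OF B(2)] T'(2)]
             hom_comp[OF hom_comp[OF W2(2) we_hom[OF T(2)]] x] in auto)
    note z = we_hom[OF S(1)]
    have "ho S V (g ** q ** (v1 ** x ** z)) (g ** b1 ** (y ** z))"
      using ho_right[OF ho_left[OF T'(3) r'(2)] z] by (simp add: cmap_comp_assoc)
    also have "ho S V (g ** b1 ** (y ** z)) (g2 ** b2 ** (y ** z))"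
      by (rule ho_right[OF B(4) hom_comp[OF T'(2) z]])
    also have "ho S V (g2 ** b2 ** (y ** z)) (g2 ** q2 ** (w' ** x ** z))"
      using ho_left[OF S(2) r2'(2)] by (simp add: cmap_comp_assoc)
    finally have gq: "ho S V (g ** q ** (v1 ** x ** z)) (g2 ** q2 ** (w' ** x ** z))" .
    have sp': "ho S X (s ** p ** (v1 ** x ** z)) (s2 ** p2 ** (w' ** x ** z))"
      using ho_right[OF sp hom_comp[OF x z]] by (simp add: cmap_comp_assoc)
    show ?thesis
      by (rule reqI[OF we_comp[OF r(1) W(1)] hom_comp[OF r'(2) W(2)] we_comp[OF r2(1) W2(1)]
            hom_comp[OF r2'(2) W2(2)] we_comp[OF we_comp[OF v1 T'(1)] S(1)]
            hom_comp[OF hom_comp[OF we_hom[OF T(2)] x] z] sp' gq])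
  qed
  have "D_comp Car R X Y V (cls Y V (Z', t, g)) (cls X Y (Z, s, f)) \<subseteq> cls X V (W, s ** p, g ** q)"
  proof
    fix r assume "r \<in> D_comp Car R X Y V (cls Y V (Z', t, g)) (cls X Y (Z, s, f))"
    then obtain W2 p2 q2 Z2 s2 f2 Z2' t2 g2 where *: "req X V (W2, s2 ** p2, g2 ** q2) r"
      "req X Y (Z, s, f) (Z2, s2, f2)" "req Y V (Z', t, g) (Z2', t2, g2)" "W2 \<in> complexes Car R"
      "quasi_iso R W2 Z2 p2" "chain_map R W2 Z2' q2" "homotopic R W2 Y (f2 ** p2) (t2 ** q2)"
      unfolding D_comp_def by blast
    have r2: "we Z2 X s2" "hom Z2 Y f2" "we Z2' Y t2" "hom Z2' V g2"
      using *(2,3) req_iff ob by blast+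
    have W2: "we W2 Z2 p2" "hom W2 Z2' q2"
      using *(4-6) r2 hom_ob unfolding we_def hom_def by blast+
    have "ho W2 Y (f2 ** p2) (t2 ** q2)"
      using *(7) hom_comp W2 r2 we_hom unfolding ho_def by blast
    then show "r \<in> cls X V (W, s ** p, g ** q)"
      using key[OF *(2,3) W2] *(1) req_trans ob by blast
  qed
  moreover have "cls X V (W, s ** p, g ** q) \<subseteq> D_comp Car R X Y V (cls Y V (Z', t, g)) (cls X Y (Z, s, f))"
  proof -
    have "W \<in> complexes Car R" "quasi_iso R W Z p" "chain_map R W Z' q"
      "homotopic R W Y (f ** p) (t ** q)"
      using W unfolding we_def hom_def ho_def by auto
    then have "(W, s ** p, g ** q) \<in> ?S"
      using req_refl[OF r] req_refl[OF r'] by blast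
    then show ?thesis
      unfolding D_comp_def by blast
  qed
  ultimately show ?thesis by blast
qed

lemma D_map_mem: "hom X Y f ==> D_map Car R X Y f \<in> D_hom Car R X Y"
  unfolding D_map_def using cls_mem we_id hom_ob by blast

lemma D_id_mem: "X \<in> complexes Car R ==> D_id Car R X \<in> D_hom Car R X X"
  unfolding D_id_def by (intro D_map_mem hom_id)

lemma D_comp_map_left:
  assumes r: "we Z X s" "hom Z Y f" and g: "hom Y V g"
  shows "D_comp Car R X Y V (D_map Car R Y V g) (cls X Y (Z, s, f)) = cls X V (Z, s, g ** f)"
  using D_comp_cls[OF r we_id g we_id r(2)] hom_ob[OF r(2)] ho_refl[OF r(2)] unfolding D_map_def by simp

lemma D_comp_map_right:
  assumes r: "we Z Y s" "hom Z V f" and W: "we W X p" "hom W Z q" "ho W Y (g ** p) (s ** q)"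
    and g: "hom X Y g"
  shows "D_comp Car R X Y V (cls Y V (Z, s, f)) (D_map Car R X Y g) = cls X V (W, p, f ** q)"
  using D_comp_cls[OF we_id[OF hom_ob(1)[OF g]] g r W] unfolding D_map_def by simp

lemma D_comp_id_left:
  assumes "\<phi> \<in> D_hom Car R X Y" "X \<in> complexes Car R" "Y \<in> complexes Car R"
  shows "D_comp Car R X Y Y (D_id Car R Y) \<phi> = \<phi>"
proof -
  obtain Z s f where r: "we Z X s" "hom Z Y f" "\<phi> = cls X Y (Z, s, f)"
    by (rule D_homE[OF assms])
  show ?thesis
    using D_comp_map_left[OF r(1,2) hom_id[OF assms(3)]] unfolding D_id_def r(3) by simp
qed

lemma D_comp_id_right:
  assumes "\<phi> \<in> D_hom Car R X Y" "X \<in> complexes Car R" "Y \<in> complexes Car R"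
  shows "D_comp Car R X X Y \<phi> (D_id Car R X) = \<phi>"
proof -
  obtain Z s f where r: "we Z X s" "hom Z Y f" "\<phi> = cls X Y (Z, s, f)"
    by (rule D_homE[OF assms])
  have "D_comp Car R X X Y (cls X Y (Z, s, f)) (D_map Car R X X cmap_id) = cls X Y (Z, s, f ** cmap_id)"
    by (rule D_comp_map_right[OF r(1,2) r(1) hom_id])
      (use hom_ob[OF r(2)] ho_refl[OF we_hom[OF r(1)]] hom_id assms in auto)
  then show ?thesis
    unfolding D_id_def r(3) by simp
qed

lemma D_comp_ex:
  assumes r: "we Z X s" "hom Z Y f" and r': "we Z' Y t" "hom Z' V g"
  obtains W p q where "we W Z p" "hom W Z' q" "ho W Y (f ** p) (t ** q)"
    "D_comp Car R X Y V (cls Y V (Z', t, g)) (cls X Y (Z, s, f)) = cls X V (W, s ** p, g ** q)"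
  using square[OF r(2) r'(1)] D_comp_cls[OF r r'] by metis

lemma D_comp_mem:
  assumes "\<phi> \<in> D_hom Car R X Y" "\<psi> \<in> D_hom Car R Y V"
    "X \<in> complexes Car R" "Y \<in> complexes Car R" "V \<in> complexes Car R"
  shows "D_comp Car R X Y V \<psi> \<phi> \<in> D_hom Car R X V"
proof -
  obtain Z s f where r: "we Z X s" "hom Z Y f" "\<phi> = cls X Y (Z, s, f)"
    by (rule D_homE[OF assms(1,3,4)])
  obtain Z' t g where r': "we Z' Y t" "hom Z' V g" "\<psi> = cls Y V (Z', t, g)"
    by (rule D_homE[OF assms(2,4,5)])
  show ?thesis
    unfolding r(3) r'(3)
    by (rule D_comp_ex[OF r(1,2) r'(1,2)])
      (use cls_mem[OF we_comp[OF r(1)] hom_comp[OF r'(2)]] in presburger)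
qed

lemma D_comp_assoc:
  assumes "\<phi> \<in> D_hom Car R X Y" "\<psi> \<in> D_hom Car R Y V" "\<chi> \<in> D_hom Car R V U"
    "X \<in> complexes Car R" "Y \<in> complexes Car R" "V \<in> complexes Car R" "U \<in> complexes Car R"
  shows "D_comp Car R X V U \<chi> (D_comp Car R X Y V \<psi> \<phi>) = D_comp Car R X Y U (D_comp Car R Y V U \<chi> \<psi>) \<phi>"
proof -
  obtain Z1 s1 f1 where r1: "we Z1 X s1" "hom Z1 Y f1" "\<phi> = cls X Y (Z1, s1, f1)"
    by (rule D_homE[OF assms(1,4,5)])
  obtain Z2 s2 f2 where r2: "we Z2 Y s2" "hom Z2 V f2" "\<psi> = cls Y V (Z2, s2, f2)"
    by (rule D_homE[OF assms(2,5,6)])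
  obtain Z3 s3 f3 where r3: "we Z3 V s3" "hom Z3 U f3" "\<chi> = cls V U (Z3, s3, f3)"
    by (rule D_homE[OF assms(3,6,7)])
  obtain A p q where A: "we A Z1 p" "hom A Z2 q" "ho A Y (f1 ** p) (s2 ** q)"
      "D_comp Car R X Y V (cls Y V (Z2, s2, f2)) (cls X Y (Z1, s1, f1)) = cls X V (A, s1 ** p, f2 ** q)"
    by (rule D_comp_ex[OF r1(1,2) r2(1,2)])
  obtain B p' q' where B: "we B Z2 p'" "hom B Z3 q'" "ho B V (f2 ** p') (s3 ** q')"
      "D_comp Car R Y V U (cls V U (Z3, s3, f3)) (cls Y V (Z2, s2, f2)) = cls Y U (B, s2 ** p', f3 ** q')"
    by (rule D_comp_ex[OF r2(1,2) r3(1,2)])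
  obtain T t t' where T: "we T A t" "hom T B t'" "ho T Z2 (q ** t) (p' ** t')"
    by (rule square[OF A(2) B(1)])
  have "ho T V (f2 ** q ** t) (f2 ** p' ** t')"
    using ho_left[OF T(3) r2(2)] by (simp add: cmap_comp_assoc)
  also have "ho T V (f2 ** p' ** t') (s3 ** (q' ** t'))"
    using ho_right[OF B(3) T(2)] by (simp add: cmap_comp_assoc)
  finally have 1: "ho T V (f2 ** q ** t) (s3 ** (q' ** t'))" .
  have "ho T Y (f1 ** (p ** t)) (s2 ** q ** t)"
    using ho_right[OF A(3) we_hom[OF T(1)]] by (simp add: cmap_comp_assoc)
  also have "ho T Y (s2 ** q ** t) (s2 ** p' ** t')"
    using ho_left[OF T(3) we_hom[OF r2(1)]] by (simp add: cmap_comp_assoc)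
  finally have 2: "ho T Y (f1 ** (p ** t)) (s2 ** p' ** t')" .
  have L: "D_comp Car R X V U \<chi> (D_comp Car R X Y V \<psi> \<phi>) =
      cls X U (T, s1 ** p ** t, f3 ** (q' ** t'))"
    unfolding r1(3) r2(3) r3(3) A(4)
    by (rule D_comp_cls[OF we_comp[OF r1(1) A(1)] hom_comp[OF r2(2) A(2)] r3(1,2) T(1)
          hom_comp[OF B(2) T(2)] 1])
  have R: "D_comp Car R X Y U (D_comp Car R Y V U \<chi> \<psi>) \<phi> =
      cls X U (T, s1 ** (p ** t), f3 ** q' ** t')"
    unfolding r1(3) r2(3) r3(3) B(4)
    by (rule D_comp_cls[OF r1(1,2) we_comp[OF r2(1) B(1)] hom_comp[OF r3(2) B(2)]
          we_comp[OF A(1) T(1)] T(2) 2])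
  show ?thesis
    unfolding L R by (simp add: cmap_comp_assoc)
qed

lemma D_isos_sym: "D_isos Car R X Y \<noteq> {} ==> D_isos Car R Y X \<noteq> {}"
  unfolding D_isos_def by blast

lemma D_isos_we:
  assumes s: "we X Y s"
  shows "D_isos Car R X Y \<noteq> {}"
proof -
  have ob: "X \<in> complexes Car R" "Y \<in> complexes Car R"
    using s hom_ob we_hom by blast+
  note h = we_hom[OF s]
  have 1: "D_comp Car R X Y X (cls Y X (X, s, cmap_id)) (D_map Car R X Y s) = D_id Car R X"
    using D_comp_map_right[OF s hom_id[OF ob(1)] we_id[OF ob(1)] hom_id[OF ob(1)] _ h] ho_refl[OF h]
    unfolding D_id_def D_map_def by simp
  have "req Y Y (X, s, s) (Y, cmap_id, cmap_id)"
    by (rule reqI[OF s h we_id[OF ob(2)] hom_id[OF ob(2)] we_id[OF ob(1)] h]) (simp_all add: ho_refl[OF h])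
  then have 2: "D_comp Car R Y X Y (D_map Car R X Y s) (cls Y X (X, s, cmap_id)) = D_id Car R Y"
    using D_comp_map_left[OF s hom_id[OF ob(1)] h] cls_eqI ob unfolding D_id_def D_map_def by simp
  show ?thesis
    unfolding D_isos_def using 1 2 D_map_mem[OF h] cls_mem[OF s hom_id[OF ob(1)]] by blast
qed

lemma D_isosE:
  assumes "D_isos Car R X Y \<noteq> {}" and ob: "X \<in> complexes Car R" "Y \<in> complexes Car R"
  obtains Z s f where "we Z X s" "we Z Y f"
proof -
  obtain \<phi> \<psi> where \<phi>: "\<phi> \<in> D_hom Car R X Y" and \<psi>: "\<psi> \<in> D_hom Car R Y X"
    and 1: "D_comp Car R X Y X \<psi> \<phi> = D_id Car R X" and 2: "D_comp Car R Y X Y \<phi> \<psi> = D_id Car R Y"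
    using assms unfolding D_isos_def by blast
  obtain Z s f where r: "we Z X s" "hom Z Y f" "\<phi> = cls X Y (Z, s, f)"
    by (rule D_homE[OF \<phi> ob])
  obtain Z' t g where r': "we Z' Y t" "hom Z' X g" "\<psi> = cls Y X (Z', t, g)"
    by (rule D_homE[OF \<psi> ob(2,1)])
  obtain W p q where W: "we W Z p" "hom W Z' q" "ho W Y (f ** p) (t ** q)"
      "D_comp Car R X Y X (cls Y X (Z', t, g)) (cls X Y (Z, s, f)) = cls X X (W, s ** p, g ** q)"
    by (rule D_comp_ex[OF r(1,2) r'(1,2)])
  obtain V p' q' where V: "we V Z' p'" "hom V Z q'" "ho V X (g ** p') (s ** q')"
      "D_comp Car R Y X Y (cls X Y (Z, s, f)) (cls Y X (Z', t, g)) = cls Y Y (V, t ** p', f ** q')"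
    by (rule D_comp_ex[OF r'(1,2) r(1,2)])
  have id: "we A A' h" if eq: "cls A' A' (A, k, h) = D_id Car R A'" and "we A A' k" "hom A A' h" for A A' h k
  proof -
    have A': "A' \<in> complexes Car R"
      using that hom_ob by blast
    have "req A' A' (A, k, h) (A', cmap_id, cmap_id)"
      using eq cls_eq_iff[OF that(2,3) we_id[OF A'] hom_id[OF A']] unfolding D_id_def D_map_def by simp
    then obtain B b c where B: "we B A b" "we B A' c" "ho B A' (h ** b) (cmap_id ** c)"
      using req_iff[OF A' A'] by blast
    then have "we B A' (h ** b)"
      using we_ho[OF ho_sym[OF B(3)]] by simp
    then show ?thesis
      using we_cancel_right B(1) that(3) by blast
  qed
  have gq: "we W X (g ** q)"
    by (rule id[OF _ we_comp[OF r(1) W(1)] hom_comp[OF r'(2) W(2)]]) (use W(4) 1 r(3) r'(3) in simp)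
  have fq: "we V Y (f ** q')"
    by (rule id[OF _ we_comp[OF r'(1) V(1)] hom_comp[OF r(2) V(2)]]) (use V(4) 2 r(3) r'(3) in simp)
  have cx: "is_complex R V" "is_complex R Z" "is_complex R Y" "is_complex R W" "is_complex R X" "is_complex R Z'"
    using hom_ob complexesD V W r r' we_hom by blast+
  have ch: "chain_map R V Z q'" "chain_map R Z Y f" "chain_map R W Z' q" "chain_map R Z' X g"
      "chain_map R Z' Y t" "chain_map R W Z p"
    using V W r r' we_hom unfolding hom_def by blast+
  have surj: "hsurj Z Y f"
    using hsurj_comp_second[OF cx(1-3) ch(1,2)] fq unfolding we_iff by blast
  have "hinj W Z' q"
    using hinj_comp_first[OF cx(4,6,5) ch(3,4)] gq unfolding we_iff by blast
  then have "hinj W Y (t ** q)"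
    using hinj_comp[OF cx(4,6,3) ch(3,5)] r'(1) unfolding we_iff by blast
  then have "hinj W Y (f ** p)"
    using hinj_homotopic ho_sym[OF W(3)] cx unfolding ho_def hom_def by blast
  then have "hinj Z Y f"
    using hinj_comp_second[OF cx(4,2,3) ch(6,2)] W(1) unfolding we_iff by blast
  then have "we Z Y f"
    using surj r(2) unfolding we_iff by blast
  then show thesis
    using that r(1) by blast
qed

end

section \<open>Coproducts and products in the derived category\<close>

locale homotopy_bicomplete = homotopy_pullbacks Car R
  for Car :: "'u set set" and R :: "('r, 'c) ring_scheme" +
  fixes Idx :: "'i set set"
    and cop :: "'i set => ('i => ('r, 'u) cochain) => ('r, 'u) cochain"
    and inc :: "'i set => ('i => ('r, 'u) cochain) => 'i => ('u, 'u) cmap"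
    and prd :: "'i set => ('i => ('r, 'u) cochain) => ('r, 'u) cochain"
    and prj :: "'i set => ('i => ('r, 'u) cochain) => 'i => ('u, 'u) cmap"
  assumes cop_ob: "J \<in> Idx ==> (\<And>j. j \<in> J ==> X j \<in> complexes Car R) ==> cop J X \<in> complexes Car R"
    and inc_hom: "J \<in> Idx ==> (\<And>j. j \<in> J ==> X j \<in> complexes Car R) ==> j \<in> J ==>
      hom (X j) (cop J X) (inc J X j)"
    and cop_lift: "J \<in> Idx ==> (\<And>j. j \<in> J ==> hom (X j) Y (f j)) ==> Y \<in> complexes Car R ==>
      \<exists>g. hom (cop J X) Y g \<and> (\<forall>j\<in>J. ho (X j) Y (g ** inc J X j) (f j))"
    and cop_unique: "J \<in> Idx ==> (\<And>j. j \<in> J ==> X j \<in> complexes Car R) ==>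
      hom (cop J X) Y g ==> hom (cop J X) Y g' ==>
      (\<And>j. j \<in> J ==> ho (X j) Y (g ** inc J X j) (g' ** inc J X j)) ==> ho (cop J X) Y g g'"
    and cop_we: "J \<in> Idx ==> (\<And>j. j \<in> J ==> we (X' j) (X j) (s j)) ==> hom (cop J X') (cop J X) g ==>
      (\<And>j. j \<in> J ==> ho (X' j) (cop J X) (g ** inc J X' j) (inc J X j ** s j)) ==>
      we (cop J X') (cop J X) g"
    and prd_ob: "J \<in> Idx ==> (\<And>j. j \<in> J ==> X j \<in> complexes Car R) ==> prd J X \<in> complexes Car R"
    and prj_hom: "J \<in> Idx ==> (\<And>j. j \<in> J ==> X j \<in> complexes Car R) ==> j \<in> J ==>
      hom (prd J X) (X j) (prj J X j)"
    and prd_lift: "J \<in> Idx ==> (\<And>j. j \<in> J ==> hom Y (X j) (f j)) ==> Y \<in> complexes Car R ==>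
      \<exists>g. hom Y (prd J X) g \<and> (\<forall>j\<in>J. ho Y (X j) (prj J X j ** g) (f j))"
    and prd_unique: "J \<in> Idx ==> (\<And>j. j \<in> J ==> X j \<in> complexes Car R) ==>
      hom Y (prd J X) g ==> hom Y (prd J X) g' ==>
      (\<And>j. j \<in> J ==> ho Y (X j) (prj J X j ** g) (prj J X j ** g')) ==> ho Y (prd J X) g g'"
    and prd_we: "J \<in> Idx ==> (\<And>j. j \<in> J ==> we (X' j) (X j) (s j)) ==> hom (prd J X') (prd J X) g ==>
      (\<And>j. j \<in> J ==> ho (prd J X') (X j) (prj J X j ** g) (s j ** prj J X' j)) ==>
      we (prd J X') (prd J X) g"
begin

lemma D_hom_choose:
  assumes "\<And>j. j \<in> J ==> \<phi> j \<in> D_hom Car R (X j) (Y j)"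
    "\<And>j. j \<in> J ==> X j \<in> complexes Car R" "\<And>j. j \<in> J ==> Y j \<in> complexes Car R"
  obtains Z s f where "\<And>j. j \<in> J ==> we (Z j) (X j) (s j)" "\<And>j. j \<in> J ==> hom (Z j) (Y j) (f j)"
    "\<And>j. j \<in> J ==> \<phi> j = cls (X j) (Y j) (Z j, s j, f j)"
proof -
  have "\<forall>j\<in>J. \<exists>r. we (fst r) (X j) (fst (snd r)) \<and> hom (fst r) (Y j) (snd (snd r)) \<and>
      \<phi> j = cls (X j) (Y j) (fst r, fst (snd r), snd (snd r))"
    by (metis D_homE assms fst_conv snd_conv)
  then obtain r where "\<forall>j\<in>J. we (fst (r j)) (X j) (fst (snd (r j))) \<and>
      hom (fst (r j)) (Y j) (snd (snd (r j))) \<and>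
      \<phi> j = cls (X j) (Y j) (fst (r j), fst (snd (r j)), snd (snd (r j)))"
    by metis
  then show thesis
    using that[of "\<lambda>j. fst (r j)" "\<lambda>j. fst (snd (r j))" "\<lambda>j. snd (snd (r j))"] by blast
qed

lemma common_roof:
  assumes "\<phi> \<in> D_hom Car R X Y" "\<psi> \<in> D_hom Car R X Y" "X \<in> complexes Car R" "Y \<in> complexes Car R"
  obtains Z s f g where "we Z X s" "hom Z Y f" "hom Z Y g" "\<phi> = cls X Y (Z, s, f)" "\<psi> = cls X Y (Z, s, g)"
proof -
  obtain A s f where r: "we A X s" "hom A Y f" "\<phi> = cls X Y (A, s, f)"
    by (rule D_homE[OF assms(1,3,4)])
  obtain B t g where r': "we B X t" "hom B Y g" "\<psi> = cls X Y (B, t, g)"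
    by (rule D_homE[OF assms(2,3,4)])
  obtain W p q where W: "we W A p" "we W B q" "ho W X (s ** p) (t ** q)"
    by (rule square_we[OF r(1) r'(1)])
  have ob: "W \<in> complexes Car R"
    using W hom_ob we_hom by blast
  have sp: "we W X (s ** p)" and fp: "hom W Y (f ** p)" and gq: "hom W Y (g ** q)"
    using we_comp hom_comp we_hom r r' W by blast+
  have 1: "cls X Y (W, s ** p, f ** p) = \<phi>"
    unfolding r(3)
    by (rule cls_eqI[OF reqI[OF sp fp r(1,2) we_id[OF ob] we_hom[OF W(1)]]])
      (use ho_refl we_hom sp fp assms in auto)
  have 2: "cls X Y (W, s ** p, g ** q) = \<psi>"
    unfolding r'(3)
    by (rule cls_eqI[OF reqI[OF sp gq r'(1,2) we_id[OF ob] we_hom[OF W(2)]]])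
      (use ho_refl W(3) gq assms in auto)
  show thesis
    using that sp fp gq 1 2 by blast
qed

lemma equal_roofs:
  assumes "we Z X s" "hom Z Y f" "hom Z Y g" "cls X Y (Z, s, f) = cls X Y (Z, s, g)"
  obtains V v where "we V Z v" "ho V Y (f ** v) (g ** v)"
proof -
  have ob: "X \<in> complexes Car R" "Y \<in> complexes Car R"
    using assms hom_ob we_hom by blast+
  have "req X Y (Z, s, f) (Z, s, g)"
    using cls_eq_iff[OF assms(1,2,1,3)] assms(4) by simp
  then obtain W p q where W: "we W Z p" "we W Z q" "ho W X (s ** p) (s ** q)" "ho W Y (f ** p) (g ** q)"
    unfolding req_iff[OF ob] by blast
  obtain V v where V: "we V W v" "ho V Z (p ** v) (q ** v)"
    by (rule cancel_left[OF W(3) assms(1) we_hom[OF W(1)] we_hom[OF W(2)]])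
  have "ho V Y (f ** (p ** v)) (g ** q ** v)"
    using ho_right[OF W(4) we_hom[OF V(1)]] by (simp add: cmap_comp_assoc)
  also have "ho V Y (g ** q ** v) (g ** (p ** v))"
    using ho_left[OF ho_sym[OF V(2)] assms(3)] by (simp add: cmap_comp_assoc)
  finally show thesis
    using that we_comp[OF W(1) V(1)] by blast
qed

lemma D_coproduct_cop:
  assumes J: "J \<in> Idx" and X: "\<And>j. j \<in> J ==> X j \<in> complexes Car R"
  shows "D_coproduct Car R J X (cop J X) (\<lambda>j. D_map Car R (X j) (cop J X) (inc J X j))"
  unfolding D_coproduct_def
proof (intro conjI ballI allI impI ex_ex1I)
  let ?C = "cop J X"
  have inc: "hom (X j) (cop J X) (inc J X j)" if "j \<in> J" for j
    by (rule inc_hom[where X = X]) (use J X that in auto)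
  show C: "?C \<in> complexes Car R"
    by (rule cop_ob[OF J X])
  show "D_map Car R (X j) ?C (inc J X j) \<in> D_hom Car R (X j) ?C" if "j \<in> J" for j
    by (rule D_map_mem[OF inc[OF that]])
  fix Y \<phi>
  assume Y: "Y \<in> complexes Car R" and \<phi>: "\<forall>j\<in>J. \<phi> j \<in> D_hom Car R (X j) Y"
  obtain Z s f where r: "\<And>j. j \<in> J ==> we (Z j) (X j) (s j)" "\<And>j. j \<in> J ==> hom (Z j) Y (f j)"
      "\<And>j. j \<in> J ==> \<phi> j = cls (X j) Y (Z j, s j, f j)"
    by (rule D_hom_choose[of J \<phi> X "\<lambda>_. Y"]) (use \<phi> X Y in blast)+
  have Z: "\<And>j. j \<in> J ==> Z j \<in> complexes Car R"
    using r hom_ob by blast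
  have inc': "hom (Z j) (cop J Z) (inc J Z j)" if "j \<in> J" for j
    by (rule inc_hom[where X = Z]) (use J Z that in auto)
  obtain S where S: "hom (cop J Z) ?C S" "\<And>j. j \<in> J ==> ho (Z j) ?C (S ** inc J Z j) (inc J X j ** s j)"
    using cop_lift[where X = Z and Y = ?C and f = "\<lambda>j. inc J X j ** s j", OF J _ C]
      hom_comp[OF inc we_hom[OF r(1)]] by blast
  have weS: "we (cop J Z) ?C S"
    by (rule cop_we[OF J r(1) S(1) S(2)])
  obtain F where F: "hom (cop J Z) Y F" "\<And>j. j \<in> J ==> ho (Z j) Y (F ** inc J Z j) (f j)"
    using cop_lift[where X = Z and Y = Y and f = f, OF J r(2) Y] by blast
  have "D_comp Car R (X j) ?C Y (cls ?C Y (cop J Z, S, F)) (D_map Car R (X j) ?C (inc J X j)) = \<phi> j"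
    if j: "j \<in> J" for j
  proof -
    have "D_comp Car R (X j) ?C Y (cls ?C Y (cop J Z, S, F)) (D_map Car R (X j) ?C (inc J X j)) =
        cls (X j) Y (Z j, s j, F ** inc J Z j)"
      by (rule D_comp_map_right[OF weS F(1) r(1)[OF j] inc'[OF j] ho_sym[OF S(2)[OF j]] inc[OF j]])
    also have "\<dots> = \<phi> j"
      unfolding r(3)[OF j]
      by (rule cls_eqI[OF req_ho[OF r(1)[OF j] ho_refl[OF we_hom[OF r(1)[OF j]]] F(2)[OF j]] X[OF j] Y])
    finally show ?thesis .
  qed
  then show "\<exists>\<psi>. \<psi> \<in> D_hom Car R ?C Y \<and>
      (\<forall>j\<in>J. D_comp Car R (X j) ?C Y \<psi> (D_map Car R (X j) ?C (inc J X j)) = \<phi> j)"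
    using cls_mem[OF weS F(1)] by blast
next
  let ?C = "cop J X"
  fix Y \<phi> \<psi> \<psi>'
  assume Y: "Y \<in> complexes Car R"
    and \<psi>: "\<psi> \<in> D_hom Car R ?C Y \<and>
      (\<forall>j\<in>J. D_comp Car R (X j) ?C Y \<psi> (D_map Car R (X j) ?C (inc J X j)) = \<phi> j)"
    and \<psi>': "\<psi>' \<in> D_hom Car R ?C Y \<and>
      (\<forall>j\<in>J. D_comp Car R (X j) ?C Y \<psi>' (D_map Car R (X j) ?C (inc J X j)) = \<phi> j)"
  have C: "?C \<in> complexes Car R"
    by (rule cop_ob[OF J X])
  have inc: "hom (X j) (cop J X) (inc J X j)" if "j \<in> J" for j
    by (rule inc_hom[where X = X]) (use J X that in auto)
  obtain Z s f g where r: "we Z ?C s" "hom Z Y f" "hom Z Y g" "\<psi> = cls ?C Y (Z, s, f)" "\<psi>' = cls ?C Y (Z, s, g)"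
    using common_roof \<psi> \<psi>' C Y by metis
  have "\<forall>j\<in>J. \<exists>V a b. we V (X j) a \<and> hom V Z b \<and> ho V ?C (s ** b) (inc J X j ** a) \<and> ho V Y (f ** b) (g ** b)"
  proof
    fix j assume j: "j \<in> J"
    obtain W p q where W: "we W (X j) p" "hom W Z q" "ho W ?C (inc J X j ** p) (s ** q)"
      by (rule square[OF inc[OF j] r(1)])
    have "cls (X j) Y (W, p, f ** q) = cls (X j) Y (W, p, g ** q)"
      using \<psi> \<psi>' j D_comp_map_right[OF r(1,2) W inc[OF j]] D_comp_map_right[OF r(1,3) W inc[OF j]]
      unfolding r(4,5) by metis
    then obtain V v where V: "we V W v" "ho V Y (f ** q ** v) (g ** q ** v)"
      by (rule equal_roofs[OF W(1) hom_comp[OF r(2) W(2)] hom_comp[OF r(3) W(2)]])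
    show "\<exists>V a b. we V (X j) a \<and> hom V Z b \<and> ho V ?C (s ** b) (inc J X j ** a) \<and> ho V Y (f ** b) (g ** b)"
      using we_comp[OF W(1) V(1)] hom_comp[OF W(2) we_hom[OF V(1)]]
        ho_right[OF ho_sym[OF W(3)] we_hom[OF V(1)]] V(2)
      by (intro exI[of _ V] exI[of _ "p ** v"] exI[of _ "q ** v"]) (simp add: cmap_comp_assoc)
  qed
  then obtain V a b where V: "\<And>j. j \<in> J ==> we (V j) (X j) (a j)" "\<And>j. j \<in> J ==> hom (V j) Z (b j)"
      "\<And>j. j \<in> J ==> ho (V j) ?C (s ** b j) (inc J X j ** a j)"
      "\<And>j. j \<in> J ==> ho (V j) Y (f ** b j) (g ** b j)"
    by metis
  have Vob: "\<And>j. j \<in> J ==> V j \<in> complexes Car R"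
    using V hom_ob by blast
  have incV: "hom (V j) (cop J V) (inc J V j)" if "j \<in> J" for j
    by (rule inc_hom[where X = V]) (use J Vob that in auto)
  obtain u where u: "hom (cop J V) Z u" "\<And>j. j \<in> J ==> ho (V j) Z (u ** inc J V j) (b j)"
    using cop_lift[where X = V and Y = Z and f = b, OF J V(2) hom_ob(1)[OF we_hom[OF r(1)]]] by blast
  have su: "hom (cop J V) ?C (s ** u)"
    by (rule hom_comp[OF we_hom[OF r(1)] u(1)])
  have "we (cop J V) ?C (s ** u)"
  proof (rule cop_we[OF J V(1) su])
    fix j assume j: "j \<in> J"
    have "ho (V j) ?C (s ** u ** inc J V j) (s ** b j)"
      using ho_left[OF u(2)[OF j] we_hom[OF r(1)]] by (simp add: cmap_comp_assoc)
    also note V(3)[OF j]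
    finally show "ho (V j) ?C (s ** u ** inc J V j) (inc J X j ** a j)" .
  qed
  then have weu: "we (cop J V) Z u"
    using we_cancel_left r(1) u(1) by blast
  have "ho (cop J V) Y (f ** u) (g ** u)"
  proof (rule cop_unique[OF J Vob hom_comp[OF r(2) u(1)] hom_comp[OF r(3) u(1)]])
    fix j assume j: "j \<in> J"
    have "ho (V j) Y (f ** u ** inc J V j) (f ** b j)"
      using ho_left[OF u(2)[OF j] r(2)] by (simp add: cmap_comp_assoc)
    also note V(4)[OF j]
    also have "ho (V j) Y (g ** b j) (g ** u ** inc J V j)"
      using ho_left[OF ho_sym[OF u(2)[OF j]] r(3)] by (simp add: cmap_comp_assoc)
    finally show "ho (V j) Y (f ** u ** inc J V j) (g ** u ** inc J V j)" .
  qed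
  then have "req ?C Y (Z, s, f) (Z, s, g)"
    using reqI[OF r(1,2,1,3) weu u(1) ho_refl[OF su]] by blast
  then show "\<psi> = \<psi>'"
    unfolding r(4,5) using cls_eqI C Y by blast
qed

text \<open>A family of roofs out of \<open>Y\<close> is combined into one by pulling back along the diagonal of a
  power of \<open>Y\<close>.\<close>

lemma diagonal_pullback:
  assumes J: "J \<in> Idx" and s: "\<And>j. j \<in> J ==> we (Z j) Y (s j)" and Y: "Y \<in> complexes Car R"
  obtains W w u where "we W Y w" "\<And>j. j \<in> J ==> hom W (Z j) (u j)"
    "\<And>j. j \<in> J ==> ho W Y (s j ** u j) w"
proof -
  have Z: "\<And>j. j \<in> J ==> Z j \<in> complexes Car R"
    using s hom_ob we_hom by blast
  let ?Y = "\<lambda>_::'i. Y"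
  have prjZ: "hom (prd J Z) (Z j) (prj J Z j)" if "j \<in> J" for j
    by (rule prj_hom[where X = Z]) (use J Z that in auto)
  have prjY: "hom (prd J ?Y) (Y) (prj J ?Y j)" if "j \<in> J" for j
    by (rule prj_hom[where X = ?Y]) (use J Y that in auto)
  obtain S where S: "hom (prd J Z) (prd J ?Y) S"
      "\<And>j. j \<in> J ==> ho (prd J Z) Y (prj J ?Y j ** S) (s j ** prj J Z j)"
    using prd_lift[where Y = "prd J Z" and X = ?Y and f = "\<lambda>j. s j ** prj J Z j", OF J _ prd_ob[OF J Z]]
      hom_comp[OF we_hom[OF s] prjZ] by blast
  have weS: "we (prd J Z) (prd J ?Y) S"
    by (rule prd_we[OF J s S(1) S(2)])
  obtain d where d: "hom Y (prd J ?Y) d" "\<And>j. j \<in> J ==> ho Y Y (prj J ?Y j ** d) cmap_id"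
    using prd_lift[OF J, of Y ?Y, OF hom_id[OF Y] Y] by blast
  obtain W p q where W: "we W Y p" "hom W (prd J Z) q" "ho W (prd J ?Y) (d ** p) (S ** q)"
    by (rule square[OF d(1) weS])
  show thesis
  proof (rule that[OF W(1)])
    show "hom W (Z j) (prj J Z j ** q)" if "j \<in> J" for j
      by (rule hom_comp[OF prjZ[OF that] W(2)])
    fix j assume j: "j \<in> J"
    have "ho W Y (s j ** (prj J Z j ** q)) (prj J ?Y j ** S ** q)"
      using ho_right[OF ho_sym[OF S(2)[OF j]] W(2)] by (simp add: cmap_comp_assoc)
    also have "ho W Y (prj J ?Y j ** S ** q) (prj J ?Y j ** d ** p)"
      using ho_left[OF ho_sym[OF W(3)] prjY[OF j]] by (simp add: cmap_comp_assoc)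
    also have "ho W Y (prj J ?Y j ** d ** p) p"
      using ho_right[OF d(2)[OF j] we_hom[OF W(1)]] by simp
    finally show "ho W Y (s j ** (prj J Z j ** q)) p" .
  qed
qed

lemma D_product_prd:
  assumes J: "J \<in> Idx" and X: "\<And>j. j \<in> J ==> X j \<in> complexes Car R"
  shows "D_product Car R J X (prd J X) (\<lambda>j. D_map Car R (prd J X) (X j) (prj J X j))"
  unfolding D_product_def
proof (intro conjI ballI allI impI ex_ex1I)
  let ?P = "prd J X"
  have prj: "hom (prd J X) (X j) (prj J X j)" if "j \<in> J" for j
    by (rule prj_hom[where X = X]) (use J X that in auto)
  show P: "?P \<in> complexes Car R"
    by (rule prd_ob[OF J X])
  show "D_map Car R ?P (X j) (prj J X j) \<in> D_hom Car R ?P (X j)" if "j \<in> J" for j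
    by (rule D_map_mem[OF prj[OF that]])
  fix Y \<phi>
  assume Y: "Y \<in> complexes Car R" and \<phi>: "\<forall>j\<in>J. \<phi> j \<in> D_hom Car R Y (X j)"
  obtain Z s f where r: "\<And>j. j \<in> J ==> we (Z j) Y (s j)" "\<And>j. j \<in> J ==> hom (Z j) (X j) (f j)"
      "\<And>j. j \<in> J ==> \<phi> j = cls Y (X j) (Z j, s j, f j)"
    by (rule D_hom_choose[of J \<phi> "\<lambda>_. Y" X]) (use \<phi> X Y in blast)+
  obtain W w u where W: "we W Y w" "\<And>j. j \<in> J ==> hom W (Z j) (u j)"
      "\<And>j. j \<in> J ==> ho W Y (s j ** u j) w"
    using diagonal_pullback[where Z = Z and s = s, OF J r(1) Y] by blast
  have Wob: "W \<in> complexes Car R"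
    using W hom_ob we_hom by blast
  obtain F where F: "hom W ?P F" "\<And>j. j \<in> J ==> ho W (X j) (prj J X j ** F) (f j ** u j)"
    using prd_lift[where Y = W and X = X and f = "\<lambda>j. f j ** u j", OF J _ Wob]
      hom_comp[OF r(2) W(2)] by blast
  have "D_comp Car R Y ?P (X j) (D_map Car R ?P (X j) (prj J X j)) (cls Y ?P (W, w, F)) = \<phi> j"
    if j: "j \<in> J" for j
  proof -
    have "D_comp Car R Y ?P (X j) (D_map Car R ?P (X j) (prj J X j)) (cls Y ?P (W, w, F)) =
        cls Y (X j) (W, w, prj J X j ** F)"
      by (rule D_comp_map_left[OF W(1) F(1) prj[OF j]])
    also have "\<dots> = \<phi> j"
      unfolding r(3)[OF j]
      by (rule cls_eqI[OF reqI[OF W(1) hom_comp[OF prj[OF j] F(1)] r(1)[OF j] r(2)[OF j] we_id[OF Wob] W(2)[OF j]]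
            Y X[OF j]])
        (use ho_sym[OF W(3)[OF j]] F(2)[OF j] in auto)
    finally show ?thesis .
  qed
  then show "\<exists>\<psi>. \<psi> \<in> D_hom Car R Y ?P \<and>
      (\<forall>j\<in>J. D_comp Car R Y ?P (X j) (D_map Car R ?P (X j) (prj J X j)) \<psi> = \<phi> j)"
    using cls_mem[OF W(1) F(1)] by blast
next
  let ?P = "prd J X"
  fix Y \<phi> \<psi> \<psi>'
  assume Y: "Y \<in> complexes Car R"
    and \<psi>: "\<psi> \<in> D_hom Car R Y ?P \<and>
      (\<forall>j\<in>J. D_comp Car R Y ?P (X j) (D_map Car R ?P (X j) (prj J X j)) \<psi> = \<phi> j)"
    and \<psi>': "\<psi>' \<in> D_hom Car R Y ?P \<and>
      (\<forall>j\<in>J. D_comp Car R Y ?P (X j) (D_map Car R ?P (X j) (prj J X j)) \<psi>' = \<phi> j)"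
  have P: "?P \<in> complexes Car R"
    by (rule prd_ob[OF J X])
  have prj: "hom (prd J X) (X j) (prj J X j)" if "j \<in> J" for j
    by (rule prj_hom[where X = X]) (use J X that in auto)
  obtain Z s f g where r: "we Z Y s" "hom Z ?P f" "hom Z ?P g" "\<psi> = cls Y ?P (Z, s, f)" "\<psi>' = cls Y ?P (Z, s, g)"
    using common_roof \<psi> \<psi>' P Y by metis
  have Z: "Z \<in> complexes Car R"
    using r hom_ob by blast
  have "\<forall>j\<in>J. \<exists>V v. we V Z v \<and> ho V (X j) (prj J X j ** f ** v) (prj J X j ** g ** v)"
  proof
    fix j assume j: "j \<in> J"
    have "cls Y (X j) (Z, s, prj J X j ** f) = cls Y (X j) (Z, s, prj J X j ** g)"
      using \<psi> \<psi>' j D_comp_map_left[OF r(1,2) prj[OF j]] D_comp_map_left[OF r(1,3) prj[OF j]]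
      unfolding r(4,5) by metis
    then show "\<exists>V v. we V Z v \<and> ho V (X j) (prj J X j ** f ** v) (prj J X j ** g ** v)"
      using equal_roofs[OF r(1) hom_comp[OF prj[OF j] r(2)] hom_comp[OF prj[OF j] r(3)]] by metis
  qed
  then obtain V v where V: "\<And>j. j \<in> J ==> we (V j) Z (v j)"
      "\<And>j. j \<in> J ==> ho (V j) (X j) (prj J X j ** f ** v j) (prj J X j ** g ** v j)"
    by metis
  obtain W w u where W: "we W Z w" "\<And>j. j \<in> J ==> hom W (V j) (u j)"
      "\<And>j. j \<in> J ==> ho W Z (v j ** u j) w"
    using diagonal_pullback[where Z = V and s = v, OF J V(1) Z] by blast
  have "ho W ?P (f ** w) (g ** w)"
  proof (rule prd_unique[OF J X hom_comp[OF r(2) we_hom[OF W(1)]] hom_comp[OF r(3) we_hom[OF W(1)]]])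
    fix j assume j: "j \<in> J"
    have "ho W (X j) (prj J X j ** (f ** w)) (prj J X j ** f ** v j ** u j)"
      using ho_left[OF ho_sym[OF W(3)[OF j]] hom_comp[OF prj[OF j] r(2)]] by (simp add: cmap_comp_assoc)
    also have "ho W (X j) (prj J X j ** f ** v j ** u j) (prj J X j ** g ** v j ** u j)"
      by (rule ho_right[OF V(2)[OF j] W(2)[OF j]])
    also have "ho W (X j) (prj J X j ** g ** v j ** u j) (prj J X j ** (g ** w))"
      using ho_left[OF W(3)[OF j] hom_comp[OF prj[OF j] r(3)]] by (simp add: cmap_comp_assoc)
    finally show "ho W (X j) (prj J X j ** (f ** w)) (prj J X j ** (g ** w))" .
  qed
  then have "req Y ?P (Z, s, f) (Z, s, g)"
    using reqI[OF r(1,2,1,3) W(1) we_hom[OF W(1)]] ho_refl[OF hom_comp[OF we_hom[OF r(1)] we_hom[OF W(1)]]]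
    by blast
  then show "\<psi> = \<psi>'"
    unfolding r(4,5) using cls_eqI P Y by blast
qed

lemma D_coproduct_unique:
  assumes C: "D_coproduct Car R J X C \<iota>" and C': "D_coproduct Car R J X C' \<iota>'"
    and X: "\<And>j. j \<in> J ==> X j \<in> complexes Car R"
  shows "D_isos Car R C C' \<noteq> {}"
proof -
  have ob: "C \<in> complexes Car R" "C' \<in> complexes Car R"
    and \<iota>: "\<And>j. j \<in> J ==> \<iota> j \<in> D_hom Car R (X j) C" "\<And>j. j \<in> J ==> \<iota>' j \<in> D_hom Car R (X j) C'"
    using C C' unfolding D_coproduct_def by blast+
  obtain \<psi> where \<psi>: "\<psi> \<in> D_hom Car R C C'" "\<And>j. j \<in> J ==> D_comp Car R (X j) C C' \<psi> (\<iota> j) = \<iota>' j"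
    using C ob(2) \<iota>(2) unfolding D_coproduct_def by meson
  obtain \<psi>' where \<psi>': "\<psi>' \<in> D_hom Car R C' C" "\<And>j. j \<in> J ==> D_comp Car R (X j) C' C \<psi>' (\<iota>' j) = \<iota> j"
    using C' ob(1) \<iota>(1) unfolding D_coproduct_def by meson
  have uniq: "\<alpha> = D_id Car R A"
    if A: "D_coproduct Car R J X A \<kappa>" and "\<alpha> \<in> D_hom Car R A A"
      "\<And>j. j \<in> J ==> D_comp Car R (X j) A A \<alpha> (\<kappa> j) = \<kappa> j" for A \<kappa> \<alpha>
  proof -
    have A': "A \<in> complexes Car R" "\<And>j. j \<in> J ==> \<kappa> j \<in> D_hom Car R (X j) A"
      using A unfolding D_coproduct_def by blast+
    then have "\<exists>!\<psi>. \<psi> \<in> D_hom Car R A A \<and> (\<forall>j\<in>J. D_comp Car R (X j) A A \<psi> (\<kappa> j) = \<kappa> j)"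
      using A unfolding D_coproduct_def by blast
    moreover have "\<forall>j\<in>J. D_comp Car R (X j) A A (D_id Car R A) (\<kappa> j) = \<kappa> j"
      using D_comp_id_left A' X by blast
    ultimately show ?thesis
      using that(2,3) D_id_mem[OF A'(1)] by blast
  qed
  have "D_comp Car R C C' C \<psi>' \<psi> = D_id Car R C"
    by (rule uniq[OF C D_comp_mem[OF \<psi>(1) \<psi>'(1) ob(1,2,1)]])
      (use D_comp_assoc[OF \<iota>(1) \<psi>(1) \<psi>'(1) X ob(1,2,1), symmetric] \<psi>(2) \<psi>'(2) in simp)
  moreover have "D_comp Car R C' C C' \<psi> \<psi>' = D_id Car R C'"
    by (rule uniq[OF C' D_comp_mem[OF \<psi>'(1) \<psi>(1) ob(2,1,2)]])
      (use D_comp_assoc[OF \<iota>(2) \<psi>'(1) \<psi>(1) X ob(2,1,2), symmetric] \<psi>(2) \<psi>'(2) in simp)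
  ultimately show ?thesis
    using \<psi>(1) \<psi>'(1) unfolding D_isos_def by blast
qed

lemma D_product_unique:
  assumes P: "D_product Car R J X P \<pi>" and P': "D_product Car R J X P' \<pi>'"
    and X: "\<And>j. j \<in> J ==> X j \<in> complexes Car R"
  shows "D_isos Car R P P' \<noteq> {}"
proof -
  have ob: "P \<in> complexes Car R" "P' \<in> complexes Car R"
    and \<pi>: "\<And>j. j \<in> J ==> \<pi> j \<in> D_hom Car R P (X j)" "\<And>j. j \<in> J ==> \<pi>' j \<in> D_hom Car R P' (X j)"
    using P P' unfolding D_product_def by blast+
  obtain \<psi> where \<psi>: "\<psi> \<in> D_hom Car R P' P" "\<And>j. j \<in> J ==> D_comp Car R P' P (X j) (\<pi> j) \<psi> = \<pi>' j"
    using P ob(2) \<pi>(2) unfolding D_product_def by meson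
  obtain \<psi>' where \<psi>': "\<psi>' \<in> D_hom Car R P P'" "\<And>j. j \<in> J ==> D_comp Car R P P' (X j) (\<pi>' j) \<psi>' = \<pi> j"
    using P' ob(1) \<pi>(1) unfolding D_product_def by meson
  have uniq: "\<alpha> = D_id Car R A"
    if A: "D_product Car R J X A \<kappa>" and "\<alpha> \<in> D_hom Car R A A"
      "\<And>j. j \<in> J ==> D_comp Car R A A (X j) (\<kappa> j) \<alpha> = \<kappa> j" for A \<kappa> \<alpha>
  proof -
    have A': "A \<in> complexes Car R" "\<And>j. j \<in> J ==> \<kappa> j \<in> D_hom Car R A (X j)"
      using A unfolding D_product_def by blast+
    then have "\<exists>!\<psi>. \<psi> \<in> D_hom Car R A A \<and> (\<forall>j\<in>J. D_comp Car R A A (X j) (\<kappa> j) \<psi> = \<kappa> j)"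
      using A unfolding D_product_def by blast
    moreover have "\<forall>j\<in>J. D_comp Car R A A (X j) (\<kappa> j) (D_id Car R A) = \<kappa> j"
      using D_comp_id_right A' X by blast
    ultimately show ?thesis
      using that(2,3) D_id_mem[OF A'(1)] by blast
  qed
  have "D_comp Car R P P' P \<psi> \<psi>' = D_id Car R P"
    by (rule uniq[OF P D_comp_mem[OF \<psi>'(1) \<psi>(1) ob(1,2,1)]])
      (use D_comp_assoc[OF \<psi>'(1) \<psi>(1) \<pi>(1) ob(1,2,1) X] \<psi>(2) \<psi>'(2) in simp)
  moreover have "D_comp Car R P' P P' \<psi>' \<psi> = D_id Car R P'"
    by (rule uniq[OF P' D_comp_mem[OF \<psi>(1) \<psi>'(1) ob(2,1,2)]])
      (use D_comp_assoc[OF \<psi>(1) \<psi>'(1) \<pi>(2) ob(2,1,2) X] \<psi>(2) \<psi>'(2) in simp)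
  ultimately show ?thesis
    using \<psi>(1) \<psi>'(1) unfolding D_isos_def by blast
qed

end

section \<open>Shifts and triangles\<close>

lemma is_complex_shift:
  assumes "is_complex R X"
  shows "is_complex R (shift k X)"
proof -
  interpret cplx R X using assms by (simp add: cplx_def)
  have dif: "dif (shift k X) n \<in> rmod_hom R (obj (shift k X) n) (obj (shift k X) (n + 1))" for n
  proof (cases "even k")
    case True
    then show ?thesis
      unfolding shift_def by simp (rule dif_hom, simp)
  next
    case False
    have "dif X (n + k) \<in> rmod_hom R (obj X (n + k)) (obj X (n + k + 1))"
      by (rule dif_hom) simp
    from rmod_hom_neg[OF rmod_axioms rmod_axioms this] show ?thesis
      unfolding shift_def using False by (simp add: add.commute add.left_commute)
  qed
  have "dif (shift k X) (n + 1) (dif (shift k X) n x) = \<zero>[obj (shift k X) (n + 2)]"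
    if "x \<in> carrier (obj (shift k X) n)" for n x
  proof -
    have x: "x \<in> carrier (obj X (n + k))"
      using that by (simp add: shift_def)
    have eq: "n + 1 + k = n + k + 1" "n + 2 + k = n + k + 1 + 1"
      by simp_all
    show ?thesis
      unfolding shift_def using x
      by (simp only: cochain.simps eq) (simp add: dif_neg[of "dif X (n + k) x" "n + k + 1"] del: add_Suc)
  qed
  then show ?thesis
    unfolding is_complex_def using dif rmod_axioms by (simp add: right_module_iff shift_def)
qed

context cochain_calculus
begin

lemma shift_ob: "X \<in> complexes Car R ==> shift k X \<in> complexes Car R"
  unfolding complexes_def using is_complex_shift by (auto simp: shift_def)

lemma shift_simps:
  "obj (shift 1 X) n = obj X (n + 1)"
  "dif (shift 1 X) n x = \<ominus>[obj X (n + 2)] dif X (n + 1) x"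
  unfolding shift_def by (simp_all add: add.assoc)

lemma hom_shift:
  assumes "hom X Y f"
  shows "hom (shift 1 X) (shift 1 Y) (shift_cmap 1 f)"
proof -
  interpret cmor R X Y f
    using assms cmorI complexesD unfolding hom_def by blast
  have "chain_map R (shift 1 X) (shift 1 Y) (shift_cmap 1 f)"
  proof (rule chain_mapI)
    show "shift_cmap 1 f n \<in> rmod_hom R (obj (shift 1 X) n) (obj (shift 1 Y) n)" for n
      by (simp add: shift_cmap_def shift_simps hom)
    show "shift_cmap 1 f (n + 1) (dif (shift 1 X) n x) = dif (shift 1 Y) n (shift_cmap 1 f n x)"
      if "x \<in> carrier (obj (shift 1 X) n)" for n x
      using that by (simp add: shift_cmap_def shift_simps add.commute)
  qed
  then show ?thesis
    using assms shift_ob unfolding hom_def by blast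
qed

lemma ho_shift:
  assumes "ho X Y f g"
  shows "ho (shift 1 X) (shift 1 Y) (shift_cmap 1 f) (shift_cmap 1 g)"
proof -
  have fg: "hom X Y f" "hom X Y g" "homotopic R X Y f g"
    using assms unfolding ho_def by auto
  have cx: "is_complex R X" "is_complex R Y"
    using fg complexesD unfolding hom_def by auto
  interpret g: cmor R X Y g
    using fg cmorI cx unfolding hom_def by blast
  from homotopicE[OF fg(3) cx] obtain s where s: "htpy R X Y s" and
    eq: "\<And>n x. x \<in> el X n ==>
      f n x = g n x \<oplus>[obj Y n] (dif Y (n - 1) (s n x) \<oplus>[obj Y n] s (n + 1) (dif X n x))" by blast
  interpret htpy R X Y s by fact
  have "homotopic R (shift 1 X) (shift 1 Y) (shift_cmap 1 f) (shift_cmap 1 g)"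
  proof (rule homotopicI)
    show "(\<lambda>n x. \<ominus>[obj Y n] s (n + 1) x) n \<in> rmod_hom R (obj (shift 1 X) n) (obj (shift 1 Y) (n - 1))" for n
      using rmod_hom_neg[OF g.X.rmod_axioms g.Y.rmod_axioms s_hom, of "n + 1"] by (simp add: shift_simps)
    fix n x assume "x \<in> carrier (obj (shift 1 X) n)"
    then have x: "x \<in> el X (n + 1)"
      by (simp add: shift_simps)
    have "dif Y n (\<ominus>[obj Y n] s (n + 1) x) = \<ominus>[obj Y (n + 1)] dif Y n (s (n + 1) x)"
      using x by (intro g.Y.dif_neg) simp
    then show "shift_cmap 1 f n x = shift_cmap 1 g n x \<oplus>[obj (shift 1 Y) n]
        (dif (shift 1 Y) (n - 1) (\<ominus>[obj Y n] s (n + 1) x) \<oplus>[obj (shift 1 Y) n]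
          \<ominus>[obj Y (n + 1)] s (n + 1 + 1) (dif (shift 1 X) n x))"
      using x eq[OF x] by (simp add: shift_cmap_def shift_simps add.commute)
  qed
  then show ?thesis
    using fg hom_shift unfolding ho_def by blast
qed

lemma cocycles_shift:
  assumes "X \<in> complexes Car R"
  shows "cocycles (shift 1 X) n = cocycles X (n + 1)"
proof -
  interpret cplx R X using assms complexesD by (simp add: cplx_def)
  have "\<ominus>[obj X (n + 2)] y = \<zero>[obj X (n + 2)] \<longleftrightarrow> y = \<zero>[obj X (n + 2)]" if "y \<in> el X (n + 2)" for y
    using that minus_minus[of y "n + 2"] add.inv_one[of "n + 2"] by (metis a_inv_def)
  then show ?thesis
    unfolding cocycles_def by (auto simp: shift_simps add.commute)
qed

lemma coboundaries_shift:
  assumes "X \<in> complexes Car R"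
  shows "coboundaries (shift 1 X) n = coboundaries X (n + 1)"
proof -
  interpret cplx R X using assms complexesD by (simp add: cplx_def)
  show ?thesis
  proof (intro equalityI subsetI)
    fix y assume "y \<in> coboundaries (shift 1 X) n"
    then show "y \<in> coboundaries X (n + 1)"
      unfolding coboundaries_def
      by (auto simp: shift_simps add.commute intro!: image_eqI[of _ _ "\<ominus>[obj X n] _"])
  next
    fix y assume "y \<in> coboundaries X (n + 1)"
    then obtain x where "x \<in> el X n" "y = dif X n x"
      by (auto elim!: coboundariesE)
    then show "y \<in> coboundaries (shift 1 X) n"
      unfolding coboundaries_def
      by (auto simp: shift_simps add.commute intro!: image_eqI[of _ _ "\<ominus>[obj X n] x"])
  qed
qed

lemma we_shift:
  assumes "we X Y f"
  shows "we (shift 1 X) (shift 1 Y) (shift_cmap 1 f)"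
proof -
  have ob: "X \<in> complexes Car R" "Y \<in> complexes Car R"
    using assms hom_ob we_hom by blast+
  show ?thesis
    using assms hom_shift unfolding we_iff hinj_def hsurj_def
    by (auto simp: cocycles_shift ob coboundaries_shift shift_cmap_def shift_simps)
qed

lemma shift_cmap_comp: "shift_cmap k (g ** f) = shift_cmap k g ** shift_cmap k f"
  unfolding shift_cmap_def cmap_comp_def by simp

lemma shift_cmap_id [simp]: "shift_cmap k cmap_id = cmap_id"
  unfolding shift_cmap_def cmap_id_def by simp

end

context homotopy_pullbacks
begin

lemma req_shift:
  assumes "req X Y (Z, s, f) (Z', s', f')" "X \<in> complexes Car R" "Y \<in> complexes Car R"
  shows "req (shift 1 X) (shift 1 Y) (shift 1 Z, shift_cmap 1 s, shift_cmap 1 f)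
    (shift 1 Z', shift_cmap 1 s', shift_cmap 1 f')"
proof -
  obtain W p q where r: "we Z X s" "hom Z Y f" "we Z' X s'" "hom Z' Y f'"
    and W: "we W Z p" "we W Z' q" "ho W X (s ** p) (s' ** q)" "ho W Y (f ** p) (f' ** q)"
    using assms req_iff by blast
  show ?thesis
    by (rule reqI[OF we_shift[OF r(1)] hom_shift[OF r(2)] we_shift[OF r(3)] hom_shift[OF r(4)]
          we_shift[OF W(1)] we_hom[OF we_shift[OF W(2)]]])
      (use ho_shift[OF W(3)] ho_shift[OF W(4)] in \<open>simp_all add: shift_cmap_comp\<close>)
qed

lemma D_shift_id:
  assumes X: "X \<in> complexes Car R"
  shows "D_shift Car R 1 X X (D_id Car R X) = D_id Car R (shift 1 X)"
proof
  note X' = shift_ob[OF X, of 1]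
  show "D_shift Car R 1 X X (D_id Car R X) \<subseteq> D_id Car R (shift 1 X)"
  proof
    fix r assume "r \<in> D_shift Car R 1 X X (D_id Car R X)"
    then obtain Z s f where r: "req X X (X, cmap_id, cmap_id) (Z, s, f)"
        "req (shift 1 X) (shift 1 X) (shift 1 Z, shift_cmap 1 s, shift_cmap 1 f) r"
      unfolding D_shift_def D_id_def D_map_def by auto
    show "r \<in> D_id Car R (shift 1 X)"
      unfolding D_id_def D_map_def
      using req_trans[OF req_shift[OF r(1) X X] r(2) X' X'] by simp
  qed
  have "req X X (X, cmap_id, cmap_id) (X, cmap_id, cmap_id)"
    by (rule req_refl[OF we_id[OF X] hom_id[OF X]])
  then have "(shift 1 X, cmap_id, cmap_id) \<in>
      (\<lambda>(Z, s, f). (shift 1 Z, shift_cmap 1 s, shift_cmap 1 f)) ` D_id Car R X"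
    unfolding D_id_def D_map_def by (intro image_eqI[of _ _ "(X, cmap_id, cmap_id)"]) auto
  then show "D_id Car R (shift 1 X) \<subseteq> D_shift Car R 1 X X (D_id Car R X)"
    unfolding D_shift_def D_id_def D_map_def by blast
qed

lemma D_id_iso: "X \<in> complexes Car R ==> D_id Car R X \<in> D_isos Car R X X"
  unfolding D_isos_def using D_id_mem D_comp_id_left by blast

lemma distinguished_triangle_standard:
  assumes tri: "standard_triangle R X Y Z f g h"
    and ob: "X \<in> complexes Car R" "Y \<in> complexes Car R" "Z \<in> complexes Car R"
  shows "distinguished_triangle Car R X Y Z (D_map Car R X Y f) (D_map Car R Y Z g)
    (D_map Car R Z (shift 1 X) h)"
proof -
  interpret X: cplx R X using ob complexesD by (simp add: cplx_def)
  obtain \<theta> where \<theta>: "chain_map R Z (cone X Y f) \<theta>"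
      "\<And>n z. z \<in> el Z n ==> h n z = fst (\<theta> n z)"
    and fg: "chain_map R X Y f" "chain_map R Y Z g"
    using tri unfolding standard_triangle_def by auto
  interpret Z: cplx R Z using ob complexesD by (simp add: cplx_def)
  have \<theta>': "\<theta> n \<in> rmod_hom R (obj Z n) (obj (cone X Y f) n)"
      "x \<in> el Z n ==> \<theta> (n + 1) (dif Z n x) = dif (cone X Y f) n (\<theta> n x)" for n x
    using \<theta>(1) unfolding chain_map_def by auto
  have "chain_map R Z (shift 1 X) h"
  proof (rule chain_mapI)
    show "h n \<in> rmod_hom R (obj Z n) (obj (shift 1 X) n)" for n
      using \<theta>'(1)[of n] \<theta>(2)[of _ n]
      by (intro rmod_homI) (auto simp: rmod_hom_def cone_def module_sum_def shift_simps Pi_iff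
          mem_Times_iff split_beta)
    show "h (n + 1) (dif Z n x) = dif (shift 1 X) n (h n x)" if x: "x \<in> el Z n" for n x
      using \<theta>'(2)[OF x] \<theta>(2)[OF x] \<theta>(2)[of "dif Z n x" "n + 1"] x
      by (simp add: cone_def shift_simps split_beta)
  qed
  then have hom: "hom X Y f" "hom Y Z g" "hom Z (shift 1 X) h"
    using fg ob shift_ob unfolding hom_def by auto
  note D = D_map_mem[OF hom(1)] D_map_mem[OF hom(2)] D_map_mem[OF hom(3)]
  show ?thesis
    unfolding distinguished_triangle_def
  proof (intro conjI D, rule bexI[OF _ ob(1)], rule bexI[OF _ ob(2)], rule bexI[OF _ ob(3)],
      intro exI conjI, rule tri, rule bexI[OF _ D_id_iso[OF ob(1)]], rule bexI[OF _ D_id_iso[OF ob(2)]],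
      rule bexI[OF _ D_id_iso[OF ob(3)]], intro conjI)
    show "D_comp Car R X Y Y (D_id Car R Y) (D_map Car R X Y f) =
        D_comp Car R X X Y (D_map Car R X Y f) (D_id Car R X)"
      using D_comp_id_left[OF D(1) ob(1,2)] D_comp_id_right[OF D(1) ob(1,2)] by simp
    show "D_comp Car R Y Z Z (D_id Car R Z) (D_map Car R Y Z g) =
        D_comp Car R Y Y Z (D_map Car R Y Z g) (D_id Car R Y)"
      using D_comp_id_left[OF D(2) ob(2,3)] D_comp_id_right[OF D(2) ob(2,3)] by simp
    show "D_comp Car R Z (shift 1 X) (shift 1 X) (D_shift Car R 1 X X (D_id Car R X)) (D_map Car R Z (shift 1 X) h) =
        D_comp Car R Z Z (shift 1 X) (D_map Car R Z (shift 1 X) h) (D_id Car R Z)"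
      using D_comp_id_left[OF D(3) ob(3) shift_ob[OF ob(1)]] D_comp_id_right[OF D(3) ob(3) shift_ob[OF ob(1)]]
      by (simp add: D_shift_id[OF ob(1)])
  qed
qed

definition triangle_closed :: "('r, 'u) cochain set => bool" where
  "triangle_closed S \<longleftrightarrow> S \<subseteq> complexes Car R \<and> S \<noteq> {} \<and>
     (\<forall>X Y s. we X Y s \<longrightarrow> (X \<in> S \<longleftrightarrow> Y \<in> S)) \<and>
     (\<forall>X\<in>S. \<forall>k. shift k X \<in> S) \<and>
     (\<forall>X\<in>complexes Car R. \<forall>Y\<in>complexes Car R. \<forall>Z\<in>complexes Car R. \<forall>f g h.
        standard_triangle R X Y Z f g h \<longrightarrow>
          (X \<in> S \<and> Y \<in> S \<longrightarrow> Z \<in> S) \<and> (X \<in> S \<and> Z \<in> S \<longrightarrow> Y \<in> S) \<and> (Y \<in> S \<and> Z \<in> S \<longrightarrow> X \<in> S))"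

lemma iso_closed:
  assumes "\<And>X Y s. we X Y s ==> X \<in> S \<longleftrightarrow> Y \<in> S" "D_isos Car R X Y \<noteq> {}"
    "X \<in> complexes Car R" "Y \<in> complexes Car R"
  shows "X \<in> S \<longleftrightarrow> Y \<in> S"
  using D_isosE[OF assms(2-4)] assms(1) by metis

lemma triangulated_subcategory_iff: "triangulated_subcategory Car R S \<longleftrightarrow> triangle_closed S"
proof
  assume S: "triangulated_subcategory Car R S"
  have iso: "X \<in> S \<longleftrightarrow> Y \<in> S" if "we X Y s" for X Y s
    using that S D_isos_we[OF that] D_isos_sym hom_ob we_hom unfolding triangulated_subcategory_def by meson
  show "triangle_closed S"
    unfolding triangle_closed_def
  proof (intro conjI allI impI ballI)
    fix X Y Z f g h
    assume ob: "X \<in> complexes Car R" "Y \<in> complexes Car R" "Z \<in> complexes Car R"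
      and "standard_triangle R X Y Z f g h"
    then have "distinguished_triangle Car R X Y Z (D_map Car R X Y f) (D_map Car R Y Z g)
      (D_map Car R Z (shift 1 X) h)"
      by (intro distinguished_triangle_standard)
    then have "(X \<in> S \<and> Y \<in> S \<longrightarrow> Z \<in> S) \<and> (X \<in> S \<and> Z \<in> S \<longrightarrow> Y \<in> S) \<and> (Y \<in> S \<and> Z \<in> S \<longrightarrow> X \<in> S)"
      using S ob unfolding triangulated_subcategory_def by blast
    then show "X \<in> S \<and> Y \<in> S ==> Z \<in> S" "X \<in> S \<and> Z \<in> S ==> Y \<in> S" "Y \<in> S \<and> Z \<in> S ==> X \<in> S"
      by blast+
  qed (use S iso in \<open>auto simp: triangulated_subcategory_def\<close>)
next
  assume S: "triangle_closed S"
  have iso: "X \<in> S \<longleftrightarrow> Y \<in> S"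
    if "D_isos Car R X Y \<noteq> {}" "X \<in> complexes Car R" "Y \<in> complexes Car R" for X Y
    by (rule iso_closed[OF _ that]) (use S in \<open>auto simp: triangle_closed_def\<close>)
  show "triangulated_subcategory Car R S"
    unfolding triangulated_subcategory_def
  proof (intro conjI allI ballI impI)
    show "Y \<in> S" if "X \<in> S" "Y \<in> complexes Car R" "D_isos Car R X Y \<noteq> {}" for X Y
      using that iso S unfolding triangle_closed_def by blast
    fix X Y Z u v w
    assume ob: "X \<in> complexes Car R" "Y \<in> complexes Car R" "Z \<in> complexes Car R"
      and tri: "distinguished_triangle Car R X Y Z u v w"
    then obtain X' Y' Z' f g h where ob': "X' \<in> complexes Car R" "Y' \<in> complexes Car R" "Z' \<in> complexes Car R"
      and tri': "standard_triangle R X' Y' Z' f g h"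
      and isos: "D_isos Car R X X' \<noteq> {}" "D_isos Car R Y Y' \<noteq> {}" "D_isos Car R Z Z' \<noteq> {}"
      unfolding distinguished_triangle_def by blast
    have "(X' \<in> S \<and> Y' \<in> S \<longrightarrow> Z' \<in> S) \<and> (X' \<in> S \<and> Z' \<in> S \<longrightarrow> Y' \<in> S) \<and> (Y' \<in> S \<and> Z' \<in> S \<longrightarrow> X' \<in> S)"
      using S ob' tri' unfolding triangle_closed_def by blast
    then show "X \<in> S \<and> Y \<in> S ==> Z \<in> S" "X \<in> S \<and> Z \<in> S ==> Y \<in> S" "Y \<in> S \<and> Z \<in> S ==> X \<in> S"
      using iso[OF isos(1) ob(1) ob'(1)] iso[OF isos(2) ob(2) ob'(2)] iso[OF isos(3) ob(3) ob'(3)]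
      by blast+
  qed (use S in \<open>auto simp: triangle_closed_def\<close>)
qed

end

context homotopy_bicomplete
begin

lemma localising_iff: "localising Idx Car R S \<longleftrightarrow> triangle_closed S \<and>
    (\<forall>J\<in>Idx. \<forall>X. (\<forall>j\<in>J. X j \<in> S) \<longrightarrow> cop J X \<in> S)"
proof
  assume S: "localising Idx Car R S"
  then have sub: "S \<subseteq> complexes Car R"
    unfolding localising_def triangulated_subcategory_def by blast
  have "cop J X \<in> S" if "J \<in> Idx" "\<forall>j\<in>J. X j \<in> S" for J X
    using S that D_coproduct_cop[OF that(1), of X] sub unfolding localising_def by blast
  then show "triangle_closed S \<and> (\<forall>J\<in>Idx. \<forall>X. (\<forall>j\<in>J. X j \<in> S) \<longrightarrow> cop J X \<in> S)"
    using S triangulated_subcategory_iff unfolding localising_def by blast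
next
  assume S: "triangle_closed S \<and> (\<forall>J\<in>Idx. \<forall>X. (\<forall>j\<in>J. X j \<in> S) \<longrightarrow> cop J X \<in> S)"
  then have cl: "X \<in> S \<longleftrightarrow> Y \<in> S" if "we X Y s" for X Y s
    using that unfolding triangle_closed_def by blast
  have "C \<in> S" if J: "J \<in> Idx" and X: "\<And>j. j \<in> J ==> X j \<in> S" and C: "D_coproduct Car R J X C \<iota>" for J X C \<iota>
  proof -
    have X': "\<And>j. j \<in> J ==> X j \<in> complexes Car R"
      using X S unfolding triangle_closed_def by blast
    have "D_isos Car R (cop J X) C \<noteq> {}"
      by (rule D_coproduct_unique[OF D_coproduct_cop[OF J X'] C X'])
    moreover have "cop J X \<in> complexes Car R"
      by (rule cop_ob[OF J]) (rule X')
    moreover have "C \<in> complexes Car R"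
      using C unfolding D_coproduct_def by blast
    ultimately have "cop J X \<in> S \<longleftrightarrow> C \<in> S"
      using iso_closed[of S "cop J X" C] cl by blast
    then show ?thesis
      using S J X by blast
  qed
  note closed = this
  show "localising Idx Car R S"
    unfolding localising_def triangulated_subcategory_iff
  proof (intro conjI ballI allI impI)
    show "triangle_closed S"
      using S by blast
    show "C \<in> S" if "J \<in> Idx" "(\<forall>j\<in>J. X j \<in> S) \<and> D_coproduct Car R J X C \<iota>" for J X C \<iota>
      by (rule closed[OF that(1) _ conjunct2[OF that(2)]]) (use that(2) in blast)
  qed
qed

lemma colocalising_iff: "colocalising Idx Car R S \<longleftrightarrow> triangle_closed S \<and>
    (\<forall>J\<in>Idx. \<forall>X. (\<forall>j\<in>J. X j \<in> S) \<longrightarrow> prd J X \<in> S)"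
proof
  assume S: "colocalising Idx Car R S"
  then have sub: "S \<subseteq> complexes Car R"
    unfolding colocalising_def triangulated_subcategory_def by blast
  have "prd J X \<in> S" if "J \<in> Idx" "\<forall>j\<in>J. X j \<in> S" for J X
    using S that D_product_prd[OF that(1), of X] sub unfolding colocalising_def by blast
  then show "triangle_closed S \<and> (\<forall>J\<in>Idx. \<forall>X. (\<forall>j\<in>J. X j \<in> S) \<longrightarrow> prd J X \<in> S)"
    using S triangulated_subcategory_iff unfolding colocalising_def by blast
next
  assume S: "triangle_closed S \<and> (\<forall>J\<in>Idx. \<forall>X. (\<forall>j\<in>J. X j \<in> S) \<longrightarrow> prd J X \<in> S)"
  then have cl: "X \<in> S \<longleftrightarrow> Y \<in> S" if "we X Y s" for X Y s
    using that unfolding triangle_closed_def by blast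
  have "P \<in> S" if J: "J \<in> Idx" and X: "\<And>j. j \<in> J ==> X j \<in> S" and P: "D_product Car R J X P \<pi>" for J X P \<pi>
  proof -
    have X': "\<And>j. j \<in> J ==> X j \<in> complexes Car R"
      using X S unfolding triangle_closed_def by blast
    have "D_isos Car R (prd J X) P \<noteq> {}"
      by (rule D_product_unique[OF D_product_prd[OF J X'] P X'])
    moreover have "prd J X \<in> complexes Car R"
      by (rule prd_ob[OF J]) (rule X')
    moreover have "P \<in> complexes Car R"
      using P unfolding D_product_def by blast
    ultimately have "prd J X \<in> S \<longleftrightarrow> P \<in> S"
      using iso_closed[of S "prd J X" P] cl by blast
    then show ?thesis
      using S J X by blast
  qed
  note closed = this
  show "colocalising Idx Car R S"
    unfolding colocalising_def triangulated_subcategory_iff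
  proof (intro conjI ballI allI impI)
    show "triangle_closed S"
      using S by blast
    show "P \<in> S" if "J \<in> Idx" "(\<forall>j\<in>J. X j \<in> S) \<and> D_product Car R J X P \<pi>" for J X P \<pi>
      by (rule closed[OF that(1) _ conjunct2[OF that(2)]]) (use that(2) in blast)
  qed
qed

end

section \<open>Small sets\<close>

definition small :: "'u set set => 'a set => bool" where
  "small Car A \<longleftrightarrow> (\<exists>T\<in>Car. A \<lesssim> T)"

text \<open>The injection depends on the set \<open>A\<close> only, hence copies of modules commute with
  restriction of scalars.\<close>

definition embed :: "'u set set => 'a set => 'a => 'u" where
  "embed Car A = (SOME h. inj_on h A \<and> h ` A \<in> Car)"

lemma small_lepoll: "small Car B ==> A \<lesssim> B ==> small Car A"
  unfolding small_def using lepoll_trans by blast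

lemma small_subset: "small Car B ==> A \<subseteq> B ==> small Car A"
  using small_lepoll subset_imp_lepoll by blast

lemma small_image: "small Car A ==> small Car (h ` A)"
  using small_lepoll image_lepoll by blast

lemma small_mem: "A \<in> Car ==> small Car A"
  unfolding small_def using lepoll_refl by blast

lemma size_universe_lepoll:
  assumes "size_universe Idx Car R" "carrier R' \<lesssim> carrier R"
  shows "size_universe Idx Car R'"
  using assms lepoll_trans unfolding size_universe_def by meson

locale universe =
  fixes Idx :: "'i set set" and Car :: "'u set set" and R :: "('r, 'c) ring_scheme"
  assumes size: "size_universe Idx Car R"
begin

lemma Car_lepoll: "S \<in> Car ==> S' \<lesssim> S ==> S' \<in> Car"
  using size unfolding size_universe_def by blast

lemma Car_PiE: "J \<in> Idx ==> \<forall>j\<in>J. S j \<in> Car ==> \<exists>T\<in>Car. T \<approx> PiE J S"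
  using size unfolding size_universe_def by (elim conjE) simp

lemma Idx_lepoll: "J \<in> Idx ==> J' \<lesssim> J ==> J' \<in> Idx"
  using size unfolding size_universe_def by blast

lemma small_ring: "small Car (carrier R)"
  using size unfolding size_universe_def small_def by blast

lemma embed: "small Car A ==> inj_on (embed Car A) A \<and> embed Car A ` A \<in> Car"
proof -
  assume "small Car A"
  then obtain T h where "T \<in> Car" "inj_on h A" "h ` A \<subseteq> T"
    unfolding small_def lepoll_def by blast
  then have "inj_on h A \<and> h ` A \<in> Car"
    using Car_lepoll subset_imp_lepoll by blast
  then show ?thesis
    unfolding embed_def by (rule someI[where P = "\<lambda>h. inj_on h A \<and> h ` A \<in> Car"])
qed

lemma small_PiE:
  assumes "J \<in> Idx" "\<And>j. j \<in> J ==> small Car (S j)"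
  shows "small Car (PiE J S)"
proof -
  let ?h = "\<lambda>j. embed Car (S j)" and ?T = "\<lambda>j. embed Car (S j) ` S j"
  have h: "inj_on (?h j) (S j)" "?T j \<in> Car" if "j \<in> J" for j
    using embed[OF assms(2)[OF that]] by auto
  have "inj_on (\<lambda>f. \<lambda>j\<in>J. ?h j (f j)) (PiE J S)"
  proof (rule inj_onI)
    fix f g assume fg: "f \<in> PiE J S" "g \<in> PiE J S" "(\<lambda>j\<in>J. ?h j (f j)) = (\<lambda>j\<in>J. ?h j (g j))"
    have "f j = g j" if "j \<in> J" for j
      using fun_cong[OF fg(3), of j] inj_onD[OF h(1)[OF that], of "f j" "g j"]
        PiE_mem[OF fg(1) that] PiE_mem[OF fg(2) that] that by simp
    then show "f = g"
      using fg(1,2) by (intro PiE_ext)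
  qed
  moreover have "(\<lambda>f. \<lambda>j\<in>J. ?h j (f j)) ` PiE J S \<subseteq> PiE J ?T"
    by auto
  ultimately have "PiE J S \<lesssim> PiE J ?T"
    unfolding lepoll_def by blast
  moreover obtain T where "T \<in> Car" "T \<approx> PiE J ?T"
    using Car_PiE[OF assms(1), of ?T] h(2) by blast
  ultimately show ?thesis
    unfolding small_def using lepoll_trans[OF _ eqpoll_imp_lepoll[OF eqpoll_sym]] by blast
qed

lemma countable_Idx: "\<exists>J\<in>Idx. infinite J \<and> (UNIV :: nat set) \<lesssim> J"
  using size unfolding size_universe_def by (meson infinite_le_lepoll)

lemma finite_Idx: "finite A ==> \<exists>J\<in>Idx. A \<lesssim> J"
  using countable_Idx by (metis finite_lepoll_infinite)

lemma small_funs: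
  assumes "A \<lesssim> J" "J \<in> Idx" "small Car S"
  shows "small Car (PiE A (\<lambda>_. S))"
proof -
  obtain h where h: "inj_on h A" "h ` A \<subseteq> J"
    using assms(1) unfolding lepoll_def by blast
  have JA: "h ` A \<in> Idx"
    by (rule Idx_lepoll[OF assms(2) subset_imp_lepoll[OF h(2)]])
  have "inj_on (\<lambda>f. \<lambda>j\<in>h ` A. f (inv_into A h j)) (PiE A (\<lambda>_. S))"
  proof (rule inj_onI)
    fix f g assume fg: "f \<in> PiE A (\<lambda>_. S)" "g \<in> PiE A (\<lambda>_. S)"
      "(\<lambda>j\<in>h ` A. f (inv_into A h j)) = (\<lambda>j\<in>h ` A. g (inv_into A h j))"
    have "f a = g a" if "a \<in> A" for a
      using fun_cong[OF fg(3), of "h a"] that h(1) by simp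
    then show "f = g"
      using fg(1,2) by (intro PiE_ext)
  qed
  moreover have "(\<lambda>f. \<lambda>j\<in>h ` A. f (inv_into A h j)) ` PiE A (\<lambda>_. S) \<subseteq> PiE (h ` A) (\<lambda>_. S)"
    by (intro image_subsetI, subst restrict_PiE_iff) (auto simp: h(1))
  ultimately have "PiE A (\<lambda>_. S) \<lesssim> PiE (h ` A) (\<lambda>_. S)"
    unfolding lepoll_def by blast
  then show ?thesis
    using small_lepoll[OF small_PiE[OF JA, of "\<lambda>_. S"]] assms(3) by blast
qed

lemma small_Times:
  assumes "small Car A" "small Car B"
  shows "small Car (A \<times> B)"
proof -
  obtain S where S: "S \<in> Car" "A \<lesssim> S"
    using assms unfolding small_def by blast
  obtain T where T: "T \<in> Car" "B \<lesssim> T"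
    using assms unfolding small_def by blast
  obtain J where J: "J \<in> Idx" "(UNIV :: bool set) \<lesssim> J"
    using finite_Idx[of "UNIV :: bool set"] by auto
  obtain h where h: "inj_on h (UNIV :: bool set)" "h ` UNIV \<subseteq> J"
    using J(2) unfolding lepoll_def by blast
  have JA: "h ` UNIV \<in> Idx"
    by (rule Idx_lepoll[OF J(1) subset_imp_lepoll[OF h(2)]])
  obtain f where f: "inj_on f A" "f ` A \<subseteq> S"
    using S unfolding lepoll_def by blast
  obtain g where g: "inj_on g B" "g ` B \<subseteq> T"
    using T unfolding lepoll_def by blast
  let ?P = "PiE (h ` UNIV) (\<lambda>j. if j = h True then S else T)"
  have ne: "h False \<noteq> h True"
    using h(1) by (metis UNIV_I inj_onD)
  have "inj_on (\<lambda>(a, b). \<lambda>j\<in>h ` UNIV. if j = h True then f a else g b) (A \<times> B)"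
  proof (rule inj_onI, clarify)
    fix a b a' b'
    assume m: "a \<in> A" "b \<in> B" "a' \<in> A" "b' \<in> B"
      and e: "(\<lambda>j\<in>h ` UNIV. if j = h True then f a else g b) = (\<lambda>j\<in>h ` UNIV. if j = h True then f a' else g b')"
    have "f a = f a'"
      using fun_cong[OF e, of "h True"] by simp
    moreover have "g b = g b'"
      using fun_cong[OF e, of "h False"] ne by simp
    ultimately show "a = a' \<and> b = b'"
      using m f(1) g(1) by (meson inj_onD)
  qed
  moreover have "(\<lambda>(a, b). \<lambda>j\<in>h ` UNIV. if j = h True then f a else g b) ` (A \<times> B) \<subseteq> ?P"
    using f(2) g(2) by (auto simp: image_subset_iff)
  ultimately have "A \<times> B \<lesssim> ?P"
    unfolding lepoll_def by blast
  moreover have "small Car ?P"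
    by (rule small_PiE[OF JA]) (simp add: small_mem S T)
  ultimately show ?thesis
    using small_lepoll by blast
qed

end


section \<open>Copies of modules and complexes\<close>

definition copy_module :: "'u set set => ('r, 'm) module => ('r, 'u) module" where
  "copy_module Car M = (let h = embed Car (carrier M); g = inv_into (carrier M) h in
     \<lparr>carrier = h ` carrier M, mult = undefined, one = undefined, zero = h \<zero>[M],
      add = (\<lambda>x y. h (g x \<oplus>[M] g y)), smult = (\<lambda>r x. h (r \<odot>[M] g x))\<rparr>)"

definition to_copy :: "'u set set => ('r, 'm) module => 'm => 'u" where
  "to_copy Car M = embed Car (carrier M)"

definition from_copy :: "'u set set => ('r, 'm) module => 'u => 'm" where
  "from_copy Car M = inv_into (carrier M) (embed Car (carrier M))"

definition copy_cochain :: "'u set set => ('r, 'm) cochain => ('r, 'u) cochain" where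
  "copy_cochain Car X = \<lparr>obj = (\<lambda>n. copy_module Car (obj X n)),
     dif = (\<lambda>n x. to_copy Car (obj X (n + 1)) (dif X n (from_copy Car (obj X n) x)))\<rparr>"

lemma rmodI:
  assumes "ring R" and "abelian_group M"
    and "\<And>r x. r \<in> carrier R ==> x \<in> carrier M ==> r \<odot>[M] x \<in> carrier M"
    and "\<And>r x y. r \<in> carrier R ==> x \<in> carrier M ==> y \<in> carrier M ==>
      r \<odot>[M] (x \<oplus>[M] y) = r \<odot>[M] x \<oplus>[M] r \<odot>[M] y"
    and "\<And>r s x. r \<in> carrier R ==> s \<in> carrier R ==> x \<in> carrier M ==>
      (r \<oplus>[R] s) \<odot>[M] x = r \<odot>[M] x \<oplus>[M] s \<odot>[M] x"
    and "\<And>r s x. r \<in> carrier R ==> s \<in> carrier R ==> x \<in> carrier M ==>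
      (r \<otimes>[R] s) \<odot>[M] x = s \<odot>[M] (r \<odot>[M] x)"
    and "\<And>x. x \<in> carrier M ==> \<one>[R] \<odot>[M] x = x"
  shows "rmod R M"
  using assms by (simp add: rmod_def rmod_axioms_def)

context universe
begin

lemma copy_inverse:
  assumes "small Car (carrier M)" "x \<in> carrier M"
  shows "from_copy Car M (to_copy Car M x) = x"
  unfolding from_copy_def to_copy_def using embed[OF assms(1)] assms(2) by (simp add: inv_into_f_f)

lemma copy_carrier: "carrier (copy_module Car M) = to_copy Car M ` carrier M"
  unfolding copy_module_def to_copy_def by (simp add: Let_def)

lemma copy_carrier_Car: "small Car (carrier M) ==> carrier (copy_module Car M) \<in> Car"
  using embed unfolding copy_carrier to_copy_def by blast

lemma copy_ops:
  assumes "small Car (carrier M)" "x \<in> carrier M" "y \<in> carrier M"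
  shows "to_copy Car M x \<oplus>[copy_module Car M] to_copy Car M y = to_copy Car M (x \<oplus>[M] y)"
    "r \<odot>[copy_module Car M] to_copy Car M x = to_copy Car M (r \<odot>[M] x)"
    "\<zero>[copy_module Car M] = to_copy Car M \<zero>[M]"
  using copy_inverse[OF assms(1,2)] copy_inverse[OF assms(1,3)]
  unfolding copy_module_def from_copy_def to_copy_def by (simp_all add: Let_def)

lemma rmod_copy:
  assumes "rmod R M" "small Car (carrier M)"
  shows "rmod R (copy_module Car M)"
proof -
  interpret rmod R M by fact
  note ops = copy_ops[OF assms(2)]
  show ?thesis
  proof (rule rmodI)
    show "abelian_group (copy_module Car M)"
    proof (rule abelian_groupI)
      show "\<exists>y\<in>carrier (copy_module Car M). y \<oplus>[copy_module Car M] x = \<zero>[copy_module Car M]"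
        if "x \<in> carrier (copy_module Car M)" for x
        using that unfolding copy_carrier
        by (auto simp: ops ops(3)[OF zero_closed zero_closed] l_neg intro!: bexI[of _ "\<ominus>[M] _"])
    qed (auto simp: copy_carrier ops ops(3)[OF zero_closed zero_closed] a_ac)
  qed (auto simp: copy_carrier ops smult_add add_smult mult_smult R.ring_axioms)
qed

lemma to_copy_hom: "rmod R M ==> small Car (carrier M) ==> to_copy Car M \<in> rmod_hom R M (copy_module Car M)"
  by (intro rmod_homI) (auto simp: copy_carrier copy_ops)

lemma from_copy_hom:
  assumes "rmod R M" "small Car (carrier M)"
  shows "from_copy Car M \<in> rmod_hom R (copy_module Car M) M"
proof -
  interpret rmod R M by fact
  show ?thesis
    using assms(2) by (intro rmod_homI) (auto simp: copy_carrier copy_ops copy_inverse)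
qed

context
  fixes X :: "('r, 'm) cochain"
  assumes X: "is_complex R X" and smallX: "\<And>n. small Car (el X n)"
begin

interpretation X: cplx R X using X by (simp add: cplx_def)

lemma to_copy_chain: "chain_map R X (copy_cochain Car X) (\<lambda>n. to_copy Car (obj X n))"
  by (rule chain_mapI) (simp_all add: copy_cochain_def to_copy_hom smallX X.rmod_axioms copy_inverse)

lemma from_copy_chain: "chain_map R (copy_cochain Car X) X (\<lambda>n. from_copy Car (obj X n))"
  by (rule chain_mapI)
    (auto simp add: copy_cochain_def from_copy_hom smallX X.rmod_axioms copy_inverse copy_carrier)

lemma copy_complex: "copy_cochain Car X \<in> complexes Car R"
proof -
  have "is_complex R (copy_cochain Car X)"
    unfolding is_complex_def right_module_iff
  proof (intro allI conjI ballI)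
    fix n
    show "rmod R (obj (copy_cochain Car X) n)"
      by (simp add: copy_cochain_def rmod_copy smallX X.rmod_axioms)
    have "(\<lambda>x. to_copy Car (obj X (n + 1)) (dif X n (from_copy Car (obj X n) x)))
        \<in> rmod_hom R (copy_module Car (obj X n)) (copy_module Car (obj X (n + 1)))"
      by (intro rmod_hom_comp[OF rmod_hom_comp[OF from_copy_hom X.dif_hom] to_copy_hom] X.rmod_axioms smallX refl)
    then show "dif (copy_cochain Car X) n \<in> rmod_hom R (obj (copy_cochain Car X) n) (obj (copy_cochain Car X) (n + 1))"
      by (simp add: copy_cochain_def)
    show "dif (copy_cochain Car X) (n + 1) (dif (copy_cochain Car X) n x) = \<zero>[obj (copy_cochain Car X) (n + 2)]"
      if "x \<in> carrier (obj (copy_cochain Car X) n)" for x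
      using that copy_ops(3)[OF smallX X.zero_closed X.zero_closed, of "n + 2"]
      by (auto simp: copy_cochain_def copy_carrier copy_inverse smallX add.commute add.left_commute)
  qed
  then show ?thesis
    unfolding complexes_def using copy_carrier_Car[OF smallX] by (simp add: copy_cochain_def)
qed

lemma from_to_copy: "x \<in> el X n ==> from_copy Car (obj X n) (to_copy Car (obj X n) x) = x"
  by (rule copy_inverse[OF smallX])

lemma to_from_copy:
  "x \<in> carrier (obj (copy_cochain Car X) n) ==> to_copy Car (obj X n) (from_copy Car (obj X n) x) = x"
  by (auto simp: copy_cochain_def copy_carrier copy_inverse smallX)

end

end

lemma hinj_iso:
  assumes "is_complex R X" "is_complex R Y" "chain_map R X Y f" "chain_map R Y X g"
    "\<And>n x. x \<in> el X n ==> g n (f n x) = x" "\<And>n y. y \<in> el Y n ==> f n (g n y) = y"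
  shows "quasi_iso R X Y f"
proof -
  interpret f: cmor R X Y f using assms by (simp add: cmorI)
  interpret g: cmor R Y X g using assms by (simp add: cmorI)
  have "hinj X Y f"
    unfolding hinj_def using assms(5) g.coboundaries f.X.cocyclesD(1) by metis
  moreover have "hsurj X Y f"
    unfolding hsurj_def
    using assms(6) g.cocycles f.Y.cocyclesD(1) f.Y.zero_coboundary f.Y.r_zero by metis
  ultimately show ?thesis
    using quasi_isoI assms by blast
qed


section \<open>Homotopy pullbacks\<close>

lemma module_sum_simps [simp]:
  "carrier (module_sum M N) = carrier M \<times> carrier N"
  "\<zero>[module_sum M N] = (\<zero>[M], \<zero>[N])"
  "(x, y) \<oplus>[module_sum M N] (x', y') = (x \<oplus>[M] x', y \<oplus>[N] y')"
  "r \<odot>[module_sum M N] (x, y) = (r \<odot>[M] x, r \<odot>[N] y)"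
  unfolding module_sum_def by simp_all

lemma rmod_module_sum:
  assumes "rmod R M" "rmod R N"
  shows "rmod R (module_sum M N)"
proof -
  interpret M: rmod R M by fact
  interpret N: rmod R N by fact
  show ?thesis
  proof (rule rmodI)
    show "abelian_group (module_sum M N)"
    proof (rule abelian_groupI)
      show "\<exists>y\<in>carrier (module_sum M N). y \<oplus>[module_sum M N] x = \<zero>[module_sum M N]"
        if "x \<in> carrier (module_sum M N)" for x
        using that by (auto simp: M.l_neg N.l_neg intro!: bexI[of _ "\<ominus>[M] _"] bexI[of _ "\<ominus>[N] _"])
    qed (auto simp: M.a_ac N.a_ac)
  qed (auto simp: M.R.ring_axioms M.smult_add N.smult_add M.add_smult N.add_smult M.mult_smult N.mult_smult)
qed

definition hpull :: "('r, 'a) cochain => ('r, 'b) cochain => ('r, 'c) cochain => ('a, 'c) cmap => ('b, 'c) cmap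
    => ('r, 'a \<times> 'b \<times> 'c) cochain" where
  "hpull Z Z' Y f t = \<lparr>obj = (\<lambda>n. module_sum (obj Z n) (module_sum (obj Z' n) (obj Y (n - 1)))),
     dif = (\<lambda>n (z, z', y). (dif Z n z, dif Z' n z', f n z \<ominus>[obj Y n] t n z' \<ominus>[obj Y n] dif Y (n - 1) y))\<rparr>"

locale hpull_data = f: cmor R Z Y f + t: cmor R Z' Y t
  for R :: "('r, 'c) ring_scheme" and Z :: "('r, 'm) cochain" and Z' :: "('r, 'n) cochain"
    and Y :: "('r, 'p) cochain" and f t
begin

abbreviation "W \<equiv> hpull Z Z' Y f t"

lemma hpull_complex: "is_complex R W"
  unfolding is_complex_def right_module_iff
proof (intro allI conjI ballI)
  fix n
  show "rmod R (obj W n)"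
    unfolding hpull_def by (simp add: rmod_module_sum f.X.rmod_axioms t.X.rmod_axioms f.Y.rmod_axioms)
  show "dif W n \<in> rmod_hom R (obj W n) (obj W (n + 1))"
  proof (rule rmod_homI)
    show "dif W n x \<in> el W (n + 1)" if "x \<in> el W n" for x
      using that by (auto simp: hpull_def)
    show "dif W n (x \<oplus>[obj W n] y) = dif W n x \<oplus>[obj W (n + 1)] dif W n y"
      if "x \<in> el W n" "y \<in> el W n" for x y
    proof -
      obtain a b c a' b' c' where xy: "x = (a, b, c)" "y = (a', b', c')"
        by (metis prod_cases3)
      have m: "a \<in> el Z n" "b \<in> el Z' n" "c \<in> el Y (n - 1)"
        "a' \<in> el Z n" "b' \<in> el Z' n" "c' \<in> el Y (n - 1)"
        using that by (auto simp: xy hpull_def)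
      have d: "dif Y (n - 1) (c \<oplus>[obj Y (n - 1)] c') = dif Y (n - 1) c \<oplus>[obj Y n] dif Y (n - 1) c'"
        using f.Y.dif_add[OF m(3,6)] by simp
      have "f n a \<in> el Y n" "f n a' \<in> el Y n" "t n b \<in> el Y n"
        "t n b' \<in> el Y n" "dif Y (n - 1) c \<in> el Y n" "dif Y (n - 1) c' \<in> el Y n"
        using m by auto
      then have "(f n a \<oplus>[obj Y n] f n a') \<ominus>[obj Y n] (t n b \<oplus>[obj Y n] t n b') \<ominus>[obj Y n]
          (dif Y (n - 1) c \<oplus>[obj Y n] dif Y (n - 1) c') =
          (f n a \<ominus>[obj Y n] t n b \<ominus>[obj Y n] dif Y (n - 1) c) \<oplus>[obj Y n]
          (f n a' \<ominus>[obj Y n] t n b' \<ominus>[obj Y n] dif Y (n - 1) c')"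
        by algebra
      then show ?thesis
        using m by (simp add: xy hpull_def d)
    qed
    show "dif W n (r \<odot>[obj W n] x) = r \<odot>[obj W (n + 1)] dif W n x"
      if "r \<in> carrier R" "x \<in> el W n" for r x
      using that f.Y.dif_smult[of r _ "n - 1"] by (auto simp: hpull_def f.Y.smult_minus)
  qed
  show "dif W (n + 1) (dif W n x) = \<zero>[obj W (n + 2)]" if "x \<in> el W n" for x
  proof -
    obtain a b c where x: "x = (a, b, c)"
      by (metis prod_cases3)
    have m: "a \<in> el Z n" "b \<in> el Z' n" "c \<in> el Y (n - 1)"
      using that by (auto simp: x hpull_def)
    have "dif Y n (f n a) \<in> el Y (n + 1)" "dif Y n (t n b) \<in> el Y (n + 1)"
      using m by auto
    then have "dif Y n (f n a) \<ominus>[obj Y (n + 1)] dif Y n (t n b) \<ominus>[obj Y (n + 1)]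
        (dif Y n (f n a) \<ominus>[obj Y (n + 1)] dif Y n (t n b) \<ominus>[obj Y (n + 1)] \<zero>[obj Y (n + 1)])
        = \<zero>[obj Y (n + 1)]"
      by algebra
    then show ?thesis
      using m by (simp add: x hpull_def add.commute)
  qed
qed

lemma hpull_fst: "chain_map R W Z (\<lambda>n. fst)"
  by (rule chain_mapI, rule rmod_homI) (auto simp: hpull_def)

lemma hpull_snd: "chain_map R W Z' (\<lambda>n x. fst (snd x))"
  by (rule chain_mapI, rule rmod_homI) (auto simp: hpull_def)

lemma hpull_homotopic: "homotopic R W Y (f ** (\<lambda>n. fst)) (t ** (\<lambda>n x. fst (snd x)))"
proof (rule homotopicI)
  show "(\<lambda>n x. snd (snd x)) n \<in> rmod_hom R (obj W n) (obj Y (n - 1))" for n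
    by (rule rmod_homI) (auto simp: hpull_def)
  fix n x assume "x \<in> el W n"
  then obtain a b c where x: "x = (a, b, c)"
    and m: "a \<in> el Z n" "b \<in> el Z' n" "c \<in> el Y (n - 1)"
    by (auto simp: hpull_def)
  have "f n a \<in> el Y n" "t n b \<in> el Y n" "dif Y (n - 1) c \<in> el Y n"
    using m by auto
  then have "f n a = t n b \<oplus>[obj Y n] (dif Y (n - 1) c \<oplus>[obj Y n]
      (f n a \<ominus>[obj Y n] t n b \<ominus>[obj Y n] dif Y (n - 1) c))"
    by algebra
  then show "(f ** (\<lambda>n. fst)) n x = (t ** (\<lambda>n x. fst (snd x))) n x \<oplus>[obj Y n]
      (dif Y (n - 1) (snd (snd x)) \<oplus>[obj Y n] snd (snd (dif W n x)))"
    unfolding cmap_comp_def comp_def by (simp add: x hpull_def)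
qed

lemma hpull_universal:
  assumes "is_complex R X" "chain_map R X Z u" "chain_map R X Z' v" "homotopic R X Y (f ** u) (t ** v)"
  obtains e where "chain_map R X W e" "(\<lambda>n. fst) ** e = u" "(\<lambda>n x. fst (snd x)) ** e = v"
proof -
  interpret u: cmor R X Z u using assms f.X.cplx by (simp add: cmorI)
  interpret v: cmor R X Z' v using assms t.X.cplx by (simp add: cmorI)
  from homotopicE[OF assms(4,1) f.Y.cplx] obtain s where s: "htpy R X Y s" and
    eq: "\<And>n x. x \<in> el X n ==> (f ** u) n x = (t ** v) n x \<oplus>[obj Y n]
      (dif Y (n - 1) (s n x) \<oplus>[obj Y n] s (n + 1) (dif X n x))" by blast
  interpret htpy R X Y s by fact
  let ?e = "\<lambda>n x. (u n x, v n x, s n x)"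
  have "chain_map R X W ?e"
  proof (rule chain_mapI)
    show "?e n \<in> rmod_hom R (obj X n) (obj W n)" for n
      by (rule rmod_homI) (auto simp: hpull_def)
    fix n x assume x: "x \<in> el X n"
    have c: "t n (v n x) \<in> el Y n" "dif Y (n - 1) (s n x) \<in> el Y n"
      "s (n + 1) (dif X n x) \<in> el Y n"
      using x by auto
    have "s (n + 1) (dif X n x) = t n (v n x) \<oplus>[obj Y n]
      (dif Y (n - 1) (s n x) \<oplus>[obj Y n] s (n + 1) (dif X n x)) \<ominus>[obj Y n] t n (v n x) \<ominus>[obj Y n] dif Y (n - 1) (s n x)"
      using c by algebra
    also have "\<dots> = f n (u n x) \<ominus>[obj Y n] t n (v n x) \<ominus>[obj Y n] dif Y (n - 1) (s n x)"
      using eq[OF x] by (simp add: cmap_comp_def)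
    finally show "?e (n + 1) (dif X n x) = dif W n (?e n x)"
      using x by (simp add: hpull_def)
  qed
  then show thesis
    by (rule that) (auto simp: cmap_comp_def fun_eq_iff)
qed

lemma hpull_quasi_iso:
  assumes t: "quasi_iso R Z' Y t"
  shows "quasi_iso R W Z (\<lambda>n. fst)"
proof -
  interpret W: cplx R W by (simp add: cplx_def hpull_complex)
  have t: "hinj Z' Y t" "hsurj Z' Y t"
    using quasi_isoD t t.X.cplx f.Y.cplx by blast+
  have "hinj W Z (\<lambda>n. fst)"
    unfolding hinj_def
  proof (intro allI ballI impI)
    fix n x assume x: "x \<in> cocycles W n" "fst x \<in> coboundaries Z n"
    obtain a b c where abc: "x = (a, b, c)"
      by (metis prod_cases3)
    have m: "a \<in> el Z n" "b \<in> el Z' n" "c \<in> el Y (n - 1)"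
      and z: "dif Z' n b = \<zero>[obj Z' (n + 1)]" "f n a \<ominus>[obj Y n] t n b \<ominus>[obj Y n] dif Y (n - 1) c = \<zero>[obj Y n]"
      using x(1) unfolding abc cocycles_def by (auto simp: hpull_def)
    obtain a0 where a0: "a0 \<in> el Z (n - 1)" "a = dif Z (n - 1) a0"
      using x(2) unfolding abc by (auto elim: f.X.coboundariesE)
    have fa: "f n a = dif Y (n - 1) (f (n - 1) a0)"
      using a0 by simp
    have c: "f n a \<in> el Y n" "t n b \<in> el Y n" "dif Y (n - 1) c \<in> el Y n"
      "f (n - 1) a0 \<in> el Y (n - 1)"
      using m a0(1) by auto
    have "f n a \<ominus>[obj Y n] t n b = dif Y (n - 1) c"
      by (rule f.Y.minus_eq_zeroD[OF z(2)]) (use c in auto)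
    then have "t n b = f n a \<ominus>[obj Y n] dif Y (n - 1) c"
      using c by (metis f.Y.minus_closed f.Y.minus_eq f.Y.a_inv_closed f.Y.minus_add f.Y.minus_minus f.Y.r_neg2)
    also have "\<dots> = dif Y (n - 1) (f (n - 1) a0 \<ominus>[obj Y (n - 1)] c)"
      using f.Y.dif_minus[of "f (n - 1) a0" "n - 1" c] m c fa by simp
    finally have tb: "t n b = dif Y (n - 1) (f (n - 1) a0 \<ominus>[obj Y (n - 1)] c)" .
    have "b \<in> coboundaries Z' n"
    proof (rule hinjD[OF t(1)])
      show "b \<in> cocycles Z' n"
        using m z by (simp add: cocycles_def)
      show "t n b \<in> coboundaries Y n"
        unfolding tb using m c by (intro f.Y.coboundariesI) auto
    qed
    then obtain b1 where b1: "b1 \<in> el Z' (n - 1)" "b = dif Z' (n - 1) b1"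
      by (rule t.X.coboundariesE)
    let ?c = "f (n - 1) a0 \<ominus>[obj Y (n - 1)] c \<ominus>[obj Y (n - 1)] t (n - 1) b1"
    have "dif Y (n - 1) ?c = t n b \<ominus>[obj Y n] dif Y (n - 1) (t (n - 1) b1)"
      using f.Y.dif_minus[of "f (n - 1) a0 \<ominus>[obj Y (n - 1)] c" "n - 1" "t (n - 1) b1"] m b1 c tb by simp
    also have "\<dots> = \<zero>[obj Y n]"
      using b1 c by simp
    finally have "?c \<in> cocycles Y (n - 1)"
      unfolding cocycles_def using m b1 c by simp
    then obtain w u where w: "w \<in> cocycles Z' (n - 1)" "u \<in> coboundaries Y (n - 1)"
        "?c = t (n - 1) w \<oplus>[obj Y (n - 1)] u"
      by (rule hsurjE[OF t(2)])
    obtain u' where u': "u' \<in> carrier (obj Y (n - 1 - 1))" "u = dif Y (n - 1 - 1) u'"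
      by (rule f.Y.coboundariesE[OF w(2)])
    have w': "w \<in> el Z' (n - 1)" "dif Z' (n - 1) w = \<zero>[obj Z' n]"
      using w(1) by (auto simp: cocycles_def)
    have k: "u \<in> el Y (n - 1)" "t (n - 1) b1 \<in> el Y (n - 1)"
      "t (n - 1) w \<in> el Y (n - 1)"
      using w(2) b1 w' f.Y.coboundaries_closed by auto
    have "c = f (n - 1) a0 \<ominus>[obj Y (n - 1)] t (n - 1) b1 \<ominus>[obj Y (n - 1)] ?c"
      using c(4) m(3) k(2) by algebra
    also have "\<dots> = f (n - 1) a0 \<ominus>[obj Y (n - 1)] (t (n - 1) b1 \<oplus>[obj Y (n - 1)] t (n - 1) w) \<ominus>[obj Y (n - 1)] u"
      unfolding w(3) using c(4) k by algebra
    finally have c': "c = f (n - 1) a0 \<ominus>[obj Y (n - 1)] (t (n - 1) b1 \<oplus>[obj Y (n - 1)] t (n - 1) w) \<ominus>[obj Y (n - 1)] u" .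
    have b': "dif Z' (n - 1) (b1 \<oplus>[obj Z' (n - 1)] w) = b"
      using t.X.dif_add[of b1 "n - 1" w] b1 w' m by simp
    have "x = dif W (n - 1) (a0, b1 \<oplus>[obj Z' (n - 1)] w, u')"
      using b1 w' a0 u' c' b' by (simp add: abc hpull_def)
    moreover have "dif W (n - 1) (a0, b1 \<oplus>[obj Z' (n - 1)] w, u') \<in> coboundaries W n"
      using a0(1) b1(1) w'(1) u'(1) by (intro W.coboundariesI) (auto simp: hpull_def)
    ultimately show "x \<in> coboundaries W n"
      by simp
  qed
  moreover have "hsurj W Z (\<lambda>n. fst)"
    unfolding hsurj_def
  proof (intro allI ballI)
    fix n z assume z: "z \<in> cocycles Z n"
    obtain b y where b: "b \<in> cocycles Z' n" "y \<in> coboundaries Y n" "f n z = t n b \<oplus>[obj Y n] y"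
      by (rule hsurjE[OF t(2) f.cocycles[OF z]])
    obtain c where c: "c \<in> el Y (n - 1)" "y = dif Y (n - 1) c"
      by (rule f.Y.coboundariesE[OF b(2)])
    have m: "b \<in> el Z' n" "z \<in> el Z n" "y \<in> el Y n" "t n b \<in> el Y n"
      using b z f.X.cocyclesD t.X.cocyclesD f.Y.coboundaries_closed by auto
    have "f n z \<ominus>[obj Y n] t n b \<ominus>[obj Y n] y = \<zero>[obj Y n]"
      unfolding b(3) using m by algebra
    then have "(z, b, c) \<in> cocycles W n"
      using c m f.X.cocyclesD(2)[OF z] t.X.cocyclesD(2)[OF b(1)] by (simp add: cocycles_def hpull_def)
    then show "\<exists>x\<in>cocycles W n. \<exists>b\<in>coboundaries Z n. z = fst x \<oplus>[obj Z n] b"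
      using f.X.zero_coboundary[of n] m by (intro bexI[of _ "(z, b, c)"] bexI[of _ "\<zero>[obj Z n]"]) auto
  qed
  ultimately show ?thesis
    by (intro quasi_isoI hpull_complex f.X.cplx hpull_fst)
qed

end

section \<open>Sums and products of modules and complexes\<close>

definition prod_module :: "'i set => ('i => ('r, 'm) module) => ('r, 'i => 'm) module" where
  "prod_module J M = \<lparr>carrier = PiE J (\<lambda>j. carrier (M j)), mult = undefined, one = undefined,
     zero = (\<lambda>j\<in>J. \<zero>[M j]), add = (\<lambda>x y. \<lambda>j\<in>J. x j \<oplus>[M j] y j),
     smult = (\<lambda>r x. \<lambda>j\<in>J. r \<odot>[M j] x j)\<rparr>"

definition sum_module :: "'i set => ('i => ('r, 'm) module) => ('r, 'i => 'm) module" where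
  "sum_module J M = (prod_module J M)
     \<lparr>carrier := {x \<in> PiE J (\<lambda>j. carrier (M j)). finite {j\<in>J. x j \<noteq> \<zero>[M j]}}\<rparr>"

definition sum_inc :: "'i set => ('i => ('r, 'm) module) => 'i => 'm => 'i => 'm" where
  "sum_inc J M j x = (\<lambda>i\<in>J. if i = j then x else \<zero>[M i])"

lemma prod_module_simps:
  "carrier (prod_module J M) = PiE J (\<lambda>j. carrier (M j))"
  "\<zero>[prod_module J M] = (\<lambda>j\<in>J. \<zero>[M j])"
  "x \<oplus>[prod_module J M] y = (\<lambda>j\<in>J. x j \<oplus>[M j] y j)"
  "r \<odot>[prod_module J M] x = (\<lambda>j\<in>J. r \<odot>[M j] x j)"
  unfolding prod_module_def by simp_all

lemma sum_module_simps:
  "carrier (sum_module J M) = {x \<in> PiE J (\<lambda>j. carrier (M j)). finite {j\<in>J. x j \<noteq> \<zero>[M j]}}"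
  "\<zero>[sum_module J M] = (\<lambda>j\<in>J. \<zero>[M j])"
  "x \<oplus>[sum_module J M] y = (\<lambda>j\<in>J. x j \<oplus>[M j] y j)"
  "r \<odot>[sum_module J M] x = (\<lambda>j\<in>J. r \<odot>[M j] x j)"
  unfolding sum_module_def by (simp_all add: prod_module_def)

lemma (in abelian_group) neg_zero: "\<ominus> \<zero> = \<zero>"
  using r_neg[OF zero_closed] by simp

locale module_family =
  fixes R :: "('r, 'c) ring_scheme" and J :: "'i set" and M :: "'i => ('r, 'm) module"
  assumes ring: "ring R" and M: "j \<in> J ==> rmod R (M j)"
begin

lemma group: "j \<in> J ==> abelian_group (M j)"
  using M unfolding rmod_def by blast

lemmas M_simps [simp] = abelian_monoid.zero_closed[OF abelian_group.axioms(1)[OF group]]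
  abelian_monoid.a_closed[OF abelian_group.axioms(1)[OF group]]
  abelian_monoid.l_zero[OF abelian_group.axioms(1)[OF group]]
  abelian_monoid.r_zero[OF abelian_group.axioms(1)[OF group]]
  abelian_group.a_inv_closed[OF group] abelian_group.l_neg[OF group]
  rmod.smult_closed[OF M] rmod.smult_zero[OF M] rmod.one_smult[OF M]
  abelian_group.neg_zero[OF group]

lemmas M_assoc = abelian_monoid.a_assoc[OF abelian_group.axioms(1)[OF group]]
lemmas M_comm = abelian_monoid.a_comm[OF abelian_group.axioms(1)[OF group]]

lemmas M_ac = M_assoc M_comm abelian_monoid.a_lcomm[OF abelian_group.axioms(1)[OF group]]

lemma rmod_prod: "rmod R (prod_module J M)"
proof (rule rmodI[OF ring])
  show "abelian_group (prod_module J M)"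
  proof (rule abelian_groupI)
    show "\<exists>y\<in>carrier (prod_module J M). y \<oplus>[prod_module J M] x = \<zero>[prod_module J M]"
      if "x \<in> carrier (prod_module J M)" for x
      using that
      by (intro bexI[of _ "\<lambda>j\<in>J. \<ominus>[M j] x j"]) (auto simp: prod_module_simps PiE_iff intro!: restrict_ext)
  qed (auto simp: prod_module_simps PiE_iff M_ac intro!: restrict_ext extensionalityI[of _ J])
qed (auto simp: prod_module_simps PiE_iff rmod.smult_add[OF M] rmod.add_smult[OF M] rmod.mult_smult[OF M]
    intro!: restrict_ext extensionalityI[of _ J])

lemma sum_closed_add:
  assumes "x \<in> carrier (sum_module J M)" "y \<in> carrier (sum_module J M)"
  shows "x \<oplus>[sum_module J M] y \<in> carrier (sum_module J M)"
proof -
  have "{j\<in>J. (\<lambda>j\<in>J. x j \<oplus>[M j] y j) j \<noteq> \<zero>[M j]} \<subseteq> {j\<in>J. x j \<noteq> \<zero>[M j]} \<union> {j\<in>J. y j \<noteq> \<zero>[M j]}"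
    by auto
  note sub = this
  show ?thesis
    unfolding sum_module_simps
  proof (intro CollectI conjI)
    show "finite {j\<in>J. (\<lambda>j\<in>J. x j \<oplus>[M j] y j) j \<noteq> \<zero>[M j]}"
      by (rule finite_subset[OF sub]) (use assms in \<open>auto simp: sum_module_simps\<close>)
  qed (use assms in \<open>auto simp: sum_module_simps PiE_iff\<close>)
qed

lemma sum_closed_map:
  assumes "x \<in> carrier (sum_module J M)" "\<And>j. j \<in> J ==> h j (x j) \<in> carrier (N j)"
    "\<And>j. j \<in> J ==> h j \<zero>[M j] = \<zero>[N j]"
  shows "(\<lambda>j\<in>J. h j (x j)) \<in> carrier (sum_module J N)"
proof -
  have "{j\<in>J. (\<lambda>j\<in>J. h j (x j)) j \<noteq> \<zero>[N j]} \<subseteq> {j\<in>J. x j \<noteq> \<zero>[M j]}"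
    using assms(3) by auto
  note sub = this
  show ?thesis
    unfolding sum_module_simps
  proof (intro CollectI conjI)
    show "finite {j\<in>J. (\<lambda>j\<in>J. h j (x j)) j \<noteq> \<zero>[N j]}"
      by (rule finite_subset[OF sub]) (use assms in \<open>auto simp: sum_module_simps\<close>)
  qed (use assms in \<open>auto simp: sum_module_simps PiE_iff\<close>)
qed

lemma rmod_sum: "rmod R (sum_module J M)"
proof (rule rmodI[OF ring])
  show "abelian_group (sum_module J M)"
  proof (rule abelian_groupI)
    show "\<exists>y\<in>carrier (sum_module J M). y \<oplus>[sum_module J M] x = \<zero>[sum_module J M]"
      if x: "x \<in> carrier (sum_module J M)" for x
    proof
      show "(\<lambda>j\<in>J. \<ominus>[M j] x j) \<in> carrier (sum_module J M)"
        by (rule sum_closed_map[OF x]) (use x in \<open>auto simp: sum_module_simps PiE_iff\<close>)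
      show "(\<lambda>j\<in>J. \<ominus>[M j] x j) \<oplus>[sum_module J M] x = \<zero>[sum_module J M]"
        using x by (auto simp: sum_module_simps PiE_iff intro!: restrict_ext)
    qed
    show "\<zero>[sum_module J M] \<in> carrier (sum_module J M)"
      by (auto simp: sum_module_simps)
  next
    show "x \<oplus>[sum_module J M] y \<in> carrier (sum_module J M)"
      if "x \<in> carrier (sum_module J M)" "y \<in> carrier (sum_module J M)" for x y
      by (rule sum_closed_add[OF that])
  qed (auto simp: sum_module_simps PiE_iff M_ac intro!: restrict_ext extensionalityI[of _ J])
next
  show "r \<odot>[sum_module J M] x \<in> carrier (sum_module J M)"
    if "r \<in> carrier R" "x \<in> carrier (sum_module J M)" for r x
    using sum_closed_map[OF that(2), of "\<lambda>j y. r \<odot>[M j] y" M] that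
    by (simp add: sum_module_simps(4)) (auto simp: sum_module_simps PiE_iff)
qed (auto simp: sum_module_simps PiE_iff rmod.smult_add[OF M] rmod.add_smult[OF M] rmod.mult_smult[OF M]
    intro!: restrict_ext extensionalityI[of _ J])

lemma sum_inc_closed: "j \<in> J ==> x \<in> carrier (M j) ==> sum_inc J M j x \<in> carrier (sum_module J M)"
proof -
  assume j: "j \<in> J" "x \<in> carrier (M j)"
  have "{i\<in>J. sum_inc J M j x i \<noteq> \<zero>[M i]} \<subseteq> {j}"
    by (auto simp: sum_inc_def)
  then show ?thesis
    using j finite_subset[of _ "{j}"] by (auto simp: sum_module_simps PiE_iff sum_inc_def)
qed

lemma sum_inc_hom: "j \<in> J ==> sum_inc J M j \<in> rmod_hom R (M j) (sum_module J M)"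
  by (intro rmod_homI sum_inc_closed) (auto simp: sum_inc_def sum_module_simps intro!: restrict_ext)

lemma sum_hom_unique:
  assumes "g \<in> rmod_hom R (sum_module J M) N" "h \<in> rmod_hom R (sum_module J M) N" "rmod R N"
    "\<And>j x. j \<in> J ==> x \<in> carrier (M j) ==> g (sum_inc J M j x) = h (sum_inc J M j x)"
    "x \<in> carrier (sum_module J M)"
  shows "g x = h x"
proof -
  interpret g: rmor R "sum_module J M" N g
    using assms rmod_sum by (simp add: rmor_def rmor_axioms_def)
  interpret h: rmor R "sum_module J M" N h
    using assms rmod_sum by (simp add: rmor_def rmor_axioms_def)
  have "\<forall>x\<in>carrier (sum_module J M). {j\<in>J. x j \<noteq> \<zero>[M j]} = A \<longrightarrow> g x = h x" if "finite A" for A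
    using that
  proof (induction A)
    case empty
    have "x = \<zero>[sum_module J M]" if "x \<in> carrier (sum_module J M)" "{j\<in>J. x j \<noteq> \<zero>[M j]} = {}" for x
      using that by (intro extensionalityI[of _ J]) (auto simp: sum_module_simps PiE_iff)
    then have "g x = h x" if "x \<in> carrier (sum_module J M)" "{j\<in>J. x j \<noteq> \<zero>[M j]} = {}" for x
      using that g.zero h.zero by (simp only:)
    then show ?case
      by blast
  next
    case (insert a A)
    show ?case
    proof (intro ballI impI)
      fix x assume x: "x \<in> carrier (sum_module J M)" "{j\<in>J. x j \<noteq> \<zero>[M j]} = insert a A"
      then have a: "a \<in> J" "x a \<in> carrier (M a)"
        by (auto simp: sum_module_simps PiE_iff)
      let ?y = "\<lambda>j\<in>J. if j = a then \<zero>[M j] else x j"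
      have y: "?y \<in> carrier (sum_module J M)"
        by (rule sum_closed_map[OF x(1)]) (use x in \<open>auto simp: sum_module_simps PiE_iff\<close>)
      have "{j\<in>J. ?y j \<noteq> \<zero>[M j]} = A"
        using x(2) insert(2) by (auto split: if_splits)
      then have gy: "g ?y = h ?y"
        using insert(3) y by blast
      have "x = ?y \<oplus>[sum_module J M] sum_inc J M a (x a)"
        using x(1) by (intro extensionalityI[of _ J]) (auto simp: sum_module_simps PiE_iff sum_inc_def)
      then show "g x = h x"
        using g.add[OF y sum_inc_closed[OF a]] h.add[OF y sum_inc_closed[OF a]] gy assms(4)[OF a] by simp
    qed
  qed
  then show ?thesis
    using assms(5) by (auto simp: sum_module_simps)
qed

lemma sum_hom_exists:
  assumes f: "\<And>j. j \<in> J ==> f j \<in> rmod_hom R (M j) N" and N: "rmod R N"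
  obtains g where "g \<in> rmod_hom R (sum_module J M) N"
    "\<And>j x. j \<in> J ==> x \<in> carrier (M j) ==> g (sum_inc J M j x) = f j x"
proof -
  interpret N: rmod R N by fact
  have fm: "rmor R (M j) N (f j)" if "j \<in> J" for j
    using f M N that by (simp add: rmor_def rmor_axioms_def)
  note f' = rmor.closed[OF fm] rmor.add[OF fm] rmor.zero[OF fm] rmor.smult[OF fm]
  let ?s = "\<lambda>x. {j\<in>J. x j \<noteq> \<zero>[M j]}"
  define g where "g x = finsum N (\<lambda>j. f j (x j)) (?s x)" for x
  have g: "g x = finsum N (\<lambda>j. f j (x j)) A"
    if "x \<in> carrier (sum_module J M)" "finite A" "?s x \<subseteq> A" "A \<subseteq> J" for x A
    unfolding g_def
  proof (rule N.add.finprod_mono_neutral_cong_left[OF that(2,3), unfolded finsum_def[symmetric]])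
    show "f i (x i) = \<zero>[N]" if "i \<in> A - ?s x" for i
      using that \<open>A \<subseteq> J\<close> f'(3)[of i] by auto
    show "(\<lambda>j. f j (x j)) \<in> A \<rightarrow> carrier N"
      using that f'(1) by (auto simp: sum_module_simps PiE_iff)
  qed (rule refl)
  have smult_finsum: "r \<odot>[N] finsum N u A = finsum N (\<lambda>j. r \<odot>[N] u j) A"
    if "finite A" "u \<in> A \<rightarrow> carrier N" "r \<in> carrier R" for r u A
    using that by (induction A) (auto simp: N.smult_add Pi_iff)
  have "g \<in> rmod_hom R (sum_module J M) N"
  proof (rule rmod_homI)
    show "g x \<in> carrier N" if "x \<in> carrier (sum_module J M)" for x
      unfolding g_def using that f'(1) by (intro N.finsum_closed) (auto simp: sum_module_simps PiE_iff)
    fix x y assume x: "x \<in> carrier (sum_module J M)" and y: "y \<in> carrier (sum_module J M)"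
    let ?A = "?s x \<union> ?s y"
    have A: "finite ?A" "?s x \<subseteq> ?A" "?s y \<subseteq> ?A" "?A \<subseteq> J"
      using x y by (auto simp: sum_module_simps)
    have xy: "x \<oplus>[sum_module J M] y \<in> carrier (sum_module J M)"
      by (rule sum_closed_add[OF x y])
    have m: "j \<in> ?A ==> x j \<in> carrier (M j) \<and> y j \<in> carrier (M j)" for j
      using x y by (auto simp: sum_module_simps PiE_iff)
    have "g (x \<oplus>[sum_module J M] y) = finsum N (\<lambda>j. f j ((x \<oplus>[sum_module J M] y) j)) ?A"
      by (rule g[OF xy A(1) _ A(4)]) (auto simp: sum_module_simps)
    also have "\<dots> = finsum N (\<lambda>j. f j (x j) \<oplus>[N] f j (y j)) ?A"
      using m f' by (intro N.finsum_cong') (auto simp: sum_module_simps Pi_iff)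
    also have "\<dots> = finsum N (\<lambda>j. f j (x j)) ?A \<oplus>[N] finsum N (\<lambda>j. f j (y j)) ?A"
      using m f' by (intro N.finsum_addf) (auto simp: Pi_iff)
    also have "\<dots> = g x \<oplus>[N] g y"
      by (simp only: g[OF x A(1,2,4)] g[OF y A(1,3,4)])
    finally show "g (x \<oplus>[sum_module J M] y) = g x \<oplus>[N] g y" .
  next
    fix r x assume r: "r \<in> carrier R" and x: "x \<in> carrier (sum_module J M)"
    interpret S: rmod R "sum_module J M" by (rule rmod_sum)
    have A: "finite (?s x)" "?s x \<subseteq> J"
      using x by (auto simp: sum_module_simps)
    have m: "j \<in> ?s x ==> x j \<in> carrier (M j)" for j
      using x by (auto simp: sum_module_simps PiE_iff)
    have "g (r \<odot>[sum_module J M] x) = finsum N (\<lambda>j. f j ((r \<odot>[sum_module J M] x) j)) (?s x)"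
      by (rule g[OF S.smult_closed[OF r x] A(1) _ A(2)]) (use r in \<open>auto simp: sum_module_simps\<close>)
    also have "\<dots> = finsum N (\<lambda>j. r \<odot>[N] f j (x j)) (?s x)"
      using m f' r by (intro N.finsum_cong') (auto simp: sum_module_simps Pi_iff)
    also have "\<dots> = r \<odot>[N] g x"
      unfolding g_def using m f'(1) A by (intro smult_finsum[symmetric] r) auto
    finally show "g (r \<odot>[sum_module J M] x) = r \<odot>[N] g x" .
  qed
  moreover have "g (sum_inc J M j x) = f j x" if j: "j \<in> J" "x \<in> carrier (M j)" for j x
  proof -
    have "g (sum_inc J M j x) = finsum N (\<lambda>i. f i (sum_inc J M j x i)) {j}"
      by (rule g[OF sum_inc_closed[OF j]]) (use j in \<open>auto simp: sum_inc_def\<close>)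
    also have "\<dots> = f j x"
      using j f'(1) by (simp add: sum_inc_def)
    finally show ?thesis .
  qed
  ultimately show thesis
    using that by blast
qed

end

definition prod_cochain :: "'i set => ('i => ('r, 'm) cochain) => ('r, 'i => 'm) cochain" where
  "prod_cochain J X = \<lparr>obj = (\<lambda>n. prod_module J (\<lambda>j. obj (X j) n)),
     dif = (\<lambda>n x. \<lambda>j\<in>J. dif (X j) n (x j))\<rparr>"

definition sum_cochain :: "'i set => ('i => ('r, 'm) cochain) => ('r, 'i => 'm) cochain" where
  "sum_cochain J X = \<lparr>obj = (\<lambda>n. sum_module J (\<lambda>j. obj (X j) n)),
     dif = (\<lambda>n x. \<lambda>j\<in>J. dif (X j) n (x j))\<rparr>"

locale cochain_family =
  fixes R :: "('r, 'c) ring_scheme" and J :: "'i set" and X :: "'i => ('r, 'm) cochain"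
  assumes ring: "ring R" and X: "j \<in> J ==> cplx R (X j)"

sublocale cochain_family \<subseteq> module_family R J "\<lambda>j. obj (X j) n" for n
proof (rule module_family.intro[OF ring])
  show "rmod R (obj (X j) n)" if "j \<in> J" for j
  proof -
    interpret cplx R "X j" by (rule X[OF that])
    show ?thesis by (rule rmod_axioms)
  qed
qed

context cochain_family
begin

lemmas d_simps [simp] = cplx.dif_closed[OF X] cplx.dif_add[OF X] cplx.dif_smult[OF X]
  cplx.dif_zero[OF X] cplx.dif_dif[OF X]

lemma prod_complex: "is_complex R (prod_cochain J X)"
  unfolding is_complex_def right_module_iff
proof (intro allI conjI ballI)
  fix n
  show "rmod R (obj (prod_cochain J X) n)"
    by (simp add: prod_cochain_def rmod_prod)
  show "dif (prod_cochain J X) n \<in> rmod_hom R (obj (prod_cochain J X) n) (obj (prod_cochain J X) (n + 1))"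
    by (rule rmod_homI) (auto simp: prod_cochain_def prod_module_simps PiE_iff intro!: restrict_ext)
  show "dif (prod_cochain J X) (n + 1) (dif (prod_cochain J X) n x) = \<zero>[obj (prod_cochain J X) (n + 2)]"
    if "x \<in> carrier (obj (prod_cochain J X) n)" for x
    using that by (auto simp: prod_cochain_def prod_module_simps PiE_iff add.commute intro!: restrict_ext)
qed

lemma sum_complex: "is_complex R (sum_cochain J X)"
  unfolding is_complex_def right_module_iff
proof (intro allI conjI ballI)
  fix n
  show "rmod R (obj (sum_cochain J X) n)"
    by (simp add: sum_cochain_def rmod_sum)
  show "dif (sum_cochain J X) n \<in> rmod_hom R (obj (sum_cochain J X) n) (obj (sum_cochain J X) (n + 1))"
  proof (rule rmod_homI)
    show "dif (sum_cochain J X) n x \<in> carrier (obj (sum_cochain J X) (n + 1))"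
      if "x \<in> carrier (obj (sum_cochain J X) n)" for x
      using that sum_closed_map[of x n "\<lambda>j. dif (X j) n" "\<lambda>j. obj (X j) (n + 1)"]
      by (auto simp: sum_cochain_def sum_module_simps(1)[of J "\<lambda>j. obj (X j) n"] PiE_iff)
  qed (auto simp: sum_cochain_def sum_module_simps PiE_iff intro!: restrict_ext)
  show "dif (sum_cochain J X) (n + 1) (dif (sum_cochain J X) n x) = \<zero>[obj (sum_cochain J X) (n + 2)]"
    if "x \<in> carrier (obj (sum_cochain J X) n)" for x
    using that by (auto simp: sum_cochain_def sum_module_simps PiE_iff add.commute intro!: restrict_ext)
qed

lemma prod_prj: "j \<in> J ==> chain_map R (prod_cochain J X) (X j) (\<lambda>n x. x j)"
  by (rule chain_mapI, rule rmod_homI) (auto simp: prod_cochain_def prod_module_simps PiE_iff)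

lemma sum_inc_chain: "j \<in> J ==> chain_map R (X j) (sum_cochain J X) (\<lambda>n. sum_inc J (\<lambda>j. obj (X j) n) j)"
  by (rule chain_mapI)
    (auto simp: sum_cochain_def sum_inc_hom sum_inc_def intro!: restrict_ext)

lemma prod_lift:
  assumes "is_complex R Y" "\<And>j. j \<in> J ==> chain_map R Y (X j) (f j)"
  shows "chain_map R Y (prod_cochain J X) (\<lambda>n y. \<lambda>j\<in>J. f j n y)"
proof (rule chain_mapI)
  have f: "cmor R Y (X j) (f j)" if "j \<in> J" for j
    using that assms X by (intro cmorI) (auto simp: cplx_def)
  note [simp] = cmor.closed[OF f] cmor.add[OF f] cmor.smult[OF f] cmor.comm[OF f]
  show "(\<lambda>y. \<lambda>j\<in>J. f j n y) \<in> rmod_hom R (obj Y n) (obj (prod_cochain J X) n)" for n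
    by (rule rmod_homI) (auto simp: prod_cochain_def prod_module_simps intro!: restrict_ext)
  show "(\<lambda>j\<in>J. f j (n + 1) (dif Y n x)) = dif (prod_cochain J X) n (\<lambda>j\<in>J. f j n x)"
    if "x \<in> el Y n" for n x
    using that by (auto simp: prod_cochain_def intro!: restrict_ext)
qed

lemma prod_homotopic:
  assumes Y: "is_complex R Y" and h: "chain_map R Y (prod_cochain J X) h"
    and g: "chain_map R Y (prod_cochain J X) g"
    and "\<And>j. j \<in> J ==> homotopic R Y (X j) ((\<lambda>n x. x j) ** g) ((\<lambda>n x. x j) ** h)"
  shows "homotopic R Y (prod_cochain J X) g h"
proof -
  interpret g: cmor R Y "prod_cochain J X" g using Y g prod_complex by (simp add: cmorI)
  interpret h: cmor R Y "prod_cochain J X" h using Y h prod_complex by (simp add: cmorI)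
  have "\<forall>j\<in>J. \<exists>s. \<forall>n. s n \<in> rmod_hom R (obj Y n) (obj (X j) (n - 1)) \<and>
     (\<forall>x\<in>el Y n. g n x j = h n x j \<oplus>[obj (X j) n]
        (dif (X j) (n - 1) (s n x) \<oplus>[obj (X j) n] s (n + 1) (dif Y n x)))"
    using assms(4) unfolding homotopic_def cmap_comp_def comp_def by blast
  then obtain s where s: "\<And>j n. j \<in> J ==> s j n \<in> rmod_hom R (obj Y n) (obj (X j) (n - 1))"
    "\<And>j n x. j \<in> J ==> x \<in> el Y n ==> g n x j = h n x j \<oplus>[obj (X j) n]
        (dif (X j) (n - 1) (s j n x) \<oplus>[obj (X j) n] s j (n + 1) (dif Y n x))"
    by metis
  show ?thesis
  proof (rule homotopicI)
    show "(\<lambda>x. \<lambda>j\<in>J. s j n x) \<in> rmod_hom R (obj Y n) (obj (prod_cochain J X) (n - 1))" for n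
      using s(1)[of _ n]
      by (intro rmod_homI) (auto simp: prod_cochain_def prod_module_simps rmod_hom_def Pi_iff intro!: restrict_ext)
    fix n x assume x: "x \<in> el Y n"
    have "g n x \<in> carrier (obj (prod_cochain J X) n)"
      using x by simp
    then have "g n x = (\<lambda>j\<in>J. g n x j)"
      by (auto simp: prod_cochain_def prod_module_simps PiE_iff extensional_restrict)
    also have "\<dots> = (\<lambda>j\<in>J. h n x j \<oplus>[obj (X j) n]
        (dif (X j) (n - 1) (s j n x) \<oplus>[obj (X j) n] s j (n + 1) (dif Y n x)))"
      using s(2) x by (intro restrict_ext) blast
    finally show "g n x = h n x \<oplus>[obj (prod_cochain J X) n]
        (dif (prod_cochain J X) (n - 1) (\<lambda>j\<in>J. s j n x) \<oplus>[obj (prod_cochain J X) n]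
          (\<lambda>j\<in>J. s j (n + 1) (dif Y n x)))"
      by (simp add: prod_cochain_def prod_module_simps cong: restrict_cong)
  qed
qed

lemma sum_lift:
  assumes Y: "is_complex R Y" and f: "\<And>j. j \<in> J ==> chain_map R (X j) Y (f j)"
  obtains g where "chain_map R (sum_cochain J X) Y g"
    "\<And>j n x. j \<in> J ==> x \<in> carrier (obj (X j) n) ==> g n (sum_inc J (\<lambda>j. obj (X j) n) j x) = f j n x"
proof -
  interpret Y: cplx R Y using Y by (simp add: cplx_def)
  interpret S: cplx R "sum_cochain J X" by (simp add: cplx_def sum_complex)
  have f': "cmor R (X j) Y (f j)" if "j \<in> J" for j
    using that f Y X by (intro cmorI) (auto simp: cplx_def)
  have "\<exists>g. g \<in> rmod_hom R (sum_module J (\<lambda>j. obj (X j) n)) (obj Y n) \<and>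
      (\<forall>j\<in>J. \<forall>x\<in>carrier (obj (X j) n). g (sum_inc J (\<lambda>j. obj (X j) n) j x) = f j n x)" for n
    by (rule sum_hom_exists[OF cmor.hom[OF f'] Y.rmod_axioms]) auto
  then obtain g where g: "\<And>n. g n \<in> rmod_hom R (sum_module J (\<lambda>j. obj (X j) n)) (obj Y n)"
      "\<And>j n x. j \<in> J ==> x \<in> carrier (obj (X j) n) ==> g n (sum_inc J (\<lambda>j. obj (X j) n) j x) = f j n x"
    by metis
  have "chain_map R (sum_cochain J X) Y g"
  proof (rule chain_mapI)
    show "g n \<in> rmod_hom R (obj (sum_cochain J X) n) (obj Y n)" for n
      using g(1) by (simp add: sum_cochain_def)
    fix n x assume x: "x \<in> carrier (obj (sum_cochain J X) n)"
    have 1: "(\<lambda>x. g (n + 1) (dif (sum_cochain J X) n x)) \<in> rmod_hom R (sum_module J (\<lambda>j. obj (X j) n)) (obj Y (n + 1))"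
      using rmod_hom_comp[OF S.dif_hom[OF refl, of n]] g(1)[of "n + 1"] by (simp add: sum_cochain_def)
    have 2: "(\<lambda>x. dif Y n (g n x)) \<in> rmod_hom R (sum_module J (\<lambda>j. obj (X j) n)) (obj Y (n + 1))"
      by (rule rmod_hom_comp[OF g(1) Y.dif_hom[OF refl]])
    show "g (n + 1) (dif (sum_cochain J X) n x) = dif Y n (g n x)"
    proof (rule sum_hom_unique[OF 1 2 Y.rmod_axioms])
      fix j y assume j: "j \<in> J" and y: "y \<in> carrier (obj (X j) n)"
      have "dif (sum_cochain J X) n (sum_inc J (\<lambda>j. obj (X j) n) j y) =
          sum_inc J (\<lambda>j. obj (X j) (n + 1)) j (dif (X j) n y)"
        using sum_inc_chain[OF j] y unfolding chain_map_def by simp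
      then show "g (n + 1) (dif (sum_cochain J X) n (sum_inc J (\<lambda>j. obj (X j) n) j y)) =
          dif Y n (g n (sum_inc J (\<lambda>j. obj (X j) n) j y))"
        using j y g(2) cmor.comm[OF f'] by simp
    qed (use x in \<open>simp add: sum_cochain_def\<close>)
  qed
  then show thesis
    using that g(2) by blast
qed

lemma sum_homotopic:
  assumes Y: "is_complex R Y" and h: "chain_map R (sum_cochain J X) Y h"
    and g: "chain_map R (sum_cochain J X) Y g"
    and "\<And>j. j \<in> J ==> homotopic R (X j) Y (g ** (\<lambda>n. sum_inc J (\<lambda>j. obj (X j) n) j))
      (h ** (\<lambda>n. sum_inc J (\<lambda>j. obj (X j) n) j))"
  shows "homotopic R (sum_cochain J X) Y g h"
proof -
  let ?i = "\<lambda>n. sum_inc J (\<lambda>j. obj (X j) n)"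
  interpret g: cmor R "sum_cochain J X" Y g using Y g sum_complex by (simp add: cmorI)
  interpret h: cmor R "sum_cochain J X" Y h using Y h sum_complex by (simp add: cmorI)
  have "\<forall>j\<in>J. \<exists>s. \<forall>n. s n \<in> rmod_hom R (obj (X j) n) (obj Y (n - 1)) \<and>
     (\<forall>x\<in>carrier (obj (X j) n). g n (?i n j x) = h n (?i n j x) \<oplus>[obj Y n]
        (dif Y (n - 1) (s n x) \<oplus>[obj Y n] s (n + 1) (dif (X j) n x)))"
    using assms(4) unfolding homotopic_def cmap_comp_def comp_def by blast
  then obtain s where s: "\<And>j n. j \<in> J ==> s j n \<in> rmod_hom R (obj (X j) n) (obj Y (n - 1))"
    "\<And>j n x. j \<in> J ==> x \<in> carrier (obj (X j) n) ==> g n (?i n j x) = h n (?i n j x) \<oplus>[obj Y n]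
        (dif Y (n - 1) (s j n x) \<oplus>[obj Y n] s j (n + 1) (dif (X j) n x))"
    by metis
  have "\<exists>t. t \<in> rmod_hom R (sum_module J (\<lambda>j. obj (X j) n)) (obj Y (n - 1)) \<and>
      (\<forall>j\<in>J. \<forall>x\<in>carrier (obj (X j) n). t (?i n j x) = s j n x)" for n
    by (rule sum_hom_exists[OF s(1) g.Y.rmod_axioms]) auto
  then obtain t where t: "\<And>n. t n \<in> rmod_hom R (sum_module J (\<lambda>j. obj (X j) n)) (obj Y (n - 1))"
      "\<And>j n x. j \<in> J ==> x \<in> carrier (obj (X j) n) ==> t n (?i n j x) = s j n x"
    by metis
  show ?thesis
  proof (rule homotopicI)
    show "t n \<in> rmod_hom R (obj (sum_cochain J X) n) (obj Y (n - 1))" for n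
      using t(1) by (simp add: sum_cochain_def)
    fix n x assume x: "x \<in> carrier (obj (sum_cochain J X) n)"
    have S: "rmod R (sum_module J (\<lambda>j. obj (X j) n))"
      by (rule rmod_sum)
    have 1: "g n \<in> rmod_hom R (sum_module J (\<lambda>j. obj (X j) n)) (obj Y n)"
      using g.hom[of n] by (simp add: sum_cochain_def)
    have 2: "h n \<in> rmod_hom R (sum_module J (\<lambda>j. obj (X j) n)) (obj Y n)"
      using h.hom[of n] by (simp add: sum_cochain_def)
    have 3: "(\<lambda>x. dif Y (n - 1) (t n x)) \<in> rmod_hom R (sum_module J (\<lambda>j. obj (X j) n)) (obj Y n)"
      by (rule rmod_hom_comp[OF t(1) g.Y.dif_hom]) simp
    have 4: "(\<lambda>x. t (n + 1) (dif (sum_cochain J X) n x)) \<in> rmod_hom R (sum_module J (\<lambda>j. obj (X j) n)) (obj Y n)"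
      using rmod_hom_comp[OF g.X.dif_hom[OF refl, of n]] t(1)[of "n + 1"] by (simp add: sum_cochain_def)
    note Y' = g.Y.rmod_axioms
    show "g n x = h n x \<oplus>[obj Y n] (dif Y (n - 1) (t n x) \<oplus>[obj Y n] t (n + 1) (dif (sum_cochain J X) n x))"
    proof (rule sum_hom_unique[OF 1 rmod_hom_add[OF S Y' 2 rmod_hom_add[OF S Y' 3 4]] Y'])
      fix j y assume j: "j \<in> J" and y: "y \<in> carrier (obj (X j) n)"
      have "dif (sum_cochain J X) n (?i n j y) = ?i (n + 1) j (dif (X j) n y)"
        using sum_inc_chain[OF j] y unfolding chain_map_def by simp
      then show "g n (?i n j y) = h n (?i n j y) \<oplus>[obj Y n]
          (dif Y (n - 1) (t n (?i n j y)) \<oplus>[obj Y n] t (n + 1) (dif (sum_cochain J X) n (?i n j y)))"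
        using s(2)[OF j y] j y t(2) by simp
    qed (use x in \<open>simp add: sum_cochain_def\<close>)
  qed
qed

end

locale quasi_iso_family = source: cochain_family R J X + target: cochain_family R J Y
  for R :: "('r, 'c) ring_scheme" and J :: "'i set" and X :: "'i => ('r, 'm) cochain"
    and Y :: "'i => ('r, 'n) cochain" +
  fixes s
  assumes s: "j \<in> J ==> quasi_iso R (X j) (Y j) (s j)"
begin

definition "S = (\<lambda>n x. \<lambda>j\<in>J. s j n (x j))"

lemma cmor: "j \<in> J ==> cmor R (X j) (Y j) (s j)"
  using quasi_isoD(1)[OF s] source.X target.X by (intro cmorI) (auto simp: cplx_def)

lemmas s_simps [simp] = cmor.closed[OF cmor] cmor.add[OF cmor] cmor.smult[OF cmor] cmor.zero[OF cmor]
  cmor.comm[OF cmor]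

lemma s_hinj: "j \<in> J ==> hinj (X j) (Y j) (s j)"
  using quasi_isoD(2)[OF s] source.X target.X by (simp add: cplx_def)

lemma s_hsurj: "j \<in> J ==> hsurj (X j) (Y j) (s j)"
  using quasi_isoD(3)[OF s] source.X target.X by (simp add: cplx_def)

lemma prod_quasi_iso: "quasi_iso R (prod_cochain J X) (prod_cochain J Y) S"
proof (rule quasi_isoI[OF source.prod_complex target.prod_complex])
  show "chain_map R (prod_cochain J X) (prod_cochain J Y) S"
    unfolding S_def
    by (rule chain_mapI, rule rmod_homI)
      (auto simp: prod_cochain_def prod_module_simps PiE_iff intro!: restrict_ext)
  interpret PX: cplx R "prod_cochain J X" by (simp add: cplx_def source.prod_complex)
  interpret PY: cplx R "prod_cochain J Y" by (simp add: cplx_def target.prod_complex)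
  show "hinj (prod_cochain J X) (prod_cochain J Y) S"
    unfolding hinj_def
  proof (intro allI ballI impI)
    fix n x assume x: "x \<in> cocycles (prod_cochain J X) n" "S n x \<in> coboundaries (prod_cochain J Y) n"
    have x': "x \<in> PiE J (\<lambda>j. carrier (obj (X j) n))" "(\<lambda>j\<in>J. dif (X j) n (x j)) = (\<lambda>j\<in>J. \<zero>[obj (X j) (n + 1)])"
      using x(1) by (auto simp: cocycles_def prod_cochain_def prod_module_simps)
    obtain y where y: "y \<in> carrier (obj (prod_cochain J Y) (n - 1))" "S n x = dif (prod_cochain J Y) (n - 1) y"
      by (rule PY.coboundariesE[OF x(2)])
    have "\<exists>w\<in>carrier (obj (X j) (n - 1)). x j = dif (X j) (n - 1) w" if j: "j \<in> J" for j
    proof -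
      interpret Xj: cplx R "X j" by (rule source.X[OF j])
      interpret Yj: cplx R "Y j" by (rule target.X[OF j])
      have "x j \<in> cocycles (X j) n"
        using x'(1) fun_cong[OF x'(2), of j] j by (auto simp: cocycles_def)
      moreover have "s j n (x j) = dif (Y j) (n - 1) (y j)"
        using fun_cong[OF y(2), of j] j by (simp add: S_def prod_cochain_def)
      moreover have "y j \<in> carrier (obj (Y j) (n - 1))"
        using y(1) j by (auto simp: prod_cochain_def prod_module_simps)
      ultimately have "x j \<in> coboundaries (X j) n"
        using hinjD[OF s_hinj[OF j]] Yj.coboundariesI[of "y j" "n - 1" n] by simp
      then show ?thesis
        by (auto elim: Xj.coboundariesE)
    qed
    then obtain w where w: "\<And>j. j \<in> J ==> w j \<in> carrier (obj (X j) (n - 1))"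
        "\<And>j. j \<in> J ==> x j = dif (X j) (n - 1) (w j)"
      by metis
    have "x = dif (prod_cochain J X) (n - 1) (\<lambda>j\<in>J. w j)"
      using x'(1) w by (intro extensionalityI[of _ J]) (auto simp: prod_cochain_def PiE_iff)
    moreover have "dif (prod_cochain J X) (n - 1) (\<lambda>j\<in>J. w j) \<in> coboundaries (prod_cochain J X) n"
      using w(1) by (intro PX.coboundariesI) (auto simp: prod_cochain_def prod_module_simps)
    ultimately show "x \<in> coboundaries (prod_cochain J X) n"
      by simp
  qed
  show "hsurj (prod_cochain J X) (prod_cochain J Y) S"
    unfolding hsurj_def
  proof (intro allI ballI)
    fix n y assume y: "y \<in> cocycles (prod_cochain J Y) n"
    have y': "y \<in> PiE J (\<lambda>j. carrier (obj (Y j) n))" "(\<lambda>j\<in>J. dif (Y j) n (y j)) = (\<lambda>j\<in>J. \<zero>[obj (Y j) (n + 1)])"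
      using y by (auto simp: cocycles_def prod_cochain_def prod_module_simps)
    have "\<exists>x b. x \<in> cocycles (X j) n \<and> b \<in> carrier (obj (Y j) (n - 1)) \<and>
        y j = s j n x \<oplus>[obj (Y j) n] dif (Y j) (n - 1) b" if j: "j \<in> J" for j
    proof -
      interpret Yj: cplx R "Y j" by (rule target.X[OF j])
      have "y j \<in> cocycles (Y j) n"
        using y'(1) fun_cong[OF y'(2), of j] j by (auto simp: cocycles_def)
      from hsurjE[OF s_hsurj[OF j] this] show ?thesis
        by (metis Yj.coboundariesE)
    qed
    then obtain x b where xb: "\<And>j. j \<in> J ==> x j \<in> cocycles (X j) n"
        "\<And>j. j \<in> J ==> b j \<in> carrier (obj (Y j) (n - 1))"
        "\<And>j. j \<in> J ==> y j = s j n (x j) \<oplus>[obj (Y j) n] dif (Y j) (n - 1) (b j)"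
      by metis
    show "\<exists>x\<in>cocycles (prod_cochain J X) n. \<exists>b\<in>coboundaries (prod_cochain J Y) n.
        y = S n x \<oplus>[obj (prod_cochain J Y) n] b"
    proof (intro bexI)
      show "(\<lambda>j\<in>J. x j) \<in> cocycles (prod_cochain J X) n"
        using xb(1) by (auto simp: cocycles_def prod_cochain_def prod_module_simps intro!: restrict_ext)
      show "dif (prod_cochain J Y) (n - 1) (\<lambda>j\<in>J. b j) \<in> coboundaries (prod_cochain J Y) n"
        using xb(2) by (intro PY.coboundariesI) (auto simp: prod_cochain_def prod_module_simps)
      show "y = S n (\<lambda>j\<in>J. x j) \<oplus>[obj (prod_cochain J Y) n] dif (prod_cochain J Y) (n - 1) (\<lambda>j\<in>J. b j)"
        using y'(1) xb(3) by (intro extensionalityI[of _ J])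
          (auto simp: S_def prod_cochain_def prod_module_simps PiE_iff)
    qed
  qed
qed

lemma sum_quasi_iso: "quasi_iso R (sum_cochain J X) (sum_cochain J Y) S"
proof (rule quasi_isoI[OF source.sum_complex target.sum_complex])
  show "chain_map R (sum_cochain J X) (sum_cochain J Y) S"
  proof (rule chain_mapI, rule rmod_homI)
    show "S n x \<in> carrier (obj (sum_cochain J Y) n)" if "x \<in> carrier (obj (sum_cochain J X) n)" for n x
      using that source.sum_closed_map[of x n "\<lambda>j. s j n" "\<lambda>j. obj (Y j) n"]
      by (auto simp: sum_cochain_def S_def sum_module_simps(1)[of J "\<lambda>j. obj (X j) n"] PiE_iff)
  qed (auto simp: S_def sum_cochain_def sum_module_simps PiE_iff intro!: restrict_ext)
  interpret PX: cplx R "sum_cochain J X" by (simp add: cplx_def source.sum_complex)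
  interpret PY: cplx R "sum_cochain J Y" by (simp add: cplx_def target.sum_complex)
  show "hinj (sum_cochain J X) (sum_cochain J Y) S"
    unfolding hinj_def
  proof (intro allI ballI impI)
    fix n x assume x: "x \<in> cocycles (sum_cochain J X) n" "S n x \<in> coboundaries (sum_cochain J Y) n"
    have x': "x \<in> PiE J (\<lambda>j. carrier (obj (X j) n))" "(\<lambda>j\<in>J. dif (X j) n (x j)) = (\<lambda>j\<in>J. \<zero>[obj (X j) (n + 1)])"
        "x \<in> carrier (sum_module J (\<lambda>j. obj (X j) n))"
      using x(1) by (auto simp: cocycles_def sum_cochain_def sum_module_simps)
    obtain y where y: "y \<in> carrier (obj (sum_cochain J Y) (n - 1))" "S n x = dif (sum_cochain J Y) (n - 1) y"
      by (rule PY.coboundariesE[OF x(2)])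
    have "\<exists>w. w \<in> carrier (obj (X j) (n - 1)) \<and> x j = dif (X j) (n - 1) w \<and>
        (x j = \<zero>[obj (X j) n] \<longrightarrow> w = \<zero>[obj (X j) (n - 1)])" if j: "j \<in> J" for j
    proof (cases "x j = \<zero>[obj (X j) n]")
      case True
      interpret Xj: cplx R "X j" by (rule source.X[OF j])
      show ?thesis
        using True Xj.dif_zero[of "n - 1"] by (intro exI[of _ "\<zero>[obj (X j) (n - 1)]"]) simp
    next
      case False
      interpret Xj: cplx R "X j" by (rule source.X[OF j])
      interpret Yj: cplx R "Y j" by (rule target.X[OF j])
      have "x j \<in> cocycles (X j) n"
        using x'(1) fun_cong[OF x'(2), of j] j by (auto simp: cocycles_def)
      moreover have "s j n (x j) = dif (Y j) (n - 1) (y j)"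
        using fun_cong[OF y(2), of j] j by (simp add: S_def sum_cochain_def)
      moreover have "y j \<in> carrier (obj (Y j) (n - 1))"
        using y(1) j by (auto simp: sum_cochain_def sum_module_simps)
      ultimately have "x j \<in> coboundaries (X j) n"
        using hinjD[OF s_hinj[OF j]] Yj.coboundariesI[of "y j" "n - 1" n] by simp
      then show ?thesis
        using False by (auto elim: Xj.coboundariesE)
    qed
    then obtain w where w: "\<And>j. j \<in> J ==> w j \<in> carrier (obj (X j) (n - 1))"
        "\<And>j. j \<in> J ==> x j = dif (X j) (n - 1) (w j)"
        "\<And>j. j \<in> J ==> x j = \<zero>[obj (X j) n] ==> w j = \<zero>[obj (X j) (n - 1)]"
      by metis
    have "(\<lambda>j\<in>J. (if x j = \<zero>[obj (X j) n] then \<zero>[obj (X j) (n - 1)] else w j))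
        \<in> carrier (sum_module J (\<lambda>j. obj (X j) (n - 1)))"
      by (rule source.sum_closed_map[OF x'(3),
            where h = "\<lambda>j y. if y = \<zero>[obj (X j) n] then \<zero>[obj (X j) (n - 1)] else w j"]) (use w in auto)
    also have "(\<lambda>j\<in>J. (if x j = \<zero>[obj (X j) n] then \<zero>[obj (X j) (n - 1)] else w j)) = (\<lambda>j\<in>J. w j)"
      using w(3) by (intro restrict_ext) auto
    finally have "(\<lambda>j\<in>J. w j) \<in> carrier (sum_module J (\<lambda>j. obj (X j) (n - 1)))" .
    then have "(\<lambda>j\<in>J. w j) \<in> carrier (obj (sum_cochain J X) (n - 1))"
      by (simp only: sum_cochain_def cochain.simps)
    then have "dif (sum_cochain J X) (n - 1) (\<lambda>j\<in>J. w j) \<in> coboundaries (sum_cochain J X) n"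
      by (intro PX.coboundariesI) auto
    moreover have "x = dif (sum_cochain J X) (n - 1) (\<lambda>j\<in>J. w j)"
      using x'(1) w(2) by (intro extensionalityI[of _ J]) (auto simp: sum_cochain_def PiE_iff)
    ultimately show "x \<in> coboundaries (sum_cochain J X) n"
      by simp
  qed
  show "hsurj (sum_cochain J X) (sum_cochain J Y) S"
    unfolding hsurj_def
  proof (intro allI ballI)
    fix n y assume y: "y \<in> cocycles (sum_cochain J Y) n"
    have y': "y \<in> PiE J (\<lambda>j. carrier (obj (Y j) n))" "(\<lambda>j\<in>J. dif (Y j) n (y j)) = (\<lambda>j\<in>J. \<zero>[obj (Y j) (n + 1)])"
        "y \<in> carrier (sum_module J (\<lambda>j. obj (Y j) n))"
      using y by (auto simp: cocycles_def sum_cochain_def sum_module_simps)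
    have "\<exists>x b. x \<in> cocycles (X j) n \<and> b \<in> carrier (obj (Y j) (n - 1)) \<and>
        y j = s j n x \<oplus>[obj (Y j) n] dif (Y j) (n - 1) b \<and>
        (y j = \<zero>[obj (Y j) n] \<longrightarrow> x = \<zero>[obj (X j) n] \<and> b = \<zero>[obj (Y j) (n - 1)])" if j: "j \<in> J" for j
    proof (cases "y j = \<zero>[obj (Y j) n]")
      case True
      interpret f: cmor R "X j" "Y j" "s j" by (rule cmor[OF j])
      show ?thesis
        using True f.Y.dif_zero[of "n - 1"]
        by (intro exI[of _ "\<zero>[obj (X j) n]"] exI[of _ "\<zero>[obj (Y j) (n - 1)]"]) (simp add: cocycles_def)
    next
      case False
      interpret Yj: cplx R "Y j" by (rule target.X[OF j])
      have "y j \<in> cocycles (Y j) n"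
        using y'(1) fun_cong[OF y'(2), of j] j by (auto simp: cocycles_def)
      from hsurjE[OF s_hsurj[OF j] this] show ?thesis
        using False by (metis Yj.coboundariesE)
    qed
    then have "\<forall>j\<in>J. \<exists>x. \<exists>b. x \<in> cocycles (X j) n \<and> b \<in> carrier (obj (Y j) (n - 1)) \<and>
        y j = s j n x \<oplus>[obj (Y j) n] dif (Y j) (n - 1) b \<and>
        (y j = \<zero>[obj (Y j) n] \<longrightarrow> x = \<zero>[obj (X j) n] \<and> b = \<zero>[obj (Y j) (n - 1)])"
      by blast
    from bchoice[OF this] obtain x where "\<forall>j\<in>J. \<exists>b. x j \<in> cocycles (X j) n \<and> b \<in> carrier (obj (Y j) (n - 1)) \<and>
        y j = s j n (x j) \<oplus>[obj (Y j) n] dif (Y j) (n - 1) b \<and>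
        (y j = \<zero>[obj (Y j) n] \<longrightarrow> x j = \<zero>[obj (X j) n] \<and> b = \<zero>[obj (Y j) (n - 1)])" ..
    from bchoice[OF this] obtain b where xb: "\<And>j. j \<in> J ==> x j \<in> cocycles (X j) n"
        "\<And>j. j \<in> J ==> b j \<in> carrier (obj (Y j) (n - 1))"
        "\<And>j. j \<in> J ==> y j = s j n (x j) \<oplus>[obj (Y j) n] dif (Y j) (n - 1) (b j)"
        "\<And>j. j \<in> J ==> y j = \<zero>[obj (Y j) n] ==> x j = \<zero>[obj (X j) n]"
        "\<And>j. j \<in> J ==> y j = \<zero>[obj (Y j) n] ==> b j = \<zero>[obj (Y j) (n - 1)]"
      by blast
    have xc: "j \<in> J ==> x j \<in> carrier (obj (X j) n)" for j
      using xb(1) by (auto simp: cocycles_def)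
    have "(\<lambda>j\<in>J. (if y j = \<zero>[obj (Y j) n] then \<zero>[obj (X j) n] else x j)) \<in> carrier (sum_module J (\<lambda>j. obj (X j) n))"
      by (rule target.sum_closed_map[OF y'(3),
            where h = "\<lambda>j v. if v = \<zero>[obj (Y j) n] then \<zero>[obj (X j) n] else x j"]) (use xc in auto)
    also have "(\<lambda>j\<in>J. (if y j = \<zero>[obj (Y j) n] then \<zero>[obj (X j) n] else x j)) = (\<lambda>j\<in>J. x j)"
      using xb(4) by (intro restrict_ext) auto
    finally have x: "(\<lambda>j\<in>J. x j) \<in> carrier (sum_module J (\<lambda>j. obj (X j) n))" .
    have "(\<lambda>j\<in>J. (if y j = \<zero>[obj (Y j) n] then \<zero>[obj (Y j) (n - 1)] else b j))
        \<in> carrier (sum_module J (\<lambda>j. obj (Y j) (n - 1)))"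
      by (rule target.sum_closed_map[OF y'(3),
            where h = "\<lambda>j v. if v = \<zero>[obj (Y j) n] then \<zero>[obj (Y j) (n - 1)] else b j"]) (use xb(2) in auto)
    also have "(\<lambda>j\<in>J. (if y j = \<zero>[obj (Y j) n] then \<zero>[obj (Y j) (n - 1)] else b j)) = (\<lambda>j\<in>J. b j)"
      using xb(5) by (intro restrict_ext) auto
    finally have b: "(\<lambda>j\<in>J. b j) \<in> carrier (sum_module J (\<lambda>j. obj (Y j) (n - 1)))" .
    then have b': "(\<lambda>j\<in>J. b j) \<in> carrier (obj (sum_cochain J Y) (n - 1))"
      by (simp only: sum_cochain_def cochain.simps)
    show "\<exists>x\<in>cocycles (sum_cochain J X) n. \<exists>b\<in>coboundaries (sum_cochain J Y) n.
        y = S n x \<oplus>[obj (sum_cochain J Y) n] b"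
    proof (intro bexI)
      have "(\<lambda>j\<in>J. dif (X j) n ((\<lambda>j\<in>J. x j) j)) = (\<lambda>j\<in>J. \<zero>[obj (X j) (n + 1)])"
        using xb(1) by (intro restrict_ext) (auto simp: cocycles_def)
      then show "(\<lambda>j\<in>J. x j) \<in> cocycles (sum_cochain J X) n"
        using x by (simp add: cocycles_def sum_cochain_def sum_module_simps(2))
      show "dif (sum_cochain J Y) (n - 1) (\<lambda>j\<in>J. b j) \<in> coboundaries (sum_cochain J Y) n"
        by (rule PY.coboundariesI[OF b']) simp
      show "y = S n (\<lambda>j\<in>J. x j) \<oplus>[obj (sum_cochain J Y) n] dif (sum_cochain J Y) (n - 1) (\<lambda>j\<in>J. b j)"
        using y'(1) xb(3) by (intro extensionalityI[of _ J])
          (auto simp: S_def sum_cochain_def sum_module_simps PiE_iff)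
    qed
  qed
qed

end

definition coproduct_cochain :: "'u set set => 'i set => ('i => ('r, 'u) cochain) => ('r, 'u) cochain" where
  "coproduct_cochain Car J X = copy_cochain Car (sum_cochain J X)"

definition coproduct_inc :: "'u set set => 'i set => ('i => ('r, 'u) cochain) => 'i => ('u, 'u) cmap" where
  "coproduct_inc Car J X j = (\<lambda>n. to_copy Car (obj (sum_cochain J X) n)) **
     (\<lambda>n. sum_inc J (\<lambda>j. obj (X j) n) j)"

definition product_cochain :: "'u set set => 'i set => ('i => ('r, 'u) cochain) => ('r, 'u) cochain" where
  "product_cochain Car J X = copy_cochain Car (prod_cochain J X)"

definition product_prj :: "'u set set => 'i set => ('i => ('r, 'u) cochain) => 'i => ('u, 'u) cmap" where
  "product_prj Car J X j = (\<lambda>n x. x j) ** (\<lambda>n. from_copy Car (obj (prod_cochain J X) n))"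

locale derived_universe = universe Idx Car R + cochain_calculus Car R
  for Idx :: "'i set set" and Car :: "'u set set" and R :: "('r, 'c) ring_scheme" +
  assumes ring_R: "ring R"
begin

lemma obj_small: "X \<in> complexes Car R ==> small Car (el X n)"
  unfolding complexes_def using small_mem by blast

lemma copy_maps:
  fixes W :: "('r, 'm) cochain"
  assumes W: "is_complex R W" "\<And>n. small Car (el W n)"
  shows "copy_cochain Car W \<in> complexes Car R" "is_complex R (copy_cochain Car W)"
    "quasi_iso R W (copy_cochain Car W) (\<lambda>n. to_copy Car (obj W n))"
    "quasi_iso R (copy_cochain Car W) W (\<lambda>n. from_copy Car (obj W n))"
proof -
  show C: "copy_cochain Car W \<in> complexes Car R"
    by (rule copy_complex[OF W])
  then show C': "is_complex R (copy_cochain Car W)"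
    by (rule complexesD)
  show "quasi_iso R W (copy_cochain Car W) (\<lambda>n. to_copy Car (obj W n))"
    by (rule hinj_iso[OF W(1) C' to_copy_chain[OF W] from_copy_chain[OF W] from_to_copy[OF W] to_from_copy[OF W]])
  show "quasi_iso R (copy_cochain Car W) W (\<lambda>n. from_copy Car (obj W n))"
    by (rule hinj_iso[OF C' W(1) from_copy_chain[OF W] to_copy_chain[OF W] to_from_copy[OF W] from_to_copy[OF W]])
qed

lemma quasi_iso_comp:
  assumes "is_complex R X" "is_complex R Y" "is_complex R Z" "quasi_iso R X Y f" "quasi_iso R Y Z g"
  shows "quasi_iso R X Z (g ** f)"
proof -
  note f = quasi_isoD[OF assms(4,1,2)] and g = quasi_isoD[OF assms(5,2,3)]
  show ?thesis
    by (rule quasi_isoI[OF assms(1,3) chain_map_comp[OF f(1) g(1)]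
          hinj_comp[OF assms(1-3) f(1) g(1) f(2) g(2)] hsurj_comp[OF assms(1-3) f(1) g(1) f(3) g(3)]])
qed

sublocale homotopy_pullbacks Car R
proof
  fix Z Y Z' :: "('r, 'u) cochain" and f t
  assume f: "hom Z Y f" and t: "we Z' Y t"
  have ob: "Z \<in> complexes Car R" "Y \<in> complexes Car R" "Z' \<in> complexes Car R"
    using f t hom_ob we_hom by blast+
  interpret H: hpull_data R Z Z' Y f t
    using f we_hom[OF t] ob complexesD cmorI unfolding hpull_data_def hom_def by blast
  let ?W = "hpull Z Z' Y f t"
  have W: "is_complex R ?W" "small Car (carrier (obj ?W n))" for n
    using H.hpull_complex obj_small ob by (auto simp: hpull_def intro!: small_Times)
  let ?C = "copy_cochain Car ?W" and ?a = "\<lambda>n. to_copy Car (obj ?W n)" and ?b = "\<lambda>n. from_copy Car (obj ?W n)"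
  note C = copy_maps[OF W]
  let ?p = "(\<lambda>n. fst) ** ?b" and ?q = "(\<lambda>n x. fst (snd x)) ** ?b"
  have b: "chain_map R ?C ?W ?b" and a: "chain_map R ?W ?C ?a"
    using C unfolding quasi_iso_def by auto
  have p: "we ?C Z ?p"
    unfolding we_def
    using C(1) ob quasi_iso_comp[OF C(2) W(1) complexesD[OF ob(1)] C(4) H.hpull_quasi_iso] t
    unfolding we_def by blast
  have q: "hom ?C Z' ?q"
    unfolding hom_def using C(1) ob chain_map_comp[OF b H.hpull_snd] by blast
  have h: "ho ?C Y (f ** ?p) (t ** ?q)"
    unfolding ho_def
    using hom_comp[OF f we_hom[OF p]] hom_comp[OF we_hom[OF t] q]
      homotopic_comp_right[OF H.hpull_homotopic C(2) W(1) complexesD[OF ob(2)] b]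
    by (simp add: cmap_comp_assoc)
  have "\<exists>e. hom X ?C e \<and> ho X Z (?p ** e) u \<and> ho X Z' (?q ** e) v"
    if uv: "hom X Z u" "hom X Z' v" "ho X Y (f ** u) (t ** v)" for X u v
  proof -
    have X: "X \<in> complexes Car R"
      using uv hom_ob by blast
    obtain e where e: "chain_map R X ?W e" "(\<lambda>n. fst) ** e = u" "(\<lambda>n x. fst (snd x)) ** e = v"
      using H.hpull_universal[OF complexesD[OF X]] uv unfolding hom_def ho_def by blast
    have ae: "hom X ?C (?a ** e)"
      unfolding hom_def using X C(1) chain_map_comp[OF e(1) a] by blast
    have ba: "?b n (?a n (e n x)) = e n x" if "x \<in> el X n" for n x
    proof -
      interpret e: cmor R X ?W e using X W(1) e(1) complexesD by (simp add: cmorI)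
      show ?thesis
        by (rule from_to_copy[OF W]) (use that in auto)
    qed
    have "ho X Z (?p ** (?a ** e)) u"
      unfolding ho_def
      using hom_comp[OF we_hom[OF p] ae] uv(1)
        homotopic_eqI[OF complexesD[OF X], of Z u "?p ** (?a ** e)"] complexesD[OF ob(1)] ba e(2)
      by (auto simp: hom_def cmap_comp_def fun_eq_iff)
    moreover have "ho X Z' (?q ** (?a ** e)) v"
      unfolding ho_def
      using hom_comp[OF q ae] uv(2)
        homotopic_eqI[OF complexesD[OF X], of Z' v "?q ** (?a ** e)"] complexesD[OF ob(3)] ba e(3)
      by (auto simp: hom_def cmap_comp_def fun_eq_iff)
    ultimately show ?thesis
      using ae by blast
  qed
  then show "\<exists>W p q. we W Z p \<and> hom W Z' q \<and> ho W Y (f ** p) (t ** q) \<and>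
      (\<forall>X u v. hom X Z u \<and> hom X Z' v \<and> ho X Y (f ** u) (t ** v) \<longrightarrow>
         (\<exists>e. hom X W e \<and> ho X Z (p ** e) u \<and> ho X Z' (q ** e) v))"
    using p q h by blast
qed

lemma family:
  assumes "\<forall>j\<in>J. X j \<in> complexes Car R"
  shows "cochain_family R J X"
  using assms ring_R complexesD by (simp add: cochain_family_def cplx_def)

lemma ho_eqI:
  assumes "hom X Y f" "hom X Y g" "\<And>n x. x \<in> el X n ==> f n x = g n x"
  shows "ho X Y f g"
  using assms homotopic_eqI complexesD unfolding ho_def hom_def by blast

lemma prod_small:
  assumes "J \<in> Idx" "\<forall>j\<in>J. X j \<in> complexes Car R"
  shows "small Car (carrier (obj (prod_cochain J X) n))"
proof -
  have "small Car (PiE J (\<lambda>j. carrier (obj (X j) n)))"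
    using assms obj_small by (intro small_PiE) auto
  then show ?thesis
    by (simp add: prod_cochain_def prod_module_simps)
qed

lemma sum_small:
  assumes "J \<in> Idx" "\<forall>j\<in>J. X j \<in> complexes Car R"
  shows "small Car (carrier (obj (sum_cochain J X) n))"
  by (rule small_subset[OF prod_small[OF assms]])
    (auto simp: prod_cochain_def sum_cochain_def prod_module_simps sum_module_simps)

context
  fixes J :: "'i set" and X :: "'i => ('r, 'u) cochain"
  assumes J: "J \<in> Idx" and X: "\<forall>j\<in>J. X j \<in> complexes Car R"
begin

interpretation F: cochain_family R J X by (rule family[OF X])

lemmas sum_copy = copy_maps[OF F.sum_complex sum_small[OF J X]]
lemmas prod_copy = copy_maps[OF F.prod_complex prod_small[OF J X]]
lemmas sum_copy_chain = quasi_isoD(1)[OF sum_copy(3) F.sum_complex sum_copy(2)]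
  quasi_isoD(1)[OF sum_copy(4) sum_copy(2) F.sum_complex]
lemmas prod_copy_chain = quasi_isoD(1)[OF prod_copy(3) F.prod_complex prod_copy(2)]
  quasi_isoD(1)[OF prod_copy(4) prod_copy(2) F.prod_complex]

lemma coproduct_ob: "coproduct_cochain Car J X \<in> complexes Car R"
  unfolding coproduct_cochain_def by (rule sum_copy(1))

lemma product_ob: "product_cochain Car J X \<in> complexes Car R"
  unfolding product_cochain_def by (rule prod_copy(1))

lemma coproduct_inc_hom: "j \<in> J ==> hom (X j) (coproduct_cochain Car J X) (coproduct_inc Car J X j)"
  unfolding hom_def coproduct_inc_def
  using X coproduct_ob chain_map_comp[OF F.sum_inc_chain sum_copy_chain(1)]
  by (simp add: coproduct_cochain_def)

lemma product_prj_hom: "j \<in> J ==> hom (product_cochain Car J X) (X j) (product_prj Car J X j)"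
  unfolding hom_def product_prj_def
  using X product_ob chain_map_comp[OF prod_copy_chain(2) F.prod_prj]
  by (simp add: product_cochain_def)

lemma sum_inc_mem:
  "j \<in> J ==> x \<in> carrier (obj (X j) n) ==>
    sum_inc J (\<lambda>j. obj (X j) n) j x \<in> carrier (obj (sum_cochain J X) n)"
  using F.sum_inc_closed by (simp add: sum_cochain_def)

lemmas sum_from_to = from_to_copy[OF F.sum_complex sum_small[OF J X]]
lemmas prod_from_to = from_to_copy[OF F.prod_complex prod_small[OF J X]]
lemmas sum_to_from = to_from_copy[OF F.sum_complex sum_small[OF J X]]
lemmas prod_to_from = to_from_copy[OF F.prod_complex prod_small[OF J X]]

lemma coproduct_lift:
  assumes f: "\<And>j. j \<in> J ==> hom (X j) Y (f j)" and Y: "Y \<in> complexes Car R"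
  shows "\<exists>g. hom (coproduct_cochain Car J X) Y g \<and> (\<forall>j\<in>J. ho (X j) Y (g ** coproduct_inc Car J X j) (f j))"
proof -
  have f': "\<And>j. j \<in> J ==> chain_map R (X j) Y (f j)"
    using f unfolding hom_def by blast
  obtain g where g: "chain_map R (sum_cochain J X) Y g"
    "\<And>j n x. j \<in> J ==> x \<in> carrier (obj (X j) n) ==> g n (sum_inc J (\<lambda>j. obj (X j) n) j x) = f j n x"
    using F.sum_lift[OF complexesD[OF Y] f'] by blast
  let ?g = "g ** (\<lambda>n. from_copy Car (obj (sum_cochain J X) n))"
  have hg: "hom (coproduct_cochain Car J X) Y ?g"
    unfolding hom_def using coproduct_ob Y chain_map_comp[OF sum_copy_chain(2) g(1)]
    by (simp add: coproduct_cochain_def)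
  moreover have "ho (X j) Y (?g ** coproduct_inc Car J X j) (f j)" if j: "j \<in> J" for j
    by (rule ho_eqI[OF hom_comp[OF hg coproduct_inc_hom[OF j]] f[OF j]])
      (simp add: cmap_comp_def coproduct_inc_def sum_from_to[OF sum_inc_mem[OF j]] g(2)[OF j])
  ultimately show ?thesis by blast
qed

lemma coproduct_unique:
  assumes g: "hom (coproduct_cochain Car J X) Y g" and h: "hom (coproduct_cochain Car J X) Y h"
    and gh: "\<And>j. j \<in> J ==> ho (X j) Y (g ** coproduct_inc Car J X j) (h ** coproduct_inc Car J X j)"
  shows "ho (coproduct_cochain Car J X) Y g h"
proof -
  let ?a = "\<lambda>n. to_copy Car (obj (sum_cochain J X) n)" and ?b = "\<lambda>n. from_copy Car (obj (sum_cochain J X) n)"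
  let ?C = "coproduct_cochain Car J X"
  have Y: "is_complex R Y"
    using g hom_ob complexesD by blast
  have ga: "chain_map R (sum_cochain J X) Y (g ** ?a)" and ha: "chain_map R (sum_cochain J X) Y (h ** ?a)"
    using g h chain_map_comp[OF sum_copy_chain(1)] unfolding hom_def coproduct_cochain_def by blast+
  have "homotopic R (sum_cochain J X) Y (g ** ?a) (h ** ?a)"
    by (rule F.sum_homotopic[OF Y ha ga])
      (use gh in \<open>auto simp: ho_def coproduct_inc_def cmap_comp_assoc\<close>)
  then have 1: "homotopic R ?C Y (g ** ?a ** ?b) (h ** ?a ** ?b)"
    unfolding coproduct_cochain_def
    by (rule homotopic_comp_right[OF _ sum_copy(2) F.sum_complex Y sum_copy_chain(2)])
  have ab: "hom ?C ?C (?a ** ?b)"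
    unfolding hom_def using coproduct_ob chain_map_comp[OF sum_copy_chain(2,1)] by (simp add: coproduct_cochain_def)
  have 2: "ho ?C Y (k ** ?a ** ?b) k" if k: "hom ?C Y k" for k
    by (rule ho_eqI)
      (use hom_comp[OF k ab] k in \<open>simp_all add: cmap_comp_assoc,
        simp add: cmap_comp_def coproduct_cochain_def sum_to_from\<close>)
  have "ho ?C Y g (g ** ?a ** ?b)"
    by (rule ho_sym[OF 2[OF g]])
  also have "ho ?C Y (g ** ?a ** ?b) (h ** ?a ** ?b)"
    using 1 ho_hom(1)[OF 2[OF g]] ho_hom(1)[OF 2[OF h]] unfolding ho_def by blast
  also have "ho ?C Y (h ** ?a ** ?b) h"
    by (rule 2[OF h])
  finally show ?thesis .
qed

lemma product_lift:
  assumes f: "\<And>j. j \<in> J ==> hom Y (X j) (f j)" and Y: "Y \<in> complexes Car R"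
  shows "\<exists>g. hom Y (product_cochain Car J X) g \<and> (\<forall>j\<in>J. ho Y (X j) (product_prj Car J X j ** g) (f j))"
proof -
  have f': "\<And>j. j \<in> J ==> chain_map R Y (X j) (f j)"
    using f unfolding hom_def by blast
  let ?h = "\<lambda>n y. \<lambda>j\<in>J. f j n y"
  let ?g = "(\<lambda>n. to_copy Car (obj (prod_cochain J X) n)) ** ?h"
  have h: "chain_map R Y (prod_cochain J X) ?h"
    by (rule F.prod_lift[OF complexesD[OF Y] f'])
  interpret h: cmor R Y "prod_cochain J X" ?h
    using h Y complexesD F.prod_complex by (simp add: cmorI)
  have hg: "hom Y (product_cochain Car J X) ?g"
    unfolding hom_def using product_ob Y chain_map_comp[OF h prod_copy_chain(1)]
    by (simp add: product_cochain_def)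
  moreover have "ho Y (X j) (product_prj Car J X j ** ?g) (f j)" if j: "j \<in> J" for j
    by (rule ho_eqI[OF hom_comp[OF product_prj_hom[OF j] hg] f[OF j]])
      (use j in \<open>simp add: cmap_comp_def product_prj_def prod_from_to[OF h.closed]\<close>)
  ultimately show ?thesis by blast
qed

lemma product_unique:
  assumes g: "hom Y (product_cochain Car J X) g" and h: "hom Y (product_cochain Car J X) h"
    and gh: "\<And>j. j \<in> J ==> ho Y (X j) (product_prj Car J X j ** g) (product_prj Car J X j ** h)"
  shows "ho Y (product_cochain Car J X) g h"
proof -
  let ?a = "\<lambda>n. to_copy Car (obj (prod_cochain J X) n)" and ?b = "\<lambda>n. from_copy Car (obj (prod_cochain J X) n)"
  let ?C = "product_cochain Car J X"
  have Y: "is_complex R Y"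
    using g hom_ob complexesD by blast
  have ga: "chain_map R Y (prod_cochain J X) (?b ** g)" and ha: "chain_map R Y (prod_cochain J X) (?b ** h)"
    using g h chain_map_comp[OF _ prod_copy_chain(2)] unfolding hom_def product_cochain_def by blast+
  have "homotopic R Y (prod_cochain J X) (?b ** g) (?b ** h)"
    by (rule F.prod_homotopic[OF Y ha ga])
      (use gh in \<open>auto simp: ho_def product_prj_def cmap_comp_assoc\<close>)
  then have 1: "homotopic R Y ?C (?a ** (?b ** g)) (?a ** (?b ** h))"
    unfolding product_cochain_def
    by (rule homotopic_comp_left[OF _ Y F.prod_complex prod_copy(2) ha prod_copy_chain(1)])
  have ab: "hom ?C ?C (?a ** ?b)"
    unfolding hom_def using product_ob chain_map_comp[OF prod_copy_chain(2,1)] by (simp add: product_cochain_def)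
  have 2: "ho Y ?C (?a ** (?b ** k)) k" if k: "hom Y ?C k" for k
  proof (rule ho_eqI)
    show "hom Y ?C (?a ** (?b ** k))"
      using hom_comp[OF ab k] by (simp add: cmap_comp_assoc)
    interpret k: cmor R Y ?C k
      using k hom_ob complexesD unfolding hom_def by (simp add: cmorI)
    show "(?a ** (?b ** k)) n x = k n x" if "x \<in> el Y n" for n x
      using k.closed[OF that] prod_to_from by (simp add: cmap_comp_def product_cochain_def)
  qed (rule k)
  have "ho Y ?C g (?a ** (?b ** g))"
    by (rule ho_sym[OF 2[OF g]])
  also have "ho Y ?C (?a ** (?b ** g)) (?a ** (?b ** h))"
    using 1 ho_hom(1)[OF 2[OF g]] ho_hom(1)[OF 2[OF h]] unfolding ho_def by blast
  also have "ho Y ?C (?a ** (?b ** h)) h"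
    by (rule 2[OF h])
  finally show ?thesis .
qed

end

context
  fixes J :: "'i set" and X Y :: "'i => ('r, 'u) cochain" and s
  assumes J: "J \<in> Idx" and s: "\<forall>j\<in>J. we (X j) (Y j) (s j)"
begin

lemma we_family_ob: "\<forall>j\<in>J. X j \<in> complexes Car R" "\<forall>j\<in>J. Y j \<in> complexes Car R"
  using s unfolding we_def by blast+

interpretation Q: quasi_iso_family R J X Y s
  using family[OF we_family_ob(1)] family[OF we_family_ob(2)] s
  unfolding quasi_iso_family_def quasi_iso_family_axioms_def we_def by blast

lemma coproduct_we:
  assumes g: "hom (coproduct_cochain Car J X) (coproduct_cochain Car J Y) g"
    and gs: "\<And>j. j \<in> J ==> ho (X j) (coproduct_cochain Car J Y) (g ** coproduct_inc Car J X j)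
      (coproduct_inc Car J Y j ** s j)"
  shows "we (coproduct_cochain Car J X) (coproduct_cochain Car J Y) g"
proof -
  let ?T = "(\<lambda>n. to_copy Car (obj (sum_cochain J Y) n)) **
    (Q.S ** (\<lambda>n. from_copy Car (obj (sum_cochain J X) n)))"
  note X = we_family_ob(1) and Y = we_family_ob(2)
  have T: "we (coproduct_cochain Car J X) (coproduct_cochain Car J Y) ?T"
    unfolding we_def
    using coproduct_ob[OF J X] coproduct_ob[OF J Y]
      quasi_iso_comp[OF sum_copy(2)[OF J X] Q.target.sum_complex sum_copy(2)[OF J Y]
        quasi_iso_comp[OF sum_copy(2)[OF J X] Q.source.sum_complex Q.target.sum_complex
          sum_copy(4)[OF J X] Q.sum_quasi_iso] sum_copy(3)[OF J Y]]
    by (simp add: coproduct_cochain_def)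
  have "ho (coproduct_cochain Car J X) (coproduct_cochain Car J Y) ?T g"
  proof (rule coproduct_unique[OF J X we_hom[OF T] g])
    fix j assume j: "j \<in> J"
    have h: "hom (X j) (coproduct_cochain Car J Y) (coproduct_inc Car J Y j ** s j)"
      by (rule hom_comp[OF coproduct_inc_hom[OF J Y j] we_hom[OF bspec[OF s j]]])
    have "ho (X j) (coproduct_cochain Car J Y) (?T ** coproduct_inc Car J X j) (coproduct_inc Car J Y j ** s j)"
    proof (rule ho_eqI[OF hom_comp[OF we_hom[OF T] coproduct_inc_hom[OF J X j]] h])
      fix n x assume x: "x \<in> carrier (obj (X j) n)"
      have "Q.S n (sum_inc J (\<lambda>j. obj (X j) n) j x) = sum_inc J (\<lambda>j. obj (Y j) n) j (s j n x)"
        by (auto simp: Q.S_def sum_inc_def intro!: restrict_ext)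
      then show "(?T ** coproduct_inc Car J X j) n x = (coproduct_inc Car J Y j ** s j) n x"
        by (simp add: cmap_comp_def coproduct_inc_def sum_from_to[OF J X sum_inc_mem[OF J X j x]])
    qed
    also have "ho (X j) (coproduct_cochain Car J Y) (coproduct_inc Car J Y j ** s j) (g ** coproduct_inc Car J X j)"
      by (rule ho_sym[OF gs[OF j]])
    finally show "ho (X j) (coproduct_cochain Car J Y) (?T ** coproduct_inc Car J X j)
      (g ** coproduct_inc Car J X j)" .
  qed
  then show ?thesis
    using T we_ho by blast
qed

lemma product_we:
  assumes g: "hom (product_cochain Car J X) (product_cochain Car J Y) g"
    and gs: "\<And>j. j \<in> J ==> ho (product_cochain Car J X) (Y j) (product_prj Car J Y j ** g)
      (s j ** product_prj Car J X j)"
  shows "we (product_cochain Car J X) (product_cochain Car J Y) g"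
proof -
  let ?U = "Q.S ** (\<lambda>n. from_copy Car (obj (prod_cochain J X) n))"
  let ?T = "(\<lambda>n. to_copy Car (obj (prod_cochain J Y) n)) ** ?U"
  note X = we_family_ob(1) and Y = we_family_ob(2)
  have U: "quasi_iso R (copy_cochain Car (prod_cochain J X)) (prod_cochain J Y) ?U"
    by (rule quasi_iso_comp[OF prod_copy(2)[OF J X] Q.source.prod_complex Q.target.prod_complex
          prod_copy(4)[OF J X] Q.prod_quasi_iso])
  have T: "we (product_cochain Car J X) (product_cochain Car J Y) ?T"
    unfolding we_def
    using product_ob[OF J X] product_ob[OF J Y]
      quasi_iso_comp[OF prod_copy(2)[OF J X] Q.target.prod_complex prod_copy(2)[OF J Y] U prod_copy(3)[OF J Y]]
    by (simp add: product_cochain_def)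
  interpret U: cmor R "copy_cochain Car (prod_cochain J X)" "prod_cochain J Y" ?U
    by (rule cmorI[OF prod_copy(2)[OF J X] Q.target.prod_complex quasi_isoD(1)[OF U prod_copy(2)[OF J X] Q.target.prod_complex]])
  have "ho (product_cochain Car J X) (product_cochain Car J Y) ?T g"
  proof (rule product_unique[OF J Y we_hom[OF T] g])
    fix j assume j: "j \<in> J"
    have h: "hom (product_cochain Car J X) (Y j) (s j ** product_prj Car J X j)"
      by (rule hom_comp[OF we_hom[OF bspec[OF s j]] product_prj_hom[OF J X j]])
    have "ho (product_cochain Car J X) (Y j) (product_prj Car J Y j ** ?T) (s j ** product_prj Car J X j)"
    proof (rule ho_eqI[OF hom_comp[OF product_prj_hom[OF J Y j] we_hom[OF T]] h])
      fix n x assume x: "x \<in> carrier (obj (product_cochain Car J X) n)"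
      have "from_copy Car (obj (prod_cochain J Y) n) (?T n x) = ?U n x"
        using prod_from_to[OF J Y U.closed] x by (simp add: cmap_comp_def product_cochain_def)
      then show "(product_prj Car J Y j ** ?T) n x = (s j ** product_prj Car J X j) n x"
        using j by (simp add: cmap_comp_def product_prj_def Q.S_def)
    qed
    also have "ho (product_cochain Car J X) (Y j) (s j ** product_prj Car J X j) (product_prj Car J Y j ** g)"
      by (rule ho_sym[OF gs[OF j]])
    finally show "ho (product_cochain Car J X) (Y j) (product_prj Car J Y j ** ?T) (product_prj Car J Y j ** g)" .
  qed
  then show ?thesis
    using T we_ho by blast
qed

end

sublocale homotopy_bicomplete Car R Idx "coproduct_cochain Car" "coproduct_inc Car"
    "product_cochain Car" "product_prj Car"
proof
  fix J :: "'i set" and X :: "'i => ('r, 'u) cochain"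
  assume J: "J \<in> Idx"
  show "\<exists>g. hom (coproduct_cochain Car J X) Y g \<and> (\<forall>j\<in>J. ho (X j) Y (g ** coproduct_inc Car J X j) (f j))"
    if "\<And>j. j \<in> J ==> hom (X j) Y (f j)" "Y \<in> complexes Car R" for Y f
    by (rule coproduct_lift[OF J _ that]) (use that hom_ob in blast)+
  show "\<exists>g. hom Y (product_cochain Car J X) g \<and> (\<forall>j\<in>J. ho Y (X j) (product_prj Car J X j ** g) (f j))"
    if "\<And>j. j \<in> J ==> hom Y (X j) (f j)" "Y \<in> complexes Car R" for Y f
    by (rule product_lift[OF J _ that]) (use that hom_ob in blast)+
  show "we (coproduct_cochain Car J X') (coproduct_cochain Car J X) g"
    if "\<And>j. j \<in> J ==> we (X' j) (X j) (s j)" "hom (coproduct_cochain Car J X') (coproduct_cochain Car J X) g"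
      "\<And>j. j \<in> J ==> ho (X' j) (coproduct_cochain Car J X) (g ** coproduct_inc Car J X' j)
        (coproduct_inc Car J X j ** s j)" for X' s g
    by (rule coproduct_we[OF J _ that(2,3)]) (use that in blast)+
  show "we (product_cochain Car J X') (product_cochain Car J X) g"
    if "\<And>j. j \<in> J ==> we (X' j) (X j) (s j)" "hom (product_cochain Car J X') (product_cochain Car J X) g"
      "\<And>j. j \<in> J ==> ho (product_cochain Car J X') (X j) (product_prj Car J X j ** g)
        (s j ** product_prj Car J X' j)" for X' s g
    by (rule product_we[OF J _ that(2,3)]) (use that in blast)+
  assume "\<And>j. j \<in> J ==> X j \<in> complexes Car R"
  then have X: "\<forall>j\<in>J. X j \<in> complexes Car R" ..
  show "coproduct_cochain Car J X \<in> complexes Car R" "product_cochain Car J X \<in> complexes Car R"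
    by (rule coproduct_ob[OF J X], rule product_ob[OF J X])
  show "hom (X j) (coproduct_cochain Car J X) (coproduct_inc Car J X j)"
    "hom (product_cochain Car J X) (X j) (product_prj Car J X j)" if "j \<in> J" for j
    by (rule coproduct_inc_hom[OF J X that], rule product_prj_hom[OF J X that])
  show "ho (coproduct_cochain Car J X) Y g g'"
    if "hom (coproduct_cochain Car J X) Y g" "hom (coproduct_cochain Car J X) Y g'"
      "\<And>j. j \<in> J ==> ho (X j) Y (g ** coproduct_inc Car J X j) (g' ** coproduct_inc Car J X j)" for Y g g'
    by (rule coproduct_unique[OF J X that])
  show "ho Y (product_cochain Car J X) g g'"
    if "hom Y (product_cochain Car J X) g" "hom Y (product_cochain Car J X) g'"
      "\<And>j. j \<in> J ==> ho Y (X j) (product_prj Car J X j ** g) (product_prj Car J X j ** g')" for Y g g'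
    by (rule product_unique[OF J X that])
qed

end

section \<open>Short exact sequences\<close>

lemma cone_complex:
  assumes "cmor R X Y f"
  shows "is_complex R (cone X Y f)"
proof -
  interpret f: cmor R X Y f by fact
  have dif: "dif (cone X Y f) n (x, y) = (\<ominus>[obj X (n + 2)] dif X (n + 1) x, f (n + 1) x \<oplus>[obj Y (n + 1)] dif Y n y)"
    for n x y
    by (simp add: cone_def)
  have obj: "obj (cone X Y f) n = module_sum (obj X (n + 1)) (obj Y n)" for n
    by (simp add: cone_def)
  show ?thesis
    unfolding is_complex_def right_module_iff
  proof (intro allI conjI ballI)
    fix n
    show "rmod R (obj (cone X Y f) n)"
      by (simp add: obj rmod_module_sum f.X.rmod_axioms f.Y.rmod_axioms)
    show "dif (cone X Y f) n \<in> rmod_hom R (obj (cone X Y f) n) (obj (cone X Y f) (n + 1))"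
    proof (rule rmod_homI)
      show "dif (cone X Y f) n v \<in> carrier (obj (cone X Y f) (n + 1))" if "v \<in> carrier (obj (cone X Y f) n)" for v
        using that by (auto simp: obj dif add.commute)
      fix v w assume "v \<in> carrier (obj (cone X Y f) n)" "w \<in> carrier (obj (cone X Y f) n)"
      then obtain x y x' y' where vw: "v = (x, y)" "w = (x', y')"
        and m: "x \<in> el X (n + 1)" "x' \<in> el X (n + 1)"
          "y \<in> el Y n" "y' \<in> el Y n"
        by (auto simp: obj)
      have "\<ominus>[obj X (n + 2)] (dif X (n + 1) x \<oplus>[obj X (n + 2)] dif X (n + 1) x') =
          \<ominus>[obj X (n + 2)] dif X (n + 1) x \<oplus>[obj X (n + 2)] \<ominus>[obj X (n + 2)] dif X (n + 1) x'"
        using m by (subst f.X.minus_add) auto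
      moreover have "dif X (n + 1) (x \<oplus>[obj X (n + 1)] x') = dif X (n + 1) x \<oplus>[obj X (n + 2)] dif X (n + 1) x'"
        using f.X.dif_add[OF m(1,2)] by (simp add: add.commute)
      moreover have "(f (n + 1) x \<oplus>[obj Y (n + 1)] f (n + 1) x') \<oplus>[obj Y (n + 1)] (dif Y n y \<oplus>[obj Y (n + 1)] dif Y n y')
          = (f (n + 1) x \<oplus>[obj Y (n + 1)] dif Y n y) \<oplus>[obj Y (n + 1)] (f (n + 1) x' \<oplus>[obj Y (n + 1)] dif Y n y')"
        using m by (simp add: f.Y.a_ac)
      ultimately show "dif (cone X Y f) n (v \<oplus>[obj (cone X Y f) n] w) =
          dif (cone X Y f) n v \<oplus>[obj (cone X Y f) (n + 1)] dif (cone X Y f) n w"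
        using m by (simp add: obj dif vw add.commute)
    next
      fix r v assume r: "r \<in> carrier R" and "v \<in> carrier (obj (cone X Y f) n)"
      then obtain x y where v: "v = (x, y)" and m: "x \<in> el X (n + 1)" "y \<in> el Y n"
        by (auto simp: obj)
      have "dif X (n + 1) (r \<odot>[obj X (n + 1)] x) = r \<odot>[obj X (n + 2)] dif X (n + 1) x"
        using f.X.dif_smult[OF r m(1)] by (simp add: add.commute)
      then show "dif (cone X Y f) n (r \<odot>[obj (cone X Y f) n] v) = r \<odot>[obj (cone X Y f) (n + 1)] dif (cone X Y f) n v"
        using r m f.X.smult_neg[OF r, of "dif X (n + 1) x" "n + 2"]
        by (simp add: obj dif v f.Y.smult_add add.commute)
    qed
    fix v assume "v \<in> carrier (obj (cone X Y f) n)"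
    then obtain x y where v: "v = (x, y)" and m: "x \<in> el X (n + 1)" "y \<in> el Y n"
      by (auto simp: obj)
    let ?u = "dif X (n + 1) x"
    have u: "?u \<in> el X (n + 2)"
      using m by simp
    have e: "n + 1 + 1 = n + 2" "n + 1 + 2 = n + 3"
      by simp_all
    have 1: "dif X (n + 2) (\<ominus>[obj X (n + 2)] ?u) = \<zero>[obj X (n + 3)]"
      using f.X.dif_neg[OF u] f.X.dif_dif[OF m(1), of "n + 2"] by (simp add: add.commute)
    have 2: "f (n + 2) (\<ominus>[obj X (n + 2)] ?u) = \<ominus>[obj Y (n + 2)] dif Y (n + 1) (f (n + 1) x)"
      using f.neg[OF u] f.comm[OF m(1), of "n + 2"] by simp
    have 3: "dif Y (n + 1) (f (n + 1) x \<oplus>[obj Y (n + 1)] dif Y n y) = dif Y (n + 1) (f (n + 1) x)"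
    proof -
      have c: "f (n + 1) x \<in> el Y (n + 1)" "dif Y n y \<in> el Y (n + 1)"
        using m by auto
      have "dif Y (n + 1) (f (n + 1) x \<oplus>[obj Y (n + 1)] dif Y n y) =
          dif Y (n + 1) (f (n + 1) x) \<oplus>[obj Y (n + 1 + 1)] dif Y (n + 1) (dif Y n y)"
        by (rule f.Y.dif_add[OF c])
      then show ?thesis
        using m c by simp
    qed
    have 4: "dif Y (n + 1) (f (n + 1) x) \<in> el Y (n + 2)"
      using m by simp
    show "dif (cone X Y f) (n + 1) (dif (cone X Y f) n v) = \<zero>[obj (cone X Y f) (n + 2)]"
      unfolding v dif obj e 1 2 3 using f.Y.l_neg[OF 4] by (simp add: add.commute)
  qed
qed

locale exact_cochains = i: cmor R X Y i + g: cmor R Y Z g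
  for R :: "('r, 'c) ring_scheme" and X :: "('r, 'm) cochain" and Y :: "('r, 'n) cochain"
    and Z :: "('r, 'p) cochain" and i g +
  assumes mono: "inj_on (i n) (el X n)"
    and exact: "y \<in> el Y n ==> g n y = \<zero>[obj Z n] \<longleftrightarrow> y \<in> i n ` el X n"
    and epi: "z \<in> el Z n ==> z \<in> g n ` el Y n"
begin

lemma gi: "x \<in> el X n ==> g n (i n x) = \<zero>[obj Z n]"
  using exact by blast

lemma cone_simps:
  "dif (cone X Y i) n (x, y) = (\<ominus>[obj X (n + 2)] dif X (n + 1) x, i (n + 1) x \<oplus>[obj Y (n + 1)] dif Y n y)"
  "obj (cone X Y i) n = module_sum (obj X (n + 1)) (obj Y n)"
  by (simp_all add: cone_def)

lemma cone_quasi_iso: "quasi_iso R (cone X Y i) Z (\<lambda>n (x, y). g n y)"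
proof (rule quasi_isoI)
  interpret C: cplx R "cone X Y i"
    unfolding cplx_def by (rule cone_complex[OF i.cmor_axioms])
  show "is_complex R (cone X Y i)" "is_complex R Z"
    by (rule C.cplx, rule g.Y.cplx)
  show "chain_map R (cone X Y i) Z (\<lambda>n (x, y). g n y)"
    by (rule chain_mapI, rule rmod_homI) (auto simp: cone_simps gi)
  have neg_zero: "x \<in> el X n ==> \<ominus>[obj X n] x = \<zero>[obj X n] ==> x = \<zero>[obj X n]" for x n
    using i.X.minus_minus i.X.neg_zero by metis
  show "hinj (cone X Y i) Z (\<lambda>n (x, y). g n y)"
    unfolding hinj_def
  proof (intro allI ballI impI)
    fix n v assume v: "v \<in> cocycles (cone X Y i) n" "(case v of (x, y) => g n y) \<in> coboundaries Z n"
    then obtain x y where xy: "v = (x, y)" "x \<in> el X (n + 1)" "y \<in> el Y n"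
        "i (n + 1) x \<oplus>[obj Y (n + 1)] dif Y n y = \<zero>[obj Y (n + 1)]"
      by (auto simp: cocycles_def cone_simps)
    obtain z where z: "z \<in> el Z (n - 1)" "g n y = dif Z (n - 1) z"
      using v(2) xy(1) by (auto elim: g.Y.coboundariesE)
    obtain y0 where y0: "y0 \<in> el Y (n - 1)" "z = g (n - 1) y0"
      using epi[OF z(1)] by blast
    have dy0: "dif Y (n - 1) y0 \<in> el Y n"
      using y0 by simp
    have "g n (dif Y (n - 1) y0) = g n y"
      using y0 z by simp
    then have "g n (y \<ominus>[obj Y n] dif Y (n - 1) y0) = \<zero>[obj Z n]"
      using xy(3) dy0 by simp
    then obtain x0 where x0: "x0 \<in> el X n" "y \<ominus>[obj Y n] dif Y (n - 1) y0 = i n x0"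
      using exact[of "y \<ominus>[obj Y n] dif Y (n - 1) y0" n] xy(3) dy0 by auto
    have ix0: "i n x0 \<in> el Y n"
      using x0 by simp
    have y: "y = i n x0 \<oplus>[obj Y n] dif Y (n - 1) y0"
      unfolding x0(2)[symmetric] using xy(3) dy0 by algebra
    have "dif Y n y = dif Y n (i n x0) \<oplus>[obj Y (n + 1)] dif Y n (dif Y (n - 1) y0)"
      unfolding y by (rule i.Y.dif_add[OF ix0 dy0])
    also have "\<dots> = i (n + 1) (dif X n x0)"
      using x0 y0 by simp
    finally have "i (n + 1) x \<oplus>[obj Y (n + 1)] i (n + 1) (dif X n x0) = \<zero>[obj Y (n + 1)]"
      using xy(4) by simp
    then have "i (n + 1) (x \<oplus>[obj X (n + 1)] dif X n x0) = i (n + 1) \<zero>[obj X (n + 1)]"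
      using xy(2) x0(1) i.add[of x "n + 1" "dif X n x0"] i.zero[of "n + 1"] i.X.dif_closed[of x0 n "n + 1"] by metis
    then have "x \<oplus>[obj X (n + 1)] dif X n x0 = \<zero>[obj X (n + 1)]"
      by (rule inj_onD[OF mono]) (use xy(2) x0(1) in auto)
    then have x: "x = \<ominus>[obj X (n + 1)] dif X n x0"
      using xy(2) x0(1) by (metis i.X.minus_equality i.X.dif_closed)
    have "v = dif (cone X Y i) (n - 1) (x0, y0)"
      by (simp add: cone_simps xy(1) x y add.commute)
    moreover have "dif (cone X Y i) (n - 1) (x0, y0) \<in> coboundaries (cone X Y i) n"
      by (rule C.coboundariesI) (use x0 y0 in \<open>auto simp: cone_simps\<close>)
    ultimately show "v \<in> coboundaries (cone X Y i) n"
      by simp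
  qed
  show "hsurj (cone X Y i) Z (\<lambda>n (x, y). g n y)"
    unfolding hsurj_def
  proof (intro allI ballI)
    fix n z assume "z \<in> cocycles Z n"
    then have z: "z \<in> el Z n" "dif Z n z = \<zero>[obj Z (n + 1)]"
      by (auto simp: cocycles_def)
    obtain y where y: "y \<in> el Y n" "z = g n y"
      using epi[OF z(1)] by blast
    have dy: "dif Y n y \<in> el Y (n + 1)"
      using y by simp
    have "g (n + 1) (dif Y n y) = \<zero>[obj Z (n + 1)]"
      using y z(2) by simp
    then obtain x where x: "x \<in> el X (n + 1)" "dif Y n y = i (n + 1) x"
      using exact[OF dy] by blast
    have "i (n + 2) (dif X (n + 1) x) = i (n + 2) \<zero>[obj X (n + 2)]"
      using i.comm[OF x(1), of "n + 2"] i.Y.dif_dif[OF y(1), of "n + 1"] x(2) by (simp add: add.commute)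
    then have dx: "dif X (n + 1) x = \<zero>[obj X (n + 2)]"
      by (rule inj_onD[OF mono]) (use x(1) in auto)
    have "dif X (n + 1) (\<ominus>[obj X (n + 1)] x) = \<zero>[obj X (n + 2)]"
      using i.X.dif_neg[OF x(1)] dx by (simp add: add.commute i.X.neg_zero)
    moreover have "i (n + 1) (\<ominus>[obj X (n + 1)] x) \<oplus>[obj Y (n + 1)] dif Y n y = \<zero>[obj Y (n + 1)]"
      using x by (simp add: i.Y.l_neg)
    ultimately have "(\<ominus>[obj X (n + 1)] x, y) \<in> cocycles (cone X Y i) n"
      using x y by (simp add: cocycles_def cone_simps add.commute i.X.neg_zero)
    then show "\<exists>v\<in>cocycles (cone X Y i) n. \<exists>b\<in>coboundaries Z n. z = (case v of (x, y) => g n y) \<oplus>[obj Z n] b"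
      using y g.Y.zero_coboundary[of n] z(1)
      by (intro bexI[of _ "(\<ominus>[obj X (n + 1)] x, y)"] bexI[of _ "\<zero>[obj Z n]"]) auto
  qed
qed

end

context derived_universe
begin

lemma exact_triangle_closed:
  assumes S: "triangle_closed S"
    and ob: "X \<in> complexes Car R" "Y \<in> complexes Car R" "Z \<in> complexes Car R"
    and ex: "exact_cochains R X Y Z i g"
  shows "X \<in> S ==> Y \<in> S ==> Z \<in> S" "X \<in> S ==> Z \<in> S ==> Y \<in> S" "Y \<in> S ==> Z \<in> S ==> X \<in> S"
proof -
  interpret exact_cochains R X Y Z i g by fact
  have C: "is_complex R (cone X Y i)" "small Car (carrier (obj (cone X Y i) n))" for n
    using cone_complex[OF i.cmor_axioms] obj_small ob by (auto simp: cone_simps intro!: small_Times)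
  let ?C = "copy_cochain Car (cone X Y i)"
  let ?a = "\<lambda>n. to_copy Car (obj (cone X Y i) n)" and ?b = "\<lambda>n. from_copy Car (obj (cone X Y i) n)"
  note copy = copy_maps[OF C]
  have a: "chain_map R (cone X Y i) ?C ?a" and b: "chain_map R ?C (cone X Y i) ?b"
    using copy unfolding quasi_iso_def by auto
  interpret b: cmor R ?C "cone X Y i" ?b
    by (rule cmorI[OF copy(2) C(1) b])
  interpret a: cmor R "cone X Y i" ?C ?a
    by (rule cmorI[OF C(1) copy(2) a])
  have "chain_map R Y (cone X Y i) (\<lambda>n y. (\<zero>[obj X (n + 1)], y))"
    by (rule chain_mapI, rule rmod_homI)
      (use i.X.dif_zero in \<open>auto simp: cone_simps i.X.neg_zero add.commute\<close>)
  then have "chain_map R Y ?C (?a ** (\<lambda>n y. (\<zero>[obj X (n + 1)], y)))"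
    using chain_map_comp a by blast
  moreover have "bij_betw (?b n) (carrier (obj ?C n)) (carrier (obj (cone X Y i) n))" for n
    by (rule bij_betw_byWitness[of _ "?a n"])
      (use to_from_copy[OF C] from_to_copy[OF C] in auto)
  ultimately have tri: "standard_triangle R X Y ?C i (?a ** (\<lambda>n y. (\<zero>[obj X (n + 1)], y))) (\<lambda>n v. fst (?b n v))"
    unfolding standard_triangle_def
    using i.chain b from_to_copy[OF C] by (auto simp: cmap_comp_def cone_simps intro!: exI[of _ ?b])
  have "we ?C Z ((\<lambda>n (x, y). g n y) ** ?b)"
    unfolding we_def
    using copy(1) ob(3) quasi_iso_comp[OF copy(2) C(1) complexesD[OF ob(3)] copy(4) cone_quasi_iso] by blast
  then have "?C \<in> S \<longleftrightarrow> Z \<in> S"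
    using S unfolding triangle_closed_def by blast
  moreover have "(X \<in> S \<and> Y \<in> S \<longrightarrow> ?C \<in> S) \<and> (X \<in> S \<and> ?C \<in> S \<longrightarrow> Y \<in> S) \<and> (Y \<in> S \<and> ?C \<in> S \<longrightarrow> X \<in> S)"
    using S tri ob copy(1) unfolding triangle_closed_def by blast
  ultimately show "X \<in> S ==> Y \<in> S ==> Z \<in> S" "X \<in> S ==> Z \<in> S ==> Y \<in> S" "Y \<in> S ==> Z \<in> S ==> X \<in> S"
    by blast+
qed

end

section \<open>Restriction of scalars\<close>

definition restrict_scalars :: "('s => 'r) => ('r, 'm) module => ('s, 'm) module" where
  "restrict_scalars \<phi> M = \<lparr>carrier = carrier M, mult = mult M, one = one M, zero = zero M, add = add M,
     smult = (\<lambda>r x. \<phi> r \<odot>[M] x)\<rparr>"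

definition restrict_cochain :: "('s => 'r) => ('r, 'm) cochain => ('s, 'm) cochain" where
  "restrict_cochain \<phi> X = \<lparr>obj = (\<lambda>n. restrict_scalars \<phi> (obj X n)), dif = dif X\<rparr>"

lemma restrict_scalars_simps [simp]:
  "carrier (restrict_scalars \<phi> M) = carrier M"
  "\<zero>[restrict_scalars \<phi> M] = \<zero>[M]"
  "x \<oplus>[restrict_scalars \<phi> M] y = x \<oplus>[M] y"
  "r \<odot>[restrict_scalars \<phi> M] x = \<phi> r \<odot>[M] x"
  unfolding restrict_scalars_def by simp_all

lemma restrict_scalars_neg [simp]: "\<ominus>[restrict_scalars \<phi> M] x = \<ominus>[M] x"
  unfolding a_inv_def m_inv_def by simp

lemma restrict_cochain_simps [simp]:
  "obj (restrict_cochain \<phi> X) n = restrict_scalars \<phi> (obj X n)"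
  "dif (restrict_cochain \<phi> X) = dif X"
  unfolding restrict_cochain_def by simp_all

lemma restrict_shift: "restrict_cochain \<phi> (shift k X) = shift k (restrict_cochain \<phi> X)"
  unfolding restrict_cochain_def shift_def by (auto simp: fun_eq_iff)

lemma restrict_module_sum:
  "module_sum (restrict_scalars \<phi> M) (restrict_scalars \<phi> N) = restrict_scalars \<phi> (module_sum M N)"
  unfolding module_sum_def restrict_scalars_def by (auto simp: fun_eq_iff)

lemma restrict_prod_module: "restrict_scalars \<phi> (prod_module J M) = prod_module J (\<lambda>j. restrict_scalars \<phi> (M j))"
  unfolding prod_module_def restrict_scalars_def by simp

lemma restrict_sum_module: "restrict_scalars \<phi> (sum_module J M) = sum_module J (\<lambda>j. restrict_scalars \<phi> (M j))"
  unfolding sum_module_def prod_module_def restrict_scalars_def by simp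

lemma restrict_cone: "cone (restrict_cochain \<phi> X) (restrict_cochain \<phi> Y) f = restrict_cochain \<phi> (cone X Y f)"
  unfolding cone_def by (simp add: restrict_cochain_def restrict_module_sum)

lemma restrict_copy_module: "restrict_scalars \<phi> (copy_module Car M) = copy_module Car (restrict_scalars \<phi> M)"
  unfolding copy_module_def by (simp add: restrict_scalars_def Let_def)

lemma restrict_copy_cochain: "restrict_cochain \<phi> (copy_cochain Car X) = copy_cochain Car (restrict_cochain \<phi> X)"
  unfolding copy_cochain_def restrict_cochain_def
  by (simp add: restrict_copy_module to_copy_def from_copy_def)

lemma restrict_coproduct:
  "restrict_cochain \<phi> (coproduct_cochain Car J X) = coproduct_cochain Car J (\<lambda>j. restrict_cochain \<phi> (X j))"
  unfolding coproduct_cochain_def sum_cochain_def restrict_copy_cochain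
  by (simp add: restrict_cochain_def restrict_sum_module)

lemma restrict_product:
  "restrict_cochain \<phi> (product_cochain Car J X) = product_cochain Car J (\<lambda>j. restrict_cochain \<phi> (X j))"
  unfolding product_cochain_def prod_cochain_def restrict_copy_cochain
  by (simp add: restrict_cochain_def restrict_prod_module)

lemma rmod_restrict_scalars:
  assumes "\<phi> \<in> ring_hom B A" "ring B" "rmod A M"
  shows "rmod B (restrict_scalars \<phi> M)"
proof -
  interpret rmod A M by fact
  have "abelian_group (restrict_scalars \<phi> M)"
    by (rule abelian_groupI) (auto simp: a_ac intro!: bexI[of _ "\<ominus>[M] _"] l_neg)
  then show ?thesis
    using assms(2) ring_hom_closed[OF assms(1)] ring_hom_add[OF assms(1)] ring_hom_mult[OF assms(1)]
      ring_hom_one[OF assms(1)]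
    by (intro rmodI) (auto simp: smult_add add_smult mult_smult)
qed

lemma hom_restrict_scalars:
  assumes "\<phi> \<in> ring_hom B A" "h \<in> rmod_hom A M N"
  shows "h \<in> rmod_hom B (restrict_scalars \<phi> M) (restrict_scalars \<phi> N)"
  using assms(2) ring_hom_closed[OF assms(1)] unfolding rmod_hom_def by auto

definition regular_module :: "('r, 'c) ring_scheme => ('r, 'r) module" where
  "regular_module R = \<lparr>carrier = carrier R, mult = mult R, one = one R, zero = zero R, add = add R,
     smult = (\<lambda>r x. x \<otimes>[R] r)\<rparr>"

lemma regular_module_simps [simp]:
  "carrier (regular_module R) = carrier R"
  "\<zero>[regular_module R] = \<zero>[R]"
  "x \<oplus>[regular_module R] y = x \<oplus>[R] y"
  "r \<odot>[regular_module R] x = x \<otimes>[R] r"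
  unfolding regular_module_def by simp_all

locale scalar_restriction = A: derived_universe Idx Car A + B: derived_universe Idx Car B
  for Idx :: "'i set set" and Car :: "'u set set" and A :: "('r, 'c) ring_scheme"
    and B :: "('s, 'd) ring_scheme" +
  fixes \<phi>
  assumes \<phi>: "\<phi> \<in> ring_hom B A"
begin

lemmas \<phi>_simps [simp] = ring_hom_closed[OF \<phi>] ring_hom_add[OF \<phi>] ring_hom_mult[OF \<phi>] ring_hom_one[OF \<phi>]

lemmas rmod_restrict = rmod_restrict_scalars[OF \<phi> B.ring_R]
lemmas hom_restrict = hom_restrict_scalars[OF \<phi>]

lemma is_complex_restrict: "is_complex A X ==> is_complex B (restrict_cochain \<phi> X)"
  unfolding is_complex_def right_module_iff by (auto intro: rmod_restrict hom_restrict)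

lemma complexes_restrict: "X \<in> complexes Car A ==> restrict_cochain \<phi> X \<in> complexes Car B"
  unfolding complexes_def using is_complex_restrict by auto

lemma chain_map_restrict:
  "chain_map A X Y f ==> chain_map B (restrict_cochain \<phi> X) (restrict_cochain \<phi> Y) f"
  unfolding chain_map_def by (auto intro: hom_restrict)

lemma we_restrict: "A.we X Y f ==> B.we (restrict_cochain \<phi> X) (restrict_cochain \<phi> Y) f"
proof -
  have 1: "cocycles (restrict_cochain \<phi> X) n = cocycles X n"
    "coboundaries (restrict_cochain \<phi> X) n = coboundaries X n" for X :: "('r, 'u) cochain" and n
    unfolding cocycles_def coboundaries_def by simp_all
  assume "A.we X Y f"
  then show ?thesis
    unfolding A.we_iff B.we_iff A.hom_def B.hom_def hinj_def hsurj_def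
    by (simp add: 1 complexes_restrict chain_map_restrict)
qed

lemma standard_triangle_restrict:
  assumes "standard_triangle A X Y Z f g h"
  shows "standard_triangle B (restrict_cochain \<phi> X) (restrict_cochain \<phi> Y) (restrict_cochain \<phi> Z) f g h"
proof -
  obtain \<theta> where "chain_map A X Y f" "chain_map A Y Z g" "chain_map A Z (cone X Y f) \<theta>"
    "\<And>n. bij_betw (\<theta> n) (el Z n) (carrier (obj (cone X Y f) n))"
    "\<And>n y. y \<in> el Y n ==> \<theta> n (g n y) = (\<zero>[obj X (n + 1)], y)"
    "\<And>n z. z \<in> el Z n ==> h n z = fst (\<theta> n z)"
    using assms unfolding standard_triangle_def by blast
  then show ?thesis
    unfolding standard_triangle_def restrict_cone
    by (intro conjI exI[of _ \<theta>] chain_map_restrict) auto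
qed

end

context derived_universe
begin

lemma regular_rmod: "rmod R (regular_module R)" (is "rmod R ?M")
proof -
  interpret R: ring R by (rule ring_R)
  have "abelian_group ?M"
    by (rule abelian_groupI) (auto simp: R.a_ac intro!: bexI[of _ "\<ominus>[R] _"] R.l_neg)
  then show ?thesis
    by (intro rmodI) (auto simp: R.l_distr R.r_distr R.m_assoc ring_R)
qed

lemma rmod_trivial:
  assumes "rmod R M"
  shows "rmod R (M\<lparr>carrier := {\<zero>[M]}\<rparr>)"
proof -
  interpret rmod R M by fact
  have "abelian_group (M\<lparr>carrier := {\<zero>[M]}\<rparr>)"
    by (rule abelian_groupI) auto
  then show ?thesis
    by (intro rmodI) (auto simp: ring_R)
qed

lemma stalk_complexes:
  assumes "M \<in> modules Car R"
  shows "stalk M \<in> complexes Car R"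
proof -
  have M: "rmod R M" "carrier M \<in> Car"
    using assms by (auto simp: modules_def right_module_iff)
  interpret rmod R M by (rule M)
  have "{\<zero>[M]} \<in> Car"
    by (rule Car_lepoll[OF M(2)]) (auto intro: subset_imp_lepoll)
  moreover have "is_complex R (stalk M)"
    unfolding is_complex_def right_module_iff stalk_def
    using M(1) rmod_trivial[OF M(1)] by (auto simp: rmod_hom_def)
  ultimately show ?thesis
    unfolding complexes_def using M(2) by (simp add: stalk_def)
qed

lemma trivial_complex: "\<exists>V\<in>complexes Car R. \<forall>n. el V n = {\<zero>[obj V n]}"
proof -
  let ?M = "copy_module Car (regular_module R)"
  have "small Car (carrier (regular_module R))"
    using small_ring by simp
  then have M: "rmod R ?M" "carrier ?M \<in> Car"
    using rmod_copy[OF regular_rmod] copy_carrier_Car by blast+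
  interpret rmod R ?M by (rule M)
  have "?M\<lparr>carrier := {\<zero>[?M]}\<rparr> \<in> modules Car R"
    using rmod_trivial[OF M(1)] Car_lepoll[OF M(2), of "{\<zero>[?M]}"]
    by (auto simp: modules_def right_module_iff intro: subset_imp_lepoll)
  from stalk_complexes[OF this] show ?thesis
    by (rule bexI[rotated]) (simp add: stalk_def)
qed

lemma trivial_complex_mem:
  assumes S: "triangle_closed S" and V: "V \<in> complexes Car R"
    and triv: "\<And>n. el V n = {\<zero>[obj V n]}"
  shows "V \<in> S"
proof -
  obtain Y where Y: "Y \<in> S" "Y \<in> complexes Car R"
    using S unfolding triangle_closed_def by blast
  interpret V: cplx R V using V complexesD by (simp add: cplx_def)
  interpret Y: cplx R Y using Y complexesD by (simp add: cplx_def)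
  have i: "chain_map R V Y (\<lambda>n x. \<zero>[obj Y n])"
    by (rule chain_mapI, rule rmod_homI) auto
  have "exact_cochains R V Y Y (\<lambda>n x. \<zero>[obj Y n]) cmap_id"
    unfolding exact_cochains_def exact_cochains_axioms_def
    using cmorI[OF V.cplx Y.cplx i] cmorI[OF Y.cplx Y.cplx chain_map_id[OF Y.cplx]]
    by (auto simp: triv cmap_id_def)
  from exact_triangle_closed(3)[OF S V Y(2) Y(2) this] show ?thesis
    using Y(1) by blast
qed

lemma triangle_closed_complexes: "triangle_closed (complexes Car R)"
  unfolding triangle_closed_def
proof (intro conjI)
  show "complexes Car R \<noteq> {}"
    using trivial_complex by blast
  show "\<forall>X Y s. we X Y s \<longrightarrow> (X \<in> complexes Car R) = (Y \<in> complexes Car R)"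
    unfolding we_def by blast
qed (use shift_ob in blast)+

lemma localising_complexes: "localising Idx Car R (complexes Car R)"
  unfolding localising_iff using triangle_closed_complexes coproduct_ob by blast

lemma colocalising_complexes: "colocalising Idx Car R (complexes Car R)"
  unfolding colocalising_iff using triangle_closed_complexes product_ob by blast

lemma stalk_injective: "stalk ` injective_modules Car R \<subseteq> complexes Car R"
  by (auto simp: injective_modules_def stalk_complexes)

lemma stalk_projective: "stalk ` projective_modules Car R \<subseteq> complexes Car R"
  by (auto simp: projective_modules_def stalk_complexes)

lemma injectives_generate_iff: "injectives_generate Idx Car R \<longleftrightarrow>
    (\<forall>S. localising Idx Car R S \<and> stalk ` injective_modules Car R \<subseteq> S \<longrightarrow> complexes Car R \<subseteq> S)"
  unfolding injectives_generate_def
  using localising_complexes stalk_injective by (intro iffI) blast+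

lemma projectives_cogenerate_iff: "projectives_cogenerate Idx Car R \<longleftrightarrow>
    (\<forall>S. colocalising Idx Car R S \<and> stalk ` projective_modules Car R \<subseteq> S \<longrightarrow> complexes Car R \<subseteq> S)"
  unfolding projectives_cogenerate_def
  using colocalising_complexes stalk_projective by (intro iffI) blast+

end

context scalar_restriction
begin

lemma preimage_triangle_closed:
  assumes S: "B.triangle_closed S"
  shows "A.triangle_closed {X \<in> complexes Car A. restrict_cochain \<phi> X \<in> S}"
  unfolding A.triangle_closed_def
proof (intro conjI allI impI ballI)
  obtain V where V: "V \<in> complexes Car A" "\<And>n. el V n = {\<zero>[obj V n]}"
    using A.trivial_complex by blast
  have "restrict_cochain \<phi> V \<in> S"
    by (rule B.trivial_complex_mem[OF S complexes_restrict[OF V(1)]]) (simp add: V(2))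
  then show "{X \<in> complexes Car A. restrict_cochain \<phi> X \<in> S} \<noteq> {}"
    using V(1) by blast
next
  fix X Y s assume "A.we X Y s"
  then show "X \<in> {X \<in> complexes Car A. restrict_cochain \<phi> X \<in> S} \<longleftrightarrow>
      Y \<in> {X \<in> complexes Car A. restrict_cochain \<phi> X \<in> S}"
    using S we_restrict[of X Y s] unfolding B.triangle_closed_def A.we_def by blast
next
  fix X k assume "X \<in> {X \<in> complexes Car A. restrict_cochain \<phi> X \<in> S}"
  then show "shift k X \<in> {X \<in> complexes Car A. restrict_cochain \<phi> X \<in> S}"
    using S A.shift_ob unfolding B.triangle_closed_def by (simp add: restrict_shift)
next
  fix X Y Z f g h
  assume ob: "X \<in> complexes Car A" "Y \<in> complexes Car A" "Z \<in> complexes Car A"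
    and "standard_triangle A X Y Z f g h"
  then have tri: "(restrict_cochain \<phi> X \<in> S \<and> restrict_cochain \<phi> Y \<in> S \<longrightarrow> restrict_cochain \<phi> Z \<in> S) \<and>
      (restrict_cochain \<phi> X \<in> S \<and> restrict_cochain \<phi> Z \<in> S \<longrightarrow> restrict_cochain \<phi> Y \<in> S) \<and>
      (restrict_cochain \<phi> Y \<in> S \<and> restrict_cochain \<phi> Z \<in> S \<longrightarrow> restrict_cochain \<phi> X \<in> S)"
    using S standard_triangle_restrict complexes_restrict unfolding B.triangle_closed_def by blast
  let ?T = "{X \<in> complexes Car A. restrict_cochain \<phi> X \<in> S}"
  show "X \<in> ?T \<and> Y \<in> ?T ==> Z \<in> ?T" "X \<in> ?T \<and> Z \<in> ?T ==> Y \<in> ?T" "Y \<in> ?T \<and> Z \<in> ?T ==> X \<in> ?T"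
    using tri ob by blast+
qed auto

lemma preimage_localising:
  assumes S: "localising Idx Car B S"
  shows "localising Idx Car A {X \<in> complexes Car A. restrict_cochain \<phi> X \<in> S}"
  unfolding A.localising_iff
proof (intro conjI ballI allI impI)
  show "A.triangle_closed {X \<in> complexes Car A. restrict_cochain \<phi> X \<in> S}"
    using S B.localising_iff preimage_triangle_closed by blast
  fix J and X :: "'i => ('r, 'u) cochain"
  assume J: "J \<in> Idx" and X: "\<forall>j\<in>J. X j \<in> {X \<in> complexes Car A. restrict_cochain \<phi> X \<in> S}"
  have "coproduct_cochain Car J X \<in> complexes Car A"
    by (rule A.coproduct_ob[OF J]) (use X in blast)
  moreover have "coproduct_cochain Car J (\<lambda>j. restrict_cochain \<phi> (X j)) \<in> S"
    using S[unfolded B.localising_iff] J X by auto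
  ultimately show "coproduct_cochain Car J X \<in> {X \<in> complexes Car A. restrict_cochain \<phi> X \<in> S}"
    by (simp add: restrict_coproduct)
qed

lemma preimage_colocalising:
  assumes S: "colocalising Idx Car B S"
  shows "colocalising Idx Car A {X \<in> complexes Car A. restrict_cochain \<phi> X \<in> S}"
  unfolding A.colocalising_iff
proof (intro conjI ballI allI impI)
  show "A.triangle_closed {X \<in> complexes Car A. restrict_cochain \<phi> X \<in> S}"
    using S B.colocalising_iff preimage_triangle_closed by blast
  fix J and X :: "'i => ('r, 'u) cochain"
  assume J: "J \<in> Idx" and X: "\<forall>j\<in>J. X j \<in> {X \<in> complexes Car A. restrict_cochain \<phi> X \<in> S}"
  have "product_cochain Car J X \<in> complexes Car A"
    by (rule A.product_ob[OF J]) (use X in blast)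
  moreover have "product_cochain Car J (\<lambda>j. restrict_cochain \<phi> (X j)) \<in> S"
    using S[unfolded B.colocalising_iff] J X by auto
  ultimately show "product_cochain Car J X \<in> {X \<in> complexes Car A. restrict_cochain \<phi> X \<in> S}"
    by (simp add: restrict_product)
qed

end

section \<open>Injective and projective modules\<close>

lemma (in rmod) neg_one_smult: "x \<in> carrier M ==> (\<ominus>[R] \<one>[R]) \<odot> x = \<ominus> x"
  using add_smult[of "\<ominus>[R] \<one>[R]" "\<one>[R]" x] by (intro minus_equality[symmetric]) (simp_all add: R.l_neg)

locale submod = rmod R M
  for R :: "('r, 'c) ring_scheme" and M :: "('r, 'm) module" (structure) and S +
  assumes sub: "S \<subseteq> carrier M"
    and sub_zero: "\<zero> \<in> S"
    and sub_add: "x \<in> S ==> y \<in> S ==> x \<oplus> y \<in> S"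
    and sub_smult: "r \<in> carrier R ==> x \<in> S ==> r \<odot> x \<in> S"
begin

lemma sub_neg: "x \<in> S ==> \<ominus> x \<in> S"
  using sub_smult[of "\<ominus>[R] \<one>[R]" x] neg_one_smult[of x] sub by auto

lemma sub_minus: "x \<in> S ==> y \<in> S ==> x \<ominus> y \<in> S"
  unfolding minus_eq by (intro sub_add sub_neg)

lemma rmod_sub: "rmod R (M\<lparr>carrier := S\<rparr>)"
proof -
  have [simp]: "x \<in> S ==> x \<in> carrier M" for x
    using sub by blast
  have "abelian_group (M\<lparr>carrier := S\<rparr>)"
    by (rule abelian_groupI) (auto simp: a_ac sub_add sub_zero intro!: bexI[of _ "\<ominus> _"] sub_neg r_neg)
  then show ?thesis
    by (intro rmodI) (auto simp: R.ring_axioms sub_smult smult_add add_smult mult_smult)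
qed

lemma sub_inclusion: "(\<lambda>x. x) \<in> rmod_hom R (M\<lparr>carrier := S\<rparr>) M"
  using sub by (intro rmod_homI) auto

end

text \<open>Quotients are realised on a set of coset representatives, so that they stay in the same type
  and in \<open>Car\<close>; the projection is \<open>coset_rep\<close>.\<close>

definition coset_rep :: "('r, 'm) module => 'm set => 'm => 'm" where
  "coset_rep M S x = (SOME y. y \<in> carrier M \<and> x \<ominus>[M] y \<in> S)"

definition quot_module :: "('r, 'm) module => 'm set => ('r, 'm) module" where
  "quot_module M S = \<lparr>carrier = coset_rep M S ` carrier M, mult = undefined, one = undefined,
     zero = coset_rep M S \<zero>[M], add = (\<lambda>x y. coset_rep M S (x \<oplus>[M] y)),
     smult = (\<lambda>r x. coset_rep M S (r \<odot>[M] x))\<rparr>"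

context submod
begin

abbreviation "rep \<equiv> coset_rep M S"

lemma rep: "x \<in> carrier M ==> rep x \<in> carrier M" "x \<in> carrier M ==> x \<ominus> rep x \<in> S"
proof -
  assume "x \<in> carrier M"
  then have "x \<in> carrier M \<and> x \<ominus> x \<in> S"
    using sub_zero by simp
  then have "rep x \<in> carrier M \<and> x \<ominus> rep x \<in> S"
    unfolding coset_rep_def by (rule someI)
  then show "rep x \<in> carrier M" "x \<ominus> rep x \<in> S"
    by blast+
qed

lemma rep_eq_iff:
  assumes x: "x \<in> carrier M" and y: "y \<in> carrier M"
  shows "rep x = rep y \<longleftrightarrow> x \<ominus> y \<in> S"
proof
  assume "rep x = rep y"
  then have "x \<ominus> y = (x \<ominus> rep x) \<ominus> (y \<ominus> rep x)"
    using x y rep(1)[OF x] by algebra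
  then show "x \<ominus> y \<in> S"
    using sub_minus rep(2)[OF x] rep(2)[OF y] \<open>rep x = rep y\<close> by simp
next
  assume xy: "x \<ominus> y \<in> S"
  have "x \<ominus> z \<in> S \<longleftrightarrow> y \<ominus> z \<in> S" if z: "z \<in> carrier M" for z
  proof
    have "y \<ominus> z = (x \<ominus> z) \<ominus> (x \<ominus> y)"
      using x y z by algebra
    then show "x \<ominus> z \<in> S ==> y \<ominus> z \<in> S"
      using sub_minus xy by simp
    have "x \<ominus> z = (y \<ominus> z) \<oplus> (x \<ominus> y)"
      using x y z by algebra
    then show "y \<ominus> z \<in> S ==> x \<ominus> z \<in> S"
      using sub_add xy by simp
  qed
  then show "rep x = rep y"
    unfolding coset_rep_def by (intro arg_cong[where f = Eps] ext) blast
qed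

lemma rep_cong: "x \<in> carrier M ==> y \<in> carrier M ==> x \<ominus> y \<in> S ==> rep x = rep y"
  using rep_eq_iff by blast

lemma rep_add_sub: "s \<in> S ==> y \<in> carrier M ==> rep (s \<oplus> y) = rep y"
proof -
  assume s: "s \<in> S" and y: "y \<in> carrier M"
  then have "s \<in> carrier M"
    using sub by blast
  then have "(s \<oplus> y) \<ominus> y = s"
    using y by algebra
  then show ?thesis
    using s y \<open>s \<in> carrier M\<close> by (intro rep_cong) auto
qed

lemma rep_eqE:
  assumes "rep x = rep y" "x \<in> carrier M" "y \<in> carrier M"
  obtains s where "s \<in> S" "x = s \<oplus> y"
proof (rule that)
  show "x \<ominus> y \<in> S"
    using assms rep_eq_iff by blast
  show "x = (x \<ominus> y) \<oplus> y"
    using assms(2,3) by algebra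
qed

lemma rep_add: "x \<in> carrier M ==> y \<in> carrier M ==> rep (rep x \<oplus> rep y) = rep (x \<oplus> y)"
proof -
  assume m: "x \<in> carrier M" "y \<in> carrier M"
  have "(x \<oplus> y) \<ominus> (rep x \<oplus> rep y) = (x \<ominus> rep x) \<oplus> (y \<ominus> rep y)"
    using m rep(1)[OF m(1)] rep(1)[OF m(2)] by algebra
  then show ?thesis
    using m rep sub_add by (intro rep_cong[symmetric]) auto
qed

lemma rep_smult: "r \<in> carrier R ==> x \<in> carrier M ==> rep (r \<odot> rep x) = rep (r \<odot> x)"
  using rep[of x] sub_smult by (intro rep_cong[symmetric]) (auto simp: smult_minus[symmetric])

lemma rep_hom: "rep \<in> rmod_hom R M (quot_module M S)"
  by (rule rmod_homI) (auto simp: quot_module_def rep_add rep_smult)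

lemma rep_zero_iff: "x \<in> carrier M ==> rep x = \<zero>[quot_module M S] \<longleftrightarrow> x \<in> S"
  unfolding quot_module_def by (simp add: rep_eq_iff minus_eq neg_zero)

lemma rmod_quot: "rmod R (quot_module M S)"
proof -
  have add: "rep x \<oplus>[quot_module M S] rep y = rep (x \<oplus> y)" if "x \<in> carrier M" "y \<in> carrier M" for x y
    using rep_add[OF that] by (simp add: quot_module_def)
  have sm: "r \<odot>[quot_module M S] rep x = rep (r \<odot> x)" if "r \<in> carrier R" "x \<in> carrier M" for r x
    using rep_smult[OF that] by (simp add: quot_module_def)
  have c: "carrier (quot_module M S) = rep ` carrier M" "\<zero>[quot_module M S] = rep \<zero>"
    by (simp_all add: quot_module_def)
  have "abelian_group (quot_module M S)"
  proof (rule abelian_groupI)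
    fix x assume "x \<in> carrier (quot_module M S)"
    then obtain y where "y \<in> carrier M" "x = rep y"
      by (auto simp: c)
    then show "\<exists>y\<in>carrier (quot_module M S). y \<oplus>[quot_module M S] x = \<zero>[quot_module M S]"
      by (intro bexI[of _ "rep (\<ominus> y)"]) (simp_all add: c add l_neg)
  qed (auto simp: c add a_ac)
  then show ?thesis
    by (intro rmodI) (auto simp: c sm add R.ring_axioms smult_add add_smult mult_smult)
qed

lemma quot_lift:
  assumes "rmor R M N f" "\<And>x. x \<in> S ==> f x = \<zero>[N]"
  shows "f \<in> rmod_hom R (quot_module M S) N" "x \<in> carrier M ==> f (rep x) = f x"
proof -
  interpret f: rmor R M N f by fact
  have eq: "f (rep x) = f x" if x: "x \<in> carrier M" for x
  proof -
    have "f x \<ominus>[N] f (rep x) = \<zero>[N]"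
      using f.minus[OF x rep(1)[OF x]] assms(2)[OF rep(2)[OF x]] by simp
    then show ?thesis
      using f.N.minus_eq_zeroD[of "f x" "f (rep x)"] x rep(1) by simp
  qed
  then show "x \<in> carrier M ==> f (rep x) = f x" .
  show "f \<in> rmod_hom R (quot_module M S) N"
    by (rule rmod_homI) (auto simp: quot_module_def eq rep)
qed

end

lemma rmod_hom_smult:
  "h \<in> rmod_hom R M N ==> r \<in> carrier R ==> x \<in> carrier M ==> h (r \<odot>[M] x) = r \<odot>[N] h x"
  by (simp add: rmod_hom_def)

lemma rmorI: "rmod R M ==> rmod R N ==> h \<in> rmod_hom R M N ==> rmor R M N h"
  by (simp add: rmor_def rmor_axioms_def)

lemma (in rmor) submod_image: "submod R N (h ` carrier M)"
proof (intro submod.intro submod_axioms.intro N.rmod_axioms)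
  show "\<zero>[N] \<in> h ` carrier M"
    using zero by (metis M.zero_closed image_eqI)
  show "x \<oplus>[N] y \<in> h ` carrier M" if "x \<in> h ` carrier M" "y \<in> h ` carrier M" for x y
    using that add M.a_closed by (metis (no_types, opaque_lifting) image_iff)
  show "r \<odot>[N] x \<in> h ` carrier M" if "r \<in> carrier R" "x \<in> h ` carrier M" for r x
    using that smult M.smult_closed by (metis (no_types, opaque_lifting) image_iff)
qed auto

lemma (in rmor) submod_kernel: "submod R M {x \<in> carrier M. h x = \<zero>[N]}"
  by (intro submod.intro submod_axioms.intro M.rmod_axioms) auto

context derived_universe
begin

lemma modules_iff: "M \<in> modules Car R \<longleftrightarrow> rmod R M \<and> carrier M \<in> Car"
  by (simp add: modules_def right_module_iff)

lemma modules_copy: "rmod R M ==> small Car (carrier M) ==> copy_module Car M \<in> modules Car R"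
  by (simp add: modules_iff rmod_copy copy_carrier_Car)

lemma modules_subset: "M \<in> modules Car R ==> rmod R N ==> carrier N \<subseteq> carrier M ==> N \<in> modules Car R"
  by (simp add: modules_iff) (use Car_lepoll subset_imp_lepoll in blast)

lemma injective_modulesI:
  assumes E: "E \<in> modules Car R"
    and split: "\<And>V j. V \<in> modules Car R ==> j \<in> rmod_hom R E V ==> inj_on j (carrier E) ==>
      \<exists>r\<in>rmod_hom R V E. \<forall>x\<in>carrier E. r (j x) = x"
  shows "E \<in> injective_modules Car R"
  unfolding injective_modules_def
proof (intro CollectI conjI E ballI impI)
  fix M N g h
  assume MN: "M \<in> modules Car R" "N \<in> modules Car R" and gh: "g \<in> rmod_hom R M N" "h \<in> rmod_hom R M E"
    and inj: "inj_on g (carrier M)"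
  have r: "rmod R M" "rmod R N" "rmod R E"
    using E MN by (auto simp: modules_iff)
  interpret g: rmor R M N g by (rule rmorI[OF r(1,2) gh(1)])
  interpret h: rmor R M E h by (rule rmorI[OF r(1,3) gh(2)])
  let ?P = "module_sum N E"
  have P: "rmod R ?P"
    by (rule rmod_module_sum[OF r(2,3)])
  let ?f = "\<lambda>m. (g m, \<ominus>[E] h m)"
  have "?f \<in> rmod_hom R M ?P"
    by (rule rmod_homI) (auto simp: h.N.minus_add h.N.a_comm h.N.smult_neg)
  then interpret f: rmor R M ?P ?f
    by (rule rmorI[OF r(1) P])
  let ?S = "?f ` carrier M"
  interpret S: submod R ?P ?S by (rule f.submod_image)
  have in1: "(\<lambda>n. (n, \<zero>[E])) \<in> rmod_hom R N ?P" and in2: "(\<lambda>e. (\<zero>[N], e)) \<in> rmod_hom R E ?P"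
    by (rule rmod_homI; simp)+
  let ?Q = "quot_module ?P ?S"
  have small: "small Car (carrier ?P)"
    using E MN by (auto simp: modules_iff intro!: small_Times small_mem)
  have smallQ: "small Car (carrier ?Q)"
    using small_image[OF small] by (simp add: quot_module_def)
  let ?V = "copy_module Car ?Q" and ?t = "to_copy Car ?Q"
  have t: "?t \<in> rmod_hom R ?Q ?V"
    by (rule to_copy_hom[OF S.rmod_quot smallQ])
  let ?j = "\<lambda>e. ?t (S.rep (\<zero>[N], e))"
  have j: "?j \<in> rmod_hom R E ?V"
    by (rule rmod_hom_comp[OF rmod_hom_comp[OF in2 S.rep_hom] t])
  have V: "?V \<in> modules Car R"
    by (rule modules_copy[OF S.rmod_quot smallQ])
  have mem: "S.rep p \<in> carrier ?Q" if "p \<in> carrier ?P" for p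
    using that by (simp add: quot_module_def)
  have t_inj: "p = p'" if "?t p = ?t p'" "p \<in> carrier ?Q" "p' \<in> carrier ?Q" for p p'
    using arg_cong[OF that(1), of "from_copy Car ?Q"] that(2,3) by (simp add: copy_inverse[OF smallQ])
  have "inj_on ?j (carrier E)"
  proof (rule inj_onI)
    fix x y assume xy: "x \<in> carrier E" "y \<in> carrier E" "?j x = ?j y"
    have m: "(\<zero>[N], x) \<in> carrier ?P" "(\<zero>[N], y) \<in> carrier ?P"
      using xy by auto
    have "S.rep (\<zero>[N], x) = S.rep (\<zero>[N], y)"
      by (rule t_inj[OF xy(3) mem[OF m(1)] mem[OF m(2)]])
    then obtain m0 where m0: "m0 \<in> carrier M" "(\<zero>[N], x) = ?f m0 \<oplus>[?P] (\<zero>[N], y)"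
      using S.rep_eqE[OF _ m] by blast
    then have eq: "g m0 = \<zero>[N]" "x = \<ominus>[E] h m0 \<oplus>[E] y"
      using m0 by auto
    then have "m0 = \<zero>[M]"
      using inj_onD[OF inj, of m0 "\<zero>[M]"] m0(1) by simp
    then show "x = y"
      using eq(2) xy(2) by (simp add: h.N.neg_zero)
  qed
  then obtain r where r: "r \<in> rmod_hom R ?V E" "\<And>x. x \<in> carrier E ==> r (?j x) = x"
    using split[OF V j] by blast
  show "\<exists>k\<in>rmod_hom R N E. \<forall>x\<in>carrier M. k (g x) = h x"
  proof (intro bexI ballI)
    show "(\<lambda>n. r (?t (S.rep (n, \<zero>[E])))) \<in> rmod_hom R N E"
      by (rule rmod_hom_comp[OF rmod_hom_comp[OF rmod_hom_comp[OF in1 S.rep_hom] t] r(1)])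
    fix x assume x: "x \<in> carrier M"
    have "S.rep (?f x \<oplus>[?P] (\<zero>[N], h x)) = S.rep (\<zero>[N], h x)"
      by (rule S.rep_add_sub) (use x in auto)
    moreover have "?f x \<oplus>[?P] (\<zero>[N], h x) = (g x, \<zero>[E])"
      using x by (simp add: h.N.l_neg)
    ultimately have "S.rep (g x, \<zero>[E]) = S.rep (\<zero>[N], h x)"
      by simp
    then show "r (?t (S.rep (g x, \<zero>[E]))) = h x"
      using r(2)[of "h x"] x by simp
  qed
qed

lemma projective_modulesI:
  assumes P: "P \<in> modules Car R"
    and split: "\<And>V q. V \<in> modules Car R ==> q \<in> rmod_hom R V P ==> q ` carrier V = carrier P ==>
      \<exists>s\<in>rmod_hom R P V. \<forall>x\<in>carrier P. q (s x) = x"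
  shows "P \<in> projective_modules Car R"
  unfolding projective_modules_def
proof (intro CollectI conjI P ballI impI)
  fix M N g h
  assume MN: "M \<in> modules Car R" "N \<in> modules Car R" and gh: "g \<in> rmod_hom R M N" "h \<in> rmod_hom R P N"
    and surj: "g ` carrier M = carrier N"
  have r: "rmod R M" "rmod R N" "rmod R P"
    using P MN by (auto simp: modules_iff)
  interpret g: rmor R M N g by (rule rmorI[OF r(1,2) gh(1)])
  interpret h: rmor R P N h by (rule rmorI[OF r(3,2) gh(2)])
  let ?D = "module_sum M P"
  let ?S = "{x \<in> carrier ?D. g (fst x) = h (snd x)}"
  interpret S: submod R ?D ?S
    by (intro submod.intro submod_axioms.intro rmod_module_sum r) auto
  let ?W = "?D\<lparr>carrier := ?S\<rparr>"
  have small: "small Car (carrier ?D)"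
    using P MN by (auto simp: modules_iff intro!: small_Times small_mem)
  have smallW: "small Car (carrier ?W)"
    by (rule small_subset[OF small]) auto
  let ?V = "copy_module Car ?W" and ?t = "to_copy Car ?W" and ?b = "from_copy Car ?W"
  have b: "?b \<in> rmod_hom R ?V ?W"
    by (rule from_copy_hom[OF S.rmod_sub smallW])
  have p: "fst \<in> rmod_hom R ?W M" "snd \<in> rmod_hom R ?W P"
    by (rule rmod_homI; auto)+
  have "\<exists>v\<in>carrier ?V. snd (?b v) = y" if y: "y \<in> carrier P" for y
  proof -
    have "h y \<in> g ` carrier M"
      using y surj by simp
    then obtain x where "x \<in> carrier M" "g x = h y"
      by (metis imageE)
    then have "(x, y) \<in> carrier ?W"
      using y by simp
    then show ?thesis
      using copy_inverse[OF smallW, of "(x, y)"] by (intro bexI[of _ "?t (x, y)"]) (auto simp: copy_carrier)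
  qed
  then have "(\<lambda>v. snd (?b v)) ` carrier ?V = carrier P"
    using rmod_hom_comp[OF b p(2)] by (auto simp: rmod_hom_def)
  then obtain s where s: "s \<in> rmod_hom R P ?V" "\<And>x. x \<in> carrier P ==> snd (?b (s x)) = x"
    using split[OF modules_copy[OF S.rmod_sub smallW] rmod_hom_comp[OF b p(2)]] by blast
  show "\<exists>k\<in>rmod_hom R P M. \<forall>x\<in>carrier P. g (k x) = h x"
  proof (intro bexI ballI)
    show "(\<lambda>x. fst (?b (s x))) \<in> rmod_hom R P M"
      by (rule rmod_hom_comp[OF rmod_hom_comp[OF s(1) b] p(1)])
    fix x assume x: "x \<in> carrier P"
    have "?b (s x) \<in> carrier ?W"
      using x s(1) b by (auto simp: rmod_hom_def)
    then show "g (fst (?b (s x))) = h x"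
      using s(2)[OF x] by simp
  qed
qed

lemma injective_extend:
  "E \<in> injective_modules Car R ==> M \<in> modules Car R ==> N \<in> modules Car R ==>
    g \<in> rmod_hom R M N ==> h \<in> rmod_hom R M E ==> inj_on g (carrier M) ==>
    \<exists>k\<in>rmod_hom R N E. \<forall>x\<in>carrier M. k (g x) = h x"
  unfolding injective_modules_def by simp

lemma injective_split:
  assumes "E \<in> injective_modules Car R" "V \<in> modules Car R" "j \<in> rmod_hom R E V" "inj_on j (carrier E)"
  obtains r where "r \<in> rmod_hom R V E" "\<And>x. x \<in> carrier E ==> r (j x) = x"
proof -
  have E: "E \<in> modules Car R"
    using assms(1) unfolding injective_modules_def by simp
  show thesis
    using injective_extend[OF assms(1) E assms(2,3) rmod_hom_id assms(4)] that by auto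
qed

lemma projective_split:
  assumes "P \<in> projective_modules Car R" "V \<in> modules Car R" "q \<in> rmod_hom R V P"
    "q ` carrier V = carrier P"
  obtains s where "s \<in> rmod_hom R P V" "\<And>x. x \<in> carrier P ==> q (s x) = x"
proof -
  have P: "P \<in> modules Car R" "\<And>M N g h. M \<in> modules Car R ==> N \<in> modules Car R ==>
      g \<in> rmod_hom R M N ==> h \<in> rmod_hom R P N ==> g ` carrier M = carrier N ==>
      \<exists>k\<in>rmod_hom R P M. \<forall>x\<in>carrier P. g (k x) = h x"
    using assms(1) unfolding projective_modules_def by simp_all
  show thesis
    using P(2)[OF assms(2) P(1) assms(3) rmod_hom_id assms(4)] that by auto
qed

lemma small_singleton: "small Car {a}"
proof -
  interpret R: ring R by (rule ring_R)
  show ?thesis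
    by (rule small_lepoll[OF small_ring])
      (auto simp: lepoll_def intro!: exI[of _ "\<lambda>_. \<one>[R]"])
qed

text \<open>A finitely supported function is encoded by a sequence enumerating its graph.\<close>

lemma small_finite_support:
  assumes "small Car X" "small Car Y"
  shows "small Car {f \<in> PiE X (\<lambda>_. Y). finite {x \<in> X. f x \<noteq> z}}" (is "small Car ?F")
proof (cases "X = {}")
  case True
  then have "?F \<subseteq> {\<lambda>_. undefined}"
    by auto
  then show ?thesis
    by (rule small_subset[OF small_singleton])
next
  case False
  then obtain x0 where x0: "x0 \<in> X" by blast
  define G where "G f = (\<lambda>x. (x, f x)) ` insert x0 {x \<in> X. f x \<noteq> z}" for f
  have range: "range (from_nat_into (G f)) = G f" if "f \<in> ?F" for f
    by (rule range_from_nat_into) (use that in \<open>auto simp: G_def intro: countable_finite\<close>)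
  have val: "p x = q x" if "p x \<noteq> z" "x \<in> X" "G p = G q" for p q x
  proof -
    have "(x, p x) \<in> G q"
      unfolding that(3)[symmetric] using that(1,2) by (simp add: G_def)
    then show ?thesis
      by (auto simp: G_def)
  qed
  have "inj_on (\<lambda>f. from_nat_into (G f)) ?F"
  proof (rule inj_onI)
    fix f g assume fg: "f \<in> ?F" "g \<in> ?F" "from_nat_into (G f) = from_nat_into (G g)"
    from fg(3) have "range (from_nat_into (G f)) = range (from_nat_into (G g))"
      by (rule arg_cong)
    then have eq: "G f = G g"
      unfolding range[OF fg(1)] range[OF fg(2)] .
    have "f x = g x" if "x \<in> X" for x
    proof (cases "f x = z")
      case False
      then show ?thesis by (rule val[OF _ that eq])
    next
      case True
      then show ?thesis
        using val[of g x f] that eq by (cases "g x = z") auto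
    qed
    then show "f = g"
      using fg by (intro PiE_ext[of f X "\<lambda>_. Y" g]) auto
  qed
  moreover have "(\<lambda>f. from_nat_into (G f)) ` ?F \<subseteq> PiE UNIV (\<lambda>_. X \<times> Y)"
  proof (rule image_subsetI)
    fix f assume f: "f \<in> ?F"
    have "G f \<subseteq> X \<times> Y"
      using f x0 by (auto simp: G_def)
    then show "from_nat_into (G f) \<in> PiE UNIV (\<lambda>_. X \<times> Y)"
      using range[OF f] by auto
  qed
  ultimately have "?F \<lesssim> PiE (UNIV :: nat set) (\<lambda>_. X \<times> Y)"
    unfolding lepoll_def by blast
  moreover obtain J where "J \<in> Idx" "(UNIV :: nat set) \<lesssim> J"
    using countable_Idx by blast
  ultimately show ?thesis
    using small_lepoll small_funs small_Times[OF assms] by blast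
qed

lemma enough_projectives:
  assumes M: "M \<in> modules Car R"
  obtains F q where "F \<in> projective_modules Car R" "q \<in> rmod_hom R F M" "q ` carrier F = carrier M"
proof -
  interpret M: rmod R M
    using M by (simp add: modules_iff)
  let ?A = "\<lambda>_ :: 'u. regular_module R"
  let ?W = "sum_module (carrier M) ?A"
  interpret W: module_family R "carrier M" ?A
    by (intro module_family.intro regular_rmod ring_R)
  have sm: "small Car (carrier ?W)"
    using small_finite_support[OF small_mem small_ring, of "carrier M"] M
    by (simp add: modules_iff sum_module_simps)
  let ?F = "copy_module Car ?W" and ?t = "to_copy Car ?W" and ?b = "from_copy Car ?W"
  have b: "?b \<in> rmod_hom R ?F ?W" and t: "?t \<in> rmod_hom R ?W ?F"
    by (rule from_copy_hom[OF W.rmod_sum sm], rule to_copy_hom[OF W.rmod_sum sm])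
  have elt: "\<exists>f. f \<in> rmod_hom R ?W N \<and> (\<forall>x\<in>carrier M. f (sum_inc (carrier M) ?A x \<one>[R]) = n x)"
    if N: "rmod R N" and n: "\<And>x. x \<in> carrier M ==> n x \<in> carrier N" for N :: "('r, 'u) module" and n
  proof -
    interpret N: rmod R N by fact
    have "(\<lambda>r. r \<odot>[N] n x) \<in> rmod_hom R (?A x) N" if "x \<in> carrier M" for x
      using n[OF that] by (intro rmod_homI) (auto simp: N.add_smult N.mult_smult)
    then obtain f where "f \<in> rmod_hom R ?W N"
      "\<And>x r. x \<in> carrier M ==> r \<in> carrier (?A x) ==> f (sum_inc (carrier M) ?A x r) = r \<odot>[N] n x"
      using W.sum_hom_exists[of "\<lambda>x r. r \<odot>[N] n x" N, OF _ N] by blast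
    then show ?thesis
      using n by (intro exI[of _ f]) simp
  qed
  have inc1: "sum_inc (carrier M) ?A x \<one>[R] \<in> carrier ?W" if "x \<in> carrier M" for x
    using W.sum_inc_closed[OF that, of "\<one>[R]"] M.R.one_closed by simp
  have F: "?F \<in> projective_modules Car R"
  proof (rule projective_modulesI)
    show "?F \<in> modules Car R"
      by (rule modules_copy[OF W.rmod_sum sm])
    fix V q assume V: "V \<in> modules Car R" and q: "q \<in> rmod_hom R V ?F" and surj: "q ` carrier V = carrier ?F"
    let ?e = "\<lambda>x. ?t (sum_inc (carrier M) ?A x \<one>[R])"
    have rV: "rmod R V"
      using V by (simp add: modules_iff)
    have "\<exists>v. v \<in> carrier V \<and> q v = ?e x" if "x \<in> carrier M" for x
    proof -
      have "?e x \<in> q ` carrier V"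
        unfolding surj copy_carrier by (rule imageI[OF inc1[OF that]])
      then obtain v where "?e x = q v" "v \<in> carrier V" by (rule imageE)
      then show ?thesis by (intro exI[of _ v]) simp
    qed
    then obtain v where v: "\<And>x. x \<in> carrier M ==> v x \<in> carrier V" "\<And>x. x \<in> carrier M ==> q (v x) = ?e x"
      by metis
    obtain f where f: "f \<in> rmod_hom R ?W V" "\<And>x. x \<in> carrier M ==> f (sum_inc (carrier M) ?A x \<one>[R]) = v x"
      using elt[of V v] rV v(1) by blast
    have fb: "(\<lambda>y. f (?b y)) \<in> rmod_hom R ?F V"
      by (rule rmod_hom_comp[OF b f(1)])
    have qf: "q (f w) = ?t w" if w: "w \<in> carrier ?W" for w
    proof (rule W.sum_hom_unique[OF rmod_hom_comp[OF f(1) q] t rmod_copy[OF W.rmod_sum sm] _ w])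
      fix x r assume x: "x \<in> carrier M" and "r \<in> carrier (?A x)"
      then have r: "r \<in> carrier R"
        by simp
      have "sum_inc (carrier M) ?A x (r \<odot>[?A x] \<one>[R]) = r \<odot>[?W] sum_inc (carrier M) ?A x \<one>[R]"
        by (rule rmod_hom_smult[OF W.sum_inc_hom[OF x] r]) simp
      then have e: "sum_inc (carrier M) ?A x r = r \<odot>[?W] sum_inc (carrier M) ?A x \<one>[R]"
        using r by simp
      have "q (f (sum_inc (carrier M) ?A x r)) = r \<odot>[?F] q (f (sum_inc (carrier M) ?A x \<one>[R]))"
        unfolding e by (rule rmod_hom_smult[OF rmod_hom_comp[OF f(1) q] r inc1[OF x]])
      also have "\<dots> = r \<odot>[?F] ?e x"
        by (simp add: f(2)[OF x] v(2)[OF x])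
      also have "\<dots> = ?t (sum_inc (carrier M) ?A x r)"
        unfolding e by (rule rmod_hom_smult[OF t r inc1[OF x], symmetric])
      finally show "q (f (sum_inc (carrier M) ?A x r)) = ?t (sum_inc (carrier M) ?A x r)" .
    qed
    have "q (f (?b y)) = y" if "y \<in> carrier ?F" for y
      using that qf unfolding copy_carrier by (auto simp: copy_inverse[OF sm])
    then show "\<exists>s\<in>rmod_hom R ?F V. \<forall>x\<in>carrier ?F. q (s x) = x"
      by (intro bexI[OF _ fb] ballI)
  qed
  obtain f where f: "f \<in> rmod_hom R ?W M" "\<And>x. x \<in> carrier M ==> f (sum_inc (carrier M) ?A x \<one>[R]) = x"
    using elt[of M "\<lambda>x. x"] M.rmod_axioms by blast
  have q: "(\<lambda>y. f (?b y)) \<in> rmod_hom R ?F M"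
    by (rule rmod_hom_comp[OF b f(1)])
  have "x \<in> (\<lambda>y. f (?b y)) ` carrier ?F" if "x \<in> carrier M" for x
    using inc1[OF that] copy_inverse[OF sm inc1[OF that]] f(2)[OF that]
    unfolding copy_carrier image_image by (intro image_eqI[of _ _ "sum_inc (carrier M) ?A x \<one>[R]"]) auto
  then have "(\<lambda>y. f (?b y)) ` carrier ?F = carrier M"
    using q by (auto simp: rmod_hom_def)
  then show thesis
    using that F q by blast
qed

end

section \<open>Coinduced modules\<close>

definition coinduced :: "('s, 'd) ring_scheme => ('r, 'c) ring_scheme => ('s => 'r) => ('s, 'm) module
    => ('r, 'r => 'm) module" where
  "coinduced B A \<phi> E = \<lparr>carrier = {g \<in> extensional (carrier A). g \<in> carrier A \<rightarrow> carrier E \<and>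
      (\<forall>x\<in>carrier A. \<forall>y\<in>carrier A. g (x \<oplus>[A] y) = g x \<oplus>[E] g y) \<and>
      (\<forall>x\<in>carrier A. \<forall>r\<in>carrier B. g (x \<otimes>[A] \<phi> r) = r \<odot>[E] g x)},
    mult = undefined, one = undefined, zero = (\<lambda>x\<in>carrier A. \<zero>[E]),
    add = (\<lambda>g h. \<lambda>x\<in>carrier A. g x \<oplus>[E] h x), smult = (\<lambda>a g. \<lambda>x\<in>carrier A. g (a \<otimes>[A] x))\<rparr>"

context scalar_restriction
begin

lemma coinduced_rmod:
  assumes "rmod B E"
  shows "rmod A (coinduced B A \<phi> E)"
proof -
  interpret E: rmod B E by fact
  interpret A': ring A by (rule A.ring_R)
  have "abelian_group (coinduced B A \<phi> E)"
  proof (rule abelian_groupI)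
    fix g assume g: "g \<in> carrier (coinduced B A \<phi> E)"
    show "\<exists>h\<in>carrier (coinduced B A \<phi> E). h \<oplus>[coinduced B A \<phi> E] g = \<zero>[coinduced B A \<phi> E]"
      using g by (intro bexI[of _ "\<lambda>x\<in>carrier A. \<ominus>[E] g x"])
        (auto simp: coinduced_def E.l_neg E.r_neg E.minus_add E.a_comm E.smult_neg Pi_iff intro!: restrict_ext)
  qed (auto simp: coinduced_def Pi_iff E.a_ac E.smult_add intro!: restrict_ext extensionalityI[of _ "carrier A"])
  then show ?thesis
    by (intro rmodI A.ring_R)
      (auto simp: coinduced_def Pi_iff A'.l_distr A'.r_distr A'.m_assoc[symmetric] E.a_ac
        intro!: restrict_ext extensionalityI[of _ "carrier A"])
qed

lemma coinduced_injective:
  assumes E: "E \<in> injective_modules Car B"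
    and fin: "finite T" "T \<subseteq> carrier A"
    and gen: "\<And>U. T \<subseteq> U ==> U \<subseteq> carrier A ==> (\<And>x y. x \<in> U ==> y \<in> U ==> x \<oplus>[A] y \<in> U) ==>
      (\<And>x r. x \<in> U ==> r \<in> carrier B ==> x \<otimes>[A] \<phi> r \<in> U) ==> U = carrier A"
    and N: "N \<in> modules Car A" and f: "f \<in> rmod_hom B (restrict_scalars \<phi> N) E"
    and inj: "inj_on f (carrier N)"
  obtains J j where "J \<in> injective_modules Car A" "j \<in> rmod_hom A N J" "inj_on j (carrier N)"
proof -
  have E': "E \<in> modules Car B"
    using E unfolding injective_modules_def by blast
  then have E'': "rmod B E" "carrier E \<in> Car"
    by (simp_all add: B.modules_iff)
  interpret A': ring A by (rule A.ring_R)
  interpret N: rmod A N using N by (simp add: A.modules_iff)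
  let ?C = "coinduced B A \<phi> E"
  note C = coinduced_rmod[OF E''(1)]
  have Cmem: "g \<in> extensional (carrier A)" "x \<in> carrier A ==> g x \<in> carrier E"
    "x \<in> carrier A ==> y \<in> carrier A ==> g (x \<oplus>[A] y) = g x \<oplus>[E] g y"
    "x \<in> carrier A ==> r \<in> carrier B ==> g (x \<otimes>[A] \<phi> r) = r \<odot>[E] g x"
    if "g \<in> carrier ?C" for g x y r
    using that by (auto simp: coinduced_def)
  have "inj_on (\<lambda>g. restrict g T) (carrier ?C)"
  proof (rule inj_onI)
    fix g h assume gh: "g \<in> carrier ?C" "h \<in> carrier ?C" "restrict g T = restrict h T"
    have "{x \<in> carrier A. g x = h x} = carrier A"
    proof (rule gen)
      show "T \<subseteq> {x \<in> carrier A. g x = h x}"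
        using fin(2) gh(3) by (auto simp: restrict_def fun_eq_iff) metis
    qed (auto simp: Cmem[OF gh(1)] Cmem[OF gh(2)])
    then show "g = h"
      using Cmem(1) gh(1,2) by (intro extensionalityI[of _ "carrier A"]) blast+
  qed
  moreover have "(\<lambda>g. restrict g T) ` carrier ?C \<subseteq> PiE T (\<lambda>_. carrier E)"
    using fin(2) Cmem(2) by auto
  ultimately have "carrier ?C \<lesssim> PiE T (\<lambda>_. carrier E)"
    unfolding lepoll_def by blast
  moreover obtain I where "I \<in> Idx" "T \<lesssim> I"
    using A.finite_Idx[OF fin(1)] by blast
  ultimately have sm: "small Car (carrier ?C)"
    using small_lepoll A.small_funs small_mem[OF E''(2)] by blast
  let ?J = "copy_module Car ?C" and ?t = "to_copy Car ?C" and ?b = "from_copy Car ?C"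
  have t: "?t \<in> rmod_hom A ?C ?J" and b: "?b \<in> rmod_hom A ?J ?C"
    by (rule A.to_copy_hom[OF C sm], rule A.from_copy_hom[OF C sm])
  have bC: "?b y \<in> carrier ?C" "?t (?b y) = y" if "y \<in> carrier ?J" for y
    using that by (auto simp: A.copy_carrier A.copy_inverse[OF sm])
  have coext: "(\<lambda>n. \<lambda>x\<in>carrier A. k (x \<odot>[L] n)) \<in> rmod_hom A L ?C"
    if L: "rmod A L" and k: "k \<in> rmod_hom B (restrict_scalars \<phi> L) E" for L :: "('r, 'u) module" and k
  proof -
    interpret L: rmod A L by fact
    have k': "n \<in> carrier L ==> k n \<in> carrier E"
      "n \<in> carrier L ==> m \<in> carrier L ==> k (n \<oplus>[L] m) = k n \<oplus>[E] k m"
      "n \<in> carrier L ==> r \<in> carrier B ==> k (\<phi> r \<odot>[L] n) = r \<odot>[E] k n" for n m r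
      using k by (auto simp: rmod_hom_def)
    show ?thesis
      by (rule rmod_homI)
        (auto simp: coinduced_def k' L.smult_add L.add_smult L.mult_smult intro!: restrict_ext)
  qed
  have "?J \<in> injective_modules Car A"
    unfolding injective_modules_def
  proof (intro CollectI conjI ballI impI A.modules_copy[OF C sm])
    fix M L g h
    assume M: "M \<in> modules Car A" and L: "L \<in> modules Car A" and g: "g \<in> rmod_hom A M L"
      and h: "h \<in> rmod_hom A M ?J" and inj: "inj_on g (carrier M)"
    have rm: "rmod A M" "rmod A L"
      using M L by (simp_all add: A.modules_iff)
    interpret M: rmod A M by (rule rm)
    let ?e = "\<lambda>m. ?b (h m) \<one>[A]"
    have bh: "(\<lambda>m. ?b (h m)) \<in> rmod_hom A M ?C"
      by (rule rmod_hom_comp[OF h b])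
    have bhm: "?b (h m) \<in> carrier ?C" if "m \<in> carrier M" for m
      using bh that by (auto simp: rmod_hom_def)
    have sm1: "?b (h (a \<odot>[M] m)) = (\<lambda>x\<in>carrier A. ?b (h m) (a \<otimes>[A] x))" if "a \<in> carrier A" "m \<in> carrier M" for a m
      using rmod_hom_smult[OF bh that] by (simp add: coinduced_def)
    have "?e \<in> rmod_hom B (restrict_scalars \<phi> M) E"
    proof (rule rmod_homI)
      show "?e (x \<oplus>[restrict_scalars \<phi> M] y) = ?e x \<oplus>[E] ?e y"
        if "x \<in> carrier (restrict_scalars \<phi> M)" "y \<in> carrier (restrict_scalars \<phi> M)" for x y
        using bh that by (simp add: rmod_hom_def coinduced_def)
      show "?e (r \<odot>[restrict_scalars \<phi> M] x) = r \<odot>[E] ?e x"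
        if "r \<in> carrier B" "x \<in> carrier (restrict_scalars \<phi> M)" for r x
        using that Cmem(4)[OF bhm, of x "\<one>[A]" r] by (simp add: sm1)
    qed (use bhm Cmem(2) in auto)
    moreover have "restrict_scalars \<phi> M \<in> modules Car B" "restrict_scalars \<phi> L \<in> modules Car B"
      using M L rmod_restrict by (auto simp: A.modules_iff B.modules_iff)
    ultimately obtain k where k: "k \<in> rmod_hom B (restrict_scalars \<phi> L) E" "\<And>m. m \<in> carrier M ==> k (g m) = ?e m"
      using B.injective_extend[OF E _ _ hom_restrict[OF g], of ?e] inj by auto
    show "\<exists>k\<in>rmod_hom A L ?J. \<forall>x\<in>carrier M. k (g x) = h x"
    proof (intro bexI ballI)
      show "(\<lambda>n. ?t (\<lambda>x\<in>carrier A. k (x \<odot>[L] n))) \<in> rmod_hom A L ?J"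
        by (rule rmod_hom_comp[OF coext[OF rm(2) k(1)] t])
      fix m assume m: "m \<in> carrier M"
      have "(\<lambda>x\<in>carrier A. k (x \<odot>[L] g m)) = ?b (h m)"
        using m Cmem(1)[OF bhm[OF m]]
        by (intro extensionalityI[of _ "carrier A"]) (simp_all add: rmod_hom_smult[OF g, symmetric] k(2) sm1)
      then show "?t (\<lambda>x\<in>carrier A. k (x \<odot>[L] g m)) = h m"
        using bC(2) h m by (simp add: rmod_hom_def Pi_iff)
    qed
  qed
  moreover have "(\<lambda>n. ?t (\<lambda>x\<in>carrier A. f (x \<odot>[N] n))) \<in> rmod_hom A N ?J"
    by (rule rmod_hom_comp[OF coext[OF N.rmod_axioms f] t])
  moreover have "inj_on (\<lambda>n. ?t (\<lambda>x\<in>carrier A. f (x \<odot>[N] n))) (carrier N)"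
  proof (rule inj_onI)
    fix n m assume nm: "n \<in> carrier N" "m \<in> carrier N"
      "?t (\<lambda>x\<in>carrier A. f (x \<odot>[N] n)) = ?t (\<lambda>x\<in>carrier A. f (x \<odot>[N] m))"
    have c: "(\<lambda>x\<in>carrier A. f (x \<odot>[N] n)) \<in> carrier ?C" "(\<lambda>x\<in>carrier A. f (x \<odot>[N] m)) \<in> carrier ?C"
      using coext[OF N.rmod_axioms f] nm(1,2) by (auto simp: rmod_hom_def Pi_iff)
    have "(\<lambda>x\<in>carrier A. f (x \<odot>[N] n)) = (\<lambda>x\<in>carrier A. f (x \<odot>[N] m))"
      using arg_cong[OF nm(3), of ?b] A.copy_inverse[OF sm c(1)] A.copy_inverse[OF sm c(2)] by simp
    from fun_cong[OF this, of "\<one>[A]"] have "f n = f m"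
      using nm by simp
    then show "n = m"
      using inj nm by (simp add: inj_on_def)
  qed
  ultimately show thesis
    using that by blast
qed

end


section \<open>Linear algebra over a field\<close>

definition scalar_ring :: "'k::field ring" where
  "scalar_ring = \<lparr>carrier = UNIV, mult = (*), one = 1, zero = 0, add = (+)\<rparr>"

lemma scalar_ring_simps [simp]:
  "carrier scalar_ring = UNIV" "\<one>[scalar_ring] = 1" "\<zero>[scalar_ring] = 0"
  "x \<otimes>[scalar_ring] y = x * y" "x \<oplus>[scalar_ring] y = x + y"
  unfolding scalar_ring_def by simp_all

lemma complement_exists:
  fixes V :: "('k::field, 'm) module"
  assumes S: "submod scalar_ring V S"
  obtains T where "submod scalar_ring V T" "S \<inter> T = {\<zero>[V]}"
    "\<And>x. x \<in> carrier V ==> \<exists>s\<in>S. \<exists>t\<in>T. x = s \<oplus>[V] t"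
proof -
  interpret S: submod scalar_ring V S by fact
  let ?A = "{T. submod scalar_ring V T \<and> S \<inter> T = {\<zero>[V]}}"
  have sub: "submod scalar_ring V T \<longleftrightarrow> T \<subseteq> carrier V \<and> \<zero>[V] \<in> T \<and> (\<forall>x\<in>T. \<forall>y\<in>T. x \<oplus>[V] y \<in> T) \<and>
      (\<forall>r. \<forall>x\<in>T. r \<odot>[V] x \<in> T)" for T
    using S.rmod_axioms by (auto simp: submod_def submod_axioms_def)
  have "\<exists>T\<in>?A. \<forall>X\<in>?A. T \<subseteq> X \<longrightarrow> X = T"
  proof (rule subset_Zorn_nonempty)
    have "submod scalar_ring V {\<zero>[V]}"
      unfolding sub by simp
    then show "?A \<noteq> {}"
      using S.sub_zero by blast
    fix \<C> assume \<C>: "\<C> \<noteq> {}" "subset.chain ?A \<C>"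
    then have mem: "\<And>T. T \<in> \<C> ==> submod scalar_ring V T \<and> S \<inter> T = {\<zero>[V]}"
      by (auto simp: subset.chain_def)
    have "x \<oplus>[V] y \<in> \<Union>\<C>" if "x \<in> T" "T \<in> \<C>" "y \<in> U" "U \<in> \<C>" for x y T U
    proof -
      have "T \<subseteq> U \<or> U \<subseteq> T"
        using \<C>(2) that by (auto simp: subset.chain_def)
      then show ?thesis
        using that mem[unfolded sub] by blast
    qed
    note add = this
    have "submod scalar_ring V (\<Union>\<C>)"
      unfolding sub
    proof (intro conjI ballI allI)
      show "x \<oplus>[V] y \<in> \<Union>\<C>" if "x \<in> \<Union>\<C>" "y \<in> \<Union>\<C>" for x y
        using that add by blast
      show "r \<odot>[V] x \<in> \<Union>\<C>" if "x \<in> \<Union>\<C>" for r x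
        using that mem[unfolded sub] by blast
    qed (use mem[unfolded sub] \<C>(1) in blast)+
    moreover have "S \<inter> \<Union>\<C> = {\<zero>[V]}"
      using mem \<C>(1) by blast
    ultimately show "\<Union>\<C> \<in> ?A"
      by blast
  qed
  then obtain T where T: "submod scalar_ring V T" "S \<inter> T = {\<zero>[V]}"
      and max': "\<forall>X\<in>?A. T \<subseteq> X \<longrightarrow> X = T"
    by (elim bexE CollectE conjE)
  have max: "X = T" if "submod scalar_ring V X" "S \<inter> X = {\<zero>[V]}" "T \<subseteq> X" for X
    by (rule bspec[OF max', THEN mp, OF _ that(3)]) (simp add: that)
  interpret T: submod scalar_ring V T by fact
  have "\<exists>s\<in>S. \<exists>t\<in>T. x = s \<oplus>[V] t" if x: "x \<in> carrier V" for x
  proof (rule ccontr)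
    assume no: "\<not> ?thesis"
    let ?X = "{t \<oplus>[V] c \<odot>[V] x | t c. t \<in> T}"
    have Tc: "t \<in> T ==> t \<in> carrier V" and Sc: "s \<in> S ==> s \<in> carrier V" for t s
      using T.sub S.sub by auto
    have cx: "c \<odot>[V] x \<in> carrier V" for c
      using x by (intro S.smult_closed) auto
    have "submod scalar_ring V ?X"
      unfolding sub
    proof (intro conjI ballI allI)
      show "?X \<subseteq> carrier V"
        using Tc cx by auto
      show "\<zero>[V] \<in> ?X"
        using S.zero_smult[OF x] T.sub_zero by (auto intro!: exI[of _ "\<zero>[V]"] exI[of _ 0])
      fix u assume "u \<in> ?X"
      then obtain t c where u: "u = t \<oplus>[V] c \<odot>[V] x" "t \<in> T" by blast
      show "r \<odot>[V] u \<in> ?X" for r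
        using S.smult_add[of r t "c \<odot>[V] x"] S.mult_smult[of c r x] T.sub_smult[of r t] x u Tc cx
        by (intro CollectI exI[of _ "r \<odot>[V] t"] exI[of _ "c * r"]) simp
      fix v assume "v \<in> ?X"
      then obtain t' c' where v: "v = t' \<oplus>[V] c' \<odot>[V] x" "t' \<in> T" by blast
      have "u \<oplus>[V] v = (t \<oplus>[V] t') \<oplus>[V] (c \<odot>[V] x \<oplus>[V] c' \<odot>[V] x)"
        unfolding u v using Tc[OF u(2)] Tc[OF v(2)] cx[of c] cx[of c'] by (simp add: S.a_ac)
      then show "u \<oplus>[V] v \<in> ?X"
        using S.add_smult[of c c' x] x T.sub_add[OF u(2) v(2)]
        by (intro CollectI exI[of _ "t \<oplus>[V] t'"] exI[of _ "c + c'"]) simp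
    qed
    moreover have "S \<inter> ?X = {\<zero>[V]}"
    proof (rule ccontr)
      assume "S \<inter> ?X \<noteq> {\<zero>[V]}"
      moreover have "\<zero>[V] \<in> S \<inter> ?X"
        using S.sub_zero S.zero_smult[OF x] T.sub_zero by (auto intro!: exI[of _ "\<zero>[V]"] exI[of _ 0])
      ultimately obtain t c where s: "t \<oplus>[V] c \<odot>[V] x \<in> S" "t \<in> T" "t \<oplus>[V] c \<odot>[V] x \<noteq> \<zero>[V]"
        by blast
      have c: "c \<noteq> 0"
      proof
        assume "c = 0"
        then have "t \<oplus>[V] c \<odot>[V] x = t"
          using S.zero_smult[OF x] Tc[OF s(2)] by simp
        then show False
          using s T(2) by auto
      qed
      let ?s = "t \<oplus>[V] c \<odot>[V] x" and ?d = "inverse c"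
      have "c \<odot>[V] x = ?s \<oplus>[V] \<ominus>[V] t"
        using Tc[OF s(2)] cx[of c] by (simp add: S.a_ac S.r_neg1 S.r_neg2)
      then have "?d \<odot>[V] (c \<odot>[V] x) = ?d \<odot>[V] ?s \<oplus>[V] ?d \<odot>[V] (\<ominus>[V] t)"
        using S.smult_add[of ?d ?s "\<ominus>[V] t"] Tc[OF s(2)] cx[of c] by simp
      moreover have "?d \<odot>[V] (c \<odot>[V] x) = x"
        using S.mult_smult[of c ?d x] S.one_smult[OF x] x c by simp
      ultimately show False
        using no S.sub_smult[OF _ s(1), of ?d] T.sub_smult[OF _ T.sub_neg[OF s(2)], of ?d] by auto
    qed
    moreover have "T \<subseteq> ?X"
    proof
      fix t assume t: "t \<in> T"
      then have "t = t \<oplus>[V] 0 \<odot>[V] x"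
        using S.zero_smult[OF x] Tc by simp
      then show "t \<in> ?X"
        using t by blast
    qed
    ultimately have "?X = T"
      by (rule max)
    moreover have "x \<in> ?X"
      using S.one_smult[OF x] x T.sub_zero by (auto intro!: exI[of _ "\<zero>[V]"] exI[of _ 1])
    ultimately have "x \<in> T" by simp
    then have "\<zero>[V] \<in> S \<and> x \<in> T \<and> x = \<zero>[V] \<oplus>[V] x"
      using x S.sub_zero by simp
    then show False
      using no by blast
  qed
  then show thesis
    using that[OF T] by blast
qed

lemma linear_retraction:
  assumes "rmor scalar_ring V W j" "inj_on j (carrier V)"
  obtains r where "r \<in> rmod_hom scalar_ring W V" "\<And>x. x \<in> carrier V ==> r (j x) = x"
proof -
  interpret j: rmor scalar_ring V W j by fact
  obtain T where T: "submod scalar_ring W T" "j ` carrier V \<inter> T = {\<zero>[W]}"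
      "\<And>x. x \<in> carrier W ==> \<exists>s\<in>j ` carrier V. \<exists>t\<in>T. x = s \<oplus>[W] t"
    using complement_exists[OF j.submod_image] by blast
  interpret T: submod scalar_ring W T by fact
  have Tc: "t \<in> T ==> t \<in> carrier W" for t
    using T.sub by blast
  have "\<exists>v. v \<in> carrier V \<and> (\<exists>t\<in>T. x = j v \<oplus>[W] t)" if "x \<in> carrier W" for x
    using T(3)[OF that] by blast
  then obtain r where r: "\<And>x. x \<in> carrier W ==> r x \<in> carrier V"
      "\<And>x. x \<in> carrier W ==> \<exists>t\<in>T. x = j (r x) \<oplus>[W] t"
    by metis
  have uniq: "r x = v" if v: "v \<in> carrier V" "t \<in> T" "x = j v \<oplus>[W] t" for x v t
  proof -
    have x: "x \<in> carrier W"
      using v Tc by auto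
    obtain t' where t': "t' \<in> T" "x = j (r x) \<oplus>[W] t'"
      using r(2)[OF x] by blast
    have c: "j v \<in> carrier W" "j (r x) \<in> carrier W" "t \<in> carrier W" "t' \<in> carrier W"
      using v t' Tc r(1)[OF x] by auto
    have "j v \<ominus>[W] j (r x) = (j v \<oplus>[W] t) \<ominus>[W] j (r x) \<ominus>[W] t"
      using c by algebra
    also have "\<dots> = (j (r x) \<oplus>[W] t') \<ominus>[W] j (r x) \<ominus>[W] t"
      using v(3) t'(2) by simp
    also have "\<dots> = t' \<ominus>[W] t"
      using c by algebra
    finally have "j (v \<ominus>[V] r x) = t' \<ominus>[W] t"
      using v(1) r(1)[OF x] by simp
    then have "j (v \<ominus>[V] r x) \<in> T"
      using T.sub_minus[OF t'(1) v(2)] by simp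
    then have "j (v \<ominus>[V] r x) \<in> j ` carrier V \<inter> T"
      using v(1) r(1)[OF x] by blast
    then have "j (v \<ominus>[V] r x) = j \<zero>[V]"
      using T(2) by simp
    then have "v \<ominus>[V] r x = \<zero>[V]"
      by (rule inj_onD[OF assms(2)]) (use v(1) r(1)[OF x] in auto)
    then show ?thesis
      using j.M.minus_eq_zeroD v(1) r(1)[OF x] by metis
  qed
  have "r \<in> rmod_hom scalar_ring W V"
  proof (rule rmod_homI)
    fix x y assume x: "x \<in> carrier W" and y: "y \<in> carrier W"
    obtain t where t: "t \<in> T" "x = j (r x) \<oplus>[W] t" using r(2)[OF x] by blast
    obtain u where u: "u \<in> T" "y = j (r y) \<oplus>[W] u" using r(2)[OF y] by blast
    have c: "j (r x) \<in> carrier W" "j (r y) \<in> carrier W" "t \<in> carrier W" "u \<in> carrier W"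
      using t u Tc r(1)[OF x] r(1)[OF y] by auto
    have "x \<oplus>[W] y = (j (r x) \<oplus>[W] t) \<oplus>[W] (j (r y) \<oplus>[W] u)"
      using t u by simp
    also have "\<dots> = (j (r x) \<oplus>[W] j (r y)) \<oplus>[W] (t \<oplus>[W] u)"
      using c by algebra
    also have "j (r x) \<oplus>[W] j (r y) = j (r x \<oplus>[V] r y)"
      using r(1)[OF x] r(1)[OF y] by simp
    finally show "r (x \<oplus>[W] y) = r x \<oplus>[V] r y"
      by (intro uniq[OF _ T.sub_add[OF t(1) u(1)]]) (use r(1)[OF x] r(1)[OF y] in auto)
  next
    fix c :: 'a and x assume x: "x \<in> carrier W"
    obtain t where t: "t \<in> T" "x = j (r x) \<oplus>[W] t" using r(2)[OF x] by blast
    have "c \<odot>[W] x = c \<odot>[W] (j (r x) \<oplus>[W] t)"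
      by (rule arg_cong[OF t(2)])
    also have "\<dots> = j (c \<odot>[V] r x) \<oplus>[W] c \<odot>[W] t"
      using r(1)[OF x] Tc[OF t(1)] by (simp add: j.N.smult_add)
    finally show "r (c \<odot>[W] x) = c \<odot>[V] r x"
      by (intro uniq[of _ "c \<odot>[W] t"]) (use r(1)[OF x] T.sub_smult[OF _ t(1), of c] in auto)
  qed (rule r(1))
  moreover have "r (j x) = x" if "x \<in> carrier V" for x
    using uniq[OF that T.sub_zero] that by simp
  ultimately show thesis
    using that by blast
qed

lemma linear_section:
  assumes "rmor scalar_ring V W q" "q ` carrier V = carrier W"
  obtains s where "s \<in> rmod_hom scalar_ring W V" "\<And>x. x \<in> carrier W ==> q (s x) = x"
proof -
  interpret q: rmor scalar_ring V W q by fact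
  let ?K = "{x \<in> carrier V. q x = \<zero>[W]}"
  obtain T where T: "submod scalar_ring V T" "?K \<inter> T = {\<zero>[V]}"
      "\<And>x. x \<in> carrier V ==> \<exists>s\<in>?K. \<exists>t\<in>T. x = s \<oplus>[V] t"
    using complement_exists[OF q.submod_kernel] by blast
  interpret T: submod scalar_ring V T by fact
  have Tc: "t \<in> T ==> t \<in> carrier V" for t
    using T.sub by blast
  have uniq: "t = u" if "t \<in> T" "u \<in> T" "q t = q u" for t u
  proof -
    have "t \<ominus>[V] u \<in> ?K \<inter> T"
      using that Tc T.sub_minus by auto
    then show ?thesis
      using T(2) q.M.minus_eq_zeroD Tc that by blast
  qed
  have "\<exists>t. t \<in> T \<and> q t = y" if y: "y \<in> carrier W" for y
  proof -
    obtain x where x: "x \<in> carrier V" "q x = y"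
      using y assms(2) by (metis imageE)
    obtain k t where "k \<in> ?K" "t \<in> T" "x = k \<oplus>[V] t"
      using T(3)[OF x(1)] by blast
    then show ?thesis
      using x(2) Tc by (intro exI[of _ t]) auto
  qed
  then obtain s where s: "\<And>y. y \<in> carrier W ==> s y \<in> T" "\<And>y. y \<in> carrier W ==> q (s y) = y"
    by metis
  have "s \<in> rmod_hom scalar_ring W V"
    by (rule rmod_homI; (rule uniq)?) (auto simp: s Tc intro!: T.sub_add T.sub_smult)
  then show thesis
    using that s(2) by blast
qed

section \<open>Removing arrows from a ring\<close>

lemma ring_scalar_ring: "ring (scalar_ring :: 'k::field ring)"
proof (intro ringI abelian_groupI monoidI)
  show "\<exists>y\<in>carrier (scalar_ring :: 'k ring). y \<oplus>[scalar_ring] x = \<zero>[scalar_ring]" for x :: 'k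
    by (rule bexI[of _ "- x"]) auto
qed (auto simp: algebra_simps)

definition with_action :: "('s, 'm) module => ('r => 'm => 'm) => ('r, 'm) module" where
  "with_action V act = \<lparr>carrier = carrier V, mult = undefined, one = undefined, zero = zero V, add = add V,
     smult = act\<rparr>"

lemma with_action_simps [simp]:
  "carrier (with_action V act) = carrier V" "\<zero>[with_action V act] = \<zero>[V]"
  "x \<oplus>[with_action V act] y = x \<oplus>[V] y" "r \<odot>[with_action V act] x = act r x"
  unfolding with_action_def by simp_all

definition arrow_extension ::
  "('r, 'c) ring_scheme => ('s, 'd) ring_scheme => ('s => 'r) => ('k::field => 's) => 'e set => ('e => 'r) =>
    ('e => 's) => ('e => 's) => ('s, 'm) module => bool" where
  "arrow_extension L G i sc Arr arr src tgt V \<longleftrightarrow>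
    (\<forall>B. (\<forall>a\<in>Arr. B a \<in> rmod_hom scalar_ring (restrict_scalars sc V) (restrict_scalars sc V) \<and>
        (\<forall>v\<in>carrier V. B a (src a \<odot>[V] v) = B a v \<and> tgt a \<odot>[V] B a v = B a v)) \<longrightarrow>
      (\<exists>act. rmod L (with_action V act) \<and> (\<forall>v\<in>carrier V. \<forall>r\<in>carrier G. act (i r) v = r \<odot>[V] v) \<and>
        (\<forall>v\<in>carrier V. \<forall>a\<in>Arr. act (arr a) v = B a v)))"

text \<open>\<open>L\<close> is obtained from \<open>G\<close> by freely adjoining the arrows in \<open>Arr\<close>: by \<open>extend\<close> a module over
  \<open>L\<close> is a module \<open>V\<close> over \<open>G\<close> with arbitrary \<open>k\<close>-linear maps \<open>V e \<rightarrow> V f\<close> for the arrows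
  \<open>e \<rightarrow> f\<close>.\<close>

locale arrow_removal = L: derived_universe Idx Car L + G: derived_universe Idx Car G
  for Idx :: "'i set set" and Car :: "'u set set" and L :: "('r, 'c) ring_scheme" and G :: "('s, 'd) ring_scheme" +
  fixes p :: "'r => 's" and i :: "'s => 'r" and sc :: "'k::field => 's"
    and Arr :: "'e set" and arr :: "'e => 'r" and src tgt :: "'e => 's"
    and Span :: "'r set"
  assumes p: "p \<in> ring_hom L G" and i: "i \<in> ring_hom G L" and pi: "s \<in> carrier G ==> p (i s) = s"
    and sc: "sc \<in> ring_hom scalar_ring G"
    and src: "a \<in> Arr ==> src a \<in> carrier G" "a \<in> Arr ==> src a \<otimes>[G] src a = src a"
      "a \<in> Arr ==> sc c \<otimes>[G] src a = src a \<otimes>[G] sc c"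
    and tgt: "a \<in> Arr ==> tgt a \<in> carrier G" "a \<in> Arr ==> tgt a \<otimes>[G] tgt a = tgt a"
      "a \<in> Arr ==> sc c \<otimes>[G] tgt a = tgt a \<otimes>[G] sc c"
    and arr: "a \<in> Arr ==> arr a \<in> carrier L" "a \<in> Arr ==> p (arr a) = \<zero>[G]"
      "a \<in> Arr ==> i (src a) \<otimes>[L] arr a = arr a" "a \<in> Arr ==> arr a \<otimes>[L] i (tgt a) = arr a"
      "a \<in> Arr ==> i (sc c) \<otimes>[L] arr a = arr a \<otimes>[L] i (sc c)"
    and square_zero: "x \<in> carrier L ==> y \<in> carrier L ==> p x = \<zero>[G] ==> p y = \<zero>[G] ==>
      x \<otimes>[L] y = \<zero>[L]"
    and generated: "U \<subseteq> carrier L ==> i ` carrier G \<subseteq> U ==> arr ` Arr \<subseteq> U ==>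
      (\<And>x y. x \<in> U ==> y \<in> U ==> x \<oplus>[L] y \<in> U) ==> (\<And>x y. x \<in> U ==> y \<in> U ==> x \<otimes>[L] y \<in> U) ==>
      U = carrier L"
    and span: "finite Span" "Span \<subseteq> carrier L"
      "Span \<subseteq> U ==> U \<subseteq> carrier L ==> (\<And>x y. x \<in> U ==> y \<in> U ==> x \<oplus>[L] y \<in> U) ==>
        (\<And>x r. x \<in> U ==> r \<in> carrier G ==> x \<otimes>[L] i r \<in> U) ==> U = carrier L"
    and extend: "rmod G V ==> arrow_extension L G i sc Arr arr src tgt (V :: ('s, 'u) module)"
    and extend_sum: "rmod G Z ==> arrow_extension L G i sc Arr arr src tgt (Z :: ('s, 'u \<times> 'u) module)"
begin

sublocale I: scalar_restriction Idx Car L G i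
  by unfold_locales (rule i)

sublocale P: scalar_restriction Idx Car G L p
  by unfold_locales (rule p)

sublocale LR: ring L by (rule L.ring_R)
sublocale GR: ring G by (rule G.ring_R)

abbreviation "Res \<equiv> restrict_scalars i"
abbreviation "Infl \<equiv> restrict_scalars p"
abbreviation "K \<equiv> restrict_scalars sc"

lemma sc_closed [simp]: "sc c \<in> carrier G"
  using ring_hom_closed[OF sc] by simp

lemma rmod_K: "rmod G V ==> rmod scalar_ring (K V)"
  by (rule rmod_restrict_scalars[OF sc ring_scalar_ring])

lemma hom_K: "h \<in> rmod_hom G V W ==> h \<in> rmod_hom scalar_ring (K V) (K W)"
  by (rule hom_restrict_scalars[OF sc])

lemma hom_Res: "h \<in> rmod_hom L V W ==> h \<in> rmod_hom G (Res V) (Res W)"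
  by (rule I.hom_restrict)

lemma L_homI:
  assumes V: "rmod L V" and W: "rmod L W" and h: "h \<in> rmod_hom G (Res V) (Res W)"
    and arr_h: "\<And>a x. a \<in> Arr ==> x \<in> carrier V ==> h (arr a \<odot>[V] x) = arr a \<odot>[W] h x"
  shows "h \<in> rmod_hom L V W"
proof -
  interpret V: rmod L V by fact
  interpret W: rmod L W by fact
  have h': "x \<in> carrier V ==> h x \<in> carrier W"
    "x \<in> carrier V ==> y \<in> carrier V ==> h (x \<oplus>[V] y) = h x \<oplus>[W] h y"
    "x \<in> carrier V ==> r \<in> carrier G ==> h (i r \<odot>[V] x) = i r \<odot>[W] h x" for x y r
    using h by (auto simp: rmod_hom_def)
  have "{r \<in> carrier L. \<forall>x\<in>carrier V. h (r \<odot>[V] x) = r \<odot>[W] h x} = carrier L"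
    by (rule generated) (auto simp: h' arr_h arr V.add_smult W.add_smult V.mult_smult W.mult_smult)
  then show ?thesis
    using h' by (intro rmod_homI) auto
qed

lemma rmod_arr:
  assumes "rmod L V" "a \<in> Arr" "x \<in> carrier V"
  shows "arr a \<odot>[V] (i (src a) \<odot>[V] x) = arr a \<odot>[V] x" "i (tgt a) \<odot>[V] (arr a \<odot>[V] x) = arr a \<odot>[V] x"
proof -
  interpret rmod L V by fact
  show "arr a \<odot>[V] (i (src a) \<odot>[V] x) = arr a \<odot>[V] x" "i (tgt a) \<odot>[V] (arr a \<odot>[V] x) = arr a \<odot>[V] x"
    using mult_smult[of "i (src a)" "arr a" x] mult_smult[of "arr a" "i (tgt a)" x] arr src tgt assms by auto
qed

lemma arr_linear:
  assumes "rmod L V" "a \<in> Arr"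
  shows "(\<lambda>x. arr a \<odot>[V] x) \<in> rmod_hom scalar_ring (K (Res V)) (K (Res V))"
proof -
  interpret rmod L V by fact
  have "i (sc c) \<odot>[V] (arr a \<odot>[V] x) = arr a \<odot>[V] (i (sc c) \<odot>[V] x)" if "x \<in> carrier V" for c x
    using mult_smult[of "i (sc c)" "arr a" x] mult_smult[of "arr a" "i (sc c)" x] arr[OF assms(2)] that by auto
  then show ?thesis
    using arr(1)[OF assms(2)] by (intro rmod_homI) (auto simp: smult_add)
qed

lemma idem_linear:
  assumes "rmod G V" "e \<in> carrier G" "\<And>c. sc c \<otimes>[G] e = e \<otimes>[G] sc c"
  shows "(\<lambda>x. e \<odot>[V] x) \<in> rmod_hom scalar_ring (K V) (K V)"
proof -
  interpret rmod G V by fact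
  have "sc c \<odot>[V] (e \<odot>[V] x) = e \<odot>[V] (sc c \<odot>[V] x)" if "x \<in> carrier V" for c x
    using mult_smult[of "sc c" e x] mult_smult[of e "sc c" x] assms(2,3) that by auto
  then show ?thesis
    using assms(2) by (intro rmod_homI) (auto simp: smult_add)
qed

lemma Res_modules: "M \<in> modules Car L ==> Res M \<in> modules Car G"
  by (simp add: L.modules_iff G.modules_iff I.rmod_restrict)

lemma Infl_modules: "M \<in> modules Car G ==> Infl M \<in> modules Car L"
  by (simp add: L.modules_iff G.modules_iff P.rmod_restrict)

definition is_extension :: "('s, 'm) module => ('e => 'm => 'm) => ('r, 'm) module => bool" where
  "is_extension V B V' \<longleftrightarrow> rmod L V' \<and> carrier V' = carrier V \<and> (\<forall>x y. x \<oplus>[V'] y = x \<oplus>[V] y) \<and>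
    (\<forall>x\<in>carrier V. (\<forall>r\<in>carrier G. i r \<odot>[V'] x = r \<odot>[V] x) \<and> (\<forall>a\<in>Arr. arr a \<odot>[V'] x = B a x))"

lemma extension_exists:
  assumes V: "arrow_extension L G i sc Arr arr src tgt V"
    and B: "\<And>a. a \<in> Arr ==> B a \<in> rmod_hom scalar_ring (K V) (K V)"
      "\<And>a x. a \<in> Arr ==> x \<in> carrier V ==> B a (src a \<odot>[V] x) = B a x"
      "\<And>a x. a \<in> Arr ==> x \<in> carrier V ==> tgt a \<odot>[V] B a x = B a x"
  shows "\<exists>V'. is_extension V B V'"
proof -
  obtain act where act: "rmod L (with_action V act)"
      "\<And>x r. x \<in> carrier V ==> r \<in> carrier G ==> act (i r) x = r \<odot>[V] x"
      "\<And>x a. x \<in> carrier V ==> a \<in> Arr ==> act (arr a) x = B a x"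
    using V[unfolded arrow_extension_def, rule_format, of B] B by blast
  then show ?thesis
    unfolding is_extension_def by (intro exI[of _ "with_action V act"]) auto
qed

lemma hom_into_extension:
  assumes "is_extension V B V'" "rmod L W" "h \<in> rmod_hom G (Res W) V"
    "\<And>a x. a \<in> Arr ==> x \<in> carrier W ==> h (arr a \<odot>[W] x) = B a (h x)"
  shows "h \<in> rmod_hom L W V'"
  using assms by (intro L_homI) (auto simp: rmod_hom_def is_extension_def Pi_iff)

lemma hom_from_extension:
  assumes "is_extension V B V'" "rmod L W" "h \<in> rmod_hom G V (Res W)"
    "\<And>a x. a \<in> Arr ==> x \<in> carrier V ==> h (B a x) = arr a \<odot>[W] h x"
  shows "h \<in> rmod_hom L V' W"
  using assms by (intro L_homI) (auto simp: rmod_hom_def is_extension_def Pi_iff)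

lemma extension_hom:
  assumes "is_extension V B V'"
  shows "h \<in> rmod_hom L V' W ==> h \<in> rmod_hom G V (Res W)" "k \<in> rmod_hom L W V' ==> k \<in> rmod_hom G (Res W) V"
  using assms hom_Res[of h V' W] hom_Res[of k W V'] by (auto simp: rmod_hom_def is_extension_def Pi_iff)

end

context submod
begin

lemma rep_surj: "rep ` carrier M = carrier (quot_module M S)"
  by (simp add: quot_module_def)

lemma quot_subset: "carrier (quot_module M S) \<subseteq> carrier M"
  using rep by (auto simp: quot_module_def)

end

context derived_universe
begin

lemma injective_split_small:
  fixes V :: "('r, 'm) module"
  assumes E: "E \<in> injective_modules Car R" and V: "rmod R V" "small Car (carrier V)"
    and j: "j \<in> rmod_hom R E V" "inj_on j (carrier E)"
  obtains r where "r \<in> rmod_hom R V E" "\<And>x. x \<in> carrier E ==> r (j x) = x"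
proof -
  have jc: "x \<in> carrier E ==> j x \<in> carrier V" for x
    using j(1) by (auto simp: rmod_hom_def)
  have "inj_on (\<lambda>x. to_copy Car V (j x)) (carrier E)"
  proof (rule inj_onI)
    fix x y assume "x \<in> carrier E" "y \<in> carrier E" "to_copy Car V (j x) = to_copy Car V (j y)"
    then show "x = y"
      using copy_inverse[OF V(2) jc] inj_onD[OF j(2)] by metis
  qed
  then obtain r where "r \<in> rmod_hom R (copy_module Car V) E"
      "\<And>x. x \<in> carrier E ==> r (to_copy Car V (j x)) = x"
    using injective_split[OF E modules_copy[OF V] rmod_hom_comp[OF j(1) to_copy_hom[OF V]]] by metis
  then show thesis
    using that[of "\<lambda>v. r (to_copy Car V v)"] rmod_hom_comp[OF to_copy_hom[OF V]] by blast
qed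

lemma projective_split_small:
  fixes V :: "('r, 'm) module"
  assumes P: "P \<in> projective_modules Car R" and V: "rmod R V" "small Car (carrier V)"
    and q: "q \<in> rmod_hom R V P" "q ` carrier V = carrier P"
  obtains s where "s \<in> rmod_hom R P V" "\<And>x. x \<in> carrier P ==> q (s x) = x"
proof -
  let ?f = "from_copy Car V"
  have "?f ` carrier (copy_module Car V) = carrier V"
    by (simp add: copy_carrier image_image copy_inverse[OF V(2)])
  then have "(\<lambda>x. q (?f x)) ` carrier (copy_module Car V) = carrier P"
    using q(2) by (metis image_image)
  then obtain s where "s \<in> rmod_hom R P (copy_module Car V)" "\<And>x. x \<in> carrier P ==> q (?f (s x)) = x"
    using projective_split[OF P modules_copy[OF V] rmod_hom_comp[OF from_copy_hom[OF V] q(1)]] by metis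
  then show thesis
    using that[of "\<lambda>v. ?f (s v)"] rmod_hom_comp[OF _ from_copy_hom[OF V]] by blast
qed

end

context arrow_removal
begin

lemma injectiveD: "E \<in> injective_modules Car R ==> E \<in> modules Car R"
  and projectiveD: "P \<in> projective_modules Car R ==> P \<in> modules Car R"
  by (simp_all add: injective_modules_def projective_modules_def)

lemma rmod_Res: "rmod L M ==> rmod G (Res M)"
  by (rule I.rmod_restrict)

lemma rmod_Infl: "rmod G M ==> rmod L (Infl M)"
  by (rule P.rmod_restrict)

lemma arrow_composite_linear:
  assumes "rmod G V" "rmod G V'" "rmod L W" "a \<in> Arr"
    "f \<in> rmod_hom scalar_ring (K V) (K (Res W))" "g \<in> rmod_hom scalar_ring (K (Res W)) (K V')"
  shows "(\<lambda>v. g (arr a \<odot>[W] f (src a \<odot>[V] v))) \<in> rmod_hom scalar_ring (K V) (K V')"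
    "(\<lambda>v. tgt a \<odot>[V'] g (arr a \<odot>[W] f v)) \<in> rmod_hom scalar_ring (K V) (K V')"
  using rmod_hom_comp[OF rmod_hom_comp[OF rmod_hom_comp[OF
      idem_linear[OF assms(1) src(1,3)[OF assms(4)]] assms(5)] arr_linear[OF assms(3,4)]] assms(6)]
    rmod_hom_comp[OF rmod_hom_comp[OF rmod_hom_comp[OF assms(5) arr_linear[OF assms(3,4)]] assms(6)]
      idem_linear[OF assms(2) tgt(1,3)[OF assms(4)]]] by (simp_all add: assms(4))

lemma restrict_injective:
  assumes E: "E \<in> injective_modules Car L"
  shows "Res E \<in> injective_modules Car G"
proof (rule G.injective_modulesI)
  have E': "E \<in> modules Car L" by (rule injectiveD[OF E])
  then show "Res E \<in> modules Car G" by (rule Res_modules)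
  fix V j assume V: "V \<in> modules Car G" and j: "j \<in> rmod_hom G (Res E) V" "inj_on j (carrier (Res E))"
  have r: "rmod L E" "rmod G V" using E' V by (auto simp: L.modules_iff G.modules_iff)
  interpret E: rmod L E by (rule r)
  interpret V: rmod G V by (rule r)
  interpret j: rmor G "Res E" V j by (rule rmorI[OF rmod_Res[OF r(1)] r(2) j(1)])
  obtain \<rho> where \<rho>: "\<rho> \<in> rmod_hom scalar_ring (K V) (K (Res E))" "\<And>x. x \<in> carrier E ==> \<rho> (j x) = x"
    using linear_retraction[OF rmorI[OF rmod_K[OF rmod_Res[OF r(1)]] rmod_K[OF r(2)] hom_K[OF j(1)]]] j(2)
    by auto
  have \<rho>c: "v \<in> carrier V ==> \<rho> v \<in> carrier E" for v
    using \<rho>(1) by (auto simp: rmod_hom_def)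
  define B where "B a v = j (arr a \<odot>[E] \<rho> (src a \<odot>[V] v))" for a v
  have jB: "j (arr a \<odot>[E] x) = B a (j x)" if "a \<in> Arr" "x \<in> carrier E" for a x
    using that src rmod_arr(1)[OF r(1) that] by (simp add: B_def \<rho>(2) j.smult[symmetric] del: j.smult)
  have "\<exists>V'. is_extension V B V'"
  proof (rule extension_exists[OF extend[OF r(2)]])
    show "B a \<in> rmod_hom scalar_ring (K V) (K V)" if "a \<in> Arr" for a
      unfolding B_def by (rule arrow_composite_linear[OF r(2) r(2) r(1) that \<rho>(1) hom_K[OF j(1)]])
    show "B a (src a \<odot>[V] v) = B a v" if "a \<in> Arr" "v \<in> carrier V" for a v
      using that src[OF that(1)] V.mult_smult[of "src a" "src a" v] by (simp add: B_def)
    show "tgt a \<odot>[V] B a v = B a v" if "a \<in> Arr" "v \<in> carrier V" for a v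
      using that src tgt arr(1) \<rho>c rmod_arr(2)[OF r(1) that(1), of "\<rho> (src a \<odot>[V] v)"]
      by (simp add: B_def j.smult[symmetric] del: j.smult)
  qed
  then obtain V' where V': "is_extension V B V'" by blast
  have "j \<in> rmod_hom L E V'"
    by (rule hom_into_extension[OF V' r(1) j(1) jB])
  moreover have "V' \<in> modules Car L"
    using V' V by (simp add: is_extension_def L.modules_iff G.modules_iff)
  ultimately obtain k where "k \<in> rmod_hom L V' E" "\<And>x. x \<in> carrier E ==> k (j x) = x"
    using L.injective_split[OF E] j(2) by auto
  then show "\<exists>r\<in>rmod_hom G V (Res E). \<forall>x\<in>carrier (Res E). r (j x) = x"
    using extension_hom[OF V'] by auto
qed

lemma restrict_projective:
  assumes P: "P \<in> projective_modules Car L"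
  shows "Res P \<in> projective_modules Car G"
proof (rule G.projective_modulesI)
  have P': "P \<in> modules Car L" by (rule projectiveD[OF P])
  then show "Res P \<in> modules Car G" by (rule Res_modules)
  fix V q assume V: "V \<in> modules Car G" and q: "q \<in> rmod_hom G V (Res P)" "q ` carrier V = carrier (Res P)"
  have r: "rmod L P" "rmod G V" using P' V by (auto simp: L.modules_iff G.modules_iff)
  interpret P: rmod L P by (rule r)
  interpret V: rmod G V by (rule r)
  interpret q: rmor G V "Res P" q by (rule rmorI[OF r(2) rmod_Res[OF r(1)] q(1)])
  obtain \<sigma> where \<sigma>: "\<sigma> \<in> rmod_hom scalar_ring (K (Res P)) (K V)" "\<And>x. x \<in> carrier P ==> q (\<sigma> x) = x"
    using linear_section[OF rmorI[OF rmod_K[OF r(2)] rmod_K[OF rmod_Res[OF r(1)]] hom_K[OF q(1)]]] q(2)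
    by auto
  have \<sigma>c: "x \<in> carrier P ==> \<sigma> x \<in> carrier V" for x
    using \<sigma>(1) by (auto simp: rmod_hom_def)
  have qc: "v \<in> carrier V ==> q v \<in> carrier P" for v
    using q.closed by simp
  define B where "B a v = tgt a \<odot>[V] \<sigma> (arr a \<odot>[P] q v)" for a v
  have qB: "q (B a v) = arr a \<odot>[P] q v" if "a \<in> Arr" "v \<in> carrier V" for a v
    using that tgt arr(1) \<sigma>c qc[OF that(2)] rmod_arr(2)[OF r(1) that(1)] by (simp add: B_def \<sigma>(2))
  have "\<exists>V'. is_extension V B V'"
  proof (rule extension_exists[OF extend[OF r(2)]])
    show "B a \<in> rmod_hom scalar_ring (K V) (K V)" if "a \<in> Arr" for a
      unfolding B_def by (rule arrow_composite_linear[OF r(2) r(2) r(1) that hom_K[OF q(1)] \<sigma>(1)])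
    show "B a (src a \<odot>[V] v) = B a v" if "a \<in> Arr" "v \<in> carrier V" for a v
      using that src(1) rmod_arr(1)[OF r(1) that(1) qc[OF that(2)]] by (simp add: B_def)
    show "tgt a \<odot>[V] B a v = B a v" if "a \<in> Arr" "v \<in> carrier V" for a v
      using that tgt[OF that(1)] arr(1) \<sigma>c qc V.mult_smult[of "tgt a" "tgt a"] by (simp add: B_def)
  qed
  then obtain V' where V': "is_extension V B V'" by blast
  have "q \<in> rmod_hom L V' P"
    by (rule hom_from_extension[OF V' r(1) q(1) qB])
  moreover have "V' \<in> modules Car L"
    using V' V by (simp add: is_extension_def L.modules_iff G.modules_iff)
  moreover have "q ` carrier V' = carrier P"
    using q(2) V' by (simp add: is_extension_def)
  ultimately obtain k where k: "k \<in> rmod_hom L P V'" "\<And>x. x \<in> carrier P ==> q (k x) = x"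
    using L.projective_split[OF P] by blast
  show "\<exists>s\<in>rmod_hom G (Res P) V. \<forall>x\<in>carrier (Res P). q (s x) = x"
    using extension_hom(2)[OF V' k(1)] k(2) by auto
qed

lemma Res_Infl_hom:
  "h \<in> rmod_hom L (Infl E) J ==> h \<in> rmod_hom G E (Res J)" "k \<in> rmod_hom L J (Infl E) ==> k \<in> rmod_hom G (Res J) E"
  using hom_Res[of h "Infl E" J] hom_Res[of k J "Infl E"] by (simp_all add: rmod_hom_def pi)

lemma inflate_injective:
  assumes E: "E \<in> injective_modules Car G"
  obtains J C j q where "J \<in> injective_modules Car L" "C \<in> injective_modules Car L"
    "j \<in> rmod_hom L (Infl E) J" "inj_on j (carrier E)" "q \<in> rmod_hom L J C" "q ` carrier J = carrier C"
    "\<And>x. x \<in> carrier J ==> q x = \<zero>[C] \<longleftrightarrow> x \<in> j ` carrier E"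
proof -
  have E': "E \<in> modules Car G" by (rule injectiveD[OF E])
  have id: "(\<lambda>x. x) \<in> rmod_hom G (Res (Infl E)) E"
    by (simp add: rmod_hom_def pi)
  obtain J j where J: "J \<in> injective_modules Car L" and j: "j \<in> rmod_hom L (Infl E) J" "inj_on j (carrier E)"
  proof (rule I.coinduced_injective[OF E span(1,2) _ Infl_modules[OF E'] id], goal_cases)
    case (1 U)
    from 1(2-) show ?case by (rule span(3))
  next
    case (3 J j)
    then show ?case using that by simp
  qed simp_all
  have J': "J \<in> modules Car L" by (rule injectiveD[OF J])
  have rE: "rmod G E" and rJ: "rmod L J"
    using E' J' by (auto simp: L.modules_iff G.modules_iff)
  interpret E: rmod G E by (rule rE)
  interpret J: rmod L J by (rule rJ)
  interpret j: rmor L "Infl E" J j by (rule rmorI[OF rmod_Infl[OF rE] rJ j(1)])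
  interpret S: submod L J "j ` carrier E"
    using j.submod_image by simp
  let ?C = "quot_module J (j ` carrier E)" and ?q = "S.rep"
  have rC: "rmod L ?C" by (rule S.rmod_quot)
  interpret C: rmod L ?C by (rule rC)
  interpret q: rmor L J ?C ?q by (rule rmorI[OF rJ rC S.rep_hom])
  have qsurj: "?q ` carrier J = carrier ?C"
    by (rule S.rep_surj)
  have C': "?C \<in> modules Car L"
    by (rule L.modules_subset[OF J' rC]) (rule S.quot_subset)
  have qj: "?q (j x) = \<zero>[?C]" if "x \<in> carrier E" for x
    using that S.rep_zero_iff[of "j x"] by auto
  obtain \<rho> where \<rho>: "\<rho> \<in> rmod_hom G (Res J) E" "\<And>x. x \<in> carrier E ==> \<rho> (j x) = x"
    using G.injective_split[OF E Res_modules[OF J'] Res_Infl_hom(1)[OF j(1)] j(2)] by blast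
  interpret \<rho>: rmor G "Res J" E \<rho> by (rule rmorI[OF rmod_Res[OF rJ] rE \<rho>(1)])
  obtain \<sigma> where \<sigma>: "\<sigma> \<in> rmod_hom scalar_ring (K (Res ?C)) (K (Res J))" "\<And>x. x \<in> carrier ?C ==> ?q (\<sigma> x) = x"
    using linear_section[OF rmorI[OF rmod_K[OF rmod_Res[OF rJ]] rmod_K[OF rmod_Res[OF rC]]
          hom_K[OF hom_Res[OF S.rep_hom]]]] qsurj by auto
  have \<sigma>c: "x \<in> carrier ?C ==> \<sigma> x \<in> carrier J" for x
    using \<sigma>(1) by (auto simp: rmod_hom_def)
  have arr_\<sigma>: "arr a \<odot>[J] \<sigma> (?q z) = arr a \<odot>[J] z" if a: "a \<in> Arr" and z: "z \<in> carrier J" for a z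
  proof -
    have "?q (\<sigma> (?q z) \<ominus>[J] z) = \<zero>[?C]"
      using z \<sigma>c \<sigma>(2) by (simp add: C.minus_eq C.r_neg)
    then obtain e where e: "e \<in> carrier E" "\<sigma> (?q z) \<ominus>[J] z = j e"
      using S.rep_zero_iff[of "\<sigma> (?q z) \<ominus>[J] z"] z \<sigma>c by auto
    have "arr a \<odot>[J] \<sigma> (?q z) \<ominus>[J] arr a \<odot>[J] z = arr a \<odot>[J] j e"
      using z \<sigma>c arr(1)[OF a] J.smult_minus[of "arr a" "\<sigma> (?q z)" z] e(2) by simp
    also have "\<dots> = j (p (arr a) \<odot>[E] e)"
      using e(1) arr(1)[OF a] j.smult[of "arr a" e] by simp
    finally have "arr a \<odot>[J] \<sigma> (?q z) \<ominus>[J] arr a \<odot>[J] z = \<zero>[J]"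
      using e(1) arr(2)[OF a] j.zero by simp
    then show ?thesis
      by (rule J.minus_eq_zeroD) (use z \<sigma>c arr(1)[OF a] in simp_all)
  qed
  have "?C \<in> injective_modules Car L"
  proof (rule L.injective_modulesI[OF C'])
    fix Y c assume Y: "Y \<in> modules Car L" and c: "c \<in> rmod_hom L ?C Y" "inj_on c (carrier ?C)"
    have rY: "rmod L Y" using Y by (simp add: L.modules_iff)
    interpret Y: rmod L Y by (rule rY)
    interpret c: rmor L ?C Y c by (rule rmorI[OF rC rY c(1)])
    obtain \<tau> where \<tau>: "\<tau> \<in> rmod_hom scalar_ring (K (Res Y)) (K (Res ?C))" "\<And>x. x \<in> carrier ?C ==> \<tau> (c x) = x"
      using linear_retraction[OF rmorI[OF rmod_K[OF rmod_Res[OF rC]] rmod_K[OF rmod_Res[OF rY]]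
            hom_K[OF hom_Res[OF c(1)]]]] c(2) by auto
    have \<tau>c: "y \<in> carrier Y ==> \<tau> y \<in> carrier ?C" for y
      using \<tau>(1) by (auto simp: rmod_hom_def)
    define \<delta> where "\<delta> a y = \<rho> (arr a \<odot>[J] \<sigma> (\<tau> (src a \<odot>[Res Y] y)))" for a y
    define Z where "Z = module_sum E (Res Y)"
    define B where "B a = (\<lambda>(x :: 'u, y). (\<delta> a y, arr a \<odot>[Y] y))" for a
    have rZ: "rmod G Z"
      unfolding Z_def by (rule rmod_module_sum[OF rE rmod_Res[OF rY]])
    interpret Z: rmod G Z by (rule rZ)
    have \<delta>c: "\<delta> a y \<in> carrier E" if "a \<in> Arr" "y \<in> carrier Y" for a y
      using that src arr(1) \<sigma>c \<tau>c \<rho>.closed by (simp add: \<delta>_def)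
    have "\<exists>Z'. is_extension Z B Z'"
    proof (rule extension_exists[OF extend_sum[OF rZ]])
      fix a assume a: "a \<in> Arr"
      have "\<delta> a \<in> rmod_hom scalar_ring (K (Res Y)) (K E)"
        unfolding \<delta>_def
        by (rule arrow_composite_linear(1)[OF rmod_Res[OF rY] rE rJ a rmod_hom_comp[OF \<tau>(1) \<sigma>(1)] hom_K[OF \<rho>(1)]])
      then show "B a \<in> rmod_hom scalar_ring (K Z) (K Z)"
        using arr_linear[OF rY a] by (auto simp: rmod_hom_def B_def Z_def)
      fix v assume v: "v \<in> carrier Z"
      obtain x y where xy: "v = (x, y)" "x \<in> carrier E" "y \<in> carrier Y"
        using v unfolding Z_def by auto
      show "B a (src a \<odot>[Z] v) = B a v"
        using xy src[OF a] a Y.mult_smult[of "i (src a)" "i (src a)" y] rmod_arr(1)[OF rY a]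
        by (simp add: B_def Z_def \<delta>_def I.\<phi>_simps(3)[symmetric] del: I.\<phi>_simps(3))
      have w: "\<sigma> (\<tau> (src a \<odot>[Res Y] y)) \<in> carrier J"
        using xy src a by (intro \<sigma>c \<tau>c) simp
      show "tgt a \<odot>[Z] B a v = B a v"
        using \<rho>.smult[of "tgt a" "arr a \<odot>[J] \<sigma> (\<tau> (src a \<odot>[Res Y] y))"] xy w tgt(1)[OF a] arr(1)[OF a]
          rmod_arr(2)[OF rJ a w] rmod_arr(2)[OF rY a] by (simp add: B_def Z_def \<delta>_def)
    qed
    then obtain Z' where Z': "is_extension Z B Z'" by blast
    define h where "h z = (\<rho> z, c (?q z))" for z
    have "h \<in> rmod_hom L J Z'"
    proof (rule hom_into_extension[OF Z' rJ])
      show "h \<in> rmod_hom G (Res J) Z"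
        using \<rho>(1) rmod_hom_comp[OF S.rep_hom c(1)] by (auto simp: rmod_hom_def h_def Z_def)
      fix a z assume a: "a \<in> Arr" and z: "z \<in> carrier J"
      have "\<delta> a (c (?q z)) = \<rho> (arr a \<odot>[J] \<sigma> (?q (i (src a) \<odot>[J] z)))"
        using z src(1)[OF a] \<tau>(2)[of "?q (i (src a) \<odot>[J] z)"] by (simp add: \<delta>_def)
      also have "\<dots> = \<rho> (arr a \<odot>[J] z)"
        using arr_\<sigma>[OF a, of "i (src a) \<odot>[J] z"] z src(1)[OF a] rmod_arr(1)[OF rJ a z] by simp
      finally show "h (arr a \<odot>[J] z) = B a (h z)"
        using z arr(1)[OF a] by (simp add: h_def B_def)
    qed
    moreover have "inj_on h (carrier J)"
    proof (rule inj_onI)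
      fix x y assume xy: "x \<in> carrier J" "y \<in> carrier J" "h x = h y"
      then have "?q x = ?q y" "\<rho> x = \<rho> y"
        using inj_onD[OF c(2), of "?q x" "?q y"] by (auto simp: h_def)
      then obtain e where e: "e \<in> carrier E" "x = j e \<oplus>[J] y"
        using S.rep_eqE[OF _ xy(1,2)] by blast
      then have "\<rho> x = e \<oplus>[E] \<rho> y"
        using \<rho>.add[of "j e" y] \<rho>(2) xy(2) by simp
      then have "e = \<zero>[E]"
        using \<open>\<rho> x = \<rho> y\<close> \<rho>.closed[of y] xy(2) e(1) E.add.l_cancel_one'[of "\<rho> y" e] E.a_comm
        by (metis E.l_zero E.zero_closed E.add.right_cancel partial_object.select_convs(1) restrict_scalars_simps(1))
      then show "x = y"
        using e(2) xy(2) j.zero by simp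
    qed
    moreover have "rmod L Z'" "carrier Z' = carrier Z"
      using Z' by (simp_all add: is_extension_def)
    moreover have "small Car (carrier Z)"
      using E' Y by (auto simp: Z_def L.modules_iff G.modules_iff intro!: L.small_Times small_mem)
    ultimately obtain R where R: "R \<in> rmod_hom L Z' J" "\<And>x. x \<in> carrier J ==> R (h x) = x"
      using L.injective_split_small[OF J, of Z' h] by auto
    have R': "R \<in> rmod_hom G Z (Res J)"
      by (rule extension_hom(1)[OF Z' R(1)])
    interpret R: rmor G Z "Res J" R by (rule rmorI[OF rZ rmod_Res[OF rJ] R'])
    have R0: "?q (R (x, \<zero>[Y])) = \<zero>[?C]" if "x \<in> carrier E" for x
      using that R(2)[of "j x"] \<rho>(2) qj by (simp add: h_def)
    have Rc: "R (x, y) \<in> carrier J" if "x \<in> carrier E" "y \<in> carrier Y" for x y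
      using R.closed[of "(x, y)"] that by (simp add: Z_def)
    have R1: "?q (R (x, y)) = ?q (R (\<zero>[E], y))" if "x \<in> carrier E" "y \<in> carrier Y" for x y
    proof -
      have "R (x, y) = R (x, \<zero>[Y]) \<oplus>[J] R (\<zero>[E], y)"
        using that R.add[of "(x, \<zero>[Y])" "(\<zero>[E], y)"] by (simp add: Z_def)
      then show ?thesis
        using that R0 by (simp add: Rc)
    qed
    let ?k = "\<lambda>y. ?q (R (\<zero>[E], y))"
    have "?k \<in> rmod_hom L Y ?C"
    proof (rule L_homI[OF rY rC])
      have "(\<lambda>y. (\<zero>[E], y)) \<in> rmod_hom G (Res Y) Z"
        by (rule rmod_homI) (simp_all add: Z_def)
      then show "?k \<in> rmod_hom G (Res Y) (Res ?C)"
        by (rule rmod_hom_comp[OF rmod_hom_comp[OF _ R'] hom_Res[OF S.rep_hom]])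
      fix a y assume a: "a \<in> Arr" and y: "y \<in> carrier Y"
      have z: "(\<zero>[E], y) \<in> carrier Z" using y by (simp add: Z_def)
      have "arr a \<odot>[J] R (\<zero>[E], y) = R (\<delta> a y, arr a \<odot>[Y] y)"
        using rmod_hom_smult[OF R(1) arr(1)[OF a], of "(\<zero>[E], y)"] Z' z a by (simp add: is_extension_def B_def)
      then show "?k (arr a \<odot>[Y] y) = arr a \<odot>[?C] ?k y"
        using R1[OF \<delta>c[OF a y], of "arr a \<odot>[Y] y"] q.smult[OF arr(1)[OF a] Rc[OF E.zero_closed y]] y arr(1)[OF a]
        by simp
    qed
    moreover have "?k (c x) = x" if x: "x \<in> carrier ?C" for x
    proof -
      obtain z where z: "z \<in> carrier J" "x = ?q z" using x qsurj by blast
      have "?k (c (?q z)) = ?q (R (h z))"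
        using R1[of "\<rho> z" "c (?q z)"] z(1) \<rho>.closed[of z] by (simp add: h_def)
      then show ?thesis
        unfolding z(2) R(2)[OF z(1)] .
    qed
    ultimately show "\<exists>r\<in>rmod_hom L Y ?C. \<forall>x\<in>carrier ?C. r (c x) = x"
      by (intro bexI ballI)
  qed
  then show thesis
    by (rule that[OF J _ j S.rep_hom qsurj S.rep_zero_iff])
qed

lemma inflate_projective:
  assumes P: "P \<in> projective_modules Car G"
  obtains F C j q where "F \<in> projective_modules Car L" "C \<in> projective_modules Car L"
    "j \<in> rmod_hom L C F" "inj_on j (carrier C)" "q \<in> rmod_hom L F (Infl P)" "q ` carrier F = carrier P"
    "\<And>x. x \<in> carrier F ==> q x = \<zero>[P] \<longleftrightarrow> x \<in> j ` carrier C"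
proof -
  have P': "P \<in> modules Car G" by (rule projectiveD[OF P])
  obtain F q where F: "F \<in> projective_modules Car L" and q: "q \<in> rmod_hom L F (Infl P)" "q ` carrier F = carrier (Infl P)"
    using L.enough_projectives[OF Infl_modules[OF P']] by blast
  have F': "F \<in> modules Car L" by (rule projectiveD[OF F])
  have rP: "rmod G P" and rF: "rmod L F"
    using P' F' by (auto simp: L.modules_iff G.modules_iff)
  interpret P: rmod G P by (rule rP)
  interpret F: rmod L F by (rule rF)
  interpret q: rmor L F "Infl P" q by (rule rmorI[OF rF rmod_Infl[OF rP] q(1)])
  define N where "N = {x \<in> carrier F. q x = \<zero>[Infl P]}"
  interpret N: submod L F N
    unfolding N_def by (rule q.submod_kernel)
  have N: "x \<in> N ==> x \<in> carrier F" "x \<in> N ==> q x = \<zero>[P]" for x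
    by (simp_all add: N_def)
  let ?C = "F\<lparr>carrier := N\<rparr>"
  have rC: "rmod L ?C" by (rule N.rmod_sub)
  have C': "?C \<in> modules Car L"
    by (rule L.modules_subset[OF F' rC]) (auto simp: N)
  have qc: "q x \<in> carrier P" if "x \<in> carrier F" for x
    using q.closed[OF that] by simp
  have qarr: "arr a \<odot>[F] x \<in> N" if "a \<in> Arr" "x \<in> carrier F" for a x
    using that arr(1,2)[OF that(1)] q.smult[of "arr a" x] qc[of x] by (simp add: N_def)
  obtain \<sigma> where \<sigma>: "\<sigma> \<in> rmod_hom G P (Res F)" "\<And>x. x \<in> carrier P ==> q (\<sigma> x) = x"
    using G.projective_split[OF P Res_modules[OF F'] Res_Infl_hom(2)[OF q(1)]] q(2) by auto
  interpret \<sigma>: rmor G P "Res F" \<sigma> by (rule rmorI[OF rP rmod_Res[OF rF] \<sigma>(1)])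
  have \<sigma>c: "x \<in> carrier P ==> \<sigma> x \<in> carrier F" for x
    using \<sigma>.closed by simp
  have "?C \<in> projective_modules Car L"
  proof (rule L.projective_modulesI[OF C'])
    fix Y c assume Y: "Y \<in> modules Car L" and c: "c \<in> rmod_hom L Y ?C" "c ` carrier Y = carrier ?C"
    have rY: "rmod L Y" using Y by (simp add: L.modules_iff)
    interpret Y: rmod L Y by (rule rY)
    have cF: "c \<in> rmod_hom L Y F"
      by (rule rmod_hom_comp[OF c(1) N.sub_inclusion])
    interpret c: rmor L Y F c by (rule rmorI[OF rY rF cF])
    have cN: "y \<in> carrier Y ==> c y \<in> N" for y
      using c(2) by auto
    obtain \<tau> where \<tau>: "\<tau> \<in> rmod_hom scalar_ring (K (Res ?C)) (K (Res Y))" "\<And>x. x \<in> carrier ?C ==> c (\<tau> x) = x"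
      using linear_section[OF rmorI[OF rmod_K[OF rmod_Res[OF rY]] rmod_K[OF rmod_Res[OF rC]]
            hom_K[OF hom_Res[OF c(1)]]]] c(2) by auto
    have \<tau>c: "x \<in> N ==> \<tau> x \<in> carrier Y" "x \<in> N ==> c (\<tau> x) = x" for x
      using \<tau> by (auto simp: rmod_hom_def)
    define \<delta> where "\<delta> a x = tgt a \<odot>[Res Y] \<tau> (arr a \<odot>[F] \<sigma> x)" for a x
    define Z where "Z = module_sum P (Res Y)"
    define B where "B a = (\<lambda>(x, y). (\<zero>[P], \<delta> a x \<oplus>[Y] arr a \<odot>[Y] y))" for a and x :: 'u
    have rZ: "rmod G Z"
      unfolding Z_def by (rule rmod_module_sum[OF rP rmod_Res[OF rY]])
    have \<delta>c: "\<delta> a x \<in> carrier Y" if "a \<in> Arr" "x \<in> carrier P" for a x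
      using that tgt(1) \<sigma>c \<tau>c qarr by (simp add: \<delta>_def)
    have \<delta>h: "\<delta> a \<in> rmod_hom scalar_ring (K P) (K (Res Y))" if a: "a \<in> Arr" for a
    proof -
      have "(\<lambda>x. arr a \<odot>[F] \<sigma> x) \<in> rmod_hom scalar_ring (K P) (K (Res ?C))"
        using rmod_hom_comp[OF hom_K[OF \<sigma>(1)] arr_linear[OF rF a]] a \<sigma>c qarr by (auto simp: rmod_hom_def)
      then show ?thesis
        unfolding \<delta>_def
        by (rule rmod_hom_comp[OF rmod_hom_comp[OF _ \<tau>(1)] idem_linear[OF rmod_Res[OF rY] tgt(1,3)[OF a]]])
    qed
    have "\<exists>Z'. is_extension Z B Z'"
    proof (rule extension_exists[OF extend_sum[OF rZ]])
      fix a assume a: "a \<in> Arr"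
      interpret \<delta>: rmor scalar_ring "K P" "K (Res Y)" "\<delta> a"
        by (rule rmorI[OF rmod_K[OF rP] rmod_K[OF rmod_Res[OF rY]] \<delta>h[OF a]])
      interpret A: rmor scalar_ring "K (Res Y)" "K (Res Y)" "\<lambda>x. arr a \<odot>[Y] x"
        by (rule rmorI[OF rmod_K[OF rmod_Res[OF rY]] rmod_K[OF rmod_Res[OF rY]] arr_linear[OF rY a]])
      have l: "\<delta> a \<in> carrier P \<rightarrow> carrier Y" "\<And>x x'. x \<in> carrier P ==> x' \<in> carrier P ==> \<delta> a (x \<oplus>[P] x') = \<delta> a x \<oplus>[Y] \<delta> a x'"
        "\<And>d x. x \<in> carrier P ==> \<delta> a (sc d \<odot>[P] x) = i (sc d) \<odot>[Y] \<delta> a x"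
        "\<And>d y. y \<in> carrier Y ==> arr a \<odot>[Y] (i (sc d) \<odot>[Y] y) = i (sc d) \<odot>[Y] (arr a \<odot>[Y] y)"
        using \<delta>h[OF a] arr_linear[OF rY a] by (auto simp: rmod_hom_def)
      show "B a \<in> rmod_hom scalar_ring (K Z) (K Z)"
        using a arr(1)[OF a] by (intro rmod_homI) (auto simp: B_def Z_def l \<delta>c Y.smult_add Y.a_ac)
      fix v assume v: "v \<in> carrier Z"
      obtain x y where xy: "v = (x, y)" "x \<in> carrier P" "y \<in> carrier Y"
        using v unfolding Z_def by auto
      have "arr a \<odot>[F] \<sigma> (src a \<odot>[P] x) = arr a \<odot>[F] \<sigma> x"
        using \<sigma>.smult[OF src(1)[OF a] xy(2)] rmod_arr(1)[OF rF a \<sigma>c[OF xy(2)]] by simp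
      then show "B a (src a \<odot>[Z] v) = B a v"
        using xy rmod_arr(1)[OF rY a xy(3)] by (simp add: B_def Z_def \<delta>_def)
      have "i (tgt a) \<odot>[Y] \<delta> a x = \<delta> a x"
        using Y.mult_smult[of "i (tgt a)" "i (tgt a)" "\<tau> (arr a \<odot>[F] \<sigma> x)"] tgt(1,2)[OF a]
          \<tau>c(1)[OF qarr[OF a \<sigma>c[OF xy(2)]]] I.\<phi>_simps(3)[of "tgt a" "tgt a"] by (simp add: \<delta>_def)
      then show "tgt a \<odot>[Z] B a v = B a v"
        using xy \<delta>c[OF a xy(2)] tgt(1)[OF a] arr(1)[OF a] rmod_arr(2)[OF rY a xy(3)] 
        by (simp add: B_def Z_def Y.smult_add)
    qed
    then obtain Z' where Z': "is_extension Z B Z'" by blast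
    define h where "h = (\<lambda>(x, y). \<sigma> x \<oplus>[F] c y)"
    have c\<delta>: "c (\<delta> a x) = arr a \<odot>[F] \<sigma> x" if a: "a \<in> Arr" and x: "x \<in> carrier P" for a x
    proof -
      have w: "arr a \<odot>[F] \<sigma> x \<in> N" by (rule qarr[OF a \<sigma>c[OF x]])
      show ?thesis
        using c.smult[OF I.\<phi>_simps(1)[OF tgt(1)[OF a]] \<tau>c(1)[OF w]] \<tau>c(2)[OF w] rmod_arr(2)[OF rF a \<sigma>c[OF x]]
        by (simp add: \<delta>_def)
    qed
    have "h \<in> rmod_hom L Z' F"
    proof (rule hom_from_extension[OF Z' rF])
      have \<sigma>': "\<sigma> (x \<oplus>[P] x') = \<sigma> x \<oplus>[F] \<sigma> x'" "r \<in> carrier G ==> \<sigma> (r \<odot>[P] x) = i r \<odot>[F] \<sigma> x"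
        if "x \<in> carrier P" "x' \<in> carrier P" for x x' r
        using \<sigma>.add \<sigma>.smult that by auto
      show "h \<in> rmod_hom G Z (Res F)"
        by (rule rmod_homI) (auto simp: h_def Z_def \<sigma>' \<sigma>c F.smult_add F.a_ac)
      fix a z assume a: "a \<in> Arr" and z: "z \<in> carrier Z"
      have \<sigma>0: "\<sigma> \<zero>[P] = \<zero>[F]" using \<sigma>.zero by simp
      show "h (B a z) = arr a \<odot>[F] h z"
        using z a arr(1)[OF a]
        by (auto simp: h_def B_def Z_def \<delta>c c\<delta> \<sigma>c \<sigma>0 F.smult_add)
    qed
    moreover have "h ` carrier Z = carrier F"
    proof (intro equalityI subsetI)
      show "x \<in> carrier F" if "x \<in> h ` carrier Z" for x
        using that \<sigma>c by (auto simp: h_def Z_def)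
      fix x assume x: "x \<in> carrier F"
      have s: "\<sigma> (q x) \<in> carrier F" by (rule \<sigma>c[OF qc[OF x]])
      have "q (x \<ominus>[F] \<sigma> (q x)) = \<zero>[Infl P]"
        using q.minus[OF x s] \<sigma>(2)[OF qc[OF x]] q.N.r_neg[of "q x"] qc[OF x] by (simp add: q.N.minus_eq)
      then have "x \<ominus>[F] \<sigma> (q x) \<in> N"
        using x s by (simp add: N_def)
      then obtain y where y: "y \<in> carrier Y" "c y = x \<ominus>[F] \<sigma> (q x)"
        using \<tau>c by blast
      have "x = h (q x, y)"
        using x s unfolding h_def by (simp add: y F.minus_eq F.a_lcomm[of "\<sigma> (q x)" x] F.r_neg)
      then show "x \<in> h ` carrier Z"
        using y(1) qc[OF x] by (auto simp: Z_def)
    qed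
    moreover have "rmod L Z'" "carrier Z' = carrier Z"
      using Z' by (simp_all add: is_extension_def)
    moreover have "small Car (carrier Z)"
      using P' Y by (auto simp: Z_def L.modules_iff G.modules_iff intro!: L.small_Times small_mem)
    ultimately obtain S where S: "S \<in> rmod_hom L F Z'" "\<And>x. x \<in> carrier F ==> h (S x) = x"
      using L.projective_split_small[OF F, of Z' h] by auto
    have S': "S \<in> rmod_hom G (Res F) Z"
      by (rule extension_hom(2)[OF Z' S(1)])
    have SN: "fst (S x) = \<zero>[P]" "snd (S x) \<in> carrier Y" "c (snd (S x)) = x" if x: "x \<in> N" for x
    proof -
      have "S x \<in> carrier Z"
        using S' N(1)[OF x] by (auto simp: rmod_hom_def)
      then obtain y z where yz: "S x = (y, z)" "y \<in> carrier P" "z \<in> carrier Y"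
        by (auto simp: Z_def)
      have h: "\<sigma> y \<oplus>[F] c z = x"
        using S(2)[OF N(1)[OF x]] by (simp add: h_def yz)
      have "q (\<sigma> y \<oplus>[F] c z) = y"
        using q.add[OF \<sigma>c[OF yz(2)] N(1)[OF cN[OF yz(3)]]] N(2)[OF cN[OF yz(3)]] \<sigma>(2) yz(2) by simp
      then have "y = \<zero>[P]"
        unfolding h using N(2)[OF x] by simp
      then show "fst (S x) = \<zero>[P]" "snd (S x) \<in> carrier Y" "c (snd (S x)) = x"
        using yz h \<sigma>.zero N(1)[OF cN[OF yz(3)]] by auto
    qed
    have "(\<lambda>x. snd (S x)) \<in> rmod_hom L ?C Y"
    proof (rule L_homI[OF rC rY])
      show "(\<lambda>x. snd (S x)) \<in> rmod_hom G (Res ?C) (Res Y)"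
      proof (rule rmod_homI)
        fix x y r assume "x \<in> carrier (Res ?C)" "y \<in> carrier (Res ?C)"
        then have "S (x \<oplus>[F] y) = S x \<oplus>[Z] S y"
          using S' N by (simp add: rmod_hom_def)
        then show "snd (S (x \<oplus>[Res ?C] y)) = snd (S x) \<oplus>[Res Y] snd (S y)"
          by (simp add: Z_def module_sum_def case_prod_unfold)
      next
        fix x r assume "r \<in> carrier G" "x \<in> carrier (Res ?C)"
        then have "S (i r \<odot>[F] x) = r \<odot>[Z] S x"
          using S' N by (simp add: rmod_hom_def)
        then show "snd (S (r \<odot>[Res ?C] x)) = r \<odot>[Res Y] snd (S x)"
          by (simp add: Z_def module_sum_def case_prod_unfold)
      qed (simp add: SN)
      fix a x assume a: "a \<in> Arr" and "x \<in> carrier ?C"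
      then have x: "x \<in> N" by simp
      have \<delta>0: "\<delta> a \<zero>[P] = \<zero>[Y]"
        using rmor.zero[OF rmorI[OF rmod_K[OF rP] rmod_K[OF rmod_Res[OF rY]] \<delta>h[OF a]]] by simp
      have Sx: "S x \<in> carrier Z"
        using S' N(1)[OF x] by (auto simp: rmod_hom_def)
      have "S (arr a \<odot>[F] x) = B a (S x)"
        using rmod_hom_smult[OF S(1) arr(1)[OF a] N(1)[OF x]] Z' Sx a by (simp add: is_extension_def)
      then show "snd (S (arr a \<odot>[?C] x)) = arr a \<odot>[Y] snd (S x)"
        using SN[OF x] \<delta>0 arr(1)[OF a] by (simp add: B_def case_prod_unfold)
    qed
    then show "\<exists>s\<in>rmod_hom L ?C Y. \<forall>x\<in>carrier ?C. c (s x) = x"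
      by (rule bexI[rotated]) (simp add: SN(3))
  qed
  moreover have "x \<in> carrier F ==> q x = \<zero>[P] \<longleftrightarrow> x \<in> (\<lambda>x. x) ` carrier ?C" for x
    by (simp add: N_def)
  ultimately show thesis
    using that[OF F _ N.sub_inclusion _ q(1)] q(2) by (simp add: inj_on_def)
qed

end

context derived_universe
begin

lemma restrict_same:
  assumes S: "triangle_closed S" and X: "X \<in> complexes Car R" "restrict_cochain \<psi> X \<in> S"
    and eq: "\<And>n r x. r \<in> carrier R ==> x \<in> el X n ==> \<psi> r \<odot>[obj X n] x = r \<odot>[obj X n] x"
  shows "X \<in> S"
proof -
  let ?Y = "restrict_cochain \<psi> X"
  have Y: "?Y \<in> complexes Car R"
    using S X(2) unfolding triangle_closed_def by blast
  interpret cplx R X using complexesD[OF X(1)] by (simp add: cplx_def)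
  have "chain_map R X ?Y cmap_id" "chain_map R ?Y X cmap_id"
    by (rule chain_mapI; auto intro!: rmod_homI simp: cmap_id_def eq)+
  then have "quasi_iso R X ?Y cmap_id"
    by (rule hinj_iso[OF complexesD[OF X(1)] complexesD[OF Y]]) (simp_all add: cmap_id_def)
  then have "we X ?Y cmap_id"
    using X(1) Y by (simp add: we_def)
  then show ?thesis
    using S X(2) unfolding triangle_closed_def by blast
qed

lemma stalk_exact:
  assumes ob: "A \<in> modules Car R" "B \<in> modules Car R" "C \<in> modules Car R"
    and j: "j \<in> rmod_hom R A B" "inj_on j (carrier A)"
    and q: "q \<in> rmod_hom R B C" "q ` carrier B = carrier C"
    and ex: "\<And>x. x \<in> carrier B ==> q x = \<zero>[C] \<longleftrightarrow> x \<in> j ` carrier A"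
  shows "exact_cochains R (stalk A) (stalk B) (stalk C) (\<lambda>n. j) (\<lambda>n. q)"
proof -
  have r: "rmod R A" "rmod R B" "rmod R C"
    using ob by (simp_all add: modules_iff)
  interpret j: rmor R A B j by (rule rmorI[OF r(1,2) j(1)])
  interpret q: rmor R B C q by (rule rmorI[OF r(2,3) q(1)])
  have c: "is_complex R (stalk A)" "is_complex R (stalk B)" "is_complex R (stalk C)"
    using ob stalk_complexes complexesD by blast+
  have "chain_map R (stalk A) (stalk B) (\<lambda>n. j)" "chain_map R (stalk B) (stalk C) (\<lambda>n. q)"
    by (rule chain_mapI; auto intro!: rmod_homI simp: stalk_def split: if_splits)+
  then show ?thesis
    using c j(2) q(2) ex
    by (intro exact_cochains.intro exact_cochains_axioms.intro cmorI) (auto simp: stalk_def image_iff)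
qed

end

lemma restrict_stalk: "restrict_cochain \<phi> (stalk M) = stalk (restrict_scalars \<phi> M)"
  unfolding restrict_cochain_def stalk_def by (auto simp: restrict_scalars_def)

context arrow_removal
begin

lemma complexes_from_L:
  assumes S: "G.triangle_closed S" and all: "\<And>X. X \<in> complexes Car L ==> restrict_cochain i X \<in> S"
  shows "complexes Car G \<subseteq> S"
proof
  fix X assume X: "X \<in> complexes Car G"
  have "restrict_cochain i (restrict_cochain p X) \<in> S"
    by (rule all[OF P.complexes_restrict[OF X]])
  then have "restrict_cochain (\<lambda>r. p (i r)) X \<in> S"
    by (simp add: restrict_cochain_def restrict_scalars_def)
  then show "X \<in> S"
    by (rule G.restrict_same[OF S X]) (simp add: pi)
qed

lemma annihilated_complex:
  assumes S: "L.triangle_closed S" and all: "\<And>X. X \<in> complexes Car G ==> restrict_cochain p X \<in> S"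
    and X: "X \<in> complexes Car L"
    and zero: "\<And>n r x. r \<in> carrier L ==> p r = \<zero>[G] ==> x \<in> el X n ==> r \<odot>[obj X n] x = \<zero>[obj X n]"
  shows "X \<in> S"
proof -
  interpret X: cplx L X using L.complexesD[OF X] by (simp add: cplx_def)
  have "restrict_cochain p (restrict_cochain i X) \<in> S"
    by (rule all[OF I.complexes_restrict[OF X]])
  then have "restrict_cochain (\<lambda>r. i (p r)) X \<in> S"
    by (simp add: restrict_cochain_def restrict_scalars_def)
  moreover have "i (p r) \<odot>[obj X n] x = r \<odot>[obj X n] x" if r: "r \<in> carrier L" and x: "x \<in> el X n" for n r x
  proof -
    let ?d = "i (p r) \<ominus>[L] r"
    interpret ring_hom_ring L G p
      by (rule ring_hom_ringI2[OF L.ring_R G.ring_R p])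
    have "p ?d = \<zero>[G]"
      using r by (simp add: a_minus_def pi GR.r_neg)
    then have "?d \<odot>[obj X n] x = \<zero>[obj X n]"
      using r x zero by simp
    moreover have "i (p r) = ?d \<oplus>[L] r"
      using r by (simp add: LR.minus_eq LR.a_assoc LR.l_neg)
    ultimately show ?thesis
      using r x X.add_smult[of ?d r x n] by simp
  qed
  ultimately show ?thesis
    by (rule L.restrict_same[OF S X])
qed

text \<open>The elements annihilated by \<open>ker p\<close> form a subcomplex, and \<open>ker p\<close> annihilates the quotient
  by it as well because \<open>ker p\<close> squares to zero.\<close>

lemma complexes_from_G:
  assumes S: "L.triangle_closed S" and all: "\<And>X. X \<in> complexes Car G ==> restrict_cochain p X \<in> S"
  shows "complexes Car L \<subseteq> S"
proof
  fix X assume X: "X \<in> complexes Car L"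
  have Xc: "is_complex L X" by (rule L.complexesD[OF X])
  interpret X: cplx L X using Xc by (simp add: cplx_def)
  define A where "A n = {x \<in> el X n. \<forall>r\<in>carrier L. p r = \<zero>[G] \<longrightarrow> r \<odot>[obj X n] x = \<zero>[obj X n]}" for n
  have sub: "submod L (obj X n) (A n)" for n
  proof (intro submod.intro submod_axioms.intro X.rmod_axioms)
    show "r \<odot>[obj X n] x \<in> A n" if "r \<in> carrier L" "x \<in> A n" for r x
    proof -
      have "s \<odot>[obj X n] (r \<odot>[obj X n] x) = \<zero>[obj X n]" if s: "s \<in> carrier L" "p s = \<zero>[G]" for s
      proof -
        have "p (r \<otimes>[L] s) = \<zero>[G]"
          using s \<open>r \<in> carrier L\<close> by simp
        then show ?thesis
          using X.mult_smult[of r s x n] \<open>r \<in> carrier L\<close> \<open>x \<in> A n\<close> s by (simp add: A_def)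
      qed
      then show ?thesis
        using that by (simp add: A_def)
    qed
  qed (auto simp: A_def X.smult_add)
  interpret A: submod L "obj X n" "A n" for n by (rule sub)
  have difA: "dif X n x \<in> A (n + 1)" if "x \<in> A n" for n x
  proof -
    interpret d: rmor L "obj X n" "obj X (n + 1)" "dif X n"
      by (rule rmorI[OF X.rmod_axioms X.rmod_axioms X.dif_hom[OF refl]])
    have "r \<odot>[obj X (n + 1)] dif X n x = \<zero>[obj X (n + 1)]" if r: "r \<in> carrier L" "p r = \<zero>[G]" for r
    proof -
      have "dif X n (r \<odot>[obj X n] x) = \<zero>[obj X (n + 1)]"
        using \<open>x \<in> A n\<close> r d.zero by (simp add: A_def)
      then show ?thesis
        using d.smult[OF r(1)] \<open>x \<in> A n\<close> by (simp add: A_def)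
    qed
    then show ?thesis
      using that d.closed by (simp add: A_def)
  qed
  define U where "U = \<lparr>obj = (\<lambda>n. (obj X n)\<lparr>carrier := A n\<rparr>), dif = dif X\<rparr>"
  define f where "f n = (\<lambda>x. coset_rep (obj X (n + 1)) (A (n + 1)) (dif X n x))" for n
  define W where "W = \<lparr>obj = (\<lambda>n. quot_module (obj X n) (A n)), dif = f\<rparr>"
  have U: "U \<in> complexes Car L"
  proof -
    have "dif X n \<in> rmod_hom L (obj U n) (obj U (n + 1))" for n
      using X.dif_hom[OF refl, of n] difA[of _ n] by (auto simp: U_def rmod_hom_def A_def)
    then have "is_complex L U"
      using Xc A.rmod_sub unfolding is_complex_def right_module_iff by (simp add: U_def A_def add.commute)
    moreover have "el U n \<in> Car" for n
      using L.modules_subset[of "obj X n" "obj U n"] X A.rmod_sub X.rmod_axioms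
      by (simp add: U_def L.modules_iff complexes_def A_def)
    ultimately show ?thesis
      by (simp add: complexes_def)
  qed
  have f: "f n \<in> rmod_hom L (obj X n) (obj W (n + 1))" for n
    unfolding f_def W_def by simp (rule rmod_hom_comp[OF X.dif_hom[OF refl] A.rep_hom])
  have fr: "rmor L (obj X n) (quot_module (obj X (n + 1)) (A (n + 1))) (f n)" for n
    using f[of n] by (intro rmorI X.rmod_axioms A.rmod_quot) (simp add: W_def)
  have f0: "f n x = \<zero>[quot_module (obj X (n + 1)) (A (n + 1))]" if "x \<in> A n" for n x
    using difA[OF that] A.rep_zero_iff[of "dif X n x" "n + 1"] A.sub[of "n + 1"] by (auto simp: f_def)
  note lift = A.quot_lift[OF fr f0]
  have W: "W \<in> complexes Car L"
  proof -
    have "f (n + 1) (f n x) = \<zero>[obj W (n + 2)]" if x: "x \<in> el X n" for n x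
    proof -
      have d: "dif X n x \<in> el X (n + 1)"
        using X.dif_hom[OF refl, of n] x by (auto simp: rmod_hom_def)
      have "f (n + 1) (f n x) = f (n + 1) (dif X n x)"
        using lift(2)[OF _ d] unfolding f_def[of n] by simp
      also have "\<dots> = \<zero>[obj W (n + 2)]"
        using Xc x A.rep_zero_iff[of "\<zero>[obj X (n + 2)]" "n + 2"] A.sub_zero[of "n + 2"]
        by (simp add: f_def W_def is_complex_def add.assoc)
      finally show ?thesis .
    qed
    then have "is_complex L W"
      using lift(1) A.rmod_quot unfolding is_complex_def right_module_iff
      by (auto simp: W_def dest: subsetD[OF A.quot_subset])
    moreover have "el W n \<in> Car" for n
      using L.modules_subset[of "obj X n" "obj W n"] X A.rmod_quot X.rmod_axioms A.quot_subset
      by (simp add: W_def L.modules_iff complexes_def)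
    ultimately show ?thesis
      by (simp add: complexes_def)
  qed
  have "exact_cochains L U X W (\<lambda>n x. x) (\<lambda>n. coset_rep (obj X n) (A n))"
  proof (intro exact_cochains.intro exact_cochains_axioms.intro cmorI L.complexesD[OF U] Xc L.complexesD[OF W])
    show "chain_map L U X (\<lambda>n x. x)"
      using A.sub_inclusion by (intro chain_mapI) (simp_all add: U_def)
    show "chain_map L X W (\<lambda>n. coset_rep (obj X n) (A n))"
    proof (rule chain_mapI)
      show "coset_rep (obj X n) (A n) \<in> rmod_hom L (obj X n) (obj W n)" for n
        using A.rep_hom by (simp add: W_def)
      show "coset_rep (obj X (n + 1)) (A (n + 1)) (dif X n x) = dif W n (coset_rep (obj X n) (A n) x)"
        if "x \<in> el X n" for n x
        using lift(2)[OF _ that] by (simp add: W_def f_def)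
    qed
    show "coset_rep (obj X n) (A n) y = \<zero>[obj W n] \<longleftrightarrow> y \<in> (\<lambda>x. x) ` el U n"
      if "y \<in> el X n" for y n
      using A.rep_zero_iff[OF that] by (simp add: W_def U_def)
    show "z \<in> coset_rep (obj X n) (A n) ` el X n" if "z \<in> el W n" for z n
      using that A.rep_surj by (simp add: W_def)
  qed (simp add: inj_on_def)
  moreover have "U \<in> S"
    by (rule annihilated_complex[OF S all U]) (simp_all add: U_def A_def)
  moreover have "W \<in> S"
  proof (rule annihilated_complex[OF S all W])
    fix n r x assume r: "r \<in> carrier L" "p r = \<zero>[G]" and "x \<in> el W n"
    then obtain y where y: "y \<in> el X n" "x = coset_rep (obj X n) (A n) y"
      using A.rep_surj[of n] by (auto simp: W_def)
    have "s \<odot>[obj X n] (r \<odot>[obj X n] y) = \<zero>[obj X n]" if "s \<in> carrier L" "p s = \<zero>[G]" for s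
      using X.mult_smult[of r s y n] square_zero[of r s] that r y(1) by simp
    then have "r \<odot>[obj X n] y \<in> A n"
      using r y(1) by (simp add: A_def)
    then show "r \<odot>[obj W n] x = \<zero>[obj W n]"
      using rmod_hom_smult[OF A.rep_hom r(1) y(1)] A.rep_zero_iff[of "r \<odot>[obj X n] y" n] r(1) y
      by (simp add: W_def)
  qed
  ultimately show "X \<in> S"
    using L.exact_triangle_closed(2)[OF S U X W] by blast
qed

theorem injectives_generate_arrow_removal: "injectives_generate Idx Car L \<longleftrightarrow> injectives_generate Idx Car G"
proof
  assume gen: "injectives_generate Idx Car L"
  show "injectives_generate Idx Car G"
    unfolding G.injectives_generate_iff
  proof (intro allI impI, elim conjE)
    fix S assume S: "localising Idx Car G S" "stalk ` injective_modules Car G \<subseteq> S"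
    let ?T = "{X \<in> complexes Car L. restrict_cochain i X \<in> S}"
    have "stalk ` injective_modules Car L \<subseteq> ?T"
      using S(2) restrict_injective L.stalk_injective by (auto simp: restrict_stalk)
    then have "complexes Car L \<subseteq> ?T"
      using gen I.preimage_localising[OF S(1)] unfolding L.injectives_generate_iff by blast
    then show "complexes Car G \<subseteq> S"
      using S(1) by (intro complexes_from_L) (auto simp: G.localising_iff)
  qed
next
  assume gen: "injectives_generate Idx Car G"
  show "injectives_generate Idx Car L"
    unfolding L.injectives_generate_iff
  proof (intro allI impI, elim conjE)
    fix S assume S: "localising Idx Car L S" "stalk ` injective_modules Car L \<subseteq> S"
    have S': "L.triangle_closed S"
      using S(1) by (simp add: L.localising_iff)
    let ?T = "{X \<in> complexes Car G. restrict_cochain p X \<in> S}"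
    have "stalk (Infl E) \<in> S" if E: "E \<in> injective_modules Car G" for E
    proof (rule inflate_injective[OF E])
      fix J C j q assume J: "J \<in> injective_modules Car L" "C \<in> injective_modules Car L"
        and ex: "j \<in> rmod_hom L (Infl E) J" "inj_on j (carrier E)" "q \<in> rmod_hom L J C" "q ` carrier J = carrier C"
          "\<And>x. x \<in> carrier J ==> q x = \<zero>[C] \<longleftrightarrow> x \<in> j ` carrier E"
      note ob = Infl_modules[OF injectiveD[OF E]] injectiveD[OF J(1)] injectiveD[OF J(2)]
      have "exact_cochains L (stalk (Infl E)) (stalk J) (stalk C) (\<lambda>n. j) (\<lambda>n. q)"
        by (rule L.stalk_exact[OF ob]) (simp_all add: ex)
      then show ?thesis
        using L.exact_triangle_closed(3)[OF S' ob[THEN L.stalk_complexes]] J S(2) by blast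
    qed
    then have "stalk ` injective_modules Car G \<subseteq> ?T"
      using G.stalk_injective by (auto simp: restrict_stalk)
    then have "complexes Car G \<subseteq> ?T"
      using gen P.preimage_localising[OF S(1)] unfolding G.injectives_generate_iff by blast
    then show "complexes Car L \<subseteq> S"
      by (intro complexes_from_G[OF S']) auto
  qed
qed

theorem projectives_cogenerate_arrow_removal:
  "projectives_cogenerate Idx Car L \<longleftrightarrow> projectives_cogenerate Idx Car G"
proof
  assume gen: "projectives_cogenerate Idx Car L"
  show "projectives_cogenerate Idx Car G"
    unfolding G.projectives_cogenerate_iff
  proof (intro allI impI, elim conjE)
    fix S assume S: "colocalising Idx Car G S" "stalk ` projective_modules Car G \<subseteq> S"
    let ?T = "{X \<in> complexes Car L. restrict_cochain i X \<in> S}"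
    have "stalk ` projective_modules Car L \<subseteq> ?T"
      using S(2) restrict_projective L.stalk_projective by (auto simp: restrict_stalk)
    then have "complexes Car L \<subseteq> ?T"
      using gen I.preimage_colocalising[OF S(1)] unfolding L.projectives_cogenerate_iff by blast
    then show "complexes Car G \<subseteq> S"
      using S(1) by (intro complexes_from_L) (auto simp: G.colocalising_iff)
  qed
next
  assume gen: "projectives_cogenerate Idx Car G"
  show "projectives_cogenerate Idx Car L"
    unfolding L.projectives_cogenerate_iff
  proof (intro allI impI, elim conjE)
    fix S assume S: "colocalising Idx Car L S" "stalk ` projective_modules Car L \<subseteq> S"
    have S': "L.triangle_closed S"
      using S(1) by (simp add: L.colocalising_iff)
    let ?T = "{X \<in> complexes Car G. restrict_cochain p X \<in> S}"
    have "stalk (Infl E) \<in> S" if E: "E \<in> projective_modules Car G" for E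
    proof (rule inflate_projective[OF E])
      fix F C j q assume F: "F \<in> projective_modules Car L" "C \<in> projective_modules Car L"
        and ex: "j \<in> rmod_hom L C F" "inj_on j (carrier C)" "q \<in> rmod_hom L F (Infl E)" "q ` carrier F = carrier E"
          "\<And>x. x \<in> carrier F ==> q x = \<zero>[E] \<longleftrightarrow> x \<in> j ` carrier C"
      note ob = projectiveD[OF F(2)] projectiveD[OF F(1)] Infl_modules[OF projectiveD[OF E]]
      have "exact_cochains L (stalk C) (stalk F) (stalk (Infl E)) (\<lambda>n. j) (\<lambda>n. q)"
        by (rule L.stalk_exact[OF ob]) (simp_all add: ex)
      then show ?thesis
        using L.exact_triangle_closed(1)[OF S' ob[THEN L.stalk_complexes]] F S(2) by blast
    qed
    then have "stalk ` projective_modules Car G \<subseteq> ?T"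
      using G.stalk_projective by (auto simp: restrict_stalk)
    then have "complexes Car G \<subseteq> ?T"
      using gen P.preimage_colocalising[OF S(1)] unfolding G.projectives_cogenerate_iff by blast
    then show "complexes Car L \<subseteq> S"
      by (intro complexes_from_G[OF S']) auto
  qed
qed

end

section \<open>Ideals and quotients\<close>

lemma (in ring) genideal_subset:
  assumes "X \<subseteq> S" "S \<subseteq> carrier R" "\<zero> \<in> S" "\<And>x y. x \<in> S ==> y \<in> S ==> x \<oplus> y \<in> S"
    "\<And>r x. r \<in> carrier R ==> x \<in> S ==> r \<otimes> x \<in> S" "\<And>r x. r \<in> carrier R ==> x \<in> S ==> x \<otimes> r \<in> S"
  shows "Idl X \<subseteq> S"
proof (rule genideal_minimal[OF _ assms(1)])
  have "\<ominus> x \<in> S" if "x \<in> S" for x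
    using assms(5)[of "\<ominus> \<one>" x] that assms(2) by (simp add: subset_iff l_minus)
  then show "ideal S R"
    using assms by (intro idealI ring_axioms add.subgroupI) (auto simp: a_inv_def)
qed

lemma (in ideal) coset_zero_iff: "x \<in> carrier R ==> I +> x = \<zero>[R Quot I] \<longleftrightarrow> x \<in> I"
  using a_rcos_self a_rcos_const by (auto simp: FactRing_def)

lemma (in ideal) coset_surj: "(+>) I ` carrier R = carrier (R Quot I)"
  by (auto simp: FactRing_simps)

lemma hom_factor:
  assumes AB: "ring A" "ring B" and \<psi>: "\<psi> \<in> ring_hom A B" "\<psi> ` carrier A = carrier B"
    and N: "abelian_group N" and \<chi>: "\<And>x. x \<in> carrier A ==> \<chi> x \<in> carrier N"
      "\<And>x y. x \<in> carrier A ==> y \<in> carrier A ==> \<chi> (x \<oplus>[A] y) = \<chi> x \<oplus>[N] \<chi> y"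
      "\<And>x. x \<in> carrier A ==> \<psi> x = \<zero>[B] ==> \<chi> x = \<zero>[N]"
    and x: "x \<in> carrier A"
  shows "\<chi> (inv_into (carrier A) \<psi> (\<psi> x)) = \<chi> x"
proof -
  interpret ring_hom_ring A B \<psi> by (rule ring_hom_ringI2[OF AB \<psi>(1)])
  interpret N: abelian_group N by (rule N)
  let ?y = "inv_into (carrier A) \<psi> (\<psi> x)"
  have y: "?y \<in> carrier A" "\<psi> ?y = \<psi> x"
    using x by (simp_all add: inv_into_into f_inv_into_f)
  have "\<psi> (?y \<ominus>[A] x) = \<zero>[B]"
    using x y by (simp add: a_minus_def S.r_neg)
  then have "\<chi> (?y \<ominus>[A] x) = \<zero>[N]"
    using \<chi>(3) x y(1) by simp
  moreover have "?y = (?y \<ominus>[A] x) \<oplus>[A] x"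
    using x y(1) by (simp add: R.minus_eq R.a_assoc R.l_neg)
  ultimately show ?thesis
    using \<chi>(2)[of "?y \<ominus>[A] x" x] \<chi>(1)[OF x] x y(1) by simp
qed

lemma ring_hom_factor:
  assumes r: "ring A" "ring B" "ring C" and \<psi>: "\<psi> \<in> ring_hom A B" "\<psi> ` carrier A = carrier B"
    and \<chi>: "\<chi> \<in> ring_hom A C" "\<And>x. x \<in> carrier A ==> \<psi> x = \<zero>[B] ==> \<chi> x = \<zero>[C]"
  obtains i where "i \<in> ring_hom B C" "\<And>x. x \<in> carrier A ==> i (\<psi> x) = \<chi> x"
proof -
  interpret ring_hom_ring A B \<psi> by (rule ring_hom_ringI2[OF r(1,2) \<psi>(1)])
  interpret \<chi>: ring_hom_ring A C \<chi> by (rule ring_hom_ringI2[OF r(1,3) \<chi>(1)])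
  let ?i = "\<lambda>y. \<chi> (inv_into (carrier A) \<psi> y)"
  have i: "?i (\<psi> x) = \<chi> x" if "x \<in> carrier A" for x
    by (rule hom_factor[OF r(1,2) \<psi> \<chi>.S.abelian_group_axioms]) (use that \<chi>(2) in auto)
  have B: "\<exists>x\<in>carrier A. y = \<psi> x" if "y \<in> carrier B" for y
    using that \<psi>(2) by blast
  have "?i \<in> ring_hom B C"
  proof (rule ring_hom_memI)
    fix x y assume "x \<in> carrier B" "y \<in> carrier B"
    then obtain a b where ab: "a \<in> carrier A" "b \<in> carrier A" "x = \<psi> a" "y = \<psi> b" using B by metis
    show "?i (x \<otimes>[B] y) = ?i x \<otimes>[C] ?i y" using ab i[of "a \<otimes>[A] b"] i by simp
    show "?i (x \<oplus>[B] y) = ?i x \<oplus>[C] ?i y" using ab i[of "a \<oplus>[A] b"] i by simp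
  next
    show "?i x \<in> carrier C" if "x \<in> carrier B" for x using B[OF that] i by auto
    show "?i \<one>[B] = \<one>[C]" using i[of "\<one>[A]"] by simp
  qed
  then show thesis using i that by blast
qed

lemma rmod_factor:
  assumes r: "ring B" and \<psi>: "\<psi> \<in> ring_hom A B" "\<psi> ` carrier A = carrier B"
    and V: "rmod A V" "\<And>x v. x \<in> carrier A ==> \<psi> x = \<zero>[B] ==> v \<in> carrier V ==> x \<odot>[V] v = \<zero>[V]"
  obtains act where "rmod B (with_action V act)"
    "\<And>x v. x \<in> carrier A ==> v \<in> carrier V ==> act (\<psi> x) v = x \<odot>[V] v"
proof -
  interpret V: rmod A V by (rule V)
  interpret ring_hom_ring A B \<psi> by (rule ring_hom_ringI2[OF V.R.ring_axioms r \<psi>(1)])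
  let ?act = "\<lambda>y v. inv_into (carrier A) \<psi> y \<odot>[V] v"
  have i: "?act (\<psi> x) v = x \<odot>[V] v" if "x \<in> carrier A" "v \<in> carrier V" for x v
    by (rule hom_factor[OF V.R.ring_axioms r \<psi> V.abelian_group_axioms]) (use that V(2) V.add_smult in auto)
  have B: "\<exists>x\<in>carrier A. y = \<psi> x" if "y \<in> carrier B" for y
    using that \<psi>(2) by blast
  have "rmod B (with_action V ?act)"
  proof (rule rmodI[OF r])
    show "abelian_group (with_action V ?act)"
      by (rule abelian_groupI) (auto simp: V.a_ac intro!: bexI[of _ "\<ominus>[V] _"] V.l_neg)
    fix x y v assume "x \<in> carrier B" "y \<in> carrier B" and v: "v \<in> carrier (with_action V ?act)"
    then obtain a b where ab: "a \<in> carrier A" "b \<in> carrier A" "x = \<psi> a" "y = \<psi> b" using B by metis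
    show "(x \<oplus>[B] y) \<odot>[with_action V ?act] v =
        x \<odot>[with_action V ?act] v \<oplus>[with_action V ?act] y \<odot>[with_action V ?act] v"
      using ab v i[of "a \<oplus>[A] b" v] i by (simp add: V.add_smult)
    show "(x \<otimes>[B] y) \<odot>[with_action V ?act] v = y \<odot>[with_action V ?act] (x \<odot>[with_action V ?act] v)"
      using ab v i[of "a \<otimes>[A] b" v] i by (simp add: V.mult_smult)
  next
    fix x v w assume "x \<in> carrier B" and v: "v \<in> carrier (with_action V ?act)"
    then obtain a where ab: "a \<in> carrier A" "x = \<psi> a" using B by metis
    show "x \<odot>[with_action V ?act] v \<in> carrier (with_action V ?act)"
      using ab v i by simp
    show "x \<odot>[with_action V ?act] (v \<oplus>[with_action V ?act] w) =
        x \<odot>[with_action V ?act] v \<oplus>[with_action V ?act] x \<odot>[with_action V ?act] w"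
      if "w \<in> carrier (with_action V ?act)"
      using ab v that i by (simp add: V.smult_add)
  next
    show "\<one>[B] \<odot>[with_action V ?act] v = v" if "v \<in> carrier (with_action V ?act)" for v
      using that i[of "\<one>[A]" v] by simp
  qed
  then show thesis using that i by blast
qed

section \<open>Path algebras\<close>

abbreviation (input) on_paths :: "('v, 'e) pre_digraph => (('v, 'e) qpath \<Rightarrow>\<^sub>0 'k::zero) => bool" where
  "on_paths Q x \<equiv> Poly_Mapping.keys x \<subseteq> paths Q"

lemma path_algebra_simps [simp]:
  "x \<in> carrier (path_algebra Q) \<longleftrightarrow> on_paths Q x" "\<zero>[path_algebra Q] = 0"
  "x \<oplus>[path_algebra Q] y = x + y" "x \<otimes>[path_algebra Q] y = path_mult x y"
  by (simp_all add: path_algebra_def)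

lemma path_mult_zero [simp]: "path_mult 0 x = 0" "path_mult x 0 = 0"
  by (simp_all add: path_mult_def)

lemma path_mult_single [simp]: "path_mult (Poly_Mapping.single (u, p, v) c) (Poly_Mapping.single (u', q, w) d) =
    (if v = u' then Poly_Mapping.single (u, p @ q, w) (c * d) else 0)"
  by (auto simp: path_mult_def)

lemma path_induct [consumes 1, case_names zero add single]:
  assumes "on_paths Q x" "P 0"
    "\<And>x y. on_paths Q x ==> on_paths Q y ==> P x ==> P y ==> P (x + y)"
    "\<And>u p v c. (u, p, v) \<in> paths Q ==> P (Poly_Mapping.single (u, p, v) c)"
  shows "P x"
  using assms(1)
proof (induction x rule: Poly_Mapping.update_induct)
  case (update f a b)
  have f: "on_paths Q f" "a \<in> paths Q"
    using update by (auto simp: keys_update split: if_splits)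
  have "Poly_Mapping.update a b f = f + Poly_Mapping.single a b"
    using update(1) by (intro poly_mapping_eqI) (auto simp: lookup_update lookup_add lookup_single in_keys_iff)
  moreover have "P (Poly_Mapping.single a b)"
    using assms(4) f(2) by (cases a) blast
  ultimately show ?case
    using assms(3)[of f "Poly_Mapping.single a b"] update(3) f by simp
qed (rule assms(2))

lemma path_induct2 [consumes 2, case_names zero_left zero_right add_left add_right single]:
  assumes "on_paths Q x" "on_paths Q y"
    "\<And>y. on_paths Q y ==> P 0 y" "\<And>x. on_paths Q x ==> P x 0"
    "\<And>x x' y. on_paths Q x ==> on_paths Q x' ==> on_paths Q y ==>
      P x y ==> P x' y ==> P (x + x') y"
    "\<And>x y y'. on_paths Q x ==> on_paths Q y ==> on_paths Q y' ==>
      P x y ==> P x y' ==> P x (y + y')"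
    "\<And>u p v c u' q w d. (u, p, v) \<in> paths Q ==> (u', q, w) \<in> paths Q ==>
      P (Poly_Mapping.single (u, p, v) c) (Poly_Mapping.single (u', q, w) d)"
  shows "P x y"
  using assms(1)
proof (induction x rule: path_induct)
  case (single u p v c)
  note path = single
  show ?case using assms(2)
    by (induction y rule: path_induct) (use assms path in auto)
qed (use assms in auto)

definition scale :: "'k::field => (('v, 'e) qpath \<Rightarrow>\<^sub>0 'k) => ('v, 'e) qpath \<Rightarrow>\<^sub>0 'k" where
  "scale c = Poly_Mapping.mapp (\<lambda>_ d. c * d)"

definition remove_arrows :: "'e set => (('v, 'e) qpath \<Rightarrow>\<^sub>0 'k::field) => ('v, 'e) qpath \<Rightarrow>\<^sub>0 'k" where
  "remove_arrows S = Poly_Mapping.mapp (\<lambda>(u, p, v) d. if set p \<inter> S = {} then d else 0)"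

lemma lookup_scale: "Poly_Mapping.lookup (scale c x) w = c * Poly_Mapping.lookup x w"
  by (auto simp: scale_def lookup_mapp in_keys_iff when_def)

lemma lookup_remove_arrows: "Poly_Mapping.lookup (remove_arrows S x) (u, p, v) =
    (if set p \<inter> S = {} then Poly_Mapping.lookup x (u, p, v) else 0)"
  by (auto simp: remove_arrows_def lookup_mapp in_keys_iff when_def)

lemma scale_simps [simp]:
  "scale c (x + y) = scale c x + scale c y" "scale c 0 = 0" "scale c (Poly_Mapping.single w d) = Poly_Mapping.single w (c * d)"
  "scale c (scale d x) = scale (c * d) x" "scale 1 x = x" "scale 0 x = 0" "scale (c + d) x = scale c x + scale d x"
  by (rule poly_mapping_eqI; auto simp: lookup_scale lookup_add lookup_single algebra_simps when_def)+

lemma remove_arrows_simps [simp]: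
  "remove_arrows S (x + y) = remove_arrows S x + remove_arrows S y" "remove_arrows S 0 = 0"
  "remove_arrows S (scale c x) = scale c (remove_arrows S x)"
  "remove_arrows S (Poly_Mapping.single (u, p, v) c) = (if set p \<inter> S = {} then Poly_Mapping.single (u, p, v) c else 0)"
  by (rule poly_mapping_eqI; auto simp: lookup_remove_arrows lookup_scale lookup_add lookup_single when_def split: if_splits)+

lemma keys_scale: "on_paths Q x ==> on_paths Q (scale c x)"
  unfolding scale_def by (rule order_trans[OF keys_mapp_subset])

lemma keys_remove_arrows: "on_paths Q x ==> on_paths Q (remove_arrows S x)"
  unfolding remove_arrows_def by (rule order_trans[OF keys_mapp_subset])

lemma keys_plus: "on_paths Q x ==> on_paths Q y ==> on_paths Q (x + y)"
  by (rule order_trans[OF keys_add Un_least])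

context
  fixes Q :: "('v, 'e) pre_digraph"
  assumes ring_A: "ring (path_algebra Q :: (('v, 'e) qpath \<Rightarrow>\<^sub>0 'k::field) ring)"
begin

interpretation A: ring "path_algebra Q :: (('v, 'e) qpath \<Rightarrow>\<^sub>0 'k) ring" by (rule ring_A)

lemma path_mult_linear:
  fixes x y z :: "('v, 'e) qpath \<Rightarrow>\<^sub>0 'k"
  assumes "on_paths Q x" "on_paths Q y" "on_paths Q z"
  shows "path_mult (x + y) z = path_mult x z + path_mult y z" "path_mult x (y + z) = path_mult x y + path_mult x z"
  using A.l_distr[of x y z] A.r_distr[of y z x] assms by simp_all

lemma path_mult_scale:
  fixes x y :: "('v, 'e) qpath \<Rightarrow>\<^sub>0 'k"
  assumes "on_paths Q x" "on_paths Q y"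
  shows "path_mult (scale c x) y = scale c (path_mult x y) \<and> path_mult x (scale c y) = scale c (path_mult x y)"
  using assms by (induction x y rule: path_induct2) (simp_all add: path_mult_linear keys_scale keys_plus mult.left_commute mult.assoc)

lemma remove_arrows_mult:
  fixes x y :: "('v, 'e) qpath \<Rightarrow>\<^sub>0 'k"
  assumes "on_paths Q x" "on_paths Q y"
  shows "remove_arrows S (path_mult x y) = path_mult (remove_arrows S x) (remove_arrows S y)"
  using assms by (induction x y rule: path_induct2) (auto simp: path_mult_linear keys_remove_arrows keys_plus Int_Un_distrib2)

lemma remove_arrows_hom: "remove_arrows S \<in> ring_hom (path_algebra Q :: (('v, 'e) qpath \<Rightarrow>\<^sub>0 'k) ring) (path_algebra Q)"
proof (rule ring_hom_memI)
  show "remove_arrows S \<one>[path_algebra Q] = \<one>[path_algebra Q]"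
    by (rule poly_mapping_eqI) (auto simp: lookup_remove_arrows path_algebra_def lookup_sum trivial_path_def lookup_single
        when_def intro!: sum.neutral split: if_splits)
qed (simp_all add: keys_remove_arrows remove_arrows_mult)

end

section \<open>Removing arrows from a bound quiver algebra\<close>

locale removable_arrows = fin_digraph Q + I: ideal I "path_algebra Q"
  for Q :: "('v, 'e) pre_digraph" and I :: "(('v, 'e) qpath \<Rightarrow>\<^sub>0 'k::field) set" +
  fixes Gen :: "(('v, 'e) qpath \<Rightarrow>\<^sub>0 'k) set" and Arr :: "'e set" and m :: nat
  assumes Gen: "Gen \<subseteq> carrier (path_algebra Q)" "genideal (path_algebra Q) Gen = I"
      "x \<in> Gen ==> \<alpha> \<in> Arr ==> \<not> arrow_occurs \<alpha> x"
    and Arr: "\<alpha> \<in> Arr ==> \<alpha> \<in> arcs Q"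
    and power: "ideal_power (path_algebra Q) (arrow_ideal Q) m \<subseteq> I"
    and hom_zero: "\<alpha> \<in> Arr ==> \<beta> \<in> Arr ==> hom_zero (bound_quiver_algebra Q I)
      (principal_rmod (bound_quiver_algebra Q I) (residue Q I (trivial_path (tail Q \<alpha>))))
      (principal_rmod (bound_quiver_algebra Q I) (residue Q I (trivial_path (head Q \<beta>))))"
begin

abbreviation A :: "(('v, 'e) qpath \<Rightarrow>\<^sub>0 'k) ring" where "A \<equiv> path_algebra Q"
abbreviation "Lam \<equiv> bound_quiver_algebra Q I"
abbreviation "res \<equiv> residue Q I"
abbreviation "arw \<alpha> \<equiv> res (arrow_path Q \<alpha>)"
abbreviation "P \<equiv> genideal Lam (arw ` Arr)"
abbreviation "Gam \<equiv> Lam Quot P"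
abbreviation "\<pi> \<equiv> a_r_coset Lam P"
abbreviation "\<psi> x \<equiv> \<pi> (res x)"
abbreviation \<theta> :: "(('v, 'e) qpath \<Rightarrow>\<^sub>0 'k) => ('v, 'e) qpath \<Rightarrow>\<^sub>0 'k" where "\<theta> \<equiv> remove_arrows Arr"
abbreviation sg :: "'v => 'e list => 'v => 'k => ('v, 'e) qpath \<Rightarrow>\<^sub>0 'k" where
  "sg u p v c \<equiv> Poly_Mapping.single (u, p, v) c"
abbreviation csc :: "'k => ('v, 'e) qpath \<Rightarrow>\<^sub>0 'k" where "csc c \<equiv> scale c \<one>[A]"

lemma in_paths [simp]: "(u, p, v) \<in> paths Q \<longleftrightarrow> awalk u p v"
  by (simp add: paths_def)

lemma res_hom: "res \<in> ring_hom A Lam"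
  using I.rcos_ring_hom by (simp add: bound_quiver_algebra_def residue_def[abs_def])

lemma ring_Lam: "ring Lam"
  using I.quotient_is_ring by (simp add: bound_quiver_algebra_def)

sublocale L: ring Lam by (rule ring_Lam)

sublocale res: ring_hom_ring A Lam res
  by (rule ring_hom_ringI2[OF I.ring_axioms ring_Lam res_hom])

lemmas A_closed [simp] = I.m_closed[simplified] I.a_closed[simplified] I.one_closed[simplified] keys_scale keys_remove_arrows
lemmas res_simps [simp] = res.hom_closed[simplified] res.hom_add[simplified] res.hom_mult[simplified] res.hom_zero[simplified]
lemma res_surj: "res ` carrier A = carrier Lam"
  using I.coset_surj by (simp add: bound_quiver_algebra_def residue_def[abs_def])

lemma res_zero_iff: "x \<in> carrier A ==> res x = \<zero>[Lam] \<longleftrightarrow> x \<in> I"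
  using I.coset_zero_iff by (simp add: bound_quiver_algebra_def residue_def[abs_def])

lemma arrow_sg: "arrow_path Q \<alpha> = sg (tail Q \<alpha>) [\<alpha>] (head Q \<alpha>) 1"
  by (simp add: arrow_path_def)

lemma arrow_closed [simp]: "\<alpha> \<in> arcs Q ==> on_paths Q (arrow_path Q \<alpha> :: _ \<Rightarrow>\<^sub>0 'k)"
  by (simp add: arrow_sg arc_implies_awalk)

lemma trivial_closed [simp]: "v \<in> verts Q ==> on_paths Q (trivial_path v :: _ \<Rightarrow>\<^sub>0 'k)"
  by (simp add: trivial_path_def awalk_Nil_iff)

sublocale P: ideal P Lam
  by (rule L.genideal_ideal) (use Arr res.hom_closed in auto)

lemma ring_Gam: "ring Gam" by (rule P.quotient_is_ring)

sublocale G: ring Gam by (rule ring_Gam)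

sublocale \<pi>: ring_hom_ring Lam Gam \<pi>
  by (rule P.rcos_ring_hom_ring)

lemma \<psi>_hom: "(\<lambda>x. \<psi> x) \<in> ring_hom A Gam"
  by (rule ring_hom_memI) simp_all

sublocale \<psi>: ring_hom_ring A Gam "\<lambda>x. \<psi> x"
  by (rule ring_hom_ringI2[OF I.ring_axioms ring_Gam \<psi>_hom])

lemma \<psi>_surj: "(\<lambda>x. \<psi> x) ` carrier A = carrier Gam"
  using P.coset_surj res_surj by (metis image_image)

lemma arw_P: "\<alpha> \<in> Arr ==> arw \<alpha> \<in> P"
  by (rule subsetD[OF L.genideal_self]) (use Arr res.hom_closed in auto)

lemma \<theta>_hom: "\<theta> \<in> ring_hom A A"
  by (rule remove_arrows_hom[OF I.ring_axioms])

sublocale \<theta>: ring_hom_ring A A \<theta>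
  by (rule ring_hom_ringI2[OF I.ring_axioms I.ring_axioms \<theta>_hom])

lemma \<theta>_Gen: "g \<in> Gen ==> \<theta> g = g"
  using Gen(3) by (intro poly_mapping_eqI) (force simp: lookup_remove_arrows arrow_occurs_def in_keys_iff)

lemma \<theta>_I: "x \<in> I ==> \<theta> x \<in> I"
proof -
  have "g \<in> carrier A \<and> \<theta> g \<in> I" if "g \<in> Gen" for g
    using subsetD[OF Gen(1) that] subsetD[OF I.genideal_self[OF Gen(1)] that] Gen(2) \<theta>_Gen[OF that] by simp
  then have "genideal A Gen \<subseteq> {x \<in> carrier A. \<theta> x \<in> I}"
    by (intro I.genideal_minimal \<theta>.ideal_vimage I.ideal_axioms) blast
  then show "x \<in> I ==> \<theta> x \<in> I"
    using Gen(2) by blast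
qed

lemma section_exists: "\<exists>i. i \<in> ring_hom Gam Lam \<and> (\<forall>x\<in>carrier A. i (\<psi> x) = res (\<theta> x))"
proof -
  have hom: "(\<lambda>x. res (\<theta> x)) \<in> ring_hom A Lam"
    using ring_hom_trans[OF \<theta>_hom res_hom] by (simp add: comp_def)
  have ker: "res (\<theta> x) = \<zero>[Lam]" if "x \<in> carrier A" "res x = \<zero>[Lam]" for x
    using that \<theta>_I res_zero_iff[of x] res_zero_iff[of "\<theta> x"] by simp
  obtain t where t: "t \<in> ring_hom Lam Lam" "\<And>x. x \<in> carrier A ==> t (res x) = res (\<theta> x)"
    using ring_hom_factor[OF I.ring_axioms ring_Lam ring_Lam res_hom res_surj hom ker] by metis
  interpret t: ring_hom_ring Lam Lam t
    by (rule ring_hom_ringI2[OF ring_Lam ring_Lam t(1)])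
  have "t (arw \<alpha>) = \<zero>[Lam]" if "\<alpha> \<in> Arr" for \<alpha>
  proof -
    have "\<theta> (arrow_path Q \<alpha>) = 0"
      using that by (simp add: arrow_sg)
    then show ?thesis
      using t(2)[of "arrow_path Q \<alpha>"] Arr[OF that] res.hom_zero by simp
  qed
  then have "P \<subseteq> {y \<in> carrier Lam. t y = \<zero>[Lam]}"
    by (intro L.genideal_subset) (use Arr res.hom_closed in auto)
  then have "t y = \<zero>[Lam]" if "y \<in> carrier Lam" "\<pi> y = \<zero>[Gam]" for y
    using P.coset_zero_iff[OF that(1)] that(2) by blast
  then obtain i where "i \<in> ring_hom Gam Lam" "\<And>y. y \<in> carrier Lam ==> i (\<pi> y) = t y"
    using ring_hom_factor[OF ring_Lam ring_Gam ring_Lam P.rcos_ring_hom P.coset_surj t(1)] by metis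
  then show ?thesis
    using t(2) by (intro exI[of _ i]) simp
qed

lemma \<psi>_\<theta>: "x \<in> carrier A ==> \<psi> (\<theta> x) = \<psi> x"
proof -
  have "\<psi> (\<theta> x) = \<psi> x" if "on_paths Q x" for x
    using that
  proof (induction x rule: path_induct)
    case (add x y)
    then show ?case
      using \<psi>.hom_add[of "\<theta> x" "\<theta> y"] \<psi>.hom_add[of x y] by (simp add: keys_remove_arrows)
  next
    case (single u p v c)
    show ?case
    proof (cases "set p \<inter> Arr = {}")
      case False
      then obtain \<alpha> q r where p: "\<alpha> \<in> Arr" "p = q @ \<alpha> # r"
        by (metis disjoint_iff split_list)
      have w: "awalk u q (tail Q \<alpha>)" "awalk (head Q \<alpha>) r v"
        using single unfolding p(2) by (auto simp: awalk_Cons_iff)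
      have eq: "sg u p v c = sg u q (tail Q \<alpha>) c \<otimes>[A] (arrow_path Q \<alpha> \<otimes>[A] sg (head Q \<alpha>) r v 1)"
        by (simp add: p arrow_sg)
      have "\<psi> (arrow_path Q \<alpha>) = \<zero>[Gam]"
        using arw_P[OF p(1)] P.coset_zero_iff Arr[OF p(1)] res.hom_closed by simp
      then have "\<psi> (sg u p v c) = \<zero>[Gam]"
        unfolding eq using w Arr[OF p(1)] by simp
      then show ?thesis
        using False \<psi>.hom_zero by simp
    qed simp
  qed simp
  then show "x \<in> carrier A ==> \<psi> (\<theta> x) = \<psi> x" by simp
qed

lemma square_zero:
  assumes "x \<in> P" "y \<in> P"
  shows "x \<otimes>[Lam] y = \<zero>[Lam]"
proof -
  have ac: "arw \<alpha> \<in> carrier Lam" "res (trivial_path (tail Q \<alpha>)) \<in> carrier Lam" "res (trivial_path (head Q \<alpha>)) \<in> carrier Lam"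
    if "\<alpha> \<in> Arr" for \<alpha>
    using Arr[OF that] by (auto intro!: res.hom_closed)
  have arr: "res (trivial_path (tail Q \<alpha>)) \<otimes>[Lam] arw \<alpha> = arw \<alpha>" "arw \<alpha> \<otimes>[Lam] res (trivial_path (head Q \<alpha>)) = arw \<alpha>"
    if "\<alpha> \<in> Arr" for \<alpha>
    using Arr[OF that] res.hom_mult[of "trivial_path (tail Q \<alpha>)" "arrow_path Q \<alpha>"]
      res.hom_mult[of "arrow_path Q \<alpha>" "trivial_path (head Q \<alpha>)"] by (simp_all add: arrow_sg trivial_path_def awalk_Nil_iff arc_implies_awalk)
  have zero: "arw \<beta> \<otimes>[Lam] (r \<otimes>[Lam] arw \<alpha>) = \<zero>[Lam]" if ab: "\<alpha> \<in> Arr" "\<beta> \<in> Arr" and r: "r \<in> carrier Lam" for \<alpha> \<beta> r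
  proof -
    let ?e = "res (trivial_path (tail Q \<alpha>))" and ?f = "res (trivial_path (head Q \<beta>))"
    note c = ac[OF ab(1)] ac[OF ab(2)] r
    let ?h = "\<lambda>x. ?f \<otimes>[Lam] (r \<otimes>[Lam] x)"
    have "?h \<in> rmod_hom Lam (principal_rmod Lam ?e) (principal_rmod Lam ?f)"
      by (rule rmod_homI) (use c in \<open>auto simp: principal_rmod_def L.r_distr L.m_assoc\<close>)
    moreover have "?e \<in> carrier (principal_rmod Lam ?e)"
      using image_eqI[of ?e "\<lambda>r. ?e \<otimes>[Lam] r" "\<one>[Lam]" "carrier Lam"] c by (simp add: principal_rmod_def)
    ultimately have "?h ?e = \<zero>[principal_rmod Lam ?f]"
      by (rule hom_zero[OF ab, unfolded hom_zero_def, rule_format])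
    then have fe: "?f \<otimes>[Lam] (r \<otimes>[Lam] ?e) = \<zero>[Lam]"
      by (simp add: principal_rmod_def)
    have "arw \<beta> \<otimes>[Lam] (r \<otimes>[Lam] arw \<alpha>) = (arw \<beta> \<otimes>[Lam] ?f) \<otimes>[Lam] (r \<otimes>[Lam] (?e \<otimes>[Lam] arw \<alpha>))"
      using arr[OF ab(1)] arr[OF ab(2)] by simp
    also have "\<dots> = arw \<beta> \<otimes>[Lam] ((?f \<otimes>[Lam] (r \<otimes>[Lam] ?e)) \<otimes>[Lam] arw \<alpha>)"
      using c by (simp add: L.m_assoc)
    finally show ?thesis
      using fe c by simp
  qed
  have sub: "arw ` Arr \<subseteq> carrier Lam" using ac by blast
  have "P \<subseteq> {x \<in> carrier Lam. \<forall>\<alpha>\<in>Arr. \<forall>r\<in>carrier Lam. x \<otimes>[Lam] (r \<otimes>[Lam] arw \<alpha>) = \<zero>[Lam]}" (is "_ \<subseteq> ?W")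
  proof (rule L.genideal_subset)
    show "x \<otimes>[Lam] s \<in> ?W" if s: "s \<in> carrier Lam" "x \<in> ?W" for s x
    proof -
      have "(x \<otimes>[Lam] s) \<otimes>[Lam] (r \<otimes>[Lam] arw \<alpha>) = x \<otimes>[Lam] ((s \<otimes>[Lam] r) \<otimes>[Lam] arw \<alpha>)"
        if "\<alpha> \<in> Arr" "r \<in> carrier Lam" for \<alpha> r
        using s that ac by (simp add: L.m_assoc)
      then show ?thesis using s by simp
    qed
  qed (use sub zero ac in \<open>auto simp: L.l_distr L.m_assoc\<close>)
  then have W: "x \<otimes>[Lam] arw \<alpha> = \<zero>[Lam]" if "x \<in> P" "\<alpha> \<in> Arr" for x \<alpha>
  proof -
    have "x \<otimes>[Lam] (\<one>[Lam] \<otimes>[Lam] arw \<alpha>) = \<zero>[Lam]"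
      using that \<open>P \<subseteq> ?W\<close> L.one_closed by blast
    then show ?thesis using ac[OF that(2)] by simp
  qed
  have "P \<subseteq> {y \<in> carrier Lam. \<forall>x\<in>P. x \<otimes>[Lam] y = \<zero>[Lam]}"
    by (rule L.genideal_subset) (use sub W P.I_r_closed in \<open>auto simp: L.r_distr L.m_assoc[symmetric]\<close>)
  then show ?thesis
    using assms by blast
qed

lemma sg_Cons: "awalk u (\<alpha> # p) v ==> sg u (\<alpha> # p) v c = arrow_path Q \<alpha> \<otimes>[A] sg (head Q \<alpha>) p v c"
  by (simp add: arrow_sg awalk_Cons_iff)

lemma csc_closed: "on_paths Q (csc c)"
  using I.one_closed by (simp add: keys_scale)

lemma csc_mult: "on_paths Q x ==> csc c \<otimes>[A] x = scale c x"
  "on_paths Q x ==> x \<otimes>[A] csc c = scale c x"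
  using path_mult_scale[OF I.ring_axioms, of "\<one>[A]" x c] path_mult_scale[OF I.ring_axioms, of x "\<one>[A]" c]
    I.l_one[of x] I.r_one[of x] I.one_closed by simp_all

lemma sc_hom: "(\<lambda>c. \<psi> (csc c)) \<in> ring_hom scalar_ring Gam"
proof (rule ring_hom_memI)
  show "\<psi> (csc (c \<otimes>[scalar_ring] d)) = \<psi> (csc c) \<otimes>[Gam] \<psi> (csc d)" for c d
    using \<psi>.hom_mult[of "csc c" "csc d"] csc_mult(1)[OF csc_closed] csc_closed by (simp del: path_algebra_simps(4))
  show "\<psi> (csc (c \<oplus>[scalar_ring] d)) = \<psi> (csc c) \<oplus>[Gam] \<psi> (csc d)" for c d
    using \<psi>.hom_add[of "csc c" "csc d"] csc_closed by simp
qed (use csc_closed \<psi>.hom_closed \<psi>.hom_one in auto)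

lemma csc_central: "on_paths Q x ==> \<psi> (csc c) \<otimes>[Gam] \<psi> x = \<psi> x \<otimes>[Gam] \<psi> (csc c)"
proof -
  assume x: "on_paths Q x"
  have "\<psi> (path_mult (csc c) x) = \<psi> (path_mult x (csc c))"
    using csc_mult[OF x, of c] by (simp only: path_algebra_simps(4))
  then show ?thesis
    using x by simp
qed

lemma \<theta>_csc: "\<theta> (csc c) = csc c"
  using \<theta>.hom_one by simp

lemma generated:
  assumes "\<And>x. x \<in> carrier A ==> res (\<theta> x) \<in> U" "\<And>\<alpha>. \<alpha> \<in> Arr ==> arw \<alpha> \<in> U"
    "\<And>x y. x \<in> U ==> y \<in> U ==> x \<oplus>[Lam] y \<in> U" "\<And>x y. x \<in> U ==> y \<in> U ==> x \<otimes>[Lam] y \<in> U"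
  shows "carrier Lam \<subseteq> U"
proof -
  have "res x \<in> U" if "on_paths Q x" for x
    using that
  proof (induction x rule: path_induct)
    case zero
    show ?case using assms(1)[of 0] by simp
  next
    case (add x y)
    then show ?case using assms(3) res.hom_add[of x y] by simp
  next
    case (single u p v c)
    then show ?case
    proof (induction p arbitrary: u)
      case Nil
      then show ?case using assms(1)[of "sg u [] v c"] by simp
    next
      case (Cons \<alpha> p)
      then have w: "awalk (head Q \<alpha>) p v" "\<alpha> \<in> arcs Q" "awalk u (\<alpha> # p) v" by (auto simp: awalk_Cons_iff)
      have "arw \<alpha> \<in> U"
        using assms(2)[of \<alpha>] assms(1)[of "arrow_path Q \<alpha>"] w(2) by (cases "\<alpha> \<in> Arr") (auto simp: arrow_sg arc_implies_awalk)
      then show ?case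
        unfolding sg_Cons[OF w(3)] using assms(4) Cons.IH w by (subst res.hom_mult) auto
    qed
  qed
  then show ?thesis
    unfolding res_surj[symmetric] by (intro image_subsetI) simp
qed

lemma long_path_in_power: "awalk u p v ==> sg u p v 1 \<in> ideal_power A (arrow_ideal Q) (length p)"
proof (induction p arbitrary: v rule: rev_induct)
  case Nil
  then show ?case by simp
next
  case (snoc \<alpha> p)
  then have w: "awalk u p (tail Q \<alpha>)" "\<alpha> \<in> arcs Q" "v = head Q \<alpha>"
    by (auto simp: awalk_Cons_iff awalk_Nil_iff)
  have "(arrow_path Q \<alpha> :: _ \<Rightarrow>\<^sub>0 'k) \<in> arrow_ideal Q"
    unfolding arrow_ideal_def by (rule subsetD[OF I.genideal_self]) (use w(2) in auto)
  then have "sg u p (tail Q \<alpha>) 1 \<otimes>[A] arrow_path Q \<alpha> \<in> ideal_power A (arrow_ideal Q) (Suc (length p))"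
    using snoc.IH[OF w(1)] by (simp add: ideal_prod.prod del: path_algebra_simps(4))
  then show ?case by (simp add: arrow_sg w(3))
qed

definition "Span = insert \<zero>[Lam] ((\<lambda>(u, p, v). res (sg u p v 1)) ` {(u, p, v). awalk u p v \<and> length p \<le> m})"

lemma Span:
  shows "finite Span" "Span \<subseteq> carrier Lam"
    "Span \<subseteq> U ==> (\<And>x y. x \<in> U ==> y \<in> U ==> x \<oplus>[Lam] y \<in> U) ==>
      (\<And>x c. x \<in> U ==> x \<otimes>[Lam] res (csc c) \<in> U) ==> carrier Lam \<subseteq> U"
proof -
  have "{(u, p, v). awalk u p v \<and> length p \<le> m} \<subseteq> verts Q \<times> {p. set p \<subseteq> arcs Q \<and> length p \<le> m} \<times> verts Q"
    by auto
  then show "finite Span"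
    unfolding Span_def using finite_lists_length_le[OF finite_arcs]
    by (intro finite.insertI finite_imageI) (rule finite_subset, auto)
  show "Span \<subseteq> carrier Lam"
    unfolding Span_def using res.hom_closed by auto
  assume U: "Span \<subseteq> U" "\<And>x y. x \<in> U ==> y \<in> U ==> x \<oplus>[Lam] y \<in> U" "\<And>x c. x \<in> U ==> x \<otimes>[Lam] res (csc c) \<in> U"
  have one: "res (sg u p v 1) \<in> U" if w: "awalk u p v" for u p v
  proof (cases "length p \<le> m")
    case True
    have "res (sg u p v 1) \<in> Span"
      unfolding Span_def by (rule insertI2, rule image_eqI[of _ _ "(u, p, v)"]) (use True w in auto)
    then show ?thesis using U(1) by blast
  next
    case False
    let ?q = "take m p" and ?r = "drop m p"
    have "awalk u (?q @ ?r) v" using w by simp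
    then have q: "awalk u ?q (awlast u ?q)" "awalk (awlast u ?q) ?r v" by (simp_all only: awalk_append_iff)
    have "sg u ?q (awlast u ?q) 1 \<in> I"
      using long_path_in_power[OF q(1)] subsetD[OF power] False by simp
    then have "sg u ?q (awlast u ?q) 1 \<otimes>[A] sg (awlast u ?q) ?r v 1 \<in> I"
      using q(2) by (intro I.I_r_closed) auto
    then have "res (sg u p v 1) = \<zero>[Lam]"
      using res_zero_iff w by simp
    then show ?thesis using U(1) by (simp add: Span_def)
  qed
  have "res x \<in> U" if "on_paths Q x" for x
    using that
  proof (induction x rule: path_induct)
    case zero
    show ?case using U(1) res.hom_zero by (simp add: Span_def)
  next
    case (add x y)
    then show ?case using U(2) res.hom_add[of x y] by simp
  next
    case (single u p v c)
    have "sg u p v c = sg u p v 1 \<otimes>[A] csc c"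
      using csc_mult(2)[of "sg u p v 1" c] single by simp
    moreover have "res (sg u p v 1 \<otimes>[A] csc c) = res (sg u p v 1) \<otimes>[Lam] res (csc c)"
      using single csc_closed by (intro res.hom_mult) auto
    ultimately show ?case
      using U(3) one single by simp
  qed
  then show "carrier Lam \<subseteq> U"
    unfolding res_surj[symmetric] by (intro image_subsetI) simp
qed

lemma \<psi>_simps:
  "on_paths Q x ==> \<psi> x \<in> carrier Gam" "\<psi> 0 = \<zero>[Gam]"
  "on_paths Q x ==> on_paths Q y ==> \<psi> (x + y) = \<psi> x \<oplus>[Gam] \<psi> y"
  "on_paths Q x ==> on_paths Q y ==> \<psi> (path_mult x y) = \<psi> x \<otimes>[Gam] \<psi> y"
  by simp_all

abbreviation "sc c \<equiv> \<psi> (csc c)"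
abbreviation "src \<alpha> \<equiv> \<psi> (trivial_path (tail Q \<alpha>))"
abbreviation "tgt \<alpha> \<equiv> \<psi> (trivial_path (head Q \<alpha>))"

lemma trivial_mult: "u \<in> verts Q ==> path_mult (trivial_path u) (trivial_path w) = (if u = w then trivial_path u else 0)"
  by (simp add: trivial_path_def)

end

context removable_arrows
begin

context
  fixes V :: "((('v, 'e) qpath \<Rightarrow>\<^sub>0 'k) set set, 'm) module" and B :: "'e => 'm => 'm"
  assumes V: "rmod Gam V"
    and B: "\<And>\<alpha>. \<alpha> \<in> Arr ==> B \<alpha> \<in> rmod_hom scalar_ring (restrict_scalars (\<lambda>c. sc c) V) (restrict_scalars (\<lambda>c. sc c) V)"
      "\<And>\<alpha> v. \<alpha> \<in> Arr ==> v \<in> carrier V ==> B \<alpha> (src \<alpha> \<odot>[V] v) = B \<alpha> v"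
      "\<And>\<alpha> v. \<alpha> \<in> Arr ==> v \<in> carrier V ==> tgt \<alpha> \<odot>[V] B \<alpha> v = B \<alpha> v"
begin

interpretation V: rmod Gam V by (rule V)

abbreviation (input) "K \<equiv> restrict_scalars (\<lambda>c. sc c) V"

definition step :: "'e => 'm => 'm" where
  "step \<alpha> v = (if \<alpha> \<in> Arr then B \<alpha> v else \<psi> (arrow_path Q \<alpha>) \<odot>[V] v)"

primrec pact :: "'e list => 'v => 'm => 'm" where
  "pact [] u v = \<psi> (trivial_path u) \<odot>[V] v"
| "pact (\<alpha> # p) u v = pact p (head Q \<alpha>) (step \<alpha> v)"

definition act :: "(('v, 'e) qpath \<Rightarrow>\<^sub>0 'k) => 'm => 'm" where
  "act x v = finsum V (\<lambda>(u, p, w). sc (Poly_Mapping.lookup x (u, p, w)) \<odot>[V] pact p u v) (Poly_Mapping.keys x)"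

lemma \<psi>_smult:
  assumes "on_paths Q x" "on_paths Q y" "v \<in> carrier V" "path_mult x y = z"
  shows "\<psi> y \<odot>[V] (\<psi> x \<odot>[V] v) = \<psi> z \<odot>[V] v"
  using assms(1-3) assms(4)[symmetric] V.mult_smult[of "\<psi> x" "\<psi> y" v] by simp

lemma smult_linear:
  assumes "on_paths Q x"
  shows "(\<lambda>v. \<psi> x \<odot>[V] v) \<in> rmod_hom scalar_ring K K"
proof (rule rmod_homI)
  fix c :: 'k and v assume "v \<in> carrier K"
  then show "\<psi> x \<odot>[V] (c \<odot>[K] v) = c \<odot>[K] (\<psi> x \<odot>[V] v)"
    using \<psi>_smult[OF assms csc_closed _ csc_mult(2)[OF assms, simplified], of v c]
      \<psi>_smult[OF csc_closed assms _ csc_mult(1)[OF assms, simplified], of v c] by simp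
qed (use assms in \<open>simp_all add: V.smult_add\<close>)

lemma step_linear: "\<alpha> \<in> arcs Q ==> step \<alpha> \<in> rmod_hom scalar_ring K K"
  using B(1)[of \<alpha>] smult_linear[of "arrow_path Q \<alpha>"] unfolding step_def[abs_def] by (cases "\<alpha> \<in> Arr") simp_all

lemma pact_linear: "awalk u p w ==> pact p u \<in> rmod_hom scalar_ring K K"
proof (induction p arbitrary: u)
  case Nil
  then have "u \<in> verts Q" by (auto simp: awalk_Nil_iff)
  then show ?case using smult_linear[of "trivial_path u"] by simp
next
  case (Cons \<alpha> p)
  then show ?case
    using rmod_hom_comp[OF step_linear[of \<alpha>] Cons.IH[of "head Q \<alpha>"]] by (simp add: awalk_Cons_iff)
qed

lemma pact_simps:
  assumes "awalk u p w"
  shows "v \<in> carrier V ==> pact p u v \<in> carrier V"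
    "v \<in> carrier V ==> v' \<in> carrier V ==> pact p u (v \<oplus>[V] v') = pact p u v \<oplus>[V] pact p u v'"
    "v \<in> carrier V ==> pact p u (sc c \<odot>[V] v) = sc c \<odot>[V] pact p u v"
  using pact_linear[OF assms] by (auto simp: rmod_hom_def)

lemma step_closed: "\<alpha> \<in> arcs Q ==> v \<in> carrier V ==> step \<alpha> v \<in> carrier V"
  using step_linear[of \<alpha>] by (auto simp: rmod_hom_def)

lemma pact_src:
  assumes "awalk u p w" "v \<in> carrier V"
  shows "pact p u (\<psi> (trivial_path u) \<odot>[V] v) = pact p u v"
proof (cases p)
  case Nil
  then have "u \<in> verts Q" using assms by (auto simp: awalk_Nil_iff)
  then show ?thesis
    using Nil assms(2) \<psi>_smult[OF _ _ _ trivial_mult[of u u], of v] by simp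
next
  case (Cons \<alpha> q)
  then have a: "\<alpha> \<in> arcs Q" "u = tail Q \<alpha>" using assms by (auto simp: awalk_Cons_iff)
  have "path_mult (trivial_path u) (arrow_path Q \<alpha> :: _ \<Rightarrow>\<^sub>0 'k) = arrow_path Q \<alpha>"
    by (simp add: trivial_path_def arrow_sg a)
  then have "step \<alpha> (\<psi> (trivial_path u) \<odot>[V] v) = step \<alpha> v"
    using \<psi>_smult[of "trivial_path u" "arrow_path Q \<alpha>" v "arrow_path Q \<alpha>"] B(2) a assms(2) by (simp add: step_def)
  then show ?thesis by (simp add: Cons)
qed

lemma pact_tgt:
  assumes "awalk u p w" "v \<in> carrier V" "w' \<in> verts Q" "w' \<noteq> w"
  shows "\<psi> (trivial_path w') \<odot>[V] pact p u v = \<zero>[V]"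
  using assms(1,2)
proof (induction p arbitrary: u v)
  case Nil
  then have u: "u = w" "u \<in> verts Q" by (auto simp: awalk_Nil_iff)
  then show ?case
    using assms(3,4) Nil(2) \<psi>_smult[OF _ _ _ trivial_mult[of u w'], of v] \<psi>_simps(2) by simp
next
  case (Cons \<alpha> p)
  then show ?case using step_closed by (simp add: awalk_Cons_iff)
qed

lemma pact_append:
  assumes "awalk u p w" "awalk w q z" "v \<in> carrier V"
  shows "pact (p @ q) u v = pact q w (pact p u v)"
  using assms(1,3)
proof (induction p arbitrary: u v)
  case Nil
  then have "u = w" by (simp add: awalk_Nil_iff)
  then show ?case using pact_src[OF assms(2) Nil(2)] by simp
next
  case (Cons \<alpha> p)
  then show ?case using step_closed by (simp add: awalk_Cons_iff)
qed

lemma act_superset: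
  assumes "finite F" "Poly_Mapping.keys x \<subseteq> F" "F \<subseteq> paths Q" "v \<in> carrier V"
  shows "act x v = finsum V (\<lambda>(u, p, w). sc (Poly_Mapping.lookup x (u, p, w)) \<odot>[V] pact p u v) F"
  unfolding act_def
proof (rule V.add.finprod_mono_neutral_cong_left[OF assms(1,2)])
  have s0: "sc 0 = \<zero>[Gam]"
    using \<psi>_simps(2) by simp
  show "(case w of (u, p, w) => sc (Poly_Mapping.lookup x (u, p, w)) \<odot>[V] pact p u v) = \<zero>[V]"
    if "w \<in> F - Poly_Mapping.keys x" for w
  proof -
    obtain u p z where w: "w = (u, p, z)" by (cases w)
    then have "awalk u p z" using that assms(3) by auto
    then show ?thesis
      using that w s0 pact_simps(1)[OF _ assms(4)] by (simp add: in_keys_iff)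
  qed
qed (use assms pact_simps(1) csc_closed in \<open>auto\<close>)

lemma act_closed: "on_paths Q x ==> v \<in> carrier V ==> act x v \<in> carrier V"
  unfolding act_def by (rule V.finsum_closed) (use pact_simps(1) csc_closed in auto)

lemma act_zero [simp]: "act 0 v = \<zero>[V]"
  by (simp add: act_def)

lemma act_add:
  assumes "on_paths Q x" "on_paths Q y" "v \<in> carrier V"
  shows "act (x + y) v = act x v \<oplus>[V] act y v"
proof -
  let ?F = "Poly_Mapping.keys x \<union> Poly_Mapping.keys y"
  have F: "finite ?F" "?F \<subseteq> paths Q" "Poly_Mapping.keys (x + y) \<subseteq> ?F"
    using assms(1,2) keys_add[of x y] by simp_all
  let ?t = "\<lambda>x (u, p, w). sc (Poly_Mapping.lookup x (u, p, w)) \<odot>[V] pact p u v"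
  have t: "?t z \<in> ?F \<rightarrow> carrier V" for z
    using F(2) pact_simps(1) assms(3) csc_closed by auto
  have "act (x + y) v = finsum V (?t (x + y)) ?F"
    by (rule act_superset[OF F(1,3,2) assms(3)])
  also have "\<dots> = finsum V (\<lambda>w. ?t x w \<oplus>[V] ?t y w) ?F"
  proof (rule V.finsum_cong')
    show "?t (x + y) w = ?t x w \<oplus>[V] ?t y w" if w: "w \<in> ?F" for w
    proof -
      obtain u p z where w': "w = (u, p, z)" "awalk u p z"
        using w F(2) by (cases w) auto
      show ?thesis
        using V.add_smult[of "sc (Poly_Mapping.lookup x w)" "sc (Poly_Mapping.lookup y w)" "pact p u v"]
          pact_simps(1)[OF w'(2) assms(3)] csc_closed w'(1) by (simp add: lookup_add)
    qed
    show "(\<lambda>w. ?t x w \<oplus>[V] ?t y w) \<in> ?F \<rightarrow> carrier V"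
      using t[of x] t[of y] by (auto simp: Pi_iff)
  qed simp
  also have "\<dots> = finsum V (?t x) ?F \<oplus>[V] finsum V (?t y) ?F"
    by (rule V.finsum_addf[OF t t])
  finally show ?thesis
    using act_superset[OF F(1) _ F(2) assms(3), of x] act_superset[OF F(1) _ F(2) assms(3), of y] by simp
qed

lemma act_single:
  assumes "awalk u p w" "v \<in> carrier V"
  shows "act (sg u p w c) v = sc c \<odot>[V] pact p u v"
  using act_superset[of "{(u, p, w)}" "sg u p w c" v] assms pact_simps(1)[OF assms] csc_closed
  by (simp split: if_splits)

lemma act_linear:
  assumes "on_paths Q x"
  shows "v \<in> carrier V ==> v' \<in> carrier V ==> act x (v \<oplus>[V] v') = act x v \<oplus>[V] act x v'"
    "v \<in> carrier V ==> act x (sc c \<odot>[V] v) = sc c \<odot>[V] act x v" "act x \<zero>[V] = \<zero>[V]"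
proof -
  show add: "act x (v \<oplus>[V] v') = act x v \<oplus>[V] act x v'" if "v \<in> carrier V" "v' \<in> carrier V" for v v'
    using assms
  proof (induction x rule: path_induct)
    case (add x y)
    then show ?case using that act_closed[OF add(1)] act_closed[OF add(2)] by (simp add: act_add V.a_ac)
  next
    case (single u p w c)
    then show ?case using that csc_closed pact_simps[of u p w] by (simp add: act_single V.smult_add)
  qed (use that in simp)
  show "act x \<zero>[V] = \<zero>[V]"
    using add[of "\<zero>[V]" "\<zero>[V]"] act_closed[OF assms, of "\<zero>[V]"] by simp
  show "act x (sc c \<odot>[V] v) = sc c \<odot>[V] act x v" if "v \<in> carrier V"
    using assms
  proof (induction x rule: path_induct)
    case (add x y)
    then show ?case using that act_closed[OF add(1)] act_closed[OF add(2)] csc_closed by (simp add: act_add V.smult_add)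
  next
    case (single u p w d)
    then have w: "awalk u p w" by simp
    have c: "path_mult (csc d) (csc c) = csc (c * d)" "path_mult (csc c) (csc d) = csc (c * d)"
      using csc_mult(1)[OF csc_closed, of c d] csc_mult(2)[OF csc_closed, of d c] by simp_all
    then show ?case
      using that csc_closed w pact_simps[OF w] \<psi>_smult[OF csc_closed csc_closed _ c(1), of "pact p u v"]
        \<psi>_smult[OF csc_closed csc_closed _ c(2), of "pact p u v"]
      by (simp add: act_single)
  qed (use that csc_closed in simp)
qed

lemma act_mult:
  assumes "on_paths Q x" "on_paths Q y" "v \<in> carrier V"
  shows "act (path_mult x y) v = act y (act x v)"
  using assms(1,2)
proof (induction x y rule: path_induct2)
  case (zero_left y)
  then show ?case using act_linear(3) by simp
next
  case (zero_right x)
  then show ?case by simp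
next
  case (add_left x x' y)
  then show ?case using assms(3) act_closed act_linear(1)[OF add_left(3)] path_mult_linear[OF I.ring_axioms add_left(1-3)]
    by (simp add: act_add)
next
  case (add_right x y y')
  then show ?case using assms(3) act_closed path_mult_linear[OF I.ring_axioms add_right(1-3)]
    by (simp add: act_add)
next
  case (single u p w c u' q z d)
  then have w: "awalk u p w" "awalk u' q z" by auto
  note cl = pact_simps(1)[OF w(1) assms(3)] csc_closed
  have "act (sg u' q z d) (act (sg u p w c) v) = sc d \<odot>[V] (sc c \<odot>[V] pact q u' (pact p u v))"
    using w cl assms(3) pact_simps[OF w(2)] by (simp add: act_single)
  also have "\<dots> = act (path_mult (sg u p w c) (sg u' q z d)) v"
  proof (cases "w = u'")
    case True
    have c: "path_mult (csc c) (csc d) = csc (c * d)"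
      using csc_mult(1)[OF csc_closed, of c d] by simp
    then show ?thesis
      using True w cl assms(3) pact_append[of u p w q z v] pact_simps(1)[OF w(2) cl(1)]
        \<psi>_smult[OF csc_closed csc_closed pact_simps(1)[OF w(2) cl(1)] c] act_single[of u "p @ q" z v "c * d"] awlast_if_cas
      by (simp del: awalk_append_iff add: awalk_appendI)
  next
    case False
    have "u' \<in> verts Q" using w(2) by auto
    then have "pact q u' (pact p u v) = pact q u' \<zero>[V]"
      using pact_src[OF w(2) cl(1)] pact_tgt[OF w(1) assms(3)] False by simp
    moreover have "pact q u' \<zero>[V] = \<zero>[V]"
      using rmor.zero
        pact_simps(2)[OF w(2), of "\<zero>[V]" "\<zero>[V]"] pact_simps(1)[OF w(2), of "\<zero>[V]"] by simp
    ultimately show ?thesis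
      using False csc_closed by simp
  qed
  finally show ?case ..
qed

lemma act_\<psi>:
  assumes "on_paths Q x" "v \<in> carrier V"
  shows "act (\<theta> x) v = \<psi> x \<odot>[V] v"
proof -
  have path: "pact p u v = \<psi> (sg u p w 1) \<odot>[V] v" if "awalk u p w" "set p \<inter> Arr = {}" "v \<in> carrier V" for u p w v
    using that
  proof (induction p arbitrary: u v)
    case Nil
    then show ?case by (simp add: trivial_path_def awalk_Nil_iff)
  next
    case (Cons \<alpha> p)
    then have a: "\<alpha> \<in> arcs Q" "awalk (head Q \<alpha>) p w" "\<alpha> \<notin> Arr" by (auto simp: awalk_Cons_iff)
    then show ?case
      using Cons \<psi>_smult[OF _ _ _ sg_Cons[OF Cons.prems(1), of 1, simplified, symmetric], of v] step_closed[OF a(1), of v]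
      by (simp add: step_def)
  qed
  have "act (\<theta> x) v = \<psi> (\<theta> x) \<odot>[V] v"
    using assms(1)
  proof (induction x rule: path_induct)
    case zero
    then show ?case using assms(2) \<psi>_simps(2) by simp
  next
    case (add x y)
    then show ?case using assms(2) V.add_smult[of "\<psi> (\<theta> x)" "\<psi> (\<theta> y)" v] by (simp add: act_add)
  next
    case (single u p w c)
    have "path_mult (sg u p w 1) (csc c) = sg u p w c"
      using csc_mult(2)[of "sg u p w 1" c] single by simp
    then show ?case
      using single assms(2) path[of u p w v] \<psi>_smult[of "sg u p w 1" "csc c" v "sg u p w c"] csc_closed \<psi>_simps(2)
      by (simp add: act_single)
  qed
  then show ?thesis
    using \<psi>_\<theta>[of x] assms(1) by simp
qed

lemma act_I: "x \<in> I ==> v \<in> carrier V ==> act x v = \<zero>[V]"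
proof -
  let ?S = "{x \<in> carrier A. \<forall>v\<in>carrier V. act x v = \<zero>[V]}"
  have "g \<in> ?S" if g: "g \<in> Gen" for g
  proof -
    have "g \<in> carrier A" "g \<in> I"
      using subsetD[OF Gen(1) g] subsetD[OF I.genideal_self[OF Gen(1)] g] Gen(2) by simp_all
    then have "\<psi> g = \<zero>[Gam]" "g \<in> carrier A"
      using res_zero_iff[of g] \<pi>.hom_zero by simp_all
    then show ?thesis
      using act_\<psi>[of g] \<theta>_Gen[OF g] by simp
  qed
  then have "genideal A Gen \<subseteq> ?S"
    by (intro I.genideal_subset) (auto simp: act_add act_mult act_linear act_closed simp del: in_paths)
  then show "x \<in> I ==> v \<in> carrier V ==> act x v = \<zero>[V]"
    using Gen(2) by blast
qed

lemma rmod_act: "rmod A (with_action V act)"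
proof (rule rmodI[OF I.ring_axioms])
  show "abelian_group (with_action V act)"
    by (rule abelian_groupI) (auto simp: V.a_ac intro!: bexI[of _ "\<ominus>[V] _"] V.l_neg)
  show "\<one>[A] \<odot>[with_action V act] v = v" if "v \<in> carrier (with_action V act)" for v
    using act_\<psi>[of "\<one>[A]" v] that \<theta>.hom_one \<psi>.hom_one by simp
qed (simp_all add: act_closed act_add act_mult act_linear)

lemma extension:
  "\<exists>act'. rmod Lam (with_action V act') \<and> (\<forall>x\<in>carrier A. \<forall>v\<in>carrier V. act' (res (\<theta> x)) v = \<psi> x \<odot>[V] v) \<and>
    (\<forall>\<alpha>\<in>Arr. \<forall>v\<in>carrier V. act' (arw \<alpha>) v = B \<alpha> v)"
proof -
  have "x \<odot>[with_action V act] v = \<zero>[with_action V act]"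
    if "x \<in> carrier A" "res x = \<zero>[Lam]" "v \<in> carrier (with_action V act)" for x v
    using that act_I res_zero_iff[of x] by simp
  then obtain act' where act': "rmod Lam (with_action (with_action V act) act')"
      "\<And>x v. x \<in> carrier A ==> v \<in> carrier V ==> act' (res x) v = act x v"
    using rmod_factor[OF ring_Lam res_hom res_surj rmod_act] by (metis with_action_simps(1,4))
  have "act' (arw \<alpha>) v = B \<alpha> v" if a: "\<alpha> \<in> Arr" and v: "v \<in> carrier V" for \<alpha> v
  proof -
    have "act' (arw \<alpha>) v = act (sg (tail Q \<alpha>) [\<alpha>] (head Q \<alpha>) 1) v"
      using act'(2)[OF _ v, of "arrow_path Q \<alpha>"] Arr[OF a] by (simp add: arrow_sg arc_implies_awalk)
    also have "\<dots> = sc 1 \<odot>[V] (tgt \<alpha> \<odot>[V] B \<alpha> v)"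
      using a v Arr[OF a] by (subst act_single) (simp_all add: step_def arc_implies_awalk)
    also have "\<dots> = B \<alpha> v"
    proof -
      have "B \<alpha> v \<in> carrier V" using B(1)[OF a] v by (auto simp: rmod_hom_def)
      then show ?thesis using B(3)[OF a v] \<psi>.hom_one by simp
    qed
    finally show ?thesis .
  qed
  then show ?thesis
    using act' act_\<psi> by (intro exI[of _ act']) (simp add: with_action_def)
qed

end

end

lemma derived_universeI: "size_universe Idx Car R ==> ring R ==> derived_universe Idx Car R"
  by (simp add: derived_universe_def universe_def derived_universe_axioms_def)

context removable_arrows
begin

theorem arrow_removal_equivalences:
  fixes Idx :: "'i set set" and Car :: "'u set set"
  assumes size: "size_universe Idx Car Lam"
  shows "injectives_generate Idx Car Lam \<longleftrightarrow> injectives_generate Idx Car Gam"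
    "projectives_cogenerate Idx Car Lam \<longleftrightarrow> projectives_cogenerate Idx Car Gam"
proof -
  obtain i where i: "i \<in> ring_hom Gam Lam" "\<And>x. x \<in> carrier A ==> i (\<psi> x) = res (\<theta> x)"
    using section_exists by blast
  interpret i: ring_hom_ring Gam Lam i
    by (rule ring_hom_ringI2[OF ring_Gam ring_Lam i(1)])
  have Gam_cases: "\<exists>x\<in>carrier A. s = \<psi> x" if "s \<in> carrier Gam" for s
    using that \<psi>_surj by blast
  have "carrier Gam \<lesssim> carrier Lam"
    using P.coset_surj image_lepoll by metis
  then have sizeG: "size_universe Idx Car Gam"
    by (rule size_universe_lepoll[OF size])
  have ac: "Poly_Mapping.keys (trivial_path (tail Q \<alpha>) :: _ \<Rightarrow>\<^sub>0 'k) \<subseteq> paths Q"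
      "Poly_Mapping.keys (trivial_path (head Q \<alpha>) :: _ \<Rightarrow>\<^sub>0 'k) \<subseteq> paths Q"
      "on_paths Q (arrow_path Q \<alpha> :: _ \<Rightarrow>\<^sub>0 'k)" if "\<alpha> \<in> Arr" for \<alpha>
    using Arr[OF that] by simp_all
  have idem: "\<psi> (trivial_path v) \<otimes>[Gam] \<psi> (trivial_path v) = \<psi> (trivial_path v)" if "v \<in> verts Q" for v
  proof -
    have "\<psi> (path_mult (trivial_path v) (trivial_path v)) = \<psi> (trivial_path v)"
      by (simp only: trivial_mult[OF that] if_True simp_thms)
    then show ?thesis using that by simp
  qed
  have ext: "arrow_extension Lam Gam i (\<lambda>c. sc c) Arr (\<lambda>\<alpha>. arw \<alpha>) (\<lambda>\<alpha>. src \<alpha>) (\<lambda>\<alpha>. tgt \<alpha>) V" if V: "rmod Gam V"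
    for V :: "((('v, 'e) qpath \<Rightarrow>\<^sub>0 'k) set set, 'm) module"
    unfolding arrow_extension_def
  proof (intro allI impI)
    fix B assume B: "\<forall>a\<in>Arr. B a \<in> rmod_hom scalar_ring (restrict_scalars (\<lambda>c. sc c) V) (restrict_scalars (\<lambda>c. sc c) V) \<and>
      (\<forall>v\<in>carrier V. B a (src a \<odot>[V] v) = B a v \<and> tgt a \<odot>[V] B a v = B a v)"
    obtain act where act: "rmod Lam (with_action V act)"
      "\<And>x v. x \<in> carrier A ==> v \<in> carrier V ==> act (res (\<theta> x)) v = \<psi> x \<odot>[V] v"
      "\<And>\<alpha> v. \<alpha> \<in> Arr ==> v \<in> carrier V ==> act (arw \<alpha>) v = B \<alpha> v"
      using extension[OF V, of B] B by blast
    have "act (i r) v = r \<odot>[V] v" if r: "r \<in> carrier Gam" and v: "v \<in> carrier V" for r v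
    proof -
      obtain x where "x \<in> carrier A" "r = \<psi> x" using Gam_cases[OF r] by blast
      then show ?thesis using act(2) i(2) v by simp
    qed
    then show "\<exists>act. rmod Lam (with_action V act) \<and> (\<forall>v\<in>carrier V. \<forall>r\<in>carrier Gam. act (i r) v = r \<odot>[V] v) \<and>
        (\<forall>v\<in>carrier V. \<forall>a\<in>Arr. act (arw a) v = B a v)"
      using act(1,3) by blast
  qed
  interpret R: arrow_removal Idx Car Lam Gam \<pi> i "\<lambda>c. sc c" Arr "\<lambda>\<alpha>. arw \<alpha>" "\<lambda>\<alpha>. src \<alpha>" "\<lambda>\<alpha>. tgt \<alpha>" Span
  proof (intro arrow_removal.intro arrow_removal_axioms.intro derived_universeI size sizeG ring_Lam ring_Gam
      P.rcos_ring_hom i(1) sc_hom Span(1,2) ext)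
    show "\<pi> (i s) = s" if s: "s \<in> carrier Gam" for s
    proof -
      obtain x where x: "x \<in> carrier A" "s = \<psi> x" using Gam_cases[OF s] by blast
      show ?thesis unfolding x(2) i(2)[OF x(1)] by (rule \<psi>_\<theta>[OF x(1)])
    qed
    show "x \<otimes>[Lam] y = \<zero>[Lam]" if "x \<in> carrier Lam" "y \<in> carrier Lam" "\<pi> x = \<zero>[Gam]" "\<pi> y = \<zero>[Gam]" for x y
      using square_zero that P.coset_zero_iff[of x] P.coset_zero_iff[of y] by simp
    have iA: "res (\<theta> x) \<in> i ` carrier Gam" if "x \<in> carrier A" for x
      using i(2)[OF that, symmetric] \<psi>.hom_closed[OF that] by blast
    show "U = carrier Lam" if "U \<subseteq> carrier Lam" "i ` carrier Gam \<subseteq> U" "arw ` Arr \<subseteq> U"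
      "\<And>x y. x \<in> U ==> y \<in> U ==> x \<oplus>[Lam] y \<in> U" "\<And>x y. x \<in> U ==> y \<in> U ==> x \<otimes>[Lam] y \<in> U" for U
    proof (rule equalityI[OF that(1) generated[OF _ _ that(4,5)]])
      show "res (\<theta> x) \<in> U" if "x \<in> carrier A" for x
        using iA[OF that] \<open>i ` carrier Gam \<subseteq> U\<close> by blast
      show "arw \<alpha> \<in> U" if "\<alpha> \<in> Arr" for \<alpha>
        using that \<open>arw ` Arr \<subseteq> U\<close> by blast
    qed
    show "U = carrier Lam" if "Span \<subseteq> U" "U \<subseteq> carrier Lam" "\<And>x y. x \<in> U ==> y \<in> U ==> x \<oplus>[Lam] y \<in> U"
      "\<And>x r. x \<in> U ==> r \<in> carrier Gam ==> x \<otimes>[Lam] i r \<in> U" for U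
    proof (rule equalityI[OF that(2) Span(3)[OF that(1,3)]])
      show "x \<otimes>[Lam] res (csc c) \<in> U" if "x \<in> U" for x c
        using \<open>\<And>x r. x \<in> U ==> r \<in> carrier Gam ==> x \<otimes>[Lam] i r \<in> U\<close>[OF that, of "sc c"] i(2)[of "csc c"] csc_closed \<theta>_csc
        by simp
    qed
    fix \<alpha> c assume a: "\<alpha> \<in> Arr"
    note ac' = ac[OF a]
    show "src \<alpha> \<in> carrier Gam" "tgt \<alpha> \<in> carrier Gam" "arw \<alpha> \<in> carrier Lam"
      using ac' by simp_all
    show "src \<alpha> \<otimes>[Gam] src \<alpha> = src \<alpha>" "tgt \<alpha> \<otimes>[Gam] tgt \<alpha> = tgt \<alpha>"
      using idem Arr[OF a] by simp_all
    show "sc c \<otimes>[Gam] src \<alpha> = src \<alpha> \<otimes>[Gam] sc c" "sc c \<otimes>[Gam] tgt \<alpha> = tgt \<alpha> \<otimes>[Gam] sc c"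
      by (rule csc_central; rule ac')+
    show "\<pi> (arw \<alpha>) = \<zero>[Gam]"
      using arw_P[OF a] P.coset_zero_iff[of "arw \<alpha>"] ac' by simp
    have it: "i (\<psi> (trivial_path v)) = res (trivial_path v)" if "on_paths Q (trivial_path v :: _ \<Rightarrow>\<^sub>0 'k)" for v
      using i(2)[of "trivial_path v"] that by (simp add: trivial_path_def)
    show "i (src \<alpha>) \<otimes>[Lam] arw \<alpha> = arw \<alpha>" "arw \<alpha> \<otimes>[Lam] i (tgt \<alpha>) = arw \<alpha>"
      using it ac' res.hom_mult[of "trivial_path (tail Q \<alpha>)" "arrow_path Q \<alpha>", symmetric]
        res.hom_mult[of "arrow_path Q \<alpha>" "trivial_path (head Q \<alpha>)", symmetric]
      by (simp_all add: arrow_sg trivial_path_def)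
    show "i (sc c) \<otimes>[Lam] arw \<alpha> = arw \<alpha> \<otimes>[Lam] i (sc c)"
    proof -
      have "res (path_mult (csc c) (arrow_path Q \<alpha>)) = res (path_mult (arrow_path Q \<alpha>) (csc c))"
        using csc_mult[OF ac'(3), of c] by (simp only: path_algebra_simps(4))
      then show ?thesis
        using ac' csc_closed i(2)[of "csc c"] \<theta>_csc by simp
    qed
  qed
  show "injectives_generate Idx Car Lam \<longleftrightarrow> injectives_generate Idx Car Gam"
    "projectives_cogenerate Idx Car Lam \<longleftrightarrow> projectives_cogenerate Idx Car Gam"
    by (rule R.injectives_generate_arrow_removal R.projectives_cogenerate_arrow_removal)+
qed

end

theorem proposition5p12:
  fixes Q :: "('v, 'e) pre_digraph"
    and I :: "(('v, 'e) qpath \<Rightarrow>\<^sub>0 'k::field) set"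
    and a :: "nat \<Rightarrow> 'e" and t :: nat
    and \<Lambda> :: "(('v, 'e) qpath \<Rightarrow>\<^sub>0 'k) set ring"
    and \<Gamma> :: "(('v, 'e) qpath \<Rightarrow>\<^sub>0 'k) set set ring"
    and Idx :: "'i set set" and Car :: "'u set set"
  assumes "fin_digraph Q"
    and "admissible_ideal Q I"
    and "\<Lambda> = bound_quiver_algebra Q I"
    and "\<forall>i\<in>{1..t}. a i \<in> arcs Q"
    and "\<exists>G. minimal_generators (path_algebra Q) I G \<and>
           (\<forall>i\<in>{1..t}. \<forall>x\<in>G. \<not> arrow_occurs (a i) x)"
    and "\<forall>i\<in>{1..t}. \<forall>j\<in>{1..t}.
           hom_zero \<Lambda> (principal_rmod \<Lambda> (residue Q I (trivial_path (tail Q (a i)))))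
                      (principal_rmod \<Lambda> (residue Q I (trivial_path (head Q (a j)))))"
    and "\<Gamma> = \<Lambda> Quot (genideal \<Lambda> ((\<lambda>i. residue Q I (arrow_path Q (a i))) ` {1..t}))"
    and "size_universe Idx Car \<Lambda>"
  shows "(injectives_generate Idx Car \<Lambda> \<longleftrightarrow> injectives_generate Idx Car \<Gamma>) \<and>
         (projectives_cogenerate Idx Car \<Lambda> \<longleftrightarrow> projectives_cogenerate Idx Car \<Gamma>)"
proof -
  obtain Gen where Gen: "minimal_generators (path_algebra Q) I Gen" "\<forall>i\<in>{1..t}. \<forall>x\<in>Gen. \<not> arrow_occurs (a i) x"
    using assms(5) by blast
  obtain m where m: "ideal I (path_algebra Q)" "ideal_power (path_algebra Q) (arrow_ideal Q) m \<subseteq> I"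
    using assms(2) unfolding admissible_ideal_def by blast
  interpret removable_arrows Q I Gen "a ` {1..t}" m
    using assms(1,4,6) Gen m unfolding assms(3)
    by (intro removable_arrows.intro removable_arrows_axioms.intro) (auto simp: minimal_generators_def)
  have "\<Gamma> = Gam"
    unfolding assms(7) assms(3) by (simp add: image_image)
  then show ?thesis
    using arrow_removal_equivalences[OF assms(8)[unfolded assms(3)]] assms(3) by simp
qed

end
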